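(* Let $V$ be a finite-dimensional graded vector space over a field of characteristic $0$. (a) Let $(\mathcal C(V),\{\ ,\ \},\Omega)$ be a commutative Pinczon algebra. Write $\Omega=\Omega_Q$, $Q=\sum_kQ_k$, with $Q_k:\underline\otimes^kV[1]\to V[1]$. Then $Q$ is a structure of $C_\infty$ algebra on $V$, and each $Q_k$ is $B$-quadratic for the bilinear form $B$ coming from the bracket. (b) Conversely, if $b$ is a non-degenerate symmetric bilinear form on $V$ (of degree $0$), any $B$-quadratic structure $Q$ of $C_\infty$ algebra on $V$ defines a unique structure of commutative Pinczon algebra on $V$ (namely the Pinczon bracket associated to $b$ together with $\Omega=\Omega_Q$).
   Context: Degrees and signs. $|x|$ is the degree of $x$ in $V$; $V[1]$ is $V$ with shifted degree $\deg(x)=|x|-1$; scalars have degree $0$. All formulas use Koszul's sign rule: in any relation between homogeneous objects, the first term has sign $+$ and every other term is implicitly multiplied by the sign of the permutation of the odd letters (vectors, maps, forms) relating it to the first term. A multilinear form $\Omega$ on $V[1]$ has degree $d$ if $\Omega(x_1,\dots,x_k)=0$ unless $d+\sum\deg(x_j)=0$. Symmetric bilinear forms of degree $0$: $b(x,y)=(-1)^{|x||y|}b(y,x)$, and $b(x,y)=0$ unless $|x|+|y|=0$; associated form on $V[1]$: $B(x,y)=(-1)^{\deg x}b(x,y)$. Cyclic forms and Pinczon brackets. A $(k+1)$-linear form $\Omega$ on $V[1]$ is cyclic if $\Omega(x_{k+1},x_1,\dots,x_k)=\Omega(x_1,\dots,x_{k+1})$; $\mathcal C^k$ is the space of $k$-linear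 cyclic forms, $\mathcal C(V)$ the space of all cyclic forms. $\Omega^{Cycl}$ is the sum of $\Omega$ over all cyclic permutations of its variables, $A\odot B=(A\otimes B)^{Cycl}$, $\iota_x\Omega=\Omega(x,\cdot,\dots,\cdot)$. A Pinczon bracket on $\mathcal C(V)$ is a bilinear map $\{\ ,\ \}$ such that: (1) $\{\mathcal C^{k+1},\mathcal C^{k'+1}\}\subset\mathcal C^{k+k'}$; (2) it makes $\mathcal C(V)$ a graded Lie algebra (for the grading $\deg-2$) with center $\mathcal C^0$; (3) for linear forms, $\{\alpha,(\beta_1\otimes\dots\otimes\beta_k)^{Cycl}\}=\sum_j\{\alpha,\beta_j\}(\beta_1\otimes\dots\hat{\beta_j}\dots\otimes\beta_k)^{Cycl}$. Pinczon brackets correspond bijectively to degree $0$ symmetric non-degenerate forms $b$ on $V$ through $\{\Omega,\Omega'\}=\sum_i\iota_{e_i}\Omega\odot\iota_{e'_i}\Omega'$, where $b(e_i,e'_j)=\delta_{ij}$; "the form $B$ coming from the bracket" is the form associated to this $b$. Shuffles and $C_\infty$. $Sh(p,q)$ is the set of $\sigma\in\mathfrak S_{p+q}$ increasing on $\{1,\dots,p\}$ and on $\{p+1,\dots,p+q\}$; $sh_{p,q}(x_1\otimes\dots\otimes x_p,x_{p+1}\otimes\dots\otimes x_{p+q})=\sum_{\sigma\in Sh(p,q)}x_{\sigma^{-1}(1)}\otimes\dots\otimes x_{\sigma^{-1}(p+q)}$. $\underline\otimes^nV[1]$ is the quotient of $\otimes^nV[1]$ by the sum of the images of $sh_{p,n-p}$,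 $0<p<n$; $\underline x_{[a,b]}$ is the class of $x_a\otimes\dots\otimes x_b$; $\underline\otimes^+V[1]=\bigoplus_{n>0}\underline\otimes^nV[1]$. It has the Lie cobracket $\delta(\underline x_{[1,n]})=\sum_{j=1}^{n-1}\underline x_{[1,j]}\bigotimes\underline x_{[j+1,n]}-\underline x_{[j+1,n]}\bigotimes\underline x_{[1,j]}$. A coderivation $Q$ of $\delta$ is determined by its Taylor components $Q_k:\underline\otimes^kV[1]\to V[1]$, $k\ge1$. A $C_\infty$ structure on $V$ is a degree $1$ coderivation $Q$ of $\delta$ with $[Q,Q]=0$. A $(k+1)$-linear cyclic form $\Omega$ vanishes on shuffle products if for every $y$ the map $(x_1,\dots,x_k)\mapsto\Omega(x_1,\dots,x_k,y)$ vanishes on the images of $sh_{p,k-p}$, $0<p<k$; $\mathcal C_{vsp}(V)$ is the space of such forms. Structures. For $Q_k$ $k$-linear with values in $V[1]$, $\Omega_{Q_k}(x_1,\dots,x_{k+1})=B(Q_k(x_1,\dots,x_k),x_{k+1})$, $\Omega_Q=\sum_{k\ge1}\Omega_{Q_k}$ (possibly infinite formal sums). $Q_k$ is $B$-quadratic if $\Omega_{Q_k}$ is cyclic; $Q$ is $B$-quadratic if all $Q_k$ are. A commutative Pinczon algebra $(\mathcal C(V),\{\ ,\ \},\Omega)$ is a Pinczon bracket on $\mathcal C(V)$ and a degree $3$ form $\Omega\in\mathcal C_{vsp}(V)$ (with components of arity at least $2$) such that $\{\Omega,\Omega\}=0$.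
   Formalization: The axiom "center C^0" fails for every bracket given by a form b on V≠0; it is replaced by: the central forms of arity at most 2 are exactly C^0. In (a) the bracket is assumed to be given by the formula from a form b, which is what "the form B coming from the bracket" refers to. *)

theory Defs
  imports Complex_Main "HOL-Library.Poly_Mapping" "HOL-Combinatorics.Permutations"
begin

section \<open>Signs, formal linear combinations, multilinear maps\<close>

definition ksgn :: "int \<Rightarrow> 'a::ring_1" where
  "ksgn m = (if even m then 1 else - 1)"

definition arity_part :: "nat \<Rightarrow> ('v list \<Rightarrow> 'w::zero) \<Rightarrow> 'v list \<Rightarrow> 'w" where
  "arity_part k f = (\<lambda>xs. if length xs = k then f xs else 0)"

text \<open>
  The vector space with basis \<open>'a\<close> is \<open>'a \<Rightarrow>\<^sub>0 'k\<close>; \<open>extend s f\<close> is the linear map into a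
  space with scalar multiplication \<open>s\<close> that takes the values \<open>f\<close> on the basis.
\<close>

definition pscale :: "'k \<Rightarrow> ('a \<Rightarrow>\<^sub>0 'k::field) \<Rightarrow> ('a \<Rightarrow>\<^sub>0 'k)" where
  "pscale c p = Poly_Mapping.map ((*) c) p"

lemma lookup_pscale: "Poly_Mapping.lookup (pscale c p) a = c * Poly_Mapping.lookup p a"
  by (simp add: pscale_def Poly_Mapping.map.rep_eq when_def)

lemma vector_space_pscale: "vector_space (pscale :: 'k::field \<Rightarrow> ('a \<Rightarrow>\<^sub>0 'k) \<Rightarrow> _)"
  by unfold_locales
     (auto intro!: poly_mapping_eqI simp: lookup_pscale lookup_add algebra_simps)

definition extend :: "('k \<Rightarrow> 'w \<Rightarrow> 'w) \<Rightarrow> ('a \<Rightarrow> 'w::ab_group_add) \<Rightarrow> ('a \<Rightarrow>\<^sub>0 'k::zero) \<Rightarrow> 'w" where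
  "extend s f p = (\<Sum>a\<in>Poly_Mapping.keys p. s (Poly_Mapping.lookup p a) (f a))"

definition pprod :: "('a \<Rightarrow>\<^sub>0 'k) \<Rightarrow> ('b \<Rightarrow>\<^sub>0 'k) \<Rightarrow> ('a \<times> 'b \<Rightarrow>\<^sub>0 'k::field)" where
  "pprod u v = (\<Sum>a\<in>Poly_Mapping.keys u. \<Sum>b\<in>Poly_Mapping.keys v.
     Poly_Mapping.single (a, b) (Poly_Mapping.lookup u a * Poly_Mapping.lookup v b))"

text \<open>Shuffles act on positions \<open>0, \<dots>, p + q - 1\<close> instead of \<open>1, \<dots>, p + q\<close>.\<close>

definition Sh :: "nat \<Rightarrow> nat \<Rightarrow> (nat \<Rightarrow> nat) set" where
  "Sh p q = {\<sigma>. \<sigma> permutes {..<p + q} \<and> strict_mono_on {..<p} \<sigma> \<and> strict_mono_on {p..<p + q} \<sigma>}"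

definition graded_commutator ::
  "int \<Rightarrow> int \<Rightarrow> (('a \<Rightarrow>\<^sub>0 'k) \<Rightarrow> ('a \<Rightarrow>\<^sub>0 'k)) \<Rightarrow> (('a \<Rightarrow>\<^sub>0 'k) \<Rightarrow> ('a \<Rightarrow>\<^sub>0 'k)) \<Rightarrow>
    ('a \<Rightarrow>\<^sub>0 'k::field) \<Rightarrow> ('a \<Rightarrow>\<^sub>0 'k)" where
  "graded_commutator m n D E w = D (E w) - pscale (ksgn (m * n)) (E (D w))"


section \<open>Graded vector spaces\<close>

locale graded_vector_space = vector_space scale
  for scale :: "'k::field_char_0 \<Rightarrow> 'v::ab_group_add \<Rightarrow> 'v" (infixr \<open>*s\<close> 75) +
  fixes G :: "int \<Rightarrow> 'v set"
  assumes finite_dimensional: "\<exists>B. finite B \<and> span B = UNIV"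
    and subspace_component: "subspace (G i)"
    and direct_sum: "\<exists>!c. (\<forall>i. c i \<in> G i) \<and> finite {i. c i \<noteq> 0} \<and> (\<Sum>i | c i \<noteq> 0. c i) = x"
begin

definition homog :: "'v set" where
  "homog = (\<Union>i. G i)"

definition component :: "'v \<Rightarrow> int \<Rightarrow> 'v" where
  "component x = (THE c. (\<forall>i. c i \<in> G i) \<and> finite {i. c i \<noteq> 0} \<and> (\<Sum>i | c i \<noteq> 0. c i) = x)"

text \<open>
  \<open>vdeg x\<close> is $|x|$ and \<open>deg x\<close> the degree in $V[1]$, for homogeneous \<open>x\<close>.  The vector \<open>0\<close> has
  every degree; the value chosen for it never matters, because all expressions in which it
  enters a sign are multilinear.
\<close>

definition vdeg :: "'v \<Rightarrow> int" where
  "vdeg x = (if x = 0 then 0 else (THE i. x \<in> G i))"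

definition deg :: "'v \<Rightarrow> int" where
  "deg x = vdeg x - 1"

definition ldeg :: "'v list \<Rightarrow> int" where
  "ldeg xs = (\<Sum>x\<leftarrow>xs. deg x)"

text \<open>
  Formulas with Koszul signs only make sense on homogeneous vectors; \<open>hom_extend\<close> extends
  them multilinearly, by expanding every argument into its (non-zero) homogeneous components.
\<close>

definition hom_extend :: "('v list \<Rightarrow> 'k) \<Rightarrow> 'v list \<Rightarrow> 'k" where
  "hom_extend f xs =
     (\<Sum>ds\<in>listset (map (\<lambda>x. {i. component x i \<noteq> 0}) xs). f (map2 component xs ds))"

definition multilinear :: "('k \<Rightarrow> 'w \<Rightarrow> 'w) \<Rightarrow> nat \<Rightarrow> ('v list \<Rightarrow> 'w::ab_group_add) \<Rightarrow> bool" where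
  "multilinear s k f \<longleftrightarrow>
     (\<forall>xs. length xs \<noteq> k \<longrightarrow> f xs = 0) \<and>
     (\<forall>us vs x y. length us + length vs + 1 = k \<longrightarrow>
        f (us @ (x + y) # vs) = f (us @ x # vs) + f (us @ y # vs)) \<and>
     (\<forall>us vs c x. length us + length vs + 1 = k \<longrightarrow>
        f (us @ (c *s x) # vs) = s c (f (us @ x # vs)))"


section \<open>Cyclic forms\<close>

text \<open>
  A form is a function on lists of vectors; its \<open>k\<close>-linear part is its restriction to lists
  of length \<open>k\<close>.
\<close>

definition has_degree :: "int \<Rightarrow> ('v list \<Rightarrow> 'k) \<Rightarrow> bool" where
  "has_degree d \<Omega> \<longleftrightarrow> (\<forall>xs. set xs \<subseteq> homog \<and> \<Omega> xs \<noteq> 0 \<longrightarrow> d + ldeg xs = 0)"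

definition cyclic_forms :: "nat \<Rightarrow> ('v list \<Rightarrow> 'k) set" where
  "cyclic_forms k = {\<Omega>. multilinear (*) k \<Omega> \<and>
     (\<forall>xs y. set xs \<subseteq> homog \<and> y \<in> homog \<and> length xs + 1 = k \<longrightarrow>
        \<Omega> (y # xs) = ksgn (deg y * ldeg xs) * \<Omega> (xs @ [y]))}"

definition all_cyclic_forms :: "('v list \<Rightarrow> 'k) set" where
  "all_cyclic_forms =
     {\<Omega>. (\<forall>k. arity_part k \<Omega> \<in> cyclic_forms k) \<and> finite {k. arity_part k \<Omega> \<noteq> (\<lambda>_. 0)}}"

text \<open>For the empty list of arguments there is one cyclic permutation, hence the \<open>max\<close>.\<close>

definition cyclization :: "('v list \<Rightarrow> 'k) \<Rightarrow> 'v list \<Rightarrow> 'k" where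
  "cyclization \<Omega> = hom_extend (\<lambda>xs. \<Sum>j<max 1 (length xs).
     ksgn (ldeg (take j xs) * ldeg (drop j xs)) * \<Omega> (rotate j xs))"

text \<open>
  \<open>tensor d A B\<close> is $A \otimes B$ for a form \<open>B\<close> of degree \<open>d\<close>:
  $(A \otimes B)(x, y) = (-1)^{d \deg x} A(x) B(y)$.  If \<open>A\<close> is $k$-linear, only the summand for
  \<open>k\<close> survives.
\<close>

definition tensor :: "int \<Rightarrow> ('v list \<Rightarrow> 'k) \<Rightarrow> ('v list \<Rightarrow> 'k) \<Rightarrow> 'v list \<Rightarrow> 'k" where
  "tensor d A B = hom_extend (\<lambda>zs. \<Sum>k\<le>length zs.
     ksgn (d * ldeg (take k zs)) * A (take k zs) * B (drop k zs))"

definition odot :: "int \<Rightarrow> ('v list \<Rightarrow> 'k) \<Rightarrow> ('v list \<Rightarrow> 'k) \<Rightarrow> 'v list \<Rightarrow> 'k" where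
  "odot d A B = cyclization (tensor d A B)"

definition contract :: "'v \<Rightarrow> ('v list \<Rightarrow> 'k) \<Rightarrow> 'v list \<Rightarrow> 'k" where
  "contract x \<Omega> = (\<lambda>xs. \<Omega> (x # xs))"

text \<open>$\beta_1 \otimes \dots \otimes \beta_k$ for a list of pairs (degree of $\beta_j$, $\beta_j$).\<close>

fun tensor_list :: "(int \<times> ('v list \<Rightarrow> 'k)) list \<Rightarrow> 'v list \<Rightarrow> 'k" where
  "tensor_list [] = (\<lambda>xs. if xs = [] then 1 else 0)"
| "tensor_list ((d, \<beta>) # bs) = tensor (\<Sum>(d', \<beta>')\<leftarrow>bs. d') \<beta> (tensor_list bs)"


section \<open>Pinczon brackets\<close>

definition graded_lie_bracket ::
  "(('v list \<Rightarrow> 'k) \<Rightarrow> ('v list \<Rightarrow> 'k) \<Rightarrow> 'v list \<Rightarrow> 'k) \<Rightarrow> bool" where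
  "graded_lie_bracket br \<longleftrightarrow>
     (\<forall>A\<in>all_cyclic_forms. \<forall>B\<in>all_cyclic_forms. br A B \<in> all_cyclic_forms) \<and>
     (\<forall>A\<in>all_cyclic_forms. \<forall>A'\<in>all_cyclic_forms. \<forall>B\<in>all_cyclic_forms. \<forall>c.
        br (\<lambda>xs. c * A xs + A' xs) B = (\<lambda>xs. c * br A B xs + br A' B xs) \<and>
        br B (\<lambda>xs. c * A xs + A' xs) = (\<lambda>xs. c * br B A xs + br B A' xs)) \<and>
     (\<forall>A\<in>all_cyclic_forms. \<forall>B\<in>all_cyclic_forms. \<forall>d e.
        has_degree d A \<and> has_degree e B \<longrightarrow>
          has_degree (d + e - 2) (br A B) \<and>
          br A B = (\<lambda>xs. - ksgn ((d - 2) * (e - 2)) * br B A xs)) \<and>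
     (\<forall>A\<in>all_cyclic_forms. \<forall>B\<in>all_cyclic_forms. \<forall>C\<in>all_cyclic_forms. \<forall>d e.
        has_degree d A \<and> has_degree e B \<longrightarrow>
          br A (br B C) = (\<lambda>xs. br (br A B) C xs + ksgn ((d - 2) * (e - 2)) * br B (br A C) xs))"

definition central ::
  "(('v list \<Rightarrow> 'k) \<Rightarrow> ('v list \<Rightarrow> 'k) \<Rightarrow> 'v list \<Rightarrow> 'k) \<Rightarrow> ('v list \<Rightarrow> 'k) \<Rightarrow> bool" where
  "central br A \<longleftrightarrow> A \<in> all_cyclic_forms \<and> (\<forall>B\<in>all_cyclic_forms. br A B = (\<lambda>_. 0))"

text \<open>
  A bracket is a function on all of \<open>'v list \<Rightarrow> 'k\<close>; outside the space of cyclic forms it is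
  fixed to be \<open>0\<close>, so that equality of brackets is equality on cyclic forms.

  The condition on the centre is that, among the forms of arity at most 2, exactly the constants
  are central.  It cannot be imposed in all arities: the bracket of a form \<open>b\<close> on $V \neq 0$ has
  non-constant central forms of higher arity.  If $\dim V = 1$, every cyclic 3-linear form is
  central; if $\dim V \geq 2$, $(B \otimes B)^{Cycl}$ is a non-zero central 4-linear form, where
  $B(x, y) = (-1)^{\deg x} b(x, y)$.
\<close>

definition pinczon_bracket ::
  "(('v list \<Rightarrow> 'k) \<Rightarrow> ('v list \<Rightarrow> 'k) \<Rightarrow> 'v list \<Rightarrow> 'k) \<Rightarrow> bool" where
  "pinczon_bracket br \<longleftrightarrow>
     (\<forall>A B. A \<notin> all_cyclic_forms \<or> B \<notin> all_cyclic_forms \<longrightarrow> br A B = (\<lambda>_. 0)) \<and>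
     (\<forall>k k'. \<forall>A\<in>cyclic_forms (k + 1). \<forall>B\<in>cyclic_forms (k' + 1). br A B \<in> cyclic_forms (k + k')) \<and>
     graded_lie_bracket br \<and>
     {A. central br A \<and> (\<forall>xs. length xs > 2 \<longrightarrow> A xs = 0)} = cyclic_forms 0 \<and>
     (\<forall>\<alpha>\<in>cyclic_forms 1. \<forall>bs. bs \<noteq> [] \<and> (\<forall>(d, \<beta>)\<in>set bs. \<beta> \<in> cyclic_forms 1 \<and> has_degree d \<beta>) \<longrightarrow>
        br \<alpha> (cyclization (tensor_list bs)) = (\<lambda>xs. \<Sum>j<length bs.
          ksgn (fst (bs ! j) * (\<Sum>i<j. fst (bs ! i))) * br \<alpha> (snd (bs ! j)) [] *
          cyclization (tensor_list (take j bs @ drop (Suc j) bs)) xs))"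

definition symmetric_nondegenerate :: "('v \<Rightarrow> 'v \<Rightarrow> 'k) \<Rightarrow> bool" where
  "symmetric_nondegenerate b \<longleftrightarrow>
     (\<forall>x y z c. b (c *s x + y) z = c * b x z + b y z \<and> b z (c *s x + y) = c * b z x + b z y) \<and>
     (\<forall>i j. \<forall>x\<in>G i. \<forall>y\<in>G j. b x y = ksgn (i * j) * b y x) \<and>
     (\<forall>i j. \<forall>x\<in>G i. \<forall>y\<in>G j. i + j \<noteq> 0 \<longrightarrow> b x y = 0) \<and>
     (\<forall>x. (\<forall>y. b x y = 0) \<longrightarrow> x = 0)"

definition dual_bases :: "('v \<Rightarrow> 'v \<Rightarrow> 'k) \<Rightarrow> 'v list \<Rightarrow> 'v list \<Rightarrow> bool" where
  "dual_bases b es es' \<longleftrightarrow>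
     set es \<subseteq> homog \<and> set es' \<subseteq> homog \<and> length es' = length es \<and>
     distinct es \<and> independent (set es) \<and> span (set es) = UNIV \<and>
     (\<forall>i<length es. \<forall>j<length es. b (es ! i) (es' ! j) = (if i = j then 1 else 0))"

text \<open>
  $\{\Omega,\Omega'\} = \sum_i \iota_{e_i}\Omega \odot \iota_{e'_i}\Omega'$.  The Koszul sign
  $(-1)^{|\Omega'| \deg e_i}$ comes from moving $e_i$ past $\Omega'$ when the letters
  $\Omega, \Omega', e_i, e'_i$ are brought into the order $\Omega, e_i, \Omega', e'_i$; the
  degree of $\iota_{e'_i}\Omega'$ is $|\Omega'| + \deg e'_i$.  With these signs
  $\{\Omega_Q, \Omega_{Q'}\} = \Omega_{[Q, Q']}$.
\<close>

definition bracket_from_form ::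
  "('v \<Rightarrow> 'v \<Rightarrow> 'k) \<Rightarrow> (('v list \<Rightarrow> 'k) \<Rightarrow> ('v list \<Rightarrow> 'k) \<Rightarrow> 'v list \<Rightarrow> 'k) \<Rightarrow> bool" where
  "bracket_from_form b br \<longleftrightarrow> symmetric_nondegenerate b \<and>
     (\<forall>es es' k k' d d'. \<forall>\<Omega>\<in>cyclic_forms (k + 1). \<forall>\<Omega>'\<in>cyclic_forms (k' + 1).
        dual_bases b es es' \<and> has_degree d \<Omega> \<and> has_degree d' \<Omega>' \<longrightarrow>
        br \<Omega> \<Omega>' = (\<lambda>xs. \<Sum>i<length es. ksgn (d' * deg (es ! i)) *
          odot (d' + deg (es' ! i)) (contract (es ! i) \<Omega>) (contract (es' ! i) \<Omega>') xs))"


section \<open>Shuffles and the Lie coalgebra of words\<close>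

definition koszul_sign :: "(nat \<Rightarrow> nat) \<Rightarrow> 'v list \<Rightarrow> 'k" where
  "koszul_sign \<sigma> zs =
     (\<Prod>(i, j)\<in>{(i, j). i < j \<and> j < length zs \<and> \<sigma> j < \<sigma> i}. ksgn (deg (zs ! i) * deg (zs ! j)))"

text \<open>A list \<open>[x\<^sub>1, \<dots>, x\<^sub>n]\<close> stands for the word $x_1 \otimes \dots \otimes x_n$.\<close>

definition sh :: "'v list \<Rightarrow> 'v list \<Rightarrow> ('v list \<Rightarrow>\<^sub>0 'k)" where
  "sh xs ys = (\<Sum>\<sigma>\<in>Sh (length xs) (length ys).
     Poly_Mapping.single (permute_list (inv \<sigma>) (xs @ ys)) (koszul_sign \<sigma> (xs @ ys)))"

definition vanishes_on_shuffles ::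
  "('k \<Rightarrow> 'w \<Rightarrow> 'w) \<Rightarrow> nat \<Rightarrow> ('v list \<Rightarrow> 'w::ab_group_add) \<Rightarrow> bool" where
  "vanishes_on_shuffles s k f \<longleftrightarrow>
     (\<forall>xs ys. xs \<noteq> [] \<and> ys \<noteq> [] \<and> length xs + length ys = k \<and> set xs \<subseteq> homog \<and> set ys \<subseteq> homog \<longrightarrow>
        extend s f (sh xs ys) = 0)"

text \<open>
  The quotient $\underline\otimes^+ V[1]$ is presented as \<open>hom_words\<close> modulo \<open>word_relations\<close>:
  formal combinations of non-empty words in homogeneous vectors, modulo multilinearity and
  shuffle products.  Its tensor square is likewise presented by combinations of pairs of words
  modulo \<open>pair_relations\<close>, and linear maps are given by maps of representatives.
\<close>

definition hom_words :: "('v list \<Rightarrow>\<^sub>0 'k) set" where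
  "hom_words = {w. \<forall>xs\<in>Poly_Mapping.keys w. xs \<noteq> [] \<and> set xs \<subseteq> homog}"

definition word_relations :: "('v list \<Rightarrow>\<^sub>0 'k) set" where
  "word_relations = module.span pscale (
     {Poly_Mapping.single (us @ (x + y) # vs) 1 - Poly_Mapping.single (us @ x # vs) 1
        - Poly_Mapping.single (us @ y # vs) 1 | us vs x y i.
        set us \<subseteq> homog \<and> set vs \<subseteq> homog \<and> x \<in> G i \<and> y \<in> G i} \<union>
     {Poly_Mapping.single (us @ (c *s x) # vs) 1 - Poly_Mapping.single (us @ x # vs) c | us vs x c.
        set us \<subseteq> homog \<and> set vs \<subseteq> homog \<and> x \<in> homog} \<union>
     {sh xs ys | xs ys. xs \<noteq> [] \<and> ys \<noteq> [] \<and> set xs \<subseteq> homog \<and> set ys \<subseteq> homog})"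

definition pair_relations :: "('v list \<times> 'v list \<Rightarrow>\<^sub>0 'k) set" where
  "pair_relations = module.span pscale (
     {pprod r w | r w. r \<in> word_relations \<and> w \<in> hom_words} \<union>
     {pprod w r | r w. r \<in> word_relations \<and> w \<in> hom_words})"

definition cobracket :: "('v list \<Rightarrow>\<^sub>0 'k) \<Rightarrow> ('v list \<times> 'v list \<Rightarrow>\<^sub>0 'k)" where
  "cobracket = extend pscale (\<lambda>xs. \<Sum>j=1..<length xs.
     Poly_Mapping.single (take j xs, drop j xs) 1
     - Poly_Mapping.single (drop j xs, take j xs) (ksgn (ldeg (take j xs) * ldeg (drop j xs))))"

definition map_of_degree :: "int \<Rightarrow> (('v list \<Rightarrow>\<^sub>0 'k) \<Rightarrow> ('v list \<Rightarrow>\<^sub>0 'k)) \<Rightarrow> bool" where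
  "map_of_degree m D \<longleftrightarrow>
     Vector_Spaces.linear pscale pscale D \<and> D ` hom_words \<subseteq> hom_words \<and>
     D ` word_relations \<subseteq> word_relations \<and>
     (\<forall>xs. xs \<noteq> [] \<and> set xs \<subseteq> homog \<longrightarrow>
        (\<exists>w\<in>hom_words. (\<forall>ys\<in>Poly_Mapping.keys w. ldeg ys = ldeg xs + m) \<and>
           D (Poly_Mapping.single xs 1) - w \<in> word_relations))"

text \<open>The map $D \otimes id + id \otimes D$ on pairs, for \<open>D\<close> of degree \<open>m\<close>.\<close>

definition pair_action ::
  "int \<Rightarrow> (('v list \<Rightarrow>\<^sub>0 'k) \<Rightarrow> ('v list \<Rightarrow>\<^sub>0 'k)) \<Rightarrow>
    ('v list \<times> 'v list \<Rightarrow>\<^sub>0 'k) \<Rightarrow> ('v list \<times> 'v list \<Rightarrow>\<^sub>0 'k)" where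
  "pair_action m D = extend pscale (\<lambda>(xs, ys).
     pprod (D (Poly_Mapping.single xs 1)) (Poly_Mapping.single ys 1)
     + pscale (ksgn (m * ldeg xs)) (pprod (Poly_Mapping.single xs 1) (D (Poly_Mapping.single ys 1))))"

definition coderivation :: "int \<Rightarrow> (('v list \<Rightarrow>\<^sub>0 'k) \<Rightarrow> ('v list \<Rightarrow>\<^sub>0 'k)) \<Rightarrow> bool" where
  "coderivation m D \<longleftrightarrow> map_of_degree m D \<and>
     (\<forall>w\<in>hom_words. cobracket (D w) - pair_action m D (cobracket w) \<in> pair_relations)"


section \<open>$C_\infty$ structures and commutative Pinczon algebras\<close>

text \<open>
  A sequence of maps $Q_k : \underline\otimes^k V[1] \to V[1]$, $k \geq 1$, is stored in one function \<open>Q\<close>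
  on lists: $Q_k$ is \<open>arity_part k Q\<close>.
\<close>

definition taylor_family :: "('v list \<Rightarrow> 'v) \<Rightarrow> bool" where
  "taylor_family Q \<longleftrightarrow> Q [] = 0 \<and>
     (\<forall>k\<ge>1. multilinear (*s) k (arity_part k Q) \<and> vanishes_on_shuffles (*s) k (arity_part k Q))"

definition proj_V :: "('v list \<Rightarrow>\<^sub>0 'k) \<Rightarrow> 'v" where
  "proj_V = extend (*s) (\<lambda>xs. if length xs = 1 then hd xs else 0)"

definition taylor_components_of ::
  "(('v list \<Rightarrow>\<^sub>0 'k) \<Rightarrow> ('v list \<Rightarrow>\<^sub>0 'k)) \<Rightarrow> ('v list \<Rightarrow> 'v) \<Rightarrow> bool" where
  "taylor_components_of D Q \<longleftrightarrow> taylor_family Q \<and>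
     (\<forall>xs. xs \<noteq> [] \<and> set xs \<subseteq> homog \<longrightarrow> Q xs = proj_V (D (Poly_Mapping.single xs 1)))"

text \<open>A $C_\infty$ structure, given through the Taylor components that determine it.\<close>

definition C_infinity :: "('v list \<Rightarrow> 'v) \<Rightarrow> bool" where
  "C_infinity Q \<longleftrightarrow> (\<exists>D. coderivation 1 D \<and> taylor_components_of D Q \<and>
     (\<forall>w\<in>hom_words. graded_commutator 1 1 D D w \<in> word_relations))"

definition shifted_form :: "('v \<Rightarrow> 'v \<Rightarrow> 'k) \<Rightarrow> 'v \<Rightarrow> 'v \<Rightarrow> 'k" where
  "shifted_form b x y = (\<Sum>i | component x i \<noteq> 0. ksgn (i - 1) * b (component x i) y)"

definition form_of :: "('v \<Rightarrow> 'v \<Rightarrow> 'k) \<Rightarrow> ('v list \<Rightarrow> 'v) \<Rightarrow> 'v list \<Rightarrow> 'k" where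
  "form_of b Q = (\<lambda>zs. if length zs \<ge> 2 then shifted_form b (Q (butlast zs)) (last zs) else 0)"

definition quadratic :: "('v \<Rightarrow> 'v \<Rightarrow> 'k) \<Rightarrow> ('v list \<Rightarrow> 'v) \<Rightarrow> bool" where
  "quadratic b Q \<longleftrightarrow> (\<forall>k\<ge>1. form_of b (arity_part k Q) \<in> cyclic_forms (k + 1))"

definition vsp_forms :: "nat \<Rightarrow> ('v list \<Rightarrow> 'k) set" where
  "vsp_forms k = {\<Omega> \<in> cyclic_forms (k + 1). \<forall>y. vanishes_on_shuffles (*) k (\<lambda>xs. \<Omega> (xs @ [y]))}"

text \<open>
  \<open>\<Omega>\<close> may have infinitely many non-zero components; $\{\Omega,\Omega\} = 0$ is understood arity by
  arity, the \<open>n\<close>-linear part being a finite sum.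
\<close>

definition commutative_pinczon_algebra ::
  "(('v list \<Rightarrow> 'k) \<Rightarrow> ('v list \<Rightarrow> 'k) \<Rightarrow> 'v list \<Rightarrow> 'k) \<Rightarrow> ('v list \<Rightarrow> 'k) \<Rightarrow> bool" where
  "commutative_pinczon_algebra br \<Omega> \<longleftrightarrow> pinczon_bracket br \<and>
     (\<forall>xs. length xs < 2 \<longrightarrow> \<Omega> xs = 0) \<and>
     (\<forall>k\<ge>1. arity_part (k + 1) \<Omega> \<in> vsp_forms k) \<and>
     has_degree 3 \<Omega> \<and>
     (\<forall>n xs. (\<Sum>i=2..n. br (arity_part i \<Omega>) (arity_part (n + 2 - i) \<Omega>) xs) = 0)"

end

end

theory Submission
  imports Defs
begin

text \<open>
  Non-degeneracy of \<open>B\<close> turns a form $\Omega$ into a map $Q$ with $\Omega(x_1, \dots, x_{k+1}) =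
  B(Q(x_1, \dots, x_k), x_{k+1})$, and cyclic invariance gives
  $\{\Omega_Q, \Omega_{Q'}\} = \Omega_{[Q, Q']}$ for the commutator of the pre-Lie product given by
  insertion.  The Jacobi identity of the bracket is therefore the one of the commutator, and
  $\{\Omega, \Omega\} = 0$ means $Q \circ Q = 0$.

  It remains to compare $Q \circ Q = 0$ with the coderivation of the Lie coalgebra of words.  The
  coderivation of the tensor coalgebra with Taylor components $Q_k$ descends to the quotient by shuffle
  products, because each $Q_k$ vanishes on them, and it is the only coderivation with these components:
  by the Dynkin-Specht-Wever argument the cobracket is injective in length at least 2.
\<close>

section \<open>Signs and sums over deconcatenations\<close>

text \<open>Two obstacles shape the proof. Koszul signs need homogeneous arguments, while the maps
  given by non-degeneracy take arbitrary vectors as values. Signs are therefore carried by a linear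
  parity involution on the arguments, and forms are compared as multilinear functions, which only
  have to agree on lists of non-zero homogeneous vectors. Secondly, words modulo shuffles are a
  quotient presented by representatives. A combination of homogeneous words is a relation exactly
  when every multilinear functional vanishing on shuffles kills it; statements about the quotient
  thus become identities between functions on lists, with operators on words replaced by their
  transposes. Uniqueness of a coderivation then requires that each such functional on words of
  length n >= 2 factor through the cobracket. The transposed Dynkin operator, which multiplies these
  functionals by n, gives the factorization, and dividing by n uses characteristic 0. Finally, the
  bracket has a constant component that the maps Q do not see, so its identities on the empty list
  are checked separately.\<close>

definition ssgn :: "int \<Rightarrow> 'w::ab_group_add \<Rightarrow> 'w" where
  "ssgn m w = (if even m then w else - w)"

lemma ssgn_ssgn [simp]: "ssgn m (ssgn n w) = ssgn (m + n) w"
  by (auto simp: ssgn_def)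

lemma ssgn_0 [simp]: "ssgn m 0 = 0"
  by (simp add: ssgn_def)

lemma ssgn_zero [simp]: "ssgn 0 w = w"
  by (simp add: ssgn_def)

lemma ssgn_add: "ssgn m (v + w) = ssgn m v + ssgn m w"
  by (simp add: ssgn_def)

lemma ssgn_minus: "ssgn m (- w) = - ssgn m w"
  by (simp add: ssgn_def)

lemma ssgn_diff: "ssgn m (v - w) = ssgn m v - ssgn m w"
  by (simp add: ssgn_def)

lemma ssgn_eq_0_iff [simp]: "ssgn m w = 0 \<longleftrightarrow> w = 0"
  by (simp add: ssgn_def)

text \<open>Exponents have to agree only where the term is non-zero. Through this hypothesis, degree
  and parity constraints on non-zero values enter the sign computations.\<close>

lemma ssgn_cong: "(w \<noteq> 0 \<Longrightarrow> even (m - n)) \<Longrightarrow> ssgn m w = ssgn n w"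
  by (cases "w = 0") (auto simp: ssgn_def)

lemma ssgn_odd: "odd m \<Longrightarrow> ssgn m w = - w"
  by (simp add: ssgn_def)

lemma ssgn_mult_left: "ssgn m (v * w) = ssgn m v * (w::'a::ring)"
  and ssgn_mult_right: "ssgn m (v * w) = v * ssgn m (w::'a::ring)"
  by (auto simp: ssgn_def)

lemma ksgn_mult_left: "ksgn m * w = ssgn m (w::'a::ring_1)"
  and ksgn_mult_right: "w * ksgn m = ssgn m (w::'a::ring_1)"
  by (auto simp: ssgn_def ksgn_def)

lemma ksgn_add: "ksgn (m + n) = ksgn m * (ksgn n :: 'a::ring_1)"
  by (auto simp: ksgn_def)

lemma ssgn_sum: "ssgn m (sum f A) = (\<Sum>a\<in>A. ssgn m (f a))"
  by (simp add: ssgn_def sum_negf)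

text \<open>Deconcatenation: the sum of \<open>f u w\<close> over all cuts
  \<open>u @ w = xs\<close>, empty parts included. Recursion on the list replaces sums over cut
  positions, so that coassociativity and the exchange of sums are plain inductions.\<close>

fun sp :: "('a list \<Rightarrow> 'a list \<Rightarrow> 'w::comm_monoid_add) \<Rightarrow> 'a list \<Rightarrow> 'w" where
  "sp f [] = f [] []"
| "sp f (x # xs) = f [] (x # xs) + sp (\<lambda>u. f (x # u)) xs"

lemma sp_cong: "(\<And>u w. u @ w = xs \<Longrightarrow> f u w = g u w) \<Longrightarrow> sp f xs = sp g xs"
proof (induction xs arbitrary: f g)
  case (Cons x xs)
  have "sp (\<lambda>u. f (x # u)) xs = sp (\<lambda>u. g (x # u)) xs"
    by (rule Cons.IH) (rule Cons.prems, simp)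
  then show ?case using Cons.prems[of "[]"] by simp
qed simp

lemma sp_cong_all: "(\<And>u w. f u w = g u w) \<Longrightarrow> sp f xs = sp g xs"
  by (rule sp_cong)

lemma sp_zero_fun [simp]: "sp (\<lambda>u w. 0) xs = 0"
  by (induction xs) auto

lemma sp_zero: "(\<And>u w. u @ w = xs \<Longrightarrow> f u w = 0) \<Longrightarrow> sp f xs = 0"
  by (subst sp_cong[where g = "\<lambda>u w. 0"]) auto

lemma sp_add: "sp (\<lambda>u w. f u w + g u w) xs = sp f xs + sp g xs"
  by (induction xs arbitrary: f g) (auto simp: ac_simps)

lemma sp_hom:
  assumes "h 0 = 0" "\<And>x y. h (x + y) = h x + h y"
  shows "h (sp f xs) = sp (\<lambda>u w. h (f u w)) xs"
  using assms by (induction xs arbitrary: f) auto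

lemma sp_ssgn: "ssgn m (sp f xs) = sp (\<lambda>u w. ssgn m (f u w)) xs"
  by (intro sp_hom) (auto simp: ssgn_add)

lemma sp_minus: "- sp f xs = sp (\<lambda>u w. - f u w) (xs :: 'a list)" for f :: "_ \<Rightarrow> _ \<Rightarrow> 'w::ab_group_add"
  by (intro sp_hom) auto

lemma sp_diff: "sp (\<lambda>u w. f u w - g u w) xs = sp f xs - sp g xs" for f :: "_ \<Rightarrow> _ \<Rightarrow> 'w::ab_group_add"
  using sp_add[of f "\<lambda>u w. - g u w" xs] by (simp add: sp_minus[symmetric])

lemma sp_sum: "(\<Sum>a\<in>A. sp (f a) xs) = sp (\<lambda>u w. \<Sum>a\<in>A. f a u w) xs"
  by (induction A rule: infinite_finite_induct) (auto simp: sp_zero sp_add[symmetric])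

lemma sp_eq_sum: "sp f xs = (\<Sum>j\<le>length xs. f (take j xs) (drop j xs))"
  by (induction xs arbitrary: f) (simp_all add: sum.atMost_Suc_shift del: sum.atMost_Suc)

lemma sp_map: "sp f (map h xs) = sp (\<lambda>u w. f (map h u) (map h w)) xs"
  by (induction xs arbitrary: f) auto

text \<open>A cut falls either before or after the distinguished letter \<open>y\<close>.\<close>

lemma sp_insert:
  "sp f (a @ y # c) = sp (\<lambda>u w. f u (w @ y # c)) a + sp (\<lambda>u w. f (a @ y # u) w) c"
  by (induction a arbitrary: f) (auto simp: ac_simps)

lemma sp_snoc: "sp f (xs @ [y]) = sp (\<lambda>u w. f u (w @ [y])) xs + f (xs @ [y]) []"
  by (simp add: sp_insert)

lemma sp_assoc:
  "sp (\<lambda>u r. sp (\<lambda>v w. f u v w) r) xs = sp (\<lambda>l w. sp (\<lambda>u v. f u v w) l) xs"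
  by (induction xs arbitrary: f) (auto simp: sp_add ac_simps)

lemma sp_swap:
  "sp (\<lambda>u w. sp (\<lambda>p q. f u w p q) ys) xs = sp (\<lambda>p q. sp (\<lambda>u w. f u w p q) xs) ys"
  by (induction xs arbitrary: f) (auto simp: sp_add)

text \<open>Both sides run over all ways to write \<open>xs\<close> as five consecutive blocks
  \<open>a\<close>, \<open>b\<close>, \<open>c\<close>, \<open>v\<close>, \<open>w\<close>; only the
  order of the cuts differs. The order on the left arises when the prefix before one inserted block
  is searched for another.\<close>

lemma sp_reorder_left:
  "sp (\<lambda>u r. sp (\<lambda>v w. sp (\<lambda>a t. sp (\<lambda>b c. f a b c v w) t) u) r) xs =
    sp (\<lambda>a r. sp (\<lambda>b r. sp (\<lambda>c r. sp (\<lambda>v w. f a b c v w) r) r) r) xs" (is "?L = ?R")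
proof -
  have "?L = sp (\<lambda>u r. sp (\<lambda>a t. sp (\<lambda>v w. sp (\<lambda>b c. f a b c v w) t) r) u) xs"
    by (rule sp_cong_all, rule sp_swap)
  also have "\<dots> = sp (\<lambda>a R. sp (\<lambda>t r. sp (\<lambda>v w. sp (\<lambda>b c. f a b c v w) t) r) R) xs"
    by (rule sp_assoc[symmetric])
  also have "\<dots> = sp (\<lambda>a R. sp (\<lambda>t r. sp (\<lambda>b c. sp (\<lambda>v w. f a b c v w) r) t) R) xs"
    by (rule sp_cong_all, rule sp_cong_all, rule sp_swap)
  also have "\<dots> = ?R"
    by (rule sp_cong_all, rule sp_assoc[symmetric])
  finally show ?thesis .
qed

text \<open>The regrouping for nested insertions: the block \<open>v\<close> is evaluated first, and
  its value becomes a letter between \<open>t\<close> and \<open>b\<close> in the block fed to the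
  other map.\<close>

lemma sp_reorder_middle:
  "sp (\<lambda>u r. sp (\<lambda>v w. sp (\<lambda>a t. sp (\<lambda>b c. f a t v b c) w) u) r) xs =
    sp (\<lambda>a r. sp (\<lambda>m c. sp (\<lambda>t r. sp (\<lambda>v b. f a t v b c) r) m) r) xs" (is "?L = ?R")
proof -
  have "?R = sp (\<lambda>a r. sp (\<lambda>t r. sp (\<lambda>l c. sp (\<lambda>v b. f a t v b c) l) r) r) xs"
    by (rule sp_cong_all, rule sp_assoc[symmetric])
  also have "\<dots> = sp (\<lambda>a r. sp (\<lambda>t r. sp (\<lambda>v r. sp (\<lambda>b c. f a t v b c) r) r) r) xs"
    by (rule sp_cong_all, rule sp_cong_all, rule sp_assoc[symmetric])
  also have "\<dots> = sp (\<lambda>u r. sp (\<lambda>a t. sp (\<lambda>v w. sp (\<lambda>b c. f a t v b c) w) r) u) xs"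
    by (rule sp_assoc)
  also have "\<dots> = ?L"
    by (rule sp_cong_all, rule sp_swap)
  finally show ?thesis by simp
qed

lemma sp_left_empty:
  assumes "\<And>u w. u \<noteq> [] \<Longrightarrow> f u w = 0" shows "sp f xs = f [] xs"
proof (cases xs)
  case (Cons a list)
  have "sp (\<lambda>u. f (a # u)) list = 0" by (rule sp_zero) (simp add: assms)
  then show ?thesis using Cons by simp
qed simp

lemma sp_right_empty:
  assumes "\<And>u w. w \<noteq> [] \<Longrightarrow> f u w = 0" shows "sp f xs = f xs []"
  using assms
proof (induction xs arbitrary: f)
  case (Cons x xs)
  show ?case using Cons.prems by (simp add: Cons.IH[OF Cons.prems])
qed simp

section \<open>Graded vector spaces\<close>

context graded_vector_space
begin

lemma vector_space_mult: "vector_space ((*) :: 'k \<Rightarrow> 'k \<Rightarrow> 'k)"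
  by unfold_locales (auto simp: algebra_simps)

lemma ksgn_scale: "ksgn m *s w = ssgn m w"
  by (simp add: ksgn_def ssgn_def)

lemma ssgn_scale: "ssgn m (c *s w) = c *s ssgn m w"
  by (simp add: ssgn_def)

lemma component_in: "component x i \<in> G i"
  and finite_component: "finite {i. component x i \<noteq> 0}"
  and sum_component: "(\<Sum>i | component x i \<noteq> 0. component x i) = x"
  using theI'[OF direct_sum[of x]] unfolding component_def by auto

lemma component_unique:
  assumes "\<And>i. c i \<in> G i" "finite {i. c i \<noteq> 0}" "(\<Sum>i | c i \<noteq> 0. c i) = x"
  shows "component x = c"
  unfolding component_def using assms by (intro the1_equality direct_sum) auto

lemma sum_component_superset:
  assumes "finite S" "{i. component x i \<noteq> 0} \<subseteq> S"
  shows "(\<Sum>i\<in>S. component x i) = x"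
proof -
  have "(\<Sum>i\<in>S. component x i) = (\<Sum>i | component x i \<noteq> 0. component x i)"
    using assms by (intro sum.mono_neutral_right) auto
  then show ?thesis by (simp add: sum_component)
qed

lemma component_unique':
  assumes "\<And>i. c i \<in> G i" "finite S" "\<And>i. i \<notin> S \<Longrightarrow> c i = 0" "(\<Sum>i\<in>S. c i) = x"
  shows "component x = c"
proof (rule component_unique)
  have sub: "{i. c i \<noteq> 0} \<subseteq> S" using assms(3) by auto
  show "finite {i. c i \<noteq> 0}" using finite_subset[OF sub assms(2)] .
  show "(\<Sum>i | c i \<noteq> 0. c i) = x"
    using assms(2) sub unfolding assms(4)[symmetric] by (intro sum.mono_neutral_left) auto
qed (rule assms(1))

lemma component_add: "component (x + y) i = component x i + component y i"
proof -
  let ?S = "{i. component x i \<noteq> 0} \<union> {i. component y i \<noteq> 0}"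
  have "component (x + y) = (\<lambda>i. component x i + component y i)"
  proof (rule component_unique')
    show "finite ?S" using finite_component by blast
    show "(\<Sum>i\<in>?S. component x i + component y i) = x + y"
      using finite_component by (simp add: sum.distrib sum_component_superset)
    show "component x i + component y i \<in> G i" for i
      using component_in subspace_component subspace_add by blast
    show "component x i + component y i = 0" if "i \<notin> ?S" for i
      using that by simp
  qed
  then show ?thesis by simp
qed

lemma component_scale: "component (c *s x) i = c *s component x i"
proof -
  have "component (c *s x) = (\<lambda>i. c *s component x i)"
  proof (rule component_unique'[where S = "{i. component x i \<noteq> 0}"])
    show "c *s component x i \<in> G i" for i
      using component_in subspace_component subspace_scale by blast
    show "(\<Sum>i | component x i \<noteq> 0. c *s component x i) = c *s x"
      by (simp add: scale_sum_right[symmetric] sum_component)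
  qed (auto simp: finite_component)
  then show ?thesis by simp
qed

lemma component_zero [simp]: "component 0 i = 0"
  using component_scale[of 0 0 i] by simp

lemma component_minus: "component (- x) i = - component x i"
  using component_scale[of "-1" x i] by simp

lemma component_homog:
  assumes "x \<in> G i" shows "component x j = (if j = i then x else 0)"
proof -
  have "component x = (\<lambda>j. if j = i then x else 0)"
  proof (rule component_unique'[where S = "{i}"])
    show "(if j = i then x else 0) \<in> G j" for j
      using assms subspace_0[OF subspace_component] by simp
  qed auto
  then show ?thesis by simp
qed

lemma component_eqI: assumes "\<And>i. component x i = component y i" shows "x = y"
proof -
  have "component x = component y" using assms by blast
  then have "(\<Sum>i | component x i \<noteq> 0. component x i) = (\<Sum>i | component y i \<noteq> 0. component y i)"
    by (rule arg_cong)
  then show ?thesis by (simp only: sum_component)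
qed

lemma zero_in_G [simp]: "0 \<in> G i"
  using subspace_component by (rule subspace_0)

lemma component_in_homog [simp]: "component x i \<in> homog"
  using component_in by (auto simp: homog_def)

lemma G_homog: "x \<in> G i \<Longrightarrow> x \<in> homog"
  by (auto simp: homog_def)

lemma vdeg_eq: assumes "x \<in> G i" "x \<noteq> 0" shows "vdeg x = i"
proof -
  have "j = i" if "x \<in> G j" for j
    by (metis component_homog[OF assms(1), of j] component_homog[OF that, of j] assms(2))
  then have "(THE i. x \<in> G i) = i" using assms(1) by (intro the_equality)
  then show ?thesis using assms(2) by (simp add: vdeg_def)
qed

lemma deg_eq: "x \<in> G i \<Longrightarrow> x \<noteq> 0 \<Longrightarrow> deg x = i - 1"
  by (simp add: deg_def vdeg_eq)

lemma homog_vdeg: "x \<in> homog \<Longrightarrow> x \<in> G (vdeg x)"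
  by (cases "x = 0") (force simp: homog_def vdeg_eq)+

lemma homog_deg: "x \<in> homog \<Longrightarrow> x \<in> G (deg x + 1)"
  using homog_vdeg by (simp add: deg_def)

lemma scale_homog: "x \<in> homog \<Longrightarrow> c *s x \<in> homog"
  using subspace_component by (auto simp: homog_def intro: subspace_scale)

lemma ldeg_simps [simp]: "ldeg [] = 0" "ldeg (x # xs) = deg x + ldeg xs"
  "ldeg (us @ vs) = ldeg us + ldeg vs"
  by (auto simp: ldeg_def)

subsection \<open>The parity involution\<close>

text \<open>The Koszul sign of moving an object of degree \<open>m\<close> past some arguments is expressed by applying
  \<open>sg m\<close> to these arguments.  In this form it is linear and makes sense on all vectors, so that
  most identities below need no homogeneity.\<close>

definition sigma :: "'v \<Rightarrow> 'v" where
  "sigma x = (\<Sum>i | component x i \<noteq> 0. ssgn (i - 1) (component x i))"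

definition sg :: "int \<Rightarrow> 'v \<Rightarrow> 'v" where
  "sg m x = (if even m then x else sigma x)"

lemma component_sigma: "component (sigma x) i = ssgn (i - 1) (component x i)"
proof -
  have "component (sigma x) = (\<lambda>i. ssgn (i - 1) (component x i))"
  proof (rule component_unique'[where S = "{i. component x i \<noteq> 0}"])
    show "ssgn (i - 1) (component x i) \<in> G i" for i
      using component_in[of x i] subspace_neg[OF subspace_component] by (simp add: ssgn_def)
  qed (simp_all add: finite_component sigma_def)
  then show ?thesis by simp
qed

lemma component_sg: "component (sg m x) i = ssgn (m * (i - 1)) (component x i)"
  by (auto simp: sg_def component_sigma ssgn_def)

lemma sg_sg [simp]: "sg m (sg n x) = sg (m + n) x"
  by (rule component_eqI) (auto simp: component_sg intro!: ssgn_cong)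

lemma sg_0 [simp]: "sg 0 x = x"
  by (simp add: sg_def)

lemma sg_zero [simp]: "sg m 0 = 0"
  by (rule component_eqI) (auto simp: component_sg)

lemma sg_add: "sg m (x + y) = sg m x + sg m y"
  by (rule component_eqI) (auto simp: component_sg component_add ssgn_add)

lemma sg_scale: "sg m (c *s x) = c *s sg m x"
  by (rule component_eqI) (auto simp: component_sg component_scale ssgn_scale)

lemma linear_sg: "Vector_Spaces.linear scale scale (sg m)"
  by (simp add: Vector_Spaces.linear_iff sg_add sg_scale vector_space_axioms)

lemma sg_cong: "even (m - n) \<Longrightarrow> sg m x = sg n x"
  by (auto simp: sg_def)

lemma map_sg_cong: "even (m - n) \<Longrightarrow> map (sg m) xs = map (sg n) xs"
  by (auto simp: sg_def)

lemma map_sg_map_sg [simp]: "map (sg m) (map (sg n) xs) = map (sg (m + n)) xs"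
  by simp

lemma map_sg_even_odd: "map (sg m) xs = (if even m then xs else map (sg 1) xs)"
  by (induction xs) (auto simp: sg_def)

lemma map_sg_0 [simp]: "map (sg 0) xs = xs"
  by (induction xs) auto

text \<open>An eigenvector condition for the parity involution. It is weaker than homogeneity, holds
  for \<open>0\<close> with every \<open>m\<close>, and suffices for moving a vector past other
  arguments.\<close>

definition ph :: "int \<Rightarrow> 'v \<Rightarrow> bool" where
  "ph m x \<longleftrightarrow> sg 1 x = ssgn m x"

lemma ph_sg: "ph m x \<Longrightarrow> sg n x = ssgn (n * m) x"
  by (auto simp: ph_def sg_def ssgn_def split: if_splits)

lemma G_ph: "x \<in> G i \<Longrightarrow> ph (i - 1) x"
  unfolding ph_def
  by (rule component_eqI) (auto simp: component_sg component_homog ssgn_def component_minus)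

lemma homog_ph: "x \<in> homog \<Longrightarrow> ph (deg x) x"
  using G_ph[OF homog_deg] by simp

text \<open>The projection onto the eigenspace described by \<open>ph m\<close>; it needs 1/2 in the
  field.\<close>

definition pp :: "int \<Rightarrow> 'v \<Rightarrow> 'v" where
  "pp m x = (1/2) *s (x + ssgn m (sg 1 x))"

lemma linear_pp: "Vector_Spaces.linear scale scale (pp m)"
  by (simp add: Vector_Spaces.linear_iff pp_def sg_add sg_scale vector_space_axioms ssgn_add ssgn_scale algebra_simps)

lemma pp_ph: "ph n x \<Longrightarrow> pp m x = (if even (m - n) then x else 0)"
proof -
  assume "ph n x"
  moreover have "(1/2) *s (x + x) = x"
    using scale_left_distrib[of "1/2" "1/2" x] by (simp add: scale_right_distrib)
  ultimately show ?thesis by (auto simp: pp_def ph_def ssgn_def)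
qed

subsection \<open>Multilinear functions of lists\<close>

text \<open>Multilinearity in all arities at once, with no condition on the empty list. Forms with
  infinitely many components are covered without splitting them by arity.\<close>

definition mlin :: "('k \<Rightarrow> 'w \<Rightarrow> 'w) \<Rightarrow> ('v list \<Rightarrow> 'w::ab_group_add) \<Rightarrow> bool" where
  "mlin s F \<longleftrightarrow> (\<forall>us vs. Vector_Spaces.linear scale s (\<lambda>x. F (us @ x # vs)))"

lemma mlinD: "mlin s F \<Longrightarrow> Vector_Spaces.linear scale s (\<lambda>x. F (us @ x # vs))"
  by (simp add: mlin_def)

lemma mlin_vs: "mlin s F \<Longrightarrow> vector_space s"
  using mlinD[of s F] by (auto simp: Vector_Spaces.linear_iff)

lemma mlin_add: "mlin s F \<Longrightarrow> F (us @ (x + y) # vs) = F (us @ x # vs) + F (us @ y # vs)"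
  using mlinD[of s F us vs] by (auto simp: Vector_Spaces.linear_iff)

lemma mlin_scale: "mlin s F \<Longrightarrow> F (us @ (c *s x) # vs) = s c (F (us @ x # vs))"
  using mlinD[of s F us vs] by (auto simp: Vector_Spaces.linear_iff)

lemma mlin_zero: "mlin s F \<Longrightarrow> F (us @ 0 # vs) = 0"
  using mlin_add[of s F us 0 0 vs] by simp

lemma mlin_zero_set: assumes "mlin s F" "0 \<in> set xs" shows "F xs = 0"
  using mlin_zero[OF assms(1)] split_list[OF assms(2)] by auto

lemma mlin_minus: "mlin s F \<Longrightarrow> F (us @ (- x) # vs) = - F (us @ x # vs)"
  using mlin_add[of s F us x "- x" vs] by (simp add: mlin_zero eq_neg_iff_add_eq_0 add.commute)

lemma mlin_diff: "mlin s F \<Longrightarrow> F (us @ (x - y) # vs) = F (us @ x # vs) - F (us @ y # vs)"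
  using mlin_add[of s F us x "- y" vs] by (simp add: mlin_minus)

lemma mlin_ssgn: "mlin s F \<Longrightarrow> F (us @ ssgn m x # vs) = ssgn m (F (us @ x # vs))"
  by (simp add: ssgn_def mlin_minus)

lemma mlin_sum: "mlin s F \<Longrightarrow> F (us @ (\<Sum>i\<in>I. f i) # vs) = (\<Sum>i\<in>I. F (us @ f i # vs))"
  by (induction I rule: infinite_finite_induct) (auto simp: mlin_zero mlin_add)

lemma mlin_sp: "mlin s F \<Longrightarrow> F (us @ sp f xs # vs) = sp (\<lambda>u w. F (us @ f u w # vs)) xs"
  by (rule sp_hom[of "\<lambda>x. F (us @ x # vs)"]) (auto simp: mlin_zero mlin_add)

lemma mlinI:
  assumes "vector_space s"
    "\<And>us vs x y. F (us @ (x + y) # vs) = F (us @ x # vs) + F (us @ y # vs)"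
    "\<And>us vs c x. F (us @ (c *s x) # vs) = s c (F (us @ x # vs))"
  shows "mlin s F"
  using assms by (simp add: mlin_def Vector_Spaces.linear_iff vector_space_axioms)

lemma multilinear_iff_mlin:
  assumes "vector_space s"
  shows "multilinear s k F \<longleftrightarrow> mlin s F \<and> (\<forall>xs. length xs \<noteq> k \<longrightarrow> F xs = 0)"
proof
  interpret s: vector_space s by fact
  assume F: "multilinear s k F"
  have "mlin s F"
  proof (rule mlinI)
    fix us vs x y
    show "F (us @ (x + y) # vs) = F (us @ x # vs) + F (us @ y # vs)"
      using F by (cases "length us + length vs + 1 = k") (auto simp: multilinear_def)
  next
    fix us vs c x
    show "F (us @ (c *s x) # vs) = s c (F (us @ x # vs))"
      using F by (cases "length us + length vs + 1 = k") (auto simp: multilinear_def)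
  qed (fact assms)
  then show "mlin s F \<and> (\<forall>xs. length xs \<noteq> k \<longrightarrow> F xs = 0)"
    using F by (simp add: multilinear_def)
qed (auto simp: multilinear_def mlin_add mlin_scale)

lemma mlin_by_arity:
  assumes "vector_space s" "\<And>k. mlin s (arity_part k F)"
  shows "mlin s F"
proof (rule mlinI)
  fix us vs x y
  show "F (us @ (x + y) # vs) = F (us @ x # vs) + F (us @ y # vs)"
    using mlin_add[OF assms(2)[of "length us + length vs + 1"], of us x y vs] by (simp add: arity_part_def)
next
  fix us vs c x
  show "F (us @ (c *s x) # vs) = s c (F (us @ x # vs))"
    using mlin_scale[OF assms(2)[of "length us + length vs + 1"], of us c x vs] by (simp add: arity_part_def)
qed (fact assms(1))

lemma mlin_length_scale:
  fixes F :: "'v list \<Rightarrow> 'k"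
  assumes "mlin (*) F" shows "mlin (*) (\<lambda>xs. c (length xs) * F xs)"
  by (rule mlinI) (auto simp: vector_space_mult mlin_add[OF assms] mlin_scale[OF assms] algebra_simps)

lemma mlin_arity_part: "mlin s F \<Longrightarrow> mlin s (arity_part k F)"
proof -
  assume F: "mlin s F"
  interpret s: vector_space s by (rule mlin_vs[OF F])
  show ?thesis
    by (rule mlinI) (auto simp: arity_part_def mlin_add[OF F] mlin_scale[OF F] s.vector_space_axioms)
qed

lemma mlin_append_left: "mlin s F \<Longrightarrow> mlin s (\<lambda>u. F (a @ u))"
  using mlinD[of s F "a @ _"] by (simp add: mlin_def)

lemma mlin_Cons: "mlin s F \<Longrightarrow> mlin s (\<lambda>u. F (a # u))"
  using mlin_append_left[of s F "[a]"] by simp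

lemma mlin_append_right: "mlin s F \<Longrightarrow> mlin s (\<lambda>u. F (u @ c))"
  using mlinD[of s F _ "_ @ c"] by (simp add: mlin_def)

lemma linear_comp:
  "Vector_Spaces.linear scale s f \<Longrightarrow> Vector_Spaces.linear scale scale g \<Longrightarrow>
    Vector_Spaces.linear scale s (\<lambda>x. f (g x))"
  by (simp add: Vector_Spaces.linear_iff)

lemma mlin_map: "mlin s F \<Longrightarrow> Vector_Spaces.linear scale scale g \<Longrightarrow> mlin s (\<lambda>u. F (map g u))"
  unfolding mlin_def by (auto intro: linear_comp[where g = g])

lemma mlin_map_sg: "mlin s F \<Longrightarrow> mlin s (\<lambda>u. F (map (sg m) u))"
  by (rule mlin_map[OF _ linear_sg])

lemma mlin_insert: "mlin s F \<Longrightarrow> mlin scale Q \<Longrightarrow> mlin s (\<lambda>v. F (a @ Q v # c))"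
  by (auto simp: mlin_def intro: linear_comp[where f = "\<lambda>x. F (a @ x # c)"])

lemma mlin_plus: "mlin s F \<Longrightarrow> mlin s H \<Longrightarrow> mlin s (\<lambda>u. F u + H u)"
  unfolding mlin_def Vector_Spaces.linear_iff using vector_space.vector_space_assms(1)
  by (auto simp: vector_space.vector_space_assms)

lemma mlin_const_scale: "mlin s F \<Longrightarrow> mlin s (\<lambda>u. s c (F u))"
  unfolding mlin_def Vector_Spaces.linear_iff
  by (auto simp: vector_space.vector_space_assms mult.commute)

lemma mlin_neg: "mlin s F \<Longrightarrow> mlin s (\<lambda>u. - F u)"
proof -
  assume F: "mlin s F"
  interpret s: vector_space s by (rule mlin_vs[OF F])
  show ?thesis using mlin_const_scale[OF F, of "-1"] by simp
qed

lemma mlin_of_ssgn: "mlin s F \<Longrightarrow> mlin s (\<lambda>u. ssgn m (F u))"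
  by (cases "even m") (simp_all add: ssgn_def mlin_neg)

lemma mlin_minus_fun: "mlin s F \<Longrightarrow> mlin s H \<Longrightarrow> mlin s (\<lambda>u. F u - H u)"
  using mlin_plus[OF _ mlin_neg, of s F H] by simp

lemma mlin_zero_fun: assumes "vector_space s" shows "mlin s (\<lambda>u. 0)"
proof -
  interpret s: vector_space s by fact
  show ?thesis by (rule mlinI) (auto intro: assms)
qed

lemma mlin_sum_fun: "vector_space s \<Longrightarrow> (\<And>i. i \<in> I \<Longrightarrow> mlin s (F i)) \<Longrightarrow> mlin s (\<lambda>u. \<Sum>i\<in>I. F i u)"
  by (induction I rule: infinite_finite_induct) (auto simp: mlin_zero_fun mlin_plus)

lemma mlin_sp_fun:
  assumes "\<And>w. mlin s (\<lambda>u. f u w)" "\<And>u. mlin s (f u)"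
  shows "mlin s (sp f)"
proof (rule mlinI)
  interpret s: vector_space s by (rule mlin_vs[OF assms(2)])
  show "vector_space s" by unfold_locales
  fix us vs x y c
  note a = mlin_add[OF assms(1)] mlin_scale[OF assms(1)]
  note b = mlin_add[OF assms(2)] mlin_scale[OF assms(2)]
  show "sp f (us @ (x + y) # vs) = sp f (us @ x # vs) + sp f (us @ y # vs)"
    by (simp add: sp_insert a b sp_add ac_simps)
  show "sp f (us @ (c *s x) # vs) = s c (sp f (us @ x # vs))"
    by (simp add: sp_insert a b s.scale_right_distrib sp_hom[of "s c"])
qed

text \<open>Each argument is the sum of its components, so lists of non-zero homogeneous vectors,
  where \<open>deg\<close> is the true degree, determine a multilinear function. Keeping the length
  admits hypotheses that hold in one arity only.\<close>

lemma mlin_eqI: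
  assumes F: "mlin s F" and H: "mlin s H"
    and eq: "\<And>ys. length ys = length xs \<Longrightarrow> set ys \<subseteq> homog - {0} \<Longrightarrow> F ys = H ys"
  shows "F xs = H xs"
proof -
  \<comment> \<open>\<open>vs\<close> is the part of the list that is already homogeneous; it grows
    to the left.\<close>
  have "F (us @ vs) = H (us @ vs)" if "set vs \<subseteq> homog - {0}" "length (us @ vs) = length xs" for us vs
    using that
  proof (induction us arbitrary: vs rule: rev_induct)
    case (snoc x us)
    have "F (us @ component x i # vs) = H (us @ component x i # vs)" if "component x i \<noteq> 0" for i
      using snoc.IH[of "component x i # vs"] snoc.prems that by simp
    then have "F (us @ (\<Sum>i | component x i \<noteq> 0. component x i) # vs) =
        H (us @ (\<Sum>i | component x i \<noteq> 0. component x i) # vs)"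
      by (simp add: mlin_sum[OF F] mlin_sum[OF H])
    then show ?case by (simp add: sum_component)
  qed (simp add: eq)
  from this[of "[]" xs] show ?thesis by simp
qed

lemma linear_eqI:
  assumes "Vector_Spaces.linear scale s f" "Vector_Spaces.linear scale s g"
    "\<And>x. x \<in> homog - {0} \<Longrightarrow> f x = g x"
  shows "f x = g x"
proof -
  have sum: "h x = (\<Sum>i | component x i \<noteq> 0. h (component x i))"
    if h: "Vector_Spaces.linear scale s h" for h
  proof -
    have add: "h (a + b) = h a + h b" for a b using h by (simp add: Vector_Spaces.linear_iff)
    then have "h 0 = 0" by (metis add_cancel_right_right add_0_right)
    with add have "h (sum f I) = (\<Sum>i\<in>I. h (f i))" for f :: "int \<Rightarrow> 'v" and I
      by (induction I rule: infinite_finite_induct) auto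
    from this[of "component x"] show ?thesis by (metis sum_component)
  qed
  show ?thesis
    unfolding sum[OF assms(1)] sum[OF assms(2)] by (intro sum.cong refl assms(3)) auto
qed

text \<open>The dictionary between the two encodings of a Koszul sign: the involution on a block of
  homogeneous arguments, and an exponent in front of the value.\<close>

lemma mlin_sg_list:
  "mlin s F \<Longrightarrow> set xs \<subseteq> homog \<Longrightarrow>
    F (as @ map (sg m) xs @ cs) = ssgn (m * ldeg xs) (F (as @ xs @ cs))"
proof (induction xs arbitrary: as)
  case (Cons x xs)
  have "F (as @ map (sg m) (x # xs) @ cs) = F (as @ ssgn (m * deg x) x # map (sg m) xs @ cs)"
    using Cons.prems by (simp add: ph_sg[OF homog_ph])
  also have "\<dots> = ssgn (m * deg x) (F ((as @ [x]) @ map (sg m) xs @ cs))"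
    using Cons.prems by (simp add: mlin_ssgn)
  also have "\<dots> = ssgn (m * deg x) (ssgn (m * ldeg xs) (F ((as @ [x]) @ xs @ cs)))"
    using Cons.IH[of "as @ [x]"] Cons.prems by simp
  finally show ?case by (simp add: algebra_simps)
qed simp

lemma mlin_sg_list0:
  "mlin s F \<Longrightarrow> set xs \<subseteq> homog \<Longrightarrow> F (map (sg m) xs) = ssgn (m * ldeg xs) (F xs)"
  using mlin_sg_list[of s F xs "[]" m "[]"] by simp

subsection \<open>Multilinear extension\<close>

lemma hom_extend_Nil: "hom_extend f [] = f []"
  by (simp add: hom_extend_def)

lemma hom_extend_Cons:
  "hom_extend f (x # xs) = (\<Sum>i | component x i \<noteq> 0. hom_extend (\<lambda>u. f (component x i # u)) xs)"
proof -
  let ?L = "listset (map (\<lambda>x. {i. component x i \<noteq> 0}) xs)"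
  have fin: "finite ?L"
  proof (induction xs)
    case (Cons y ys)
    have "set_Cons A B = (\<lambda>(a, l). a # l) ` (A \<times> B)" for A :: "int set" and B
      by (auto simp: set_Cons_def)
    then show ?case using Cons finite_component by simp
  qed simp
  have "listset (map (\<lambda>x. {i. component x i \<noteq> 0}) (x # xs)) =
      (\<lambda>(i, l). i # l) ` ({i. component x i \<noteq> 0} \<times> ?L)"
    by (auto simp: set_Cons_def)
  moreover have "inj_on (\<lambda>(i, l). i # l) ({i. component x i \<noteq> 0} \<times> ?L)"
    by (auto simp: inj_on_def)
  ultimately have "hom_extend f (x # xs) =
      (\<Sum>p\<in>{i. component x i \<noteq> 0} \<times> ?L. f (map2 component (x # xs) (fst p # snd p)))"
    unfolding hom_extend_def by (simp add: sum.reindex case_prod_unfold)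
  also have "\<dots> = (\<Sum>i | component x i \<noteq> 0. \<Sum>l\<in>?L. f (map2 component (x # xs) (i # l)))"
    by (subst sum.cartesian_product) (simp add: case_prod_unfold)
  finally show ?thesis by (simp add: hom_extend_def)
qed

text \<open>This replaces a formula defined through homogeneous components by any multilinear
  function agreeing with it on non-zero homogeneous lists.\<close>

lemma hom_extend_eq_mlin:
  assumes "mlin (*) F" "\<And>xs. set xs \<subseteq> homog - {0} \<Longrightarrow> f xs = F xs"
  shows "hom_extend f xs = F xs"
  using assms
proof (induction xs arbitrary: f F)
  case Nil
  then show ?case by (simp add: hom_extend_Nil)
next
  case (Cons x xs)
  have "hom_extend (\<lambda>u. f (component x i # u)) xs = F (component x i # xs)" if "component x i \<noteq> 0" for i
    by (rule Cons.IH[OF mlin_Cons[OF Cons.prems(1)]]) (use Cons.prems(2) that in simp)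
  then have "hom_extend f (x # xs) = (\<Sum>i | component x i \<noteq> 0. F ([] @ component x i # xs))"
    by (simp add: hom_extend_Cons)
  also have "\<dots> = F (x # xs)"
    by (subst mlin_sum[OF Cons.prems(1), symmetric]) (simp add: sum_component)
  finally show ?case .
qed

subsection \<open>Rotations and cyclic forms\<close>

text \<open>Cyclic rotation with its Koszul sign, made linear: the first letter is split into its
  two parity parts, and the odd part applies the involution to the letters that it passes.\<close>

fun rot :: "('v list \<Rightarrow> 'w::ab_group_add) \<Rightarrow> 'v list \<Rightarrow> 'w" where
  "rot F [] = F []"
| "rot F (x # xs) = F (xs @ [pp 0 x]) + F (map (sg 1) xs @ [pp 1 x])"

lemma pp_add: "pp m (x + y) = pp m x + pp m y"
  and pp_scale: "pp m (c *s x) = c *s pp m x"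
  using linear_pp[of m] by (auto simp: Vector_Spaces.linear_iff)

lemma mlin_rot: assumes "mlin s F" shows "mlin s (rot F)"
proof (rule mlinI)
  interpret s: vector_space s by (rule mlin_vs[OF assms])
  show "vector_space s" by unfold_locales
  fix us vs x y c
  note last = mlin_add[OF assms, of _ _ _ "[]"] mlin_scale[OF assms, of _ _ _ "[]"]
  show "rot F (us @ (x + y) # vs) = rot F (us @ x # vs) + rot F (us @ y # vs)"
  proof (cases us)
    case (Cons a us')
    show ?thesis
      using mlin_add[OF mlin_append_right[OF assms, of "[pp 0 a]"], of us' x y vs]
        mlin_add[OF mlin_map_sg[OF mlin_append_right[OF assms, of "[pp 1 a]"], of 1], of us' x y vs]
      by (simp add: Cons)
  qed (simp add: pp_add last)
  show "rot F (us @ (c *s x) # vs) = s c (rot F (us @ x # vs))"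
  proof (cases us)
    case (Cons a us')
    show ?thesis
      using mlin_scale[OF mlin_append_right[OF assms, of "[pp 0 a]"], of us' c x vs]
        mlin_scale[OF mlin_map_sg[OF mlin_append_right[OF assms, of "[pp 1 a]"], of 1], of us' c x vs]
      by (simp add: Cons s.scale_right_distrib)
  qed (simp add: pp_scale last s.scale_right_distrib)
qed

lemma mlin_rot_pow: "mlin s F \<Longrightarrow> mlin s ((rot ^^ j) F)"
  by (induction j) (auto intro: mlin_rot)

lemma rot_ph:
  assumes F: "mlin s F" and "ph m y" shows "rot F (y # xs) = F (map (sg m) xs @ [y])"
proof -
  have "F (us @ [0]) = 0" for us using mlin_zero[OF F, of us "[]"] .
  then show ?thesis using assms(2) map_sg_even_odd[of m xs] by (auto simp: pp_ph)
qed

lemma rot_homog: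
  assumes "mlin s F" "x \<in> homog" "set xs \<subseteq> homog"
  shows "rot F (x # xs) = ssgn (deg x * ldeg xs) (F (xs @ [x]))"
  using rot_ph[OF assms(1) homog_ph[OF assms(2)], of xs]
    mlin_sg_list[OF assms(1,3), of "[]" "deg x" "[x]"] by simp

lemma rot_pow_block:
  assumes "mlin s F" "set us \<subseteq> homog" "set vs \<subseteq> homog"
  shows "(rot ^^ length us) F (us @ vs) = ssgn (ldeg us * ldeg vs) (F (vs @ us))"
  using assms
proof (induction us arbitrary: vs)
  case (Cons x us)
  have "(rot ^^ length (x # us)) F ((x # us) @ vs) = rot ((rot ^^ length us) F) (x # us @ vs)"
    by simp
  also have "\<dots> = ssgn (deg x * ldeg (us @ vs)) ((rot ^^ length us) F (us @ (vs @ [x])))"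
    using Cons.prems by (simp add: rot_homog[OF mlin_rot_pow] del: rot.simps)
  also have "\<dots> = ssgn (deg x * ldeg (us @ vs)) (ssgn (ldeg us * ldeg (vs @ [x])) (F ((vs @ [x]) @ us)))"
    using Cons.IH[of "vs @ [x]"] Cons.prems by simp
  also have "\<dots> = ssgn (ldeg (x # us) * ldeg vs) (F (vs @ x # us))"
    by (simp, rule ssgn_cong) (auto simp: algebra_simps)
  finally show ?case by simp
qed simp

lemma rot_pow_take:
  assumes "mlin s F" "set zs \<subseteq> homog" "j \<le> length zs"
  shows "(rot ^^ j) F zs = ssgn (ldeg (take j zs) * ldeg (drop j zs)) (F (drop j zs @ take j zs))"
proof -
  have "length (take j zs) = j" using assms(3) by simp
  moreover have "set (take j zs) \<subseteq> homog" "set (drop j zs) \<subseteq> homog"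
    using assms(2) by (auto dest: in_set_takeD in_set_dropD)
  ultimately show ?thesis
    using rot_pow_block[OF assms(1), of "take j zs" "drop j zs"] by simp
qed

text \<open>A full turn moves a block past nothing and so carries no sign. Rotation therefore has
  finite order on lists of a given length, and sums over all rotations are invariant.\<close>

lemma rot_pow_length: assumes "mlin s F" shows "(rot ^^ length zs) F zs = F zs"
proof -
  have "(rot ^^ length zs) F ys = F ys" if "length ys = length zs" "set ys \<subseteq> homog - {0}" for ys
    using rot_pow_take[OF assms, of ys "length zs"] that by auto
  then show ?thesis using mlin_eqI[OF mlin_rot_pow[OF assms] assms] by blast
qed

lemma rot_sum: "rot (\<lambda>u. \<Sum>i\<in>I. F i u) zs = (\<Sum>i\<in>I. rot (F i) zs)"
  by (cases zs) (auto simp: sum.distrib)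

lemma rot_pow_sum: "(rot ^^ j) (\<lambda>u. \<Sum>i\<in>I. F i u) zs = (\<Sum>i\<in>I. (rot ^^ j) (F i) zs)"
proof (induction j arbitrary: zs)
  case (Suc j)
  then have "(rot ^^ j) (\<lambda>u. \<Sum>i\<in>I. F i u) = (\<lambda>zs. \<Sum>i\<in>I. (rot ^^ j) (F i) zs)" by blast
  then show ?case by (simp add: rot_sum)
qed simp

lemma rot_scale: "rot (\<lambda>u. c * F u) zs = c * (rot F zs :: 'k)"
  by (cases zs) (auto simp: algebra_simps)

lemma rot_pow_scale: "(rot ^^ j) (\<lambda>u. c * F u) zs = c * ((rot ^^ j) F zs :: 'k)"
proof (induction j arbitrary: zs)
  case (Suc j)
  then have "(rot ^^ j) (\<lambda>u. c * F u) = (\<lambda>zs. c * (rot ^^ j) F zs)" by blast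
  then show ?case by (simp add: rot_scale)
qed simp

lemma rot_map_sg: "rot (\<lambda>u. F (map (sg m) u)) zs = rot F (map (sg m) zs)"
proof (cases zs)
  case (Cons x xs)
  have "sg m (pp n x) = pp n (sg m x)" for n
    by (simp add: pp_def sg_scale sg_add ssgn_def add.commute)
       (metis sg_add sg_zero add_eq_0_iff sg_sg add.commute)
  then show ?thesis by (simp add: Cons comp_def add.commute)
qed simp

lemma rot_cong_length:
  "(\<And>u. length u = length zs \<Longrightarrow> F u = H u) \<Longrightarrow> rot F zs = rot H zs"
  by (cases zs) auto

lemma rot_pow_cong_length:
  "(\<And>u. length u = length zs \<Longrightarrow> F u = H u) \<Longrightarrow> (rot ^^ j) F zs = (rot ^^ j) H zs"
proof (induction j arbitrary: zs)
  case (Suc j)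
  show ?case using Suc.IH Suc.prems by (auto intro!: rot_cong_length)
qed simp

definition cyc :: "('v list \<Rightarrow> 'k) \<Rightarrow> 'v list \<Rightarrow> 'k" where
  "cyc F zs = (\<Sum>j<max 1 (length zs). (rot ^^ j) F zs)"

lemma cyc_Nil [simp]: "cyc F [] = F []"
  by (simp add: cyc_def)

lemma mlin_cyc: assumes "mlin (*) F" shows "mlin (*) (cyc F)"
  by (rule mlinI)
     (auto simp: vector_space_mult cyc_def mlin_add[OF mlin_rot_pow[OF assms]]
       mlin_scale[OF mlin_rot_pow[OF assms]] sum.distrib sum_distrib_left distrib_left)

text \<open>Shifting the exponent exchanges the first summand for one after the last, and these
  agree by \<open>rot_pow_length\<close>.\<close>

lemma cyc_rot_aux:
  assumes "mlin (*) F"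
  shows "(\<Sum>j<max 1 (length zs). (rot ^^ Suc j) F zs) = cyc F zs"
proof (cases "zs = []")
  case False
  then have n: "max 1 (length zs) = length zs" by (cases zs) auto
  have "(\<Sum>j<length zs. (rot ^^ Suc j) F zs) + F zs = (\<Sum>j<Suc (length zs). (rot ^^ j) F zs)"
    by (subst sum.lessThan_Suc_shift) (simp add: add.commute)
  also have "\<dots> = (\<Sum>j<length zs. (rot ^^ j) F zs) + F zs"
    by (simp add: rot_pow_length[OF assms])
  finally show ?thesis by (simp only: n cyc_def add_right_cancel)
qed (simp add: cyc_def)

lemma rot_cyc: assumes "mlin (*) F" shows "rot (cyc F) = cyc F"
proof
  fix zs
  have "rot (cyc F) zs = rot (\<lambda>u. \<Sum>j<max 1 (length zs). (rot ^^ j) F u) zs"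
    by (rule rot_cong_length) (simp add: cyc_def)
  then show "rot (cyc F) zs = cyc F zs"
    using cyc_rot_aux[OF assms, of zs] by (simp add: rot_sum)
qed

lemma cyc_rot: assumes "mlin (*) F" shows "cyc (rot F) = cyc F"
  using cyc_rot_aux[OF assms] by (auto simp: cyc_def funpow_swap1)

lemma cyc_rot_pow: "mlin (*) F \<Longrightarrow> cyc ((rot ^^ j) F) = cyc F"
  by (induction j) (auto simp: cyc_rot mlin_rot_pow)

lemma cyc_sum: "cyc (\<lambda>u. \<Sum>i\<in>I. F i u) zs = (\<Sum>i\<in>I. cyc (F i) zs)"
  unfolding cyc_def rot_pow_sum by (rule sum.swap)

lemma cyc_scale: "cyc (\<lambda>u. c * F u) zs = c * cyc F zs"
  by (simp add: cyc_def rot_pow_scale sum_distrib_left)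

lemma cyc_add: "cyc (\<lambda>u. F u + H u) zs = cyc F zs + cyc H zs"
  using cyc_sum[of "\<lambda>i. if i then F else H" UNIV zs] by (simp add: UNIV_bool add.commute)

lemma cyc_cong_length: "(\<And>u. length u = length zs \<Longrightarrow> F u = H u) \<Longrightarrow> cyc F zs = cyc H zs"
  unfolding cyc_def by (intro sum.cong refl rot_pow_cong_length) auto

lemma cyclization_eq: assumes "mlin (*) F" shows "cyclization F = cyc F"
proof
  fix xs
  show "cyclization F xs = cyc F xs"
    unfolding cyclization_def
  proof (rule hom_extend_eq_mlin[OF mlin_cyc[OF assms]])
    fix xs :: "'v list" assume xs: "set xs \<subseteq> homog - {0}"
    show "(\<Sum>j<max 1 (length xs). ksgn (ldeg (take j xs) * ldeg (drop j xs)) * F (rotate j xs)) = cyc F xs"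
      unfolding cyc_def
    proof (intro sum.cong refl)
      fix j assume "j \<in> {..<max 1 (length xs)}"
      then have j: "j < length xs \<or> xs = [] \<and> j = 0" by (cases xs) auto
      then have "rotate j xs = drop j xs @ take j xs" by (auto simp: rotate_drop_take)
      then show "ksgn (ldeg (take j xs) * ldeg (drop j xs)) * F (rotate j xs) = (rot ^^ j) F xs"
        using j xs by (subst rot_pow_take[OF assms]) (auto simp: ksgn_mult_left)
    qed
  qed
qed

text \<open>This trades a condition on homogeneous arguments for a fixed point equation between
  functions, usable on all vectors.\<close>

lemma cyclic_forms_iff: "F \<in> cyclic_forms k \<longleftrightarrow> multilinear (*) k F \<and> rot F = F"
proof (cases "multilinear (*) k F")
  case True
  then have F: "mlin (*) F" and Fk: "\<And>xs. length xs \<noteq> k \<Longrightarrow> F xs = 0"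
    by (auto simp: multilinear_iff_mlin vector_space_mult)
  have "rot F = F" if c: "F \<in> cyclic_forms k"
  proof
    fix xs show "rot F xs = F xs"
    proof (rule mlin_eqI[OF mlin_rot[OF F] F])
      fix ys assume ys: "set ys \<subseteq> homog - {0}"
      show "rot F ys = F ys"
      proof (cases ys)
        case (Cons a as)
        show ?thesis
        proof (cases "length ys = k")
          case True
          then have "F (a # as) = ksgn (deg a * ldeg as) * F (as @ [a])"
            using c ys Cons by (auto simp: cyclic_forms_def)
          moreover have "a \<in> homog" "set as \<subseteq> homog" using ys Cons by auto
          ultimately show ?thesis by (simp add: Cons rot_homog[OF F] ksgn_mult_left del: rot.simps)
        next
          case False
          then show ?thesis by (simp add: Cons Fk)
        qed
      qed simp
    qed
  qed
  moreover have "F \<in> cyclic_forms k" if r: "rot F = F"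
  proof -
    have "F (y # xs) = ksgn (deg y * ldeg xs) * F (xs @ [y])" if "set xs \<subseteq> homog" "y \<in> homog" for xs y
      using rot_homog[OF F that(2,1)] unfolding r ksgn_mult_left .
    then show ?thesis using True unfolding cyclic_forms_def by blast
  qed
  ultimately show ?thesis using True by blast
qed (simp add: cyclic_forms_def)

lemma rot_arity_part: "rot (arity_part k F) = arity_part k (rot F)"
proof
  fix zs show "rot (arity_part k F) zs = arity_part k (rot F) zs"
    by (cases zs) (auto simp: arity_part_def)
qed

lemma all_cyclic_iff:
  "F \<in> all_cyclic_forms \<longleftrightarrow> mlin (*) F \<and> rot F = F \<and> finite {k. arity_part k F \<noteq> (\<lambda>_. 0)}"
proof -
  have "(\<forall>k. arity_part k F \<in> cyclic_forms k) \<longleftrightarrow> mlin (*) F \<and> rot F = F"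
  proof
    assume *: "\<forall>k. arity_part k F \<in> cyclic_forms k"
    then have "mlin (*) (arity_part k F)" for k
      by (simp add: cyclic_forms_iff multilinear_iff_mlin vector_space_mult)
    then have "mlin (*) F" by (rule mlin_by_arity[OF vector_space_mult])
    moreover have "rot F xs = F xs" for xs
    proof -
      have "arity_part (length xs) (rot F) xs = arity_part (length xs) F xs"
        using * by (simp add: cyclic_forms_iff rot_arity_part)
      then show ?thesis by (simp add: arity_part_def)
    qed
    ultimately show "mlin (*) F \<and> rot F = F" by blast
  next
    assume "mlin (*) F \<and> rot F = F"
    then show "\<forall>k. arity_part k F \<in> cyclic_forms k"
      by (auto simp: cyclic_forms_iff multilinear_iff_mlin vector_space_mult mlin_arity_part rot_arity_part)
         (auto simp: arity_part_def)
  qed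
  then show ?thesis by (auto simp: all_cyclic_forms_def)
qed

lemma cyclic_forms_all: assumes "F \<in> cyclic_forms k" shows "F \<in> all_cyclic_forms"
proof -
  have F: "mlin (*) F" "rot F = F" and Fk: "\<And>xs. length xs \<noteq> k \<Longrightarrow> F xs = 0"
    using assms by (auto simp: cyclic_forms_iff multilinear_iff_mlin vector_space_mult)
  have "{j. arity_part j F \<noteq> (\<lambda>_. 0)} \<subseteq> {k}"
    using Fk by (auto simp: arity_part_def fun_eq_iff)
  then show ?thesis using F finite_subset by (auto simp: all_cyclic_iff)
qed

lemma cyclic_formsD:
  assumes "F \<in> cyclic_forms k"
  shows "mlin (*) F" "rot F = F" "length xs \<noteq> k \<Longrightarrow> F xs = 0"
  using assms by (auto simp: cyclic_forms_iff multilinear_iff_mlin vector_space_mult)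

lemma cyclic_formsI:
  assumes "mlin (*) F" "rot F = F" "\<And>xs. length xs \<noteq> k \<Longrightarrow> F xs = 0"
  shows "F \<in> cyclic_forms k"
  using assms by (auto simp: cyclic_forms_iff multilinear_iff_mlin vector_space_mult)

lemma cyclic_move:
  assumes "mlin s F" "rot F = F" "ph m y" shows "F (y # xs) = F (map (sg m) xs @ [y])"
  using rot_ph[OF assms(1,3)] assms(2) by metis

lemma cyclic_block:
  assumes F: "mlin s F" "rot F = F" and "set w \<subseteq> homog"
  shows "F (w @ xs) = F (map (sg (ldeg w)) xs @ w)"
  using assms(3)
proof (induction w arbitrary: xs)
  case (Cons x w)
  let ?m = "deg x"
  have x: "ph ?m x" and w: "set w \<subseteq> homog" using Cons.prems by (auto intro: homog_ph)
  have "F ((x # w) @ xs) = F ([] @ map (sg ?m) w @ (map (sg ?m) xs @ [x]))"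
    using cyclic_move[OF F x, of "w @ xs"] by simp
  also have "\<dots> = ssgn (?m * ldeg w) (F (w @ (map (sg ?m) xs @ [x])))"
    by (subst mlin_sg_list[OF F(1) w]) simp
  also have "\<dots> = ssgn (?m * ldeg w) (F (map (sg (ldeg w + ?m)) xs @ sg (ldeg w) x # w))"
    by (subst Cons.IH[OF w]) (simp add: comp_def)
  \<comment> \<open>\<open>x\<close> and \<open>w\<close> pass each other twice, once in each
    direction, so these two signs cancel.\<close>
  also have "\<dots> = F (map (sg (ldeg w + ?m)) xs @ x # w)"
    by (simp add: ph_sg[OF x] mlin_ssgn[OF F(1)]) (rule trans[OF ssgn_cong[where n = 0]], auto)
  finally show ?case by (simp add: add.commute)
qed (simp add: comp_def)

subsection \<open>Parity\<close>

text \<open>The part of the degree that signs can see. It is an identity on all arguments,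
  homogeneous or not, and every form splits into an even and an odd part.\<close>

definition parity :: "int \<Rightarrow> ('v list \<Rightarrow> 'w::ab_group_add) \<Rightarrow> bool" where
  "parity d F \<longleftrightarrow> (\<forall>xs. F (map (sg 1) xs) = ssgn d (F xs))"

lemma parity_sg: "parity d F \<Longrightarrow> F (map (sg m) xs) = ssgn (m * d) (F xs)"
proof -
  assume d: "parity d F"
  show ?thesis using map_sg_even_odd[of m xs] d by (auto simp: parity_def intro!: ssgn_cong) (auto simp: ssgn_def)
qed

lemma has_degree_parity:
  assumes "mlin (*) F" "has_degree d F" shows "parity d F"
  unfolding parity_def
proof
  fix xs show "F (map (sg 1) xs) = ssgn d (F xs)"
  proof (rule mlin_eqI[OF mlin_map_sg[OF assms(1)] mlin_of_ssgn[OF assms(1)]])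
    fix ys assume "set ys \<subseteq> homog - {0}"
    then have ys: "set ys \<subseteq> homog" by auto
    have "F (map (sg 1) ys) = ssgn (ldeg ys) (F ys)"
      using mlin_sg_list0[OF assms(1) ys, of 1] by simp
    also have "\<dots> = ssgn d (F ys)"
    proof (rule ssgn_cong)
      assume "F ys \<noteq> 0"
      then have "d + ldeg ys = 0" using assms(2) ys by (auto simp: has_degree_def)
      then show "even (ldeg ys - d)" by presburger
    qed
    finally show "F (map (sg 1) ys) = ssgn d (F ys)" .
  qed
qed

lemma ssgn_eq_self: "ssgn m w = ssgn n w \<Longrightarrow> w \<noteq> (0::'k) \<Longrightarrow> even (m - n)"
  by (auto simp: ssgn_def split: if_splits)

text \<open>The projection onto the forms of parity \<open>p\<close>.\<close>

definition par :: "int \<Rightarrow> ('v list \<Rightarrow> 'k) \<Rightarrow> 'v list \<Rightarrow> 'k" where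
  "par p F xs = (1/2) * (F xs + ssgn p (F (map (sg 1) xs)))"

lemma mlin_par: "mlin (*) F \<Longrightarrow> mlin (*) (par p F)"
  unfolding par_def by (intro mlin_const_scale[where s = "(*)"] mlin_plus mlin_of_ssgn mlin_map_sg)

lemma rot_par: assumes "rot F = F" shows "rot (par p F) = par p F"
proof
  fix zs
  have "rot (par p F) zs = (1/2) * (rot F zs + ssgn p (rot (\<lambda>u. F (map (sg 1) u)) zs))"
    by (cases zs) (simp_all add: par_def ssgn_add algebra_simps)
  also have "\<dots> = (1/2) * (F zs + ssgn p (F (map (sg 1) zs)))"
    by (simp only: rot_map_sg assms)
  finally show "rot (par p F) zs = par p F zs" by (simp add: par_def)
qed

lemma sg2: "sg 1 (sg 1 x) = x"
  using sg_cong[of 2 0 x] by simp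

lemma parity_par: "parity p (par p F)"
  by (auto simp: parity_def par_def comp_def sg2 ssgn_def algebra_simps simp del: sg_sg)

lemma par_parity: "parity d F \<Longrightarrow> par p F xs = (if even (p - d) then F xs else 0)"
  by (auto simp: parity_def par_def ssgn_def)

lemma par_linear: "par p (\<lambda>xs. c * A xs + B xs) = (\<lambda>xs. c * par p A xs + par p B xs)"
  by (auto simp: par_def ssgn_def algebra_simps)

subsection \<open>Tensor products of forms\<close>

definition tens :: "int \<Rightarrow> ('v list \<Rightarrow> 'k) \<Rightarrow> ('v list \<Rightarrow> 'k) \<Rightarrow> 'v list \<Rightarrow> 'k" where
  "tens d A B = sp (\<lambda>u w. A (map (sg d) u) * B w)"

lemma mlin_mult_left: "mlin (*) A \<Longrightarrow> mlin (*) (\<lambda>u. A u * (c::'k))"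
  using mlin_const_scale[of "(*)" A c] by (simp add: mult.commute)

lemma mlin_tens: "mlin (*) A \<Longrightarrow> mlin (*) B \<Longrightarrow> mlin (*) (tens d A B)"
  unfolding tens_def
  by (intro mlin_sp_fun mlin_mult_left mlin_map_sg mlin_const_scale[where s = "(*)"])

lemma tensor_eq:
  assumes "mlin (*) A" "mlin (*) B" shows "tensor d A B = tens d A B"
proof
  fix xs
  show "tensor d A B xs = tens d A B xs"
    unfolding tensor_def
  proof (rule hom_extend_eq_mlin[OF mlin_tens[OF assms]])
    fix zs :: "'v list" assume zs: "set zs \<subseteq> homog - {0}"
    show "(\<Sum>k\<le>length zs. ksgn (d * ldeg (take k zs)) * A (take k zs) * B (drop k zs)) = tens d A B zs"
      unfolding tens_def sp_eq_sum
    proof (intro sum.cong refl)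
      fix k
      have "set (take k zs) \<subseteq> homog" using zs by (auto dest: in_set_takeD)
      then show "ksgn (d * ldeg (take k zs)) * A (take k zs) * B (drop k zs)
          = A (map (sg d) (take k zs)) * B (drop k zs)"
        by (simp add: mlin_sg_list0[OF assms(1)] ksgn_mult_left)
    qed
  qed
qed

subsection \<open>Insertion of a family of maps\<close>

text \<open>\<open>act q F Q\<close> is the composition of \<open>F\<close> with the coderivation of parity \<open>q\<close> of the tensor
  coalgebra whose Taylor components are \<open>Q\<close>.\<close>

definition act :: "int \<Rightarrow> ('v list \<Rightarrow> 'w::ab_group_add) \<Rightarrow> ('v list \<Rightarrow> 'v) \<Rightarrow> 'v list \<Rightarrow> 'w" where
  "act q F Q = sp (\<lambda>u r. sp (\<lambda>v w. F (map (sg q) u @ Q v # w)) r)"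

lemma mlin_sp_param:
  assumes "\<And>u w. mlin s (\<lambda>z. f z u w)" shows "mlin s (\<lambda>z. sp (f z) r)"
  unfolding sp_eq_sum by (intro mlin_sum_fun assms mlin_vs[OF assms])

lemma mlin_act:
  assumes "mlin s F" "mlin scale Q" shows "mlin s (act q F Q)"
  unfolding act_def
proof (rule mlin_sp_fun)
  show "mlin s (\<lambda>u. sp (\<lambda>v w. F (map (sg q) u @ Q v # w)) r)" for r
    by (rule mlin_sp_param) (rule mlin_map_sg[OF mlin_append_right[OF assms(1)]])
  show "mlin s (sp (\<lambda>v w. F (map (sg q) u @ Q v # w)))" for u
  proof (rule mlin_sp_fun)
    show "mlin s (\<lambda>v. F (map (sg q) u @ Q v # w))" for w
      by (rule mlin_insert[OF assms])
    show "mlin s (\<lambda>w. F (map (sg q) u @ Q v # w))" for v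
      using mlin_append_left[OF assms(1), of "map (sg q) u @ [Q v]"] by simp
  qed
qed

lemma act_cong: "even (q - q') \<Longrightarrow> act q F Q = act q' F Q"
  unfolding act_def by (simp add: map_sg_cong[of q q'])

lemma act_diff_left: "act q (\<lambda>u. F u - H u) Q xs = act q F Q xs - act q H Q xs"
  by (simp add: act_def sp_diff cong: sp_cong_all)

lemma act_ssgn_left: "act q (\<lambda>u. ssgn m (F u)) Q xs = ssgn m (act q F Q xs)"
  by (simp add: act_def sp_ssgn cong: sp_cong_all)

lemma act_diff_right:
  "mlin s F \<Longrightarrow> act q F (\<lambda>u. Q u - R u) xs = act q F Q xs - act q F R xs"
  by (simp add: act_def mlin_diff sp_diff cong: sp_cong_all)

lemma act_ssgn_right: "mlin s F \<Longrightarrow> act q F (\<lambda>u. ssgn m (Q u)) xs = ssgn m (act q F Q xs)"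
  by (simp add: act_def sp_ssgn mlin_ssgn cong: sp_cong_all)

lemma act_zero_right: "mlin s F \<Longrightarrow> act q F (\<lambda>u. 0) xs = 0"
  by (simp add: act_def mlin_zero)

text \<open>A map of parity \<open>q\<close> commutes with the involution up to the sign of moving
  the map itself.\<close>

definition qparity :: "int \<Rightarrow> ('v list \<Rightarrow> 'v) \<Rightarrow> bool" where
  "qparity q Q \<longleftrightarrow> (\<forall>m xs. Q (map (sg m) xs) = ssgn (m * q) (sg m (Q xs)))"

lemma qparityD: "qparity q Q \<Longrightarrow> Q (map (sg m) xs) = ssgn (m * q) (sg m (Q xs))"
  by (simp add: qparity_def)

text \<open>The part of a double insertion in which \<open>Q1\<close> enters to the right of \<open>Q2\<close>.\<close>

definition act2 :: "int \<Rightarrow> int \<Rightarrow> ('v list \<Rightarrow> 'w::ab_group_add) \<Rightarrow> ('v list \<Rightarrow> 'v) \<Rightarrow> ('v list \<Rightarrow> 'v) \<Rightarrow>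
    'v list \<Rightarrow> 'w" where
  "act2 q1 q2 F Q1 Q2 = sp (\<lambda>u r. sp (\<lambda>v w. sp (\<lambda>a r'. sp (\<lambda>b c.
     F (map (sg (q1 + q2)) u @ sg q1 (Q2 v) # map (sg q1) a @ Q1 b # c)) r') w) r)"

text \<open>In a double insertion the letter \<open>Q2 v\<close> lies to the right of the block fed
  to \<open>Q1\<close>, inside this block, or to its left. The middle case is the insertion of the
  composite map. In the first case the involution belonging to \<open>Q2\<close> has to be taken out
  of \<open>Q1\<close>, whence the sign \<open>q1 * q2\<close>.\<close>

lemma pre_Lie:
  assumes F: "mlin s F" and Q1: "mlin scale Q1" and q1: "qparity q1 Q1"
  shows "act q2 (act q1 F Q1) Q2 xs = act (q1 + q2) F (act q2 Q1 Q2) xs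
    + act2 q1 q2 F Q1 Q2 xs + ssgn (q1 * q2) (act2 q2 q1 F Q2 Q1 xs)"
proof -
  define g where "g a b c = F (map (sg q1) a @ Q1 b # c)" for a b c
  have split: "act q1 F Q1 (A @ y # C) =
      sp (\<lambda>a r. sp (\<lambda>b c. g a b (c @ y # C)) r) A + sp (\<lambda>a r. sp (\<lambda>b c. g a (r @ y # b) c) C) A
      + sp (\<lambda>a r. sp (\<lambda>b c. g (A @ y # a) b c) r) C" for A y C
    by (simp add: act_def g_def[symmetric] sp_insert sp_add)
  let ?m = "map (sg q2)"
  have "act q2 (act q1 F Q1) Q2 xs = sp (\<lambda>u r. sp (\<lambda>v w. act q1 F Q1 (?m u @ Q2 v # w)) r) xs"
    by (simp add: act_def)
  also have "\<dots> =
      sp (\<lambda>u r. sp (\<lambda>v w. sp (\<lambda>a r. sp (\<lambda>b c. g (?m a) (?m b) (?m c @ Q2 v # w)) r) u) r) xs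
    + sp (\<lambda>u r. sp (\<lambda>v w. sp (\<lambda>a r. sp (\<lambda>b c. g (?m a) (?m r @ Q2 v # b) c) w) u) r) xs
    + sp (\<lambda>u r. sp (\<lambda>v w. sp (\<lambda>a r. sp (\<lambda>b c. g (?m u @ Q2 v # a) b c) r) w) r) xs"
    by (simp only: split sp_add sp_map)
  also have "sp (\<lambda>u r. sp (\<lambda>v w. sp (\<lambda>a r. sp (\<lambda>b c. g (?m a) (?m b) (?m c @ Q2 v # w)) r) u) r) xs
      = ssgn (q1 * q2) (act2 q2 q1 F Q2 Q1 xs)"
  proof -
    have "g (?m a) (?m b) (?m c @ Q2 v # w) =
        ssgn (q1 * q2) (F (map (sg (q2 + q1)) a @ sg q2 (Q1 b) # map (sg q2) c @ Q2 v # w))" for a b c v w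
      unfolding g_def qparityD[OF q1] mlin_ssgn[OF F] map_sg_map_sg by (simp add: ac_simps)
    then show ?thesis
      by (simp add: sp_reorder_left act2_def sp_ssgn cong: sp_cong_all)
  qed
  also have "sp (\<lambda>u r. sp (\<lambda>v w. sp (\<lambda>a r. sp (\<lambda>b c. g (?m a) (?m r @ Q2 v # b) c) w) u) r) xs
      = act (q1 + q2) F (act q2 Q1 Q2) xs"
  proof -
    have "act (q1 + q2) F (act q2 Q1 Q2) xs =
       sp (\<lambda>a R. sp (\<lambda>M c. sp (\<lambda>r R'. sp (\<lambda>v b. g (?m a) (?m r @ Q2 v # b) c) R') M) R) xs"
      unfolding act_def g_def map_sg_map_sg by (simp add: mlin_sp[OF F] cong: sp_cong_all)
    then show ?thesis by (simp only: sp_reorder_middle)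
  qed
  also have "sp (\<lambda>u r. sp (\<lambda>v w. sp (\<lambda>a r. sp (\<lambda>b c. g (?m u @ Q2 v # a) b c) r) w) r) xs
      = act2 q1 q2 F Q1 Q2 xs"
    unfolding act2_def g_def by (simp only: map_append list.map map_sg_map_sg append_assoc append_Cons)
  finally show ?thesis by (simp add: ac_simps)
qed

text \<open>For an odd map the two kinds of disjoint insertions occur with opposite signs and
  cancel: the square of the coderivation is the coderivation of the square.\<close>

lemma act_act_odd:
  assumes "mlin s F" "mlin scale Q" "qparity q Q" "odd q"
  shows "act q (act q F Q) Q xs = act (q + q) F (act q Q Q) xs"
proof -
  show ?thesis using pre_Lie[OF assms(1-3), of q Q xs] assms(4) by (simp add: ssgn_odd)
qed

definition qcomm :: "int \<Rightarrow> int \<Rightarrow> ('v list \<Rightarrow> 'v) \<Rightarrow> ('v list \<Rightarrow> 'v) \<Rightarrow> 'v list \<Rightarrow> 'v" where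
  "qcomm p q Q R xs = act q Q R xs - ssgn (p * q) (act p R Q xs)"

lemma mlin_qcomm: "mlin scale Q \<Longrightarrow> mlin scale R \<Longrightarrow> mlin scale (qcomm p q Q R)"
  unfolding qcomm_def by (intro mlin_minus_fun mlin_of_ssgn mlin_act)

text \<open>The disjoint double insertions are symmetric in the two maps up to the Koszul sign and
  drop out of the antisymmetrization, so that insertion is a right action of the commutator
  algebra.\<close>

lemma act_qcomm:
  assumes F: "mlin s F" and Q: "mlin scale Q" "qparity p Q" and R: "mlin scale R" "qparity q R"
  shows "act (p + q) F (qcomm p q Q R) xs =
    act q (act p F Q) R xs - ssgn (p * q) (act p (act q F R) Q xs)"
proof -
  have "act (p + q) F (qcomm p q Q R) xs =
      act (p + q) F (act q Q R) xs - ssgn (p * q) (act (q + p) F (act p R Q) xs)"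
    unfolding qcomm_def
    by (simp add: act_diff_right[OF F] act_ssgn_right[OF F] add.commute)
  then show ?thesis
    unfolding pre_Lie[OF F Q] pre_Lie[OF F R]
    by (simp add: ssgn_add mult.commute) (simp add: ssgn_def)
qed

text \<open>Each double commutator expands into insertions, and \<open>act_qcomm\<close>, applied
  with each of the three maps as the outer one, matches all terms. Eight parity cases settle the
  signs.\<close>

lemma qcomm_Jacobi:
  assumes Q: "mlin scale Q" "qparity p Q" and R: "mlin scale R" "qparity q R"
    and S: "mlin scale S" "qparity r S"
  shows "qcomm p (q + r) Q (qcomm q r R S) xs = qcomm (p + q) r (qcomm p q Q R) S xs
    + ssgn (p * q) (qcomm q (p + r) R (qcomm p r Q S) xs)"
proof -
  have l: "act m (qcomm k n Q' R') S' xs =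
      act m (act n Q' R') S' xs - ssgn (k * n) (act m (act k R' Q') S' xs)" for m k n Q' R' S'
    unfolding qcomm_def by (simp add: act_diff_left act_ssgn_left)
  show ?thesis
    unfolding qcomm_def[of p "q + r"] qcomm_def[of "p + q" r] qcomm_def[of q "p + r"]
      l act_qcomm[OF Q(1) R S] act_qcomm[OF S(1) Q R] act_qcomm[OF R(1) Q S]
    by (cases "even p"; cases "even q"; cases "even r") (simp_all add: ssgn_def)
qed

end

section \<open>The bracket of a non-degenerate symmetric form\<close>

locale form_graded_vector_space = graded_vector_space scale G
  for scale :: "'k::field_char_0 \<Rightarrow> 'v::ab_group_add \<Rightarrow> 'v" (infixr \<open>*s\<close> 75) and G +
  fixes b :: "'v \<Rightarrow> 'v \<Rightarrow> 'k"
  assumes form: "symmetric_nondegenerate b"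
begin

abbreviation BB :: "'v \<Rightarrow> 'v \<Rightarrow> 'k" where "BB \<equiv> shifted_form b"

lemma b_add_left: "b (x + y) z = b x z + b y z"
  and b_add_right: "b z (x + y) = b z x + b z y"
  using form unfolding symmetric_nondegenerate_def by (metis mult_1 scale_one)+

lemma b_zero_left: "b 0 z = 0" and b_zero_right: "b z 0 = 0"
  using b_add_left[of 0 0 z] b_add_right[of z 0 0] by auto

lemma b_scale_left: "b (c *s x) z = c * b x z"
  and b_scale_right: "b z (c *s x) = c * b z x"
  using form unfolding symmetric_nondegenerate_def
  by (metis add.right_neutral b_zero_left) (metis add.right_neutral b_zero_right form symmetric_nondegenerate_def)

lemma linear_b_left: "Vector_Spaces.linear scale (*) (\<lambda>x. b x y)"
  and linear_b_right: "Vector_Spaces.linear scale (*) (b x)"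
  by (auto simp: Vector_Spaces.linear_iff vector_space_axioms vector_space_mult
      b_add_left b_add_right b_scale_left b_scale_right)

lemma b_sym: "x \<in> G i \<Longrightarrow> y \<in> G j \<Longrightarrow> b x y = ksgn (i * j) * b y x"
  and b_degree: "x \<in> G i \<Longrightarrow> y \<in> G j \<Longrightarrow> b x y \<noteq> 0 \<Longrightarrow> i + j = 0"
  and b_nondegenerate: "(\<And>y. b x y = 0) \<Longrightarrow> x = 0"
  using form unfolding symmetric_nondegenerate_def by blast+

lemma BB_eq: "BB x y = b (sg 1 x) y"
proof -
  have "b (\<Sum>i\<in>I. f i) y = (\<Sum>i\<in>I. b (f i) y)" for f and I :: "int set"
    by (induction I rule: infinite_finite_induct) (auto simp: b_zero_left b_add_left)
  moreover have "b (ssgn m x) y = ksgn m * b x y" for m x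
    by (simp add: b_scale_left[symmetric] ksgn_scale)
  ultimately show ?thesis by (simp add: shifted_form_def sg_def sigma_def)
qed

lemma linear_BB_left: "Vector_Spaces.linear scale (*) (\<lambda>x. BB x y)"
  and linear_BB_right: "Vector_Spaces.linear scale (*) (BB x)"
  unfolding BB_eq[abs_def] by (rule linear_comp[OF linear_b_left linear_sg] linear_b_right)+

lemma BB_add_left: "BB (x + y) z = BB x z + BB y z"
  and BB_add_right: "BB z (x + y) = BB z x + BB z y"
  and BB_scale_left: "BB (c *s x) z = c * BB x z"
  and BB_scale_right: "BB z (c *s x) = c * BB z x"
  using linear_BB_left[of z] linear_BB_right[of z] by (auto simp: Vector_Spaces.linear_iff)

lemma BB_zero_left [simp]: "BB 0 z = 0" and BB_zero_right [simp]: "BB z 0 = 0"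
  using BB_add_left[of 0 0 z] BB_add_right[of z 0 0] by auto

lemma BB_ssgn_left: "BB (ssgn m x) z = ssgn m (BB x z)"
  and BB_ssgn_right: "BB z (ssgn m x) = ssgn m (BB z x)"
  by (simp_all add: BB_scale_left BB_scale_right flip: ksgn_scale ksgn_mult_left)

lemma BB_diff_left: "BB (x - y) z = BB x z - BB y z"
  using BB_add_left[of "x - y" y z] by simp

text \<open>Homogeneous vectors with non-zero pairing have opposite degrees, hence equal
  parities.\<close>

lemma b_sg: "b (sg m x) y = b x (sg m y)"
proof (rule linear_eqI[OF linear_comp[OF linear_b_left linear_sg] linear_b_left])
  fix x assume "x \<in> homog - {0}"
  then obtain i where i: "x \<in> G i" by (auto simp: homog_def)
  show "b (sg m x) y = b x (sg m y)"
  proof (rule linear_eqI[OF linear_b_right linear_comp[OF linear_b_right linear_sg]])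
    fix y assume "y \<in> homog - {0}"
    then obtain j where j: "y \<in> G j" by (auto simp: homog_def)
    have "ssgn (m * (i - 1)) (b x y) = ssgn (m * (j - 1)) (b x y)"
    proof (rule ssgn_cong)
      assume "b x y \<noteq> 0"
      then have "i + j = 0" by (rule b_degree[OF i j])
      then have "i = - j" by simp
      then show "even (m * (i - 1) - m * (j - 1))" by simp
    qed
    then show "b (sg m x) y = b x (sg m y)"
      by (simp add: ph_sg[OF G_ph[OF i]] ph_sg[OF G_ph[OF j]] b_scale_left b_scale_right ksgn_mult_left
          flip: ksgn_scale)
  qed
qed

lemma BB_sg: "BB (sg m x) y = BB x (sg m y)"
  by (simp add: BB_eq b_sg add.commute)

lemma BB_antisym: "BB x y = - BB (sg 1 y) x"
proof (rule linear_eqI[OF linear_BB_left])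
  show "Vector_Spaces.linear (*s) (*) (\<lambda>x. - BB (sg 1 y) x)"
    by (simp add: Vector_Spaces.linear_iff vector_space_axioms vector_space_mult BB_add_right BB_scale_right)
  fix x assume "x \<in> homog - {0}"
  then obtain i where i: "x \<in> G i" by (auto simp: homog_def)
  show "BB x y = - BB (sg 1 y) x"
  proof (rule linear_eqI[OF linear_BB_right])
    show "Vector_Spaces.linear (*s) (*) (\<lambda>y. - BB (sg 1 y) x)"
      by (simp add: Vector_Spaces.linear_iff vector_space_axioms vector_space_mult BB_add_left BB_scale_left
          sg_add sg_scale)
    fix y assume "y \<in> homog - {0}"
    then obtain j where j: "y \<in> G j" by (auto simp: homog_def)
    have "BB x y = ssgn (i - 1 + i * j) (b y x)"
      by (simp add: BB_eq ph_sg[OF G_ph[OF i]] b_scale_left ksgn_mult_left b_sym[OF i j] flip: ksgn_scale)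
    \<comment> \<open>For \<open>j = - i\<close> the exponent is \<open>i - 1 - i * i\<close>, which
      is odd: the degree shift turns the symmetric form into an antisymmetric one.\<close>
    also have "\<dots> = ssgn 1 (b y x)"
    proof (rule ssgn_cong)
      assume "b y x \<noteq> 0"
      then have "j + i = 0" by (rule b_degree[OF j i])
      then have "j = - i" by simp
      then show "even (i - 1 + i * j - 1)" by simp
    qed
    also have "\<dots> = - BB (sg 1 y) x"
      using sg_cong[of 2 0 y] by (simp add: BB_eq ssgn_def)
    finally show "BB x y = - BB (sg 1 y) x" .
  qed
qed

lemma BB_antisym_ph: "ph m x \<Longrightarrow> BB y x = - ssgn m (BB x y)"
  using BB_antisym[of y x] by (simp add: ph_sg BB_ssgn_left)

lemma BB_degree: "x \<in> G i \<Longrightarrow> y \<in> G j \<Longrightarrow> BB x y \<noteq> 0 \<Longrightarrow> i + j = 0"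
  by (auto simp: BB_eq ph_sg[OF G_ph] b_scale_left dest: b_degree simp flip: ksgn_scale)

lemma BB_nondegenerate: assumes "\<And>y. BB x y = 0" shows "x = 0"
proof -
  have "sg 1 x = 0" using assms b_nondegenerate by (simp add: BB_eq)
  then have "sg 1 (sg 1 x) = 0" by simp
  then show ?thesis by (simp only: sg2)
qed

lemma BB_ext: assumes "\<And>y. BB x y = BB z y" shows "x = z"
  using BB_nondegenerate[of "x - z"] assms by (simp add: BB_diff_left)

text \<open>A maximal independent set of homogeneous vectors spans, because every vector is a sum of
  its components.\<close>

lemma homog_basis:
  obtains E where "finite E" "E \<subseteq> homog" "independent E" "span E = UNIV"
proof -
  obtain E where E: "E \<subseteq> homog" "independent E" "homog \<subseteq> span E"
    using maximal_independent_subset[of homog] by blast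
  obtain B where B: "finite B" "span B = UNIV" using finite_dimensional by blast
  have "finite E" using independent_span_bound[OF B(1) E(2)] B(2) by simp
  moreover have "x \<in> span E" for x
  proof -
    have "(\<Sum>i | component x i \<noteq> 0. component x i) \<in> span E"
      by (rule span_sum) (use E(3) component_in_homog in blast)
    then show ?thesis by (simp only: sum_component)
  qed
  ultimately show ?thesis using E that by blast
qed

lemma Riesz:
  assumes "Vector_Spaces.linear scale (*) \<phi>"
  shows "\<exists>!v. \<forall>y. BB v y = \<phi> y"
proof -
  obtain E where E: "finite E" "independent E" "span E = UNIV" using homog_basis by metis
  interpret fd: finite_dimensional_vector_space scale E
    using E by unfold_locales auto
  have ext: "f = g" if "Vector_Spaces.linear scale (*) f" "Vector_Spaces.linear scale (*) g"
      "\<And>e. e \<in> E \<Longrightarrow> f e = g e" for f g :: "'v \<Rightarrow> 'k"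
  proof
    fix x
    have "f 0 = 0" "g 0 = 0"
      using that(1,2) unfolding Vector_Spaces.linear_iff by (metis add_cancel_right_right add_0_right)+
    then have "subspace {x. f x = g x}"
      using that(1,2) by (auto simp: subspace_def Vector_Spaces.linear_iff)
    moreover have "x \<in> span E" using E(3) by simp
    ultimately show "f x = g x"
      using span_induct[of x E "\<lambda>x. f x = g x"] that(3) by blast
  qed
  \<comment> \<open>Taking the basis vectors themselves as targets makes the pairing with the basis
    an endomorphism, so that injectivity, which is non-degeneracy, gives surjectivity.\<close>
  define L where "L v = (\<Sum>e\<in>E. BB v e *s e)" for v
  have coeff: "c e = d e" if "(\<Sum>e\<in>E. c e *s e) = (\<Sum>e\<in>E. d e *s e)" "e \<in> E" for c d e
  proof -
    have "(\<Sum>e\<in>E. (c e - d e) *s e) = 0"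
      using that(1) by (simp add: scale_left_diff_distrib sum_subtractf)
    from independentD[OF E(2,1) subset_refl this that(2)] show ?thesis by simp
  qed
  have lin: "Vector_Spaces.linear scale scale L"
    by (simp add: Vector_Spaces.linear_iff vector_space_axioms L_def BB_add_left BB_scale_left
        scale_left_distrib sum.distrib scale_sum_right)
  have eq: "v = w" if "\<And>e. e \<in> E \<Longrightarrow> BB v e = BB w e" for v w
  proof -
    have "BB v = BB w" by (rule ext[OF linear_BB_right linear_BB_right that])
    then show ?thesis by (intro BB_ext) simp
  qed
  have "inj L"
  proof (rule injI)
    fix v w assume vw: "L v = L w"
    show "v = w" by (rule eq) (rule coeff[OF vw[unfolded L_def]])
  qed
  then have "surj L" by (rule fd.linear_inj_imp_surj[OF lin])
  then obtain v where Lv: "L v = (\<Sum>e\<in>E. \<phi> e *s e)" by (metis surj_def)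
  have "BB v e = \<phi> e" if "e \<in> E" for e
    by (rule coeff[OF Lv[unfolded L_def] that])
  then have v: "BB v = \<phi>" by (rule ext[OF linear_BB_right assms])
  show ?thesis
  proof (rule ex1I[of _ v])
    show "w = v" if "\<forall>y. BB w y = \<phi> y" for w
      using that v by (intro BB_ext) (metis (full_types))
  qed (simp add: v)
qed

text \<open>The map whose associated form is \<open>A\<close>. It reads \<open>A\<close> on
  non-empty lists only, so the constant part of \<open>A\<close> is lost.\<close>

definition form_map :: "('v list \<Rightarrow> 'k) \<Rightarrow> 'v list \<Rightarrow> 'v" where
  "form_map A xs = (THE v. \<forall>y. BB v y = A (xs @ [y]))"

lemma BB_form_map: assumes "mlin (*) A" shows "BB (form_map A xs) y = A (xs @ [y])"
proof -
  have "Vector_Spaces.linear scale (*) (\<lambda>y. A (xs @ [y]))" by (rule mlinD[OF assms])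
  from theI'[OF Riesz[OF this]] show ?thesis unfolding form_map_def by blast
qed

lemma form_map_eqI: "mlin (*) A \<Longrightarrow> (\<And>y. BB v y = A (xs @ [y])) \<Longrightarrow> form_map A xs = v"
  by (rule BB_ext) (simp add: BB_form_map)

lemma mlin_form_map: assumes "mlin (*) A" shows "mlin scale (form_map A)"
proof (rule mlinI[OF vector_space_axioms])
  fix us vs x y c
  show "form_map A (us @ (x + y) # vs) = form_map A (us @ x # vs) + form_map A (us @ y # vs)"
    by (rule form_map_eqI[OF assms]) (simp add: BB_add_left BB_form_map[OF assms] mlin_add[OF assms])
  show "form_map A (us @ (c *s x) # vs) = c *s form_map A (us @ x # vs)"
    by (rule form_map_eqI[OF assms]) (simp add: BB_scale_left BB_form_map[OF assms] mlin_scale[OF assms])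
qed

lemma form_map_linear:
  assumes "mlin (*) A" "mlin (*) B"
  shows "form_map (\<lambda>xs. c * A xs + B xs) xs = c *s form_map A xs + form_map B xs"
  by (rule form_map_eqI[OF mlin_plus[OF mlin_const_scale[OF assms(1)] assms(2)]]) (simp add: BB_add_left BB_scale_left BB_form_map[OF assms(1)] BB_form_map[OF assms(2)])

lemma qparity_form_map: assumes "mlin (*) A" "parity d A" shows "qparity d (form_map A)"
  unfolding qparity_def
proof (intro allI)
  fix m xs
  show "form_map A (map (sg m) xs) = ssgn (m * d) (sg m (form_map A xs))"
  proof (rule form_map_eqI[OF assms(1)])
    fix y
    have "A (map (sg m) xs @ [y]) = A (map (sg m) (xs @ [sg (- m) y]))" by simp
    also have "\<dots> = ssgn (m * d) (A (xs @ [sg (- m) y]))" by (rule parity_sg[OF assms(2)])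
    also have "\<dots> = ssgn (m * d) (A (xs @ [sg m y]))" by (simp add: sg_cong[of "- m" m])
    finally show "BB (ssgn (m * d) (sg m (form_map A xs))) y = A (map (sg m) xs @ [y])"
      by (simp add: BB_ssgn_left BB_sg BB_form_map[OF assms(1)])
  qed
qed

lemma ph_form_map:
  assumes "mlin (*) A" "parity d A" "set us \<subseteq> homog" shows "ph (d + ldeg us) (form_map A us)"
proof -
  have "ssgn (ldeg us) (form_map A us) = ssgn d (sg 1 (form_map A us))"
    using mlin_sg_list0[OF mlin_form_map[OF assms(1)] assms(3), of 1] qparityD[OF qparity_form_map[OF assms(1,2)], of 1 us]
    by simp
  then have "ssgn d (ssgn (ldeg us) (form_map A us)) = ssgn d (ssgn d (sg 1 (form_map A us)))" by (rule arg_cong)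
  then show ?thesis by (simp add: ph_def) (simp add: ssgn_def)
qed

text \<open>The sum over dual bases of products of contracted forms, written without bases:
  contracting dual vectors into two forms amounts to pairing the values of their maps. The
  involution is the sign of moving the second form past arguments of the first.\<close>

definition pairing :: "int \<Rightarrow> ('v list \<Rightarrow> 'k) \<Rightarrow> ('v list \<Rightarrow> 'k) \<Rightarrow> 'v list \<Rightarrow> 'k" where
  "pairing d A B = sp (\<lambda>u w. BB (form_map A (map (sg d) u)) (form_map B w))"

definition hbracket :: "int \<Rightarrow> ('v list \<Rightarrow> 'k) \<Rightarrow> ('v list \<Rightarrow> 'k) \<Rightarrow> 'v list \<Rightarrow> 'k" where
  "hbracket d A B = cyc (pairing d A B)"

lemma mlin_comp_linear:
  "Vector_Spaces.linear scale s h \<Longrightarrow> mlin scale Q \<Longrightarrow> mlin s (\<lambda>u. h (Q u))"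
  by (auto simp: mlin_def intro!: linear_comp[where f = h])

lemma mlin_pairing: assumes "mlin (*) A" "mlin (*) B" shows "mlin (*) (pairing d A B)"
  unfolding pairing_def
  by (intro mlin_sp_fun mlin_comp_linear[OF linear_BB_left] mlin_comp_linear[OF linear_BB_right]
      mlin_map_sg mlin_form_map assms)

lemma mlin_hbracket: "mlin (*) A \<Longrightarrow> mlin (*) B \<Longrightarrow> mlin (*) (hbracket d A B)"
  unfolding hbracket_def by (intro mlin_cyc mlin_pairing)

lemma rot_hbracket: "mlin (*) A \<Longrightarrow> mlin (*) B \<Longrightarrow> rot (hbracket d A B) = hbracket d A B"
  unfolding hbracket_def by (intro rot_cyc mlin_pairing)

text \<open>The rotations of \<open>xs @ [y]\<close> correspond to the cuts of \<open>xs\<close>;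
  the front block \<open>w\<close> moves behind \<open>y\<close>.\<close>

lemma cyc_snoc:
  assumes "mlin (*) F" "set xs \<subseteq> homog" "y \<in> homog"
  shows "cyc F (xs @ [y]) = sp (\<lambda>w v. ssgn (ldeg w * (ldeg v + deg y)) (F (v @ y # w))) xs"
proof -
  have "cyc F (xs @ [y]) = (\<Sum>j<Suc (length xs). (rot ^^ j) F (xs @ [y]))"
    by (simp add: cyc_def max_def)
  also have "\<dots> = (\<Sum>j\<le>length xs. ssgn (ldeg (take j xs) * (ldeg (drop j xs) + deg y))
      (F (drop j xs @ y # take j xs)))"
    unfolding lessThan_Suc_atMost
    by (intro sum.cong refl, subst rot_pow_take[OF assms(1)]) (use assms in auto)
  finally show ?thesis by (simp add: sp_eq_sum)
qed

text \<open>The rotations in which the last argument is an input of \<open>Q\<^sub>A\<close> give the insertion of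
  \<open>Q\<^sub>B\<close> into \<open>Q\<^sub>A\<close>, the others the insertion of \<open>Q\<^sub>A\<close> into \<open>Q\<^sub>B\<close>.\<close>

lemma hbracket_snoc:
  assumes A: "mlin (*) A" "rot A = A" "parity p A" and B: "mlin (*) B" "rot B = B" "parity q B"
  shows "hbracket q A B (xs @ [y]) = BB (qcomm p q (form_map A) (form_map B) xs) y"
proof -
  \<comment> \<open>The right side as a multilinear function of the whole list, so that both sides
    need to be compared on homogeneous arguments only.\<close>
  define H where "H zs = (if zs = [] then 0 else BB (qcomm p q (form_map A) (form_map B) (butlast zs)) (last zs))" for zs
  have mH: "mlin (*) H"
  proof (rule mlinI[OF vector_space_mult])
    note m = mlin_qcomm[OF mlin_form_map[OF A(1)] mlin_form_map[OF B(1)]]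
    fix us vs x y c
    show "H (us @ (x + y) # vs) = H (us @ x # vs) + H (us @ y # vs)"
      by (cases vs rule: rev_cases)
         (auto simp: H_def butlast_append BB_add_right BB_add_left mlin_add[OF m])
    show "H (us @ (c *s x) # vs) = c * H (us @ x # vs)"
      by (cases vs rule: rev_cases)
         (auto simp: H_def butlast_append BB_scale_right BB_scale_left mlin_scale[OF m])
  qed
  have hom: "cyc (pairing q A B) (xs @ [y]) = BB (qcomm p q (form_map A) (form_map B) xs) y"
    if xs: "set xs \<subseteq> homog" and y: "y \<in> homog" for xs y
  proof -
    have expand: "cyc (pairing q A B) (xs @ [y]) = sp (\<lambda>w v. sp (\<lambda>u w2. ssgn (ldeg w * (ldeg v + deg y))
        (BB (form_map A (map (sg q) u)) (form_map B (w2 @ y # w)))) v) xs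
      + sp (\<lambda>w v. sp (\<lambda>u w'. ssgn (ldeg w * (ldeg v + deg y))
        (BB (form_map A (map (sg q) (v @ y # u))) (form_map B w'))) w) xs"
      unfolding cyc_snoc[OF mlin_pairing[OF A(1) B(1)] xs y]
      by (simp add: pairing_def sp_insert ssgn_add sp_add sp_ssgn cong: sp_cong_all)
    have left: "sp (\<lambda>w v. sp (\<lambda>u w2. ssgn (ldeg w * (ldeg v + deg y))
        (BB (form_map A (map (sg q) u)) (form_map B (w2 @ y # w)))) v) xs
      = - ssgn (p * q) (BB (act p (form_map B) (form_map A) xs) y)"
    proof -
      have "ssgn (ldeg w * (ldeg (u @ w2) + deg y)) (BB (form_map A (map (sg q) u)) (form_map B (w2 @ y # w)))
          = - ssgn (p * q) (BB (form_map B (map (sg p) w @ form_map A u # w2)) y)"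
        if hom: "set w \<subseteq> homog" "set u \<subseteq> homog" "set w2 \<subseteq> homog" for w u w2
      proof -
        let ?a = "form_map A u" and ?m = "p + ldeg u"
        have a: "ph ?m ?a" by (rule ph_form_map[OF A(1,3) hom(2)])
        have yy: "ph (deg y) y" by (rule homog_ph[OF y])
        let ?t = "B (w @ ?a # w2 @ [y])"
        \<comment> \<open>A non-zero value of \<open>B\<close> forces its arguments to have total
          parity \<open>q\<close>. The signs of this half agree only under this constraint.\<close>
        have par: "even (q + ldeg w + ?m + ldeg w2 + deg y)" if "?t \<noteq> 0"
        proof -
          have "ssgn q ?t = B (map (sg 1) w @ sg 1 ?a # map (sg 1) (w2 @ [y]))"
            using B(3) unfolding parity_def by (metis list.simps(9) map_append)
          also have "\<dots> = ssgn ?m (B ([] @ map (sg 1) w @ (?a # map (sg 1) (w2 @ [y]))))"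
            using mlin_ssgn[OF B(1), of "map (sg 1) w" ?m ?a] ph_sg[OF a, of 1] by simp
          also have "\<dots> = ssgn ?m (ssgn (ldeg w) (B ((w @ [?a]) @ map (sg 1) (w2 @ [y]) @ [])))"
            by (subst mlin_sg_list[OF B(1) hom(1)]) simp
          also have "\<dots> = ssgn ?m (ssgn (ldeg w) (ssgn (ldeg (w2 @ [y])) ?t))"
            by (subst mlin_sg_list[OF B(1)]) (use hom y in auto)
          finally have "ssgn q ?t = ssgn (?m + (ldeg w + (ldeg w2 + deg y))) ?t" by simp
          from ssgn_eq_self[OF this that] show ?thesis by (simp add: algebra_simps)
        qed
        \<comment> \<open>Antisymmetry brings the value of \<open>form_map A\<close> into the last
          slot of \<open>B\<close>, and cyclic invariance then moves \<open>w2\<close> and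
          \<open>y\<close> behind it.\<close>
        have "BB (form_map A (map (sg q) u)) (form_map B (w2 @ y # w))
            = ssgn (q * ldeg u) (- ssgn ?m (B ((w2 @ [y]) @ (w @ [?a]))))"
          using BB_antisym_ph[OF a, of "form_map B (w2 @ y # w)"] mlin_sg_list0[OF mlin_form_map[OF A(1)] hom(2), of q]
          by (simp add: BB_ssgn_left BB_form_map[OF B(1)])
             (simp add: ssgn_def)
        also have "B ((w2 @ [y]) @ (w @ [?a])) = B (map (sg (ldeg (w2 @ [y]))) (w @ [?a]) @ w2 @ [y])"
          by (rule cyclic_block[OF B(1,2)]) (use hom y in auto)
        also have "\<dots> = ssgn (ldeg (w2 @ [y]) * ?m) (ssgn (ldeg (w2 @ [y]) * ldeg w) ?t)"
          using mlin_sg_list[OF B(1) hom(1), of "[]" "ldeg (w2 @ [y])" "?a # w2 @ [y]"]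
          by (simp add: ph_sg[OF a] mlin_ssgn[OF B(1)])
        finally have 1: "BB (form_map A (map (sg q) u)) (form_map B (w2 @ y # w)) =
          - ssgn (q * ldeg u + ?m + (ldeg w2 + deg y) * ?m + (ldeg w2 + deg y) * ldeg w) ?t"
          by (simp add: ssgn_minus algebra_simps)
        have 2: "BB (form_map B (map (sg p) w @ ?a # w2)) y = ssgn (p * ldeg w) ?t"
          using mlin_sg_list[OF B(1) hom(1), of "[]" p "?a # w2 @ [y]"] by (simp add: BB_form_map[OF B(1)])
        show ?thesis unfolding 1 2 ssgn_minus ssgn_ssgn minus_equation_iff[of "- _"] minus_minus
        proof (rule arg_cong[of _ _ uminus], rule ssgn_cong)
          assume "?t \<noteq> 0"
          from par[OF this] show "even (ldeg w * (ldeg (u @ w2) + deg y) +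
            (q * ldeg u + (p + ldeg u) + (ldeg w2 + deg y) * (p + ldeg u) + (ldeg w2 + deg y) * ldeg w)
             - (p * q + p * ldeg w))"
            by (simp add: even_add even_mult_iff) blast
        qed
      qed
      then have "sp (\<lambda>w v. sp (\<lambda>u w2. ssgn (ldeg w * (ldeg v + deg y))
          (BB (form_map A (map (sg q) u)) (form_map B (w2 @ y # w)))) v) xs =
         sp (\<lambda>w v. sp (\<lambda>u w2. - ssgn (p * q) (BB (form_map B (map (sg p) w @ form_map A u # w2)) y)) v) xs"
        using xs by (intro sp_cong) auto
      then show ?thesis
        by (simp add: act_def sp_ssgn sp_minus sp_hom[of "\<lambda>v. BB v y"] BB_add_left cong: sp_cong_all)
    qed
    have right: "sp (\<lambda>w v. sp (\<lambda>u w'. ssgn (ldeg w * (ldeg v + deg y))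
        (BB (form_map A (map (sg q) (v @ y # u))) (form_map B w'))) w) xs = BB (act q (form_map A) (form_map B) xs) y"
    proof -
      have "ssgn (ldeg (u @ w) * (ldeg v + deg y)) (BB (form_map A (map (sg q) (v @ y # u))) (form_map B w))
          = BB (form_map A (map (sg q) u @ form_map B w # v)) y"
        if hom: "set u \<subseteq> homog" "set w \<subseteq> homog" "set v \<subseteq> homog" for u w v
      proof -
        let ?c = "form_map B w" and ?m = "q + ldeg w"
        have c: "ph ?m ?c" by (rule ph_form_map[OF B(1,3) hom(2)])
        let ?t = "A (u @ ?c # v @ [y])"
        have "BB (form_map A (map (sg q) (v @ y # u))) ?c = ssgn (q * (ldeg v + deg y + ldeg u)) (A ((v @ [y]) @ u @ [?c]))"
          using mlin_sg_list[OF A(1), of "v @ y # u" "[]" q "[?c]"] hom y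
          by (simp add: BB_form_map[OF A(1)] add.assoc)
        also have "A ((v @ [y]) @ u @ [?c]) = A (map (sg (ldeg (v @ [y]))) (u @ [?c]) @ v @ [y])"
          by (rule cyclic_block[OF A(1,2)]) (use hom y in auto)
        also have "\<dots> = ssgn (ldeg (v @ [y]) * ?m) (ssgn (ldeg (v @ [y]) * ldeg u) ?t)"
          using mlin_sg_list[OF A(1) hom(1), of "[]" "ldeg (v @ [y])" "?c # v @ [y]"]
          by (simp add: ph_sg[OF c] mlin_ssgn[OF A(1)])
        finally have 1: "BB (form_map A (map (sg q) (v @ y # u))) ?c =
          ssgn (q * (ldeg v + deg y + ldeg u) + (ldeg v + deg y) * ?m + (ldeg v + deg y) * ldeg u) ?t"
          by (simp add: algebra_simps)
        have 2: "BB (form_map A (map (sg q) u @ ?c # v)) y = ssgn (q * ldeg u) ?t"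
          using mlin_sg_list[OF A(1) hom(1), of "[]" q "?c # v @ [y]"] by (simp add: BB_form_map[OF A(1)])
        show ?thesis unfolding 1 2 ssgn_ssgn
          by (rule ssgn_cong) (simp add: even_add even_mult_iff, blast)
      qed
      then have "sp (\<lambda>w v. sp (\<lambda>u w'. ssgn (ldeg w * (ldeg v + deg y))
          (BB (form_map A (map (sg q) (v @ y # u))) (form_map B w'))) w) xs =
         sp (\<lambda>w v. sp (\<lambda>u w'. BB (form_map A (map (sg q) u @ form_map B w' # v)) y) w) xs"
        using xs by (intro sp_cong) auto
      then show ?thesis
        by (simp add: act_def sp_hom[of "\<lambda>v. BB v y"] BB_add_left sp_assoc[symmetric] cong: sp_cong_all)
    qed
    show ?thesis unfolding expand left right
      by (simp add: qcomm_def BB_diff_left BB_ssgn_left)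
  qed
  have "hbracket q A B (xs @ [y]) = H (xs @ [y])"
  proof (rule mlin_eqI[OF mlin_hbracket[OF A(1) B(1)] mH])
    fix ys :: "'v list" assume "length ys = length (xs @ [y])" and ys: "set ys \<subseteq> homog - {0}"
    then show "hbracket q A B ys = H ys"
      using hom[of "butlast ys" "last ys"] ys
      by (cases ys rule: rev_cases) (auto simp: hbracket_def H_def)
  qed
  then show ?thesis by (simp add: H_def)
qed

end

lemma sp_mult_left: "sp (\<lambda>u w. c * f u w) xs = c * sp f xs" for c :: "'a::ring"
  by (intro sp_hom[symmetric]) (auto simp: distrib_left)

lemma sp_nonzeroE:
  assumes "sp f xs \<noteq> 0" obtains u w where "u @ w = xs" "f u w \<noteq> 0"
  using assms sp_zero[of xs f] by blast

context graded_vector_space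
begin

lemma cyc_linear: "cyc (\<lambda>u. c * F u + H u) zs = c * cyc F zs + cyc H zs"
  by (simp add: cyc_add cyc_scale)

lemma cyc_zero: "cyc (\<lambda>u. 0) zs = 0"
  using cyc_scale[of 0 "\<lambda>u. 0" zs] by simp

lemma cyc_length_zero: "(\<And>u. length u = length zs \<Longrightarrow> F u = 0) \<Longrightarrow> cyc F zs = 0"
  using cyc_cong_length[of zs F "\<lambda>u. 0"] by (simp add: cyc_zero)

lemma cyc_nonzeroE:
  assumes F: "mlin (*) F" and zs: "set zs \<subseteq> homog" and "cyc F zs \<noteq> 0"
  obtains ys where "set ys \<subseteq> homog" "ldeg ys = ldeg zs" "length ys = length zs" "F ys \<noteq> 0"
proof -
  obtain j where j: "j < max 1 (length zs)" "(rot ^^ j) F zs \<noteq> 0"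
    using assms(3) unfolding cyc_def by (metis (no_types, lifting) lessThan_iff sum.neutral)
  then have jl: "j \<le> length zs" by auto
  have "F (drop j zs @ take j zs) \<noteq> 0" using j(2) rot_pow_take[OF F zs jl] by auto
  moreover have "set (drop j zs @ take j zs) \<subseteq> homog"
    using zs by (auto dest: in_set_takeD in_set_dropD)
  moreover have "ldeg (drop j zs @ take j zs) = ldeg zs"
    using ldeg_simps(3)[of "take j zs" "drop j zs"] by simp
  ultimately show ?thesis using that[of "drop j zs @ take j zs"] jl by auto
qed

lemma finite_arities_iff:
  "finite {k. arity_part k F \<noteq> (\<lambda>_. 0)} \<longleftrightarrow> (\<exists>N. \<forall>xs. length xs > N \<longrightarrow> F xs = 0)"
proof
  assume "finite {k. arity_part k F \<noteq> (\<lambda>_. 0)}"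
  then obtain N where "\<forall>k\<in>{k. arity_part k F \<noteq> (\<lambda>_. 0)}. k \<le> N"
    unfolding finite_nat_set_iff_bounded_le by blast
  then have N: "k \<le> N" if "arity_part k F \<noteq> (\<lambda>_. 0)" for k using that by blast
  have "F xs = 0" if "length xs > N" for xs
  proof -
    have "arity_part (length xs) F = (\<lambda>_. 0)" using N[of "length xs"] that by linarith
    from fun_cong[OF this, of xs] show ?thesis by (simp add: arity_part_def)
  qed
  then show "\<exists>N. \<forall>xs. length xs > N \<longrightarrow> F xs = 0" by blast
next
  assume "\<exists>N. \<forall>xs. length xs > N \<longrightarrow> F xs = 0"
  then obtain N where "\<And>xs. length xs > N \<Longrightarrow> F xs = 0" by blast
  then have "arity_part k F = (\<lambda>_. 0)" if "k > N" for k
    using that by (auto simp: arity_part_def fun_eq_iff)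
  then have "{k. arity_part k F \<noteq> (\<lambda>_. 0)} \<subseteq> {..N}"
    by (metis (mono_tags, lifting) atMost_iff mem_Collect_eq not_le subsetI)
  then show "finite {k. arity_part k F \<noteq> (\<lambda>_. 0)}" by (rule finite_subset) simp
qed

lemma all_cyclicD:
  assumes "F \<in> all_cyclic_forms"
  shows "mlin (*) F" "rot F = F" "\<exists>N. \<forall>xs. length xs > N \<longrightarrow> F xs = 0"
  using assms by (auto simp: all_cyclic_iff finite_arities_iff)

lemma all_cyclicI:
  "mlin (*) F \<Longrightarrow> rot F = F \<Longrightarrow> (\<And>xs. length xs > N \<Longrightarrow> F xs = 0) \<Longrightarrow> F \<in> all_cyclic_forms"
  by (auto simp: all_cyclic_iff finite_arities_iff)

lemma rot_linear: "rot (\<lambda>xs. c * A xs + B xs) zs = c * rot A zs + (rot B zs :: 'k)"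
  by (cases zs) (auto simp: algebra_simps)

lemma all_cyclic_linear:
  assumes A: "A \<in> all_cyclic_forms" and B: "B \<in> all_cyclic_forms"
  shows "(\<lambda>xs. c * A xs + B xs) \<in> all_cyclic_forms"
proof -
  obtain M N where "\<And>xs. length xs > M \<Longrightarrow> A xs = 0" "\<And>xs. length xs > N \<Longrightarrow> B xs = 0"
    using all_cyclicD(3)[OF A] all_cyclicD(3)[OF B] by blast
  then show ?thesis
    using all_cyclicD(1,2)[OF A] all_cyclicD(1,2)[OF B]
    by (intro all_cyclicI[where N = "max M N"] mlin_plus mlin_const_scale[where s = "(*)"] ext)
       (auto simp: rot_linear)
qed

lemma all_cyclic_add:
  "A \<in> all_cyclic_forms \<Longrightarrow> B \<in> all_cyclic_forms \<Longrightarrow> (\<lambda>xs. A xs + B xs) \<in> all_cyclic_forms"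
  using all_cyclic_linear[of A B 1] by simp

lemma par_all: assumes "A \<in> all_cyclic_forms" shows "par p A \<in> all_cyclic_forms"
proof -
  obtain N where "\<And>xs. length xs > N \<Longrightarrow> A xs = 0" using all_cyclicD(3)[OF assms] by blast
  then show ?thesis
    using all_cyclicD(1,2)[OF assms]
    by (intro all_cyclicI[where N = N] mlin_par rot_par) (auto simp: par_def)
qed

end

section \<open>Degrees, antisymmetry and Jacobi identity for the bracket of a form\<close>

context form_graded_vector_space
begin

lemma form_map_zero: "mlin (*) A \<Longrightarrow> (\<And>y. A (xs @ [y]) = 0) \<Longrightarrow> form_map A xs = 0"
  by (rule form_map_eqI) auto

lemma form_map_zero_fun [simp]: "form_map (\<lambda>xs. 0) xs = 0"
  by (rule form_map_zero) (auto simp: mlin_zero_fun vector_space_mult)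

lemma pairing_linear_left:
  assumes "mlin (*) A" "mlin (*) A'"
  shows "pairing d (\<lambda>xs. c * A xs + A' xs) B ys = c * pairing d A B ys + pairing d A' B ys"
  by (simp add: pairing_def form_map_linear[OF assms] BB_add_left BB_scale_left sp_add sp_mult_left cong: sp_cong_all)

lemma pairing_linear_right:
  assumes "mlin (*) B" "mlin (*) B'"
  shows "pairing d A (\<lambda>xs. c * B xs + B' xs) ys = c * pairing d A B ys + pairing d A B' ys"
  by (simp add: pairing_def form_map_linear[OF assms] BB_add_right BB_scale_right sp_add sp_mult_left cong: sp_cong_all)

lemma hbracket_linear_left:
  assumes "mlin (*) A" "mlin (*) A'"
  shows "hbracket d (\<lambda>xs. c * A xs + A' xs) B = (\<lambda>xs. c * hbracket d A B xs + hbracket d A' B xs)"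
proof -
  have "pairing d (\<lambda>xs. c * A xs + A' xs) B = (\<lambda>ys. c * pairing d A B ys + pairing d A' B ys)"
    using pairing_linear_left[OF assms] by blast
  then show ?thesis by (simp only: hbracket_def) (rule ext, rule cyc_linear)
qed

lemma hbracket_linear_right:
  assumes "mlin (*) B" "mlin (*) B'"
  shows "hbracket d A (\<lambda>xs. c * B xs + B' xs) = (\<lambda>xs. c * hbracket d A B xs + hbracket d A B' xs)"
proof -
  have "pairing d A (\<lambda>xs. c * B xs + B' xs) = (\<lambda>ys. c * pairing d A B ys + pairing d A B' ys)"
    using pairing_linear_right[OF assms] by blast
  then show ?thesis by (simp only: hbracket_def) (rule ext, rule cyc_linear)
qed

lemma hbracket_cong: "even (d - d') \<Longrightarrow> hbracket d A B = hbracket d' A B"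
  unfolding hbracket_def pairing_def by (simp add: map_sg_cong[of d d'])

lemma hbracket_zero_left: "(\<And>xs. form_map A xs = 0) \<Longrightarrow> hbracket d A B xs = 0"
  by (auto simp: hbracket_def pairing_def intro!: cyc_length_zero)

lemma hbracket_zero_right: "(\<And>xs. form_map B xs = 0) \<Longrightarrow> hbracket d A B xs = 0"
  by (auto simp: hbracket_def pairing_def intro!: cyc_length_zero)

lemma hbracket_arity:
  assumes A: "A \<in> cyclic_forms (k + 1)" and B: "B \<in> cyclic_forms (k' + 1)"
  shows "hbracket d A B \<in> cyclic_forms (k + k')"
proof (rule cyclic_formsI)
  note A' = cyclic_formsD[OF A] and B' = cyclic_formsD[OF B]
  show "mlin (*) (hbracket d A B)" "rot (hbracket d A B) = hbracket d A B"
    by (rule mlin_hbracket[OF A'(1) B'(1)] rot_hbracket[OF A'(1) B'(1)])+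
  have QA: "form_map A u = 0" if "length u \<noteq> k" for u using that by (intro form_map_zero A') auto
  have QB: "form_map B u = 0" if "length u \<noteq> k'" for u using that by (intro form_map_zero B') auto
  show "hbracket d A B xs = 0" if xs: "length xs \<noteq> k + k'" for xs
    unfolding hbracket_def pairing_def
  proof (rule cyc_length_zero, rule sp_zero)
    fix ys u w :: "'v list" assume "length ys = length xs" "u @ w = ys"
    then have "length u \<noteq> k \<or> length w \<noteq> k'" using xs by auto
    then show "BB (form_map A (map (sg d) u)) (form_map B w) = 0" by (auto simp: QA QB)
  qed
qed

lemma hbracket_all:
  assumes A: "A \<in> all_cyclic_forms" and B: "B \<in> all_cyclic_forms"
  shows "hbracket d A B \<in> all_cyclic_forms"
proof -
  note A' = all_cyclicD[OF A] and B' = all_cyclicD[OF B]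
  obtain M N where M: "\<And>xs. length xs > M \<Longrightarrow> A xs = 0" and N: "\<And>xs. length xs > N \<Longrightarrow> B xs = 0"
    using A'(3) B'(3) by blast
  have QA: "form_map A u = 0" if "length u > M" for u using that by (intro form_map_zero A' M) auto
  have QB: "form_map B u = 0" if "length u > N" for u using that by (intro form_map_zero B' N) auto
  show ?thesis
  proof (rule all_cyclicI[where N = "M + N"])
    show "mlin (*) (hbracket d A B)" "rot (hbracket d A B) = hbracket d A B"
      by (rule mlin_hbracket[OF A'(1) B'(1)] rot_hbracket[OF A'(1) B'(1)])+
    show "hbracket d A B xs = 0" if xs: "M + N < length xs" for xs
      unfolding hbracket_def pairing_def
    proof (rule cyc_length_zero, rule sp_zero)
      fix ys u w :: "'v list" assume "length ys = length xs" "u @ w = ys"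
      then have "length u > M \<or> length w > N" using xs by auto
      then show "BB (form_map A (map (sg d) u)) (form_map B w) = 0" by (auto simp: QA QB)
    qed
  qed
qed

lemma parity_hbracket:
  assumes A: "mlin (*) A" "parity p A" and B: "mlin (*) B" "parity q B"
  shows "parity (p + q) (hbracket d A B)"
proof -
  note a = qparityD[OF qparity_form_map[OF A]] and bb = qparityD[OF qparity_form_map[OF B]]
  have pairing: "pairing d A B (map (sg 1) ys) = ssgn (p + q) (pairing d A B ys)" for ys
  proof -
    have "BB (form_map A (map (sg d) (map (sg 1) u))) (form_map B (map (sg 1) w)) =
        ssgn (p + q) (BB (form_map A (map (sg d) u)) (form_map B w))" for u w
    proof -
      have "BB (form_map A (map (sg d) (map (sg 1) u))) (form_map B (map (sg 1) w))
        = BB (form_map A (map (sg 1) (map (sg d) u))) (form_map B (map (sg 1) w))"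
        by (simp only: map_sg_map_sg add.commute)
      also have "\<dots> = ssgn p (ssgn q (BB (sg 1 (form_map A (map (sg d) u))) (sg 1 (form_map B w))))"
        using a[of 1 "map (sg d) u"] bb[of 1 w] by (simp only: BB_ssgn_left BB_ssgn_right mult_1 ssgn_ssgn add.commute)
      also have "\<dots> = ssgn (p + q) (BB (form_map A (map (sg d) u)) (sg 1 (sg 1 (form_map B w))))"
        by (simp only: BB_sg ssgn_ssgn)
      finally show ?thesis by (simp only: sg2)
    qed
    then show ?thesis by (simp only: pairing_def sp_map sp_ssgn)
  qed
  show ?thesis unfolding parity_def
  proof
    fix xs
    have "(rot ^^ j) (pairing d A B) (map (sg 1) xs) = ssgn (p + q) ((rot ^^ j) (pairing d A B) xs)" for j xs
    proof (induction j arbitrary: xs)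
      case (Suc j)
      have "(rot ^^ Suc j) (pairing d A B) (map (sg 1) xs) = rot (\<lambda>u. (rot ^^ j) (pairing d A B) (map (sg 1) u)) xs"
        by (simp add: rot_map_sg)
      also have "\<dots> = ssgn (p + q) (rot ((rot ^^ j) (pairing d A B)) xs)"
        unfolding Suc by (cases xs) (simp_all add: ssgn_add)
      finally show ?case by simp
    qed (simp add: pairing)
    then show "hbracket d A B (map (sg 1) xs) = ssgn (p + q) (hbracket d A B xs)"
      by (simp add: hbracket_def cyc_def ssgn_sum)
  qed
qed

lemma BB_component: assumes "y \<in> G l" shows "BB v y = BB (component v (- l)) y"
proof (rule linear_eqI[OF linear_BB_left])
  show "Vector_Spaces.linear (*s) (*) (\<lambda>v. BB (component v (- l)) y)"
    by (simp add: Vector_Spaces.linear_iff vector_space_axioms vector_space_mult component_add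
        component_scale BB_add_left BB_scale_left)
  fix v assume "v \<in> homog - {0}"
  then obtain i where i: "v \<in> G i" by (auto simp: homog_def)
  show "BB v y = BB (component v (- l)) y"
  proof (cases "- l = i")
    case False
    then have "BB v y = 0" using BB_degree[OF i assms] by (metis add_eq_0_iff minus_equation_iff)
    then show ?thesis using False by (simp add: component_homog[OF i])
  qed (simp add: component_homog[OF i])
qed

text \<open>The component of degree \<open>j\<close> is detected by vectors of degree
  \<open>- j\<close>, so a vector that pairs only with degree \<open>- i\<close> has no component
  outside degree \<open>i\<close>.\<close>

lemma in_G_if_BB:
  assumes "\<And>j y. y \<in> G j \<Longrightarrow> BB v y \<noteq> 0 \<Longrightarrow> i + j = 0" shows "v \<in> G i"
proof -
  have "component v j = 0" if "j \<noteq> i" for j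
  proof (rule BB_ext)
    fix y
    show "BB (component v j) y = BB 0 y"
    proof (rule linear_eqI[OF linear_BB_right linear_BB_right])
      fix y assume "y \<in> homog - {0}"
      then obtain l where l: "y \<in> G l" by (auto simp: homog_def)
      show "BB (component v j) y = BB 0 y"
      proof (cases "j + l = 0")
        case True
        then have j: "j = - l" by simp
        have "BB (component v j) y = BB v y" unfolding j by (rule BB_component[OF l, symmetric])
        moreover have "i + l \<noteq> 0" using True that by simp
        then have "BB v y = 0" using assms[OF l] by blast
        ultimately show ?thesis by simp
      next
        case False
        then show ?thesis using BB_degree[OF component_in l] by (metis BB_zero_left)
      qed
    qed
  qed
  then have "v = component v i"
    by - (rule component_eqI, auto simp: component_homog[OF component_in])
  then show ?thesis using component_in[of v i] by simp
qed

text \<open>For \<open>d = 3\<close> the value lies in degree \<open>ldeg us + 2\<close>, that is,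
  the map has degree 1 for the shifted grading.\<close>

lemma form_map_in_G:
  assumes A: "mlin (*) A" "has_degree d A" "set us \<subseteq> homog"
  shows "form_map A us \<in> G (ldeg us + d - 1)"
proof (rule in_G_if_BB)
  fix j y assume y: "y \<in> G j" and nz: "BB (form_map A us) y \<noteq> 0"
  then have "A (us @ [y]) \<noteq> 0" by (simp add: BB_form_map[OF A(1)])
  moreover have "deg y = j - 1" using nz by (intro deg_eq y) auto
  ultimately show "ldeg us + d - 1 + j = 0"
    using A(2)[unfolded has_degree_def, rule_format, of "us @ [y]"] A(3) G_homog[OF y] by simp
qed

lemma has_degree_hbracket:
  assumes A: "mlin (*) A" "has_degree d A" and B: "mlin (*) B" "has_degree e B"
  shows "has_degree (d + e - 2) (hbracket m A B)"
  unfolding has_degree_def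
proof (intro allI impI)
  fix xs assume xs: "set xs \<subseteq> homog \<and> hbracket m A B xs \<noteq> 0"
  then obtain ys where ys: "set ys \<subseteq> homog" "ldeg ys = ldeg xs" "pairing m A B ys \<noteq> 0"
    using cyc_nonzeroE[OF mlin_pairing[OF A(1) B(1)]] unfolding hbracket_def by metis
  then obtain u w where uw: "u @ w = ys" "BB (form_map A (map (sg m) u)) (form_map B w) \<noteq> 0"
    unfolding pairing_def by (elim sp_nonzeroE)
  have hom: "set u \<subseteq> homog" "set w \<subseteq> homog" using ys uw by auto
  have "BB (form_map A u) (form_map B w) \<noteq> 0"
    using uw(2) by (simp add: mlin_sg_list0[OF mlin_form_map[OF A(1)] hom(1)] BB_ssgn_left)
  from BB_degree[OF form_map_in_G[OF A hom(1)] form_map_in_G[OF B hom(2)] this]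
  have "ldeg u + d - 1 + (ldeg w + e - 1) = 0" .
  moreover have "ldeg xs = ldeg u + ldeg w" using ys(2) uw(1) by auto
  ultimately show "d + e - 2 + ldeg xs = 0" by simp
qed

lemma hbracket_Nil: "hbracket d A B [] = BB (form_map A []) (form_map B [])"
  by (simp add: hbracket_def pairing_def)

lemma ph_form_map_Nil: "mlin (*) A \<Longrightarrow> parity d A \<Longrightarrow> ph d (form_map A [])"
  using ph_form_map[of A d "[]"] by simp

lemma BB_parity:
  assumes "ph m x" "ph n y" "BB x y \<noteq> 0" shows "even (m - n)"
proof -
  have "ssgn m (BB x y) = ssgn n (BB x y)"
    using BB_sg[of 1 x y] assms(1,2) by (simp add: ph_def BB_ssgn_left BB_ssgn_right)
  then show ?thesis using assms(3) by (rule ssgn_eq_self)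
qed

text \<open>On non-empty lists this is the antisymmetry of the commutator. The value on the empty
  list pairs the vectors that represent the linear parts of the two forms, and there the
  antisymmetry of \<open>BB\<close> applies.\<close>

lemma hbracket_antisym:
  assumes A: "mlin (*) A" "rot A = A" "parity p A" and B: "mlin (*) B" "rot B = B" "parity q B"
  shows "hbracket q A B xs = - ssgn (p * q) (hbracket p B A xs)"
proof (cases xs rule: rev_cases)
  case Nil
  let ?x = "form_map A []" and ?y = "form_map B []"
  have ph: "ph p ?x" "ph q ?y" by (rule ph_form_map_Nil[OF A(1,3)] ph_form_map_Nil[OF B(1,3)])+
  have "BB ?x ?y = - ssgn q (BB ?y ?x)" using BB_antisym_ph[OF ph(2)] .
  also have "ssgn q (BB ?y ?x) = ssgn (p * q) (BB ?y ?x)"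
    by (rule ssgn_cong) (use BB_parity[OF ph(2,1)] in auto)
  finally show ?thesis by (simp add: Nil hbracket_Nil)
next
  case (snoc ys y)
  have "qcomm p q (form_map A) (form_map B) ys = - ssgn (p * q) (qcomm q p (form_map B) (form_map A) ys)"
    by (simp add: qcomm_def ssgn_diff mult.commute) (simp add: ssgn_def)
  then show ?thesis
    using BB_scale_left[of "-1"]
    by (simp add: snoc hbracket_snoc[OF A B] hbracket_snoc[OF B A] BB_ssgn_left)
qed

lemma form_map_hbracket:
  assumes A: "mlin (*) A" "rot A = A" "parity p A" and B: "mlin (*) B" "rot B = B" "parity q B"
  shows "form_map (hbracket q A B) = qcomm p q (form_map A) (form_map B)"
  by (rule ext, rule form_map_eqI[OF mlin_hbracket[OF A(1) B(1)]]) (simp add: hbracket_snoc[OF A B])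

text \<open>On non-empty lists this is the Jacobi identity of the commutator. On the empty list
  every term evaluates the bilinear part of one form on the vectors representing the linear parts of
  the other two.\<close>

lemma hbracket_Jacobi:
  assumes A: "mlin (*) A" "rot A = A" "parity p A" and B: "mlin (*) B" "rot B = B" "parity q B"
    and C: "mlin (*) C" "rot C = C" "parity r C"
  shows "hbracket (q + r) A (hbracket r B C) xs =
    hbracket r (hbracket q A B) C xs + ssgn (p * q) (hbracket (p + r) B (hbracket r A C) xs)"
proof -
  note AB = mlin_hbracket[OF A(1) B(1)] rot_hbracket[OF A(1) B(1)] parity_hbracket[OF A(1,3) B(1,3)]
    and BC = mlin_hbracket[OF B(1) C(1)] rot_hbracket[OF B(1) C(1)] parity_hbracket[OF B(1,3) C(1,3)]
    and AC = mlin_hbracket[OF A(1) C(1)] rot_hbracket[OF A(1) C(1)] parity_hbracket[OF A(1,3) C(1,3)]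
  show ?thesis
  proof (cases xs rule: rev_cases)
    case (snoc ys y)
    show ?thesis
      using qcomm_Jacobi[OF mlin_form_map[OF A(1)] qparity_form_map[OF A(1,3)] mlin_form_map[OF B(1)] qparity_form_map[OF B(1,3)]
        mlin_form_map[OF C(1)] qparity_form_map[OF C(1,3)], of ys]
      by (simp add: snoc hbracket_snoc[OF A BC] hbracket_snoc[OF AB C] hbracket_snoc[OF B AC]
          form_map_hbracket[OF A B] form_map_hbracket[OF B C] form_map_hbracket[OF A C] BB_add_left BB_ssgn_left)
  next
    case Nil
    let ?a = "form_map A []" and ?b = "form_map B []" and ?c = "form_map C []"
    have pa: "ph p ?a" and pb: "ph q ?b" and pc: "ph r ?c"
      by (rule ph_form_map_Nil[OF A(1,3)] ph_form_map_Nil[OF B(1,3)] ph_form_map_Nil[OF C(1,3)])+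
    have q0: "qcomm m n Q R [] = Q [R []] - ssgn (m * n) (R [Q []])" for m n Q R
      by (simp add: qcomm_def act_def)
    have par3: "even (m + i + j)" if "mlin (*) F" "parity m F" "ph i x" "ph j y" "F [x, y] \<noteq> 0"
      for F :: "'v list \<Rightarrow> 'k" and m i j x y
    proof -
      have "ssgn m (F [x, y]) = F ([] @ sg 1 x # [sg 1 y])"
        using parity_sg[OF that(2), of 1 "[x, y]"] by simp
      also have "\<dots> = ssgn i (F ([x] @ sg 1 y # []))"
        using that(3) mlin_ssgn[OF that(1), of "[]" i x "[sg 1 y]"] by (simp add: ph_def)
      also have "\<dots> = ssgn (i + j) (F [x, y])"
        using that(4) mlin_ssgn[OF that(1), of "[x]" j y "[]"] by (simp add: ph_def)
      finally have "ssgn m (F [x, y]) = ssgn (i + j) (F [x, y])" .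
      from ssgn_eq_self[OF this that(5)] show ?thesis by presburger
    qed
    have swap: "F [x, y] = ssgn (i * j) (F [y, x])"
      if "mlin (*) F" "rot F = F" "ph i x" "ph j y" for F :: "'v list \<Rightarrow> 'k" and i j x y
      using cyclic_move[OF that(1,2,3), of "[y]"] mlin_ssgn[OF that(1), of "[]" "i * j" y "[x]"]
      by (simp add: ph_sg[OF that(4)])
    have anti: "BB ?a v = - ssgn p (BB v ?a)" for v
      using BB_antisym_ph[OF pa, of v] by (simp add: ssgn_minus) (simp add: ssgn_def)
    have antib: "BB ?b v = - ssgn q (BB v ?b)" for v
      using BB_antisym_ph[OF pb, of v] by (simp add: ssgn_minus) (simp add: ssgn_def)
    \<comment> \<open>In \<open>t1\<close>, \<open>t3\<close> and \<open>t4\<close> the two terms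
      with the bilinear part of \<open>B\<close>, \<open>A\<close> and \<open>C\<close> respectively
      are matched by cyclic invariance; \<open>par3\<close> reduces the signs.\<close>
    have t1: "ssgn p (BB (form_map B [?c]) ?a) = ssgn (p * q) (BB (form_map B [?a]) ?c)"
      unfolding BB_form_map[OF B(1)] append.simps swap[OF B(1,2) pc pa] ssgn_ssgn
    proof (rule ssgn_cong)
      assume "B [?a, ?c] \<noteq> 0"
      from par3[OF B(1,3) pa pc this] show "even (p + r * p - p * q)"
        by (simp add: even_add even_mult_iff) blast
    qed
    have t3: "BB (form_map A [?b]) ?c = - ssgn (p * q) (- ssgn q (BB (form_map A [?c]) ?b))"
      unfolding BB_form_map[OF A(1)] append.simps swap[OF A(1,2) pb pc] ssgn_minus minus_minus ssgn_ssgn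
    proof (rule ssgn_cong)
      assume "A [?c, ?b] \<noteq> 0"
      from par3[OF A(1,3) pc pb this] show "even (q * r - (p * q + q))"
        by (simp add: even_add even_mult_iff) blast
    qed
    have t4: "ssgn (p + q * r) (BB (form_map C [?b]) ?a) = ssgn (q + p * q + p * r) (BB (form_map C [?a]) ?b)"
      unfolding BB_form_map[OF C(1)] append.simps swap[OF C(1,2) pb pa] ssgn_ssgn
    proof (rule ssgn_cong)
      assume "C [?a, ?b] \<noteq> 0"
      from par3[OF C(1,3) pa pb this] show "even (p + q * r + q * p - (q + p * q + p * r))"
        by (simp add: even_add even_mult_iff) blast
    qed
    have d: "BB v (x - y) = BB v x - BB v y" for v x y
      using BB_add_right[of v "x - y" y] by simp
    show ?thesis
      unfolding Nil hbracket_Nil form_map_hbracket[OF A B] form_map_hbracket[OF B C] form_map_hbracket[OF A C] q0 d BB_diff_left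
        BB_ssgn_left BB_ssgn_right anti antib
      using t1 t3 t4 by (simp add: ssgn_diff ssgn_minus algebra_simps)
  qed
qed

subsection \<open>The associated Pinczon bracket\<close>

text \<open>The signs in the bracket depend only on the parity of the second form, which is split into its even
  and odd parts; \<open>hbracket d\<close> uses the signs for a second form of parity \<open>d\<close>.\<close>

definition form_bracket :: "('v list \<Rightarrow> 'k) \<Rightarrow> ('v list \<Rightarrow> 'k) \<Rightarrow> 'v list \<Rightarrow> 'k" where
  "form_bracket A B = (if A \<in> all_cyclic_forms \<and> B \<in> all_cyclic_forms
     then (\<lambda>xs. hbracket 0 A (par 0 B) xs + hbracket 1 A (par 1 B) xs) else (\<lambda>_. 0))"

lemma form_bracket_parity:
  assumes A: "A \<in> all_cyclic_forms" and B: "B \<in> all_cyclic_forms" "parity q B"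
  shows "form_bracket A B = hbracket q A B"
proof -
  have par: "par p B = (if even (p - q) then B else (\<lambda>_. 0))" for p
    using par_parity[OF B(2)] by auto
  have "hbracket p A (\<lambda>_. 0) = (\<lambda>_. 0)" for p by (rule ext, rule hbracket_zero_right) simp
  then show ?thesis
    using A B(1) hbracket_cong[of 0 q A B] hbracket_cong[of 1 q A B] by (auto simp: form_bracket_def par)
qed

lemma form_bracket_all: "A \<in> all_cyclic_forms \<Longrightarrow> B \<in> all_cyclic_forms \<Longrightarrow> form_bracket A B \<in> all_cyclic_forms"
  by (simp add: form_bracket_def all_cyclic_add hbracket_all par_all)

lemma form_bracket_linear_left:
  assumes "A \<in> all_cyclic_forms" "A' \<in> all_cyclic_forms" "B \<in> all_cyclic_forms"
  shows "form_bracket (\<lambda>xs. c * A xs + A' xs) B = (\<lambda>xs. c * form_bracket A B xs + form_bracket A' B xs)"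
  using assms all_cyclic_linear[OF assms(1,2), of c]
  by (simp add: form_bracket_def hbracket_linear_left all_cyclicD(1) distrib_left add.assoc add.left_commute)

lemma form_bracket_linear_right:
  assumes "A \<in> all_cyclic_forms" "A' \<in> all_cyclic_forms" "B \<in> all_cyclic_forms"
  shows "form_bracket B (\<lambda>xs. c * A xs + A' xs) = (\<lambda>xs. c * form_bracket B A xs + form_bracket B A' xs)"
  using assms all_cyclic_linear[OF assms(1,2), of c]
  by (simp add: form_bracket_def par_linear hbracket_linear_right all_cyclicD(1) mlin_par distrib_left add.assoc
      add.left_commute)

lemma form_bracket_add_right:
  assumes "A \<in> all_cyclic_forms" "A' \<in> all_cyclic_forms" "B \<in> all_cyclic_forms"
  shows "form_bracket B (\<lambda>xs. A xs + A' xs) = (\<lambda>xs. form_bracket B A xs + form_bracket B A' xs)"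
  using form_bracket_linear_right[OF assms, of 1] by simp

text \<open>No parity is prescribed for \<open>C\<close>, so the identity is taken for its even and
  its odd part and added up.\<close>

lemma form_bracket_Jacobi:
  assumes A: "A \<in> all_cyclic_forms" "parity p A" and B: "B \<in> all_cyclic_forms" "parity q B"
    and C: "C \<in> all_cyclic_forms"
  shows "form_bracket A (form_bracket B C) = (\<lambda>xs. form_bracket (form_bracket A B) C xs + ssgn (p * q) (form_bracket B (form_bracket A C) xs))"
proof -
  note A' = all_cyclicD(1,2)[OF A(1)] and B' = all_cyclicD(1,2)[OF B(1)]
  have parC: "par r C \<in> all_cyclic_forms" for r by (rule par_all[OF C])
  have Cr: "mlin (*) (par r C)" "rot (par r C) = par r C" "parity r (par r C)" for r
    using all_cyclicD(1,2)[OF parC] parity_par by auto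
  have exp: "form_bracket X (form_bracket Y C) xs =
      hbracket (q + 0) X (hbracket 0 Y (par 0 C)) xs + hbracket (q + 1) X (hbracket 1 Y (par 1 C)) xs"
    if X: "X \<in> all_cyclic_forms" and Y: "Y \<in> all_cyclic_forms" "parity q Y" for X Y q xs
  proof -
    have 1: "form_bracket X (hbracket r Y (par r C)) = hbracket (q + r) X (hbracket r Y (par r C))" for r
      by (rule form_bracket_parity[OF X hbracket_all[OF Y(1) parC] parity_hbracket[OF all_cyclicD(1)[OF Y(1)] Y(2) Cr(1,3)]])
    have "form_bracket X (form_bracket Y C) xs = form_bracket X (hbracket 0 Y (par 0 C)) xs + form_bracket X (hbracket 1 Y (par 1 C)) xs"
      using form_bracket_add_right[OF hbracket_all[OF Y(1) parC[of 0], of 0] hbracket_all[OF Y(1) parC[of 1], of 1] X] Y(1) C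
      by (simp add: form_bracket_def[of Y C])
    then show ?thesis by (simp add: 1)
  qed
  have AB: "form_bracket A B = hbracket q A B" by (rule form_bracket_parity[OF A(1) B])
  have "form_bracket (form_bracket A B) C xs = hbracket 0 (hbracket q A B) (par 0 C) xs + hbracket 1 (hbracket q A B) (par 1 C) xs" for xs
    using hbracket_all[OF A(1) B(1), of q] C by (simp add: AB form_bracket_def[of "hbracket q A B"])
  then show ?thesis
    using exp[OF A(1) B] exp[OF B(1) A] hbracket_Jacobi[OF A' A(2) B' B(2) Cr[of 0]]
      hbracket_Jacobi[OF A' A(2) B' B(2) Cr[of 1]]
    by (simp add: fun_eq_iff ssgn_add)
qed

lemma graded_lie_bracket_form_bracket: "graded_lie_bracket form_bracket"
  unfolding graded_lie_bracket_def
proof (intro conjI ballI allI impI)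
  fix A B assume A: "A \<in> all_cyclic_forms" and B: "B \<in> all_cyclic_forms"
  show "form_bracket A B \<in> all_cyclic_forms" by (rule form_bracket_all[OF A B])
  fix d e assume deg: "has_degree d A \<and> has_degree e B"
  note A' = all_cyclicD(1,2)[OF A] and B' = all_cyclicD(1,2)[OF B]
  have pA: "parity d A" and pB: "parity e B" using deg has_degree_parity A' B' by auto
  have AB: "form_bracket A B = hbracket e A B" "form_bracket B A = hbracket d B A" by (rule form_bracket_parity A B pA pB)+
  show "has_degree (d + e - 2) (form_bracket A B)"
    unfolding AB using deg by (intro has_degree_hbracket A' B') auto
  show "form_bracket A B = (\<lambda>xs. - ksgn ((d - 2) * (e - 2)) * form_bracket B A xs)"
  proof
    fix xs
    have "ssgn (d * e) (hbracket d B A xs) = ssgn ((d - 2) * (e - 2)) (hbracket d B A xs)"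
      by (rule ssgn_cong) (simp add: algebra_simps)
    then show "form_bracket A B xs = - ksgn ((d - 2) * (e - 2)) * form_bracket B A xs"
      unfolding AB hbracket_antisym[OF A' pA B' pB] by (simp add: ksgn_mult_left)
  qed
  fix C assume C: "C \<in> all_cyclic_forms"
  show "form_bracket A (form_bracket B C) = (\<lambda>xs. form_bracket (form_bracket A B) C xs + ksgn ((d - 2) * (e - 2)) * form_bracket B (form_bracket A C) xs)"
    unfolding form_bracket_Jacobi[OF A pA B pB C] ksgn_mult_left
    by (rule ext, rule arg_cong, rule ssgn_cong) (simp add: algebra_simps)
next
  fix A A' B c
  assume "A \<in> all_cyclic_forms" "A' \<in> all_cyclic_forms" "B \<in> all_cyclic_forms"
  then show "form_bracket (\<lambda>xs. c * A xs + A' xs) B = (\<lambda>xs. c * form_bracket A B xs + form_bracket A' B xs)"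
    "form_bracket B (\<lambda>xs. c * A xs + A' xs) = (\<lambda>xs. c * form_bracket B A xs + form_bracket B A' xs)"
    by (simp_all add: form_bracket_linear_left form_bracket_linear_right)
qed

end

section \<open>Tensor products of linear forms\<close>

context graded_vector_space
begin

lemma cyclic_forms_add:
  assumes "A \<in> cyclic_forms k" "B \<in> cyclic_forms k" shows "(\<lambda>xs. A xs + B xs) \<in> cyclic_forms k"
proof (rule cyclic_formsI)
  note A = cyclic_formsD[OF assms(1)] and B = cyclic_formsD[OF assms(2)]
  show "mlin (*) (\<lambda>xs. A xs + B xs)" by (rule mlin_plus[OF A(1) B(1)])
  show "rot (\<lambda>xs. A xs + B xs) = (\<lambda>xs. A xs + B xs)"
    using rot_linear[of 1 A B] A(2) B(2) by auto
  show "A xs + B xs = 0" if "length xs \<noteq> k" for xs using A(3)[OF that] B(3)[OF that] by simp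
qed

lemma mlin_contract: "mlin s A \<Longrightarrow> mlin s (contract x A)"
  unfolding contract_def by (rule mlin_Cons)

lemma tensor_list_degrees: "(\<Sum>(d', \<beta>')\<leftarrow>bs. d') = sum_list (map fst bs)"
  by (rule arg_cong[of _ _ sum_list], rule map_cong) auto

definition linear_forms :: "(int \<times> ('v list \<Rightarrow> 'k)) list \<Rightarrow> bool" where
  "linear_forms bs \<longleftrightarrow> (\<forall>(d, \<beta>)\<in>set bs. \<beta> \<in> cyclic_forms 1 \<and> has_degree d \<beta>)"

lemma mlin_tensor_list: "linear_forms bs \<Longrightarrow> mlin (*) (tensor_list bs)"
proof (induction bs)
  case Nil
  show ?case by (rule mlinI) (auto simp: vector_space_mult)
next
  case (Cons p bs)
  obtain d \<beta> where p: "p = (d, \<beta>)" by force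
  have "mlin (*) \<beta>" "linear_forms bs" using Cons.prems by (auto simp: linear_forms_def p cyclic_formsD(1))
  then show ?case using Cons.IH by (simp add: p tensor_eq mlin_tens)
qed

lemma tensor_list_Cons:
  assumes "linear_forms ((d, \<beta>) # bs)"
  shows "tensor_list ((d, \<beta>) # bs) (x # xs) = \<beta> [sg (sum_list (map fst bs)) x] * tensor_list bs xs"
    and "tensor_list ((d, \<beta>) # bs) [] = 0"
proof -
  let ?D = "sum_list (map fst bs)"
  have \<beta>: "\<beta> \<in> cyclic_forms 1" and bs: "linear_forms bs"
    using assms by (auto simp: linear_forms_def)
  have zero: "\<beta> u = 0" if "length u \<noteq> 1" for u by (rule cyclic_formsD(3)[OF \<beta> that])
  have eq: "tensor_list ((d, \<beta>) # bs) = tens ?D \<beta> (tensor_list bs)"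
    by (simp add: tensor_eq[OF cyclic_formsD(1)[OF \<beta>] mlin_tensor_list[OF bs]] tensor_list_degrees)
  show "tensor_list ((d, \<beta>) # bs) [] = 0" unfolding eq by (simp add: tens_def zero)
  have "tens ?D \<beta> (tensor_list bs) (x # xs) =
      sp (\<lambda>u w. \<beta> (sg ?D x # map (sg ?D) u) * tensor_list bs w) xs"
    by (simp add: tens_def zero)
  also have "\<dots> = \<beta> [sg ?D x] * tensor_list bs xs"
    by (subst sp_left_empty) (auto simp: zero)
  finally show "tensor_list ((d, \<beta>) # bs) (x # xs) = \<beta> [sg ?D x] * tensor_list bs xs"
    unfolding eq .
qed

lemma tensor_list_length:
  "linear_forms bs \<Longrightarrow> length xs \<noteq> length bs \<Longrightarrow> tensor_list bs xs = 0"
proof (induction bs arbitrary: xs)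
  case (Cons p bs)
  obtain d \<beta> where p: "p = (d, \<beta>)" by force
  have "linear_forms bs" using Cons.prems by (auto simp: linear_forms_def)
  then show ?case
    using Cons tensor_list_Cons[of d \<beta> bs] by (cases xs) (auto simp: p simp del: tensor_list.simps)
qed simp

lemma linear_form_sg:
  assumes "\<beta> \<in> cyclic_forms 1" "has_degree d \<beta>" shows "\<beta> [sg m x] = ssgn (m * d) (\<beta> [x])"
  using parity_sg[OF has_degree_parity[OF cyclic_formsD(1)[OF assms(1)] assms(2)], of m "[x]"] by simp

text \<open>The argument of the removed form carries the degrees of all later forms, and every
  earlier argument loses the degree of the removed form. Together the exponent is this degree times
  the sum of all others.\<close>

lemma tensor_list_remove:
  assumes "linear_forms bs" "j < length bs" "length v = j"
  shows "tensor_list bs (v @ a # w) =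
    ssgn (fst (bs ! j) * (sum_list (map fst bs) - fst (bs ! j)))
      (snd (bs ! j) [a] * tensor_list (take j bs @ drop (Suc j) bs) (v @ w))"
  using assms
proof (induction bs arbitrary: j v)
  case (Cons p bs)
  obtain d \<beta> where p: "p = (d, \<beta>)" by force
  have \<beta>: "\<beta> \<in> cyclic_forms 1" "has_degree d \<beta>" and bs: "linear_forms bs"
    using Cons.prems by (auto simp: linear_forms_def p)
  note rec = tensor_list_Cons(1)[OF Cons.prems(1)[unfolded p]]
  show ?case
  proof (cases v)
    case Nil
    then show ?thesis using Cons.prems(3)
      by (simp add: p rec linear_form_sg[OF \<beta>] del: tensor_list.simps)
        (simp add: ssgn_def mult.commute)
  next
    case (Cons x v')
    obtain j' where j: "j = Suc j'" "j' < length bs" "length v' = j'"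
      using Cons Cons.prems by auto
    let ?e = "fst (bs ! j')" and ?D = "sum_list (map fst bs)" and ?bs = "take j' bs @ drop (Suc j') bs"
    have D: "sum_list (map fst ?bs) = ?D - ?e"
    proof -
      have "?D = sum_list (map fst (take j' bs @ bs ! j' # drop (Suc j') bs))"
        using id_take_nth_drop[OF j(2)] by simp
      then show ?thesis by simp
    qed
    have bs': "linear_forms ((d, \<beta>) # ?bs)"
      using Cons.prems(1) by (auto simp: linear_forms_def p dest: in_set_takeD in_set_dropD)
    have "tensor_list (p # bs) (v @ a # w) = \<beta> [sg ?D x] * tensor_list bs (v' @ a # w)"
      by (simp add: p rec Cons del: tensor_list.simps)
    also have "\<dots> = ssgn (?D * d) (\<beta> [x]) *
        ssgn (?e * (?D - ?e)) (snd (bs ! j') [a] * tensor_list ?bs (v' @ w))"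
      by (simp add: linear_form_sg[OF \<beta>] Cons.IH[OF bs j(2,3)] del: tensor_list.simps)
    also have "\<dots> = ssgn (?D * d + ?e * (?D - ?e)) (snd (bs ! j') [a] * (\<beta> [x] * tensor_list ?bs (v' @ w)))"
      by (simp add: ssgn_mult_left[symmetric] ssgn_mult_right[symmetric] mult.left_commute add.commute)
    also have "\<dots> = ssgn (?e * (d + ?D - ?e)) (snd (bs ! j') [a] * tensor_list ((d, \<beta>) # ?bs) (v @ w))"
      by (simp add: Cons tensor_list_Cons(1)[OF bs'] D linear_form_sg[OF \<beta>]
          ssgn_mult_left[symmetric] ssgn_mult_right[symmetric] del: tensor_list.simps map_append)
         (rule ssgn_cong, simp add: algebra_simps)
    finally show ?thesis by (simp add: p j(1) del: tensor_list.simps)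
  qed
qed simp

text \<open>Where the product does not vanish, each form fixes the degree of its argument, so the
  last arguments have the parity of the last forms.\<close>

lemma tensor_list_ldeg:
  assumes "linear_forms bs" "set v \<subseteq> homog" "set w \<subseteq> homog" "length v \<le> length bs"
    "tensor_list bs (v @ w) \<noteq> 0"
  shows "even (sum_list (map fst (drop (length v) bs)) + ldeg w)"
  using assms
proof (induction bs arbitrary: v w)
  case Nil
  then show ?case by (cases w) auto
next
  case (Cons p bs)
  obtain d \<beta> where p: "p = (d, \<beta>)" by force
  have \<beta>: "\<beta> \<in> cyclic_forms 1" "has_degree d \<beta>" and bs: "linear_forms bs"
    using Cons.prems by (auto simp: linear_forms_def p)
  note rec = tensor_list_Cons[OF Cons.prems(1)[unfolded p]]
  show ?case
  proof (cases v)
    case (Cons x v')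
    then have "tensor_list bs (v' @ w) \<noteq> 0" using Cons.prems(5) by (auto simp: p rec simp del: tensor_list.simps)
    then show ?thesis using Cons.IH[OF bs, of v' w] Cons.prems Cons by simp
  next
    case Nil
    show ?thesis
    proof (cases w)
      case Nil
      then show ?thesis using Cons.prems(5) \<open>v = []\<close> by (simp add: p rec del: tensor_list.simps)
    next
      case w: (Cons x w')
      have "\<beta> [sg (sum_list (map fst bs)) x] \<noteq> 0" and t: "tensor_list bs w' \<noteq> 0"
        using Cons.prems(5) \<open>v = []\<close> by (auto simp: p w rec simp del: tensor_list.simps)
      then have "\<beta> [x] \<noteq> 0" by (simp add: linear_form_sg[OF \<beta>])
      then have "d + deg x = 0"
        using \<beta>(2)[unfolded has_degree_def, rule_format, of "[x]"] Cons.prems(3) w by simp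
      moreover have "even (sum_list (map fst bs) + ldeg w')"
        using Cons.IH[OF bs, of "[]" w'] t Cons.prems(3) w by simp
      ultimately show ?thesis by (simp add: Nil w p) presburger
    qed
  qed
qed

definition vec_form :: "('v \<Rightarrow> 'k) \<Rightarrow> 'v list \<Rightarrow> 'k" where
  "vec_form \<phi> xs = (if length xs = 1 then \<phi> (hd xs) else 0)"

lemma vec_form_simps [simp]: "vec_form \<phi> (x # y # zs) = 0"
  by (auto simp: vec_form_def)

lemma vec_form_cyclic:
  assumes "Vector_Spaces.linear scale (*) \<phi>" shows "vec_form \<phi> \<in> cyclic_forms 1"
proof (rule cyclic_formsI)
  have "vec_form \<phi> (us @ x # vs) = (if us = [] \<and> vs = [] then \<phi> x else 0)" for us x vs
    by (cases us; cases vs) (auto simp: vec_form_def)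
  then show "mlin (*) (vec_form \<phi>)"
    using assms by (intro mlinI) (auto simp: Vector_Spaces.linear_iff)
  have "\<phi> (pp 0 x) + \<phi> (pp 1 x) = \<phi> x" for x
  proof -
    have "pp 0 x + pp 1 x = (1/2) *s (x + x)"
      by (simp add: pp_def ssgn_def scale_right_distrib scale_right_diff_distrib)
    also have "\<dots> = x" using scale_left_distrib[of "1/2" "1/2" x] by (simp add: scale_right_distrib)
    finally show ?thesis using assms by (metis Vector_Spaces.linear_iff)
  qed
  then show "rot (vec_form \<phi>) = vec_form \<phi>"
  proof (intro ext)
    fix xs show "rot (vec_form \<phi>) xs = vec_form \<phi> xs"
      using \<open>\<And>x. \<phi> (pp 0 x) + \<phi> (pp 1 x) = \<phi> x\<close> by (cases xs) (auto simp: vec_form_def)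
  qed
qed (simp add: vec_form_def)

end

section \<open>Centre and derivation property of the bracket\<close>

context form_graded_vector_space
begin

lemma form_map_vec_form: "form_map (vec_form (BB a)) u = (if u = [] then a else 0)"
  by (cases u) (auto intro!: form_map_eqI cyclic_formsD(1)[OF vec_form_cyclic[OF linear_BB_right]] simp: vec_form_def)

lemma parity_vec_form: "ph m a \<Longrightarrow> parity m (vec_form (BB a))"
  by (auto simp: parity_def vec_form_def hd_map ph_def BB_ssgn_left simp flip: BB_sg)
     (metis BB_sg BB_ssgn_left One_nat_def hd_map length_0_conv zero_neq_one)

lemma linear_form_eq_vec_form: assumes "A \<in> cyclic_forms 1" shows "A = vec_form (BB (form_map A []))"
proof
  note A = cyclic_formsD[OF assms]
  fix xs show "A xs = vec_form (BB (form_map A [])) xs"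
    using A(3)[of xs] by (cases xs) (auto simp: vec_form_def BB_form_map[OF A(1)] length_Suc_conv)
qed

lemma vec_form_BB_linear: "vec_form (BB (c *s x + y)) = (\<lambda>xs. c * vec_form (BB x) xs + vec_form (BB y) xs)"
  by (auto simp: vec_form_def BB_add_left BB_scale_left)

lemma vec_form_BB_cyclic: "vec_form (BB a) \<in> cyclic_forms 1"
  by (rule vec_form_cyclic[OF linear_BB_right])

text \<open>The map of a constant is zero. Conversely, a central form is tested against the linear
  forms \<open>vec_form (BB v)\<close>: on at most one further argument the cyclization has a single
  summand, so the bracket is a value of \<open>A\<close> with \<open>v\<close> in the last slot and
  nothing can cancel. Here the bound on the arity enters.\<close>

lemma form_bracket_center:
  "{A. central form_bracket A \<and> (\<forall>xs. length xs > 2 \<longrightarrow> A xs = 0)} = cyclic_forms 0"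
proof (intro equalityI subsetI)
  fix A assume "A \<in> cyclic_forms 0"
  then have A: "A \<in> all_cyclic_forms" "\<And>xs. length xs \<noteq> 0 \<Longrightarrow> A xs = 0"
    by (auto simp: cyclic_forms_all cyclic_formsD(3))
  then have "form_map A xs = 0" for xs by (intro form_map_zero all_cyclicD) auto
  then have "hbracket d A B xs = 0" for d B xs by (intro hbracket_zero_left)
  then show "A \<in> {A. central form_bracket A \<and> (\<forall>xs. length xs > 2 \<longrightarrow> A xs = 0)}"
    using A(1) A(2)[of "_ # _"] by (auto simp: central_def form_bracket_def) (metis A(2) length_0_conv list.size(3) not_less_zero)
next
  fix A assume "A \<in> {A. central form_bracket A \<and> (\<forall>xs. length xs > 2 \<longrightarrow> A xs = 0)}"
  then have A: "A \<in> all_cyclic_forms" and c: "\<And>B. B \<in> all_cyclic_forms \<Longrightarrow> form_bracket A B = (\<lambda>_. 0)"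
    and long: "\<And>xs. length xs > 2 \<Longrightarrow> A xs = 0" by (auto simp: central_def)
  note A' = all_cyclicD(1,2)[OF A]
  have key: "A (map (sg (i - 1)) ys @ [v]) = 0" if v: "v \<in> G i" and ys: "length ys \<le> 1" for v i ys
  proof -
    let ?\<beta> = "vec_form (BB v)"
    have "form_bracket A ?\<beta> = hbracket (i - 1) A ?\<beta>"
      by (rule form_bracket_parity[OF A cyclic_forms_all[OF vec_form_BB_cyclic] parity_vec_form[OF G_ph[OF v]]])
    then have "hbracket (i - 1) A ?\<beta> ys = 0" using c[OF cyclic_forms_all[OF vec_form_BB_cyclic]] by metis
    moreover have "pairing (i - 1) A ?\<beta> ys = A (map (sg (i - 1)) ys @ [v])"
      unfolding pairing_def by (subst sp_right_empty) (auto simp: form_map_vec_form BB_form_map[OF A'(1)])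
    moreover have "max 1 (length ys) = 1" using ys by simp
    ultimately show ?thesis by (simp add: hbracket_def cyc_def)
  qed
  show "A \<in> cyclic_forms 0"
  proof (rule cyclic_formsI[OF A'])
    fix xs :: "'v list" assume xs: "length xs \<noteq> 0"
    show "A xs = 0"
    proof (rule mlin_eqI[OF A'(1), of "\<lambda>_. 0"])
      show "mlin (*) (\<lambda>_. 0)" by (rule mlin_zero_fun[OF vector_space_mult])
      fix zs assume zs: "length zs = length xs" "set zs \<subseteq> homog - {0}"
      show "A zs = 0"
      proof (cases "length zs > 2")
        case False
        obtain ys v where [simp]: "zs = ys @ [v]" using xs zs by (cases zs rule: rev_cases) auto
        obtain i where i: "v \<in> G i" using zs by (auto simp: homog_def)
        \<comment> \<open>Applying the same involution twice is the identity, which removes the sign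
          in \<open>key\<close>.\<close>
        have "A (map (sg (i - 1)) (map (sg (i - 1)) ys) @ [v]) = 0"
          by (rule key[OF i]) (use False in auto)
        moreover have "map (sg (i - 1)) (map (sg (i - 1)) ys) = ys"
          using map_sg_cong[of "i - 1 + (i - 1)" 0 ys] unfolding map_sg_map_sg map_sg_0 by simp
        ultimately show ?thesis by simp
      qed (simp add: long)
    qed
  qed
qed

lemma cyc_tensor_list:
  assumes "linear_forms bs"
  shows "cyc (tensor_list bs) \<in> cyclic_forms (length bs)"
  using assms mlin_tensor_list[OF assms] tensor_list_length[OF assms]
  by (intro cyclic_formsI mlin_cyc rot_cyc cyc_length_zero) auto

lemma parity_tensor_list:
  assumes "linear_forms bs" shows "parity (sum_list (map fst bs)) (tensor_list bs)"
  unfolding parity_def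
proof
  note m = mlin_tensor_list[OF assms]
  fix xs show "tensor_list bs (map (sg 1) xs) = ssgn (sum_list (map fst bs)) (tensor_list bs xs)"
  proof (rule mlin_eqI[OF mlin_map_sg[OF m] mlin_of_ssgn[OF m]])
    fix ys assume "set ys \<subseteq> homog - {0}"
    then have ys: "set ys \<subseteq> homog" by auto
    have "tensor_list bs (map (sg 1) ys) = ssgn (ldeg ys) (tensor_list bs ys)"
      using mlin_sg_list0[OF m ys, of 1] by simp
    also have "\<dots> = ssgn (sum_list (map fst bs)) (tensor_list bs ys)"
      by (rule ssgn_cong) (use tensor_list_ldeg[OF assms, of "[]" ys] ys in auto)
    finally show "tensor_list bs (map (sg 1) ys) = ssgn (sum_list (map fst bs)) (tensor_list bs ys)" .
  qed
qed

lemma parity_cyc: assumes "parity d F" shows "parity d (cyc F)"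
  unfolding parity_def
proof
  fix xs
  have "(rot ^^ j) F (map (sg 1) xs) = ssgn d ((rot ^^ j) F xs)" for j xs
  proof (induction j arbitrary: xs)
    case (Suc j)
    have "(rot ^^ Suc j) F (map (sg 1) xs) = rot (\<lambda>u. (rot ^^ j) F (map (sg 1) u)) xs"
      by (simp add: rot_map_sg)
    also have "\<dots> = ssgn d (rot ((rot ^^ j) F) xs)"
      unfolding Suc by (cases xs) (simp_all add: ssgn_add)
    finally show ?case by simp
  qed (use assms in \<open>simp add: parity_def\<close>)
  then show "cyc F (map (sg 1) xs) = ssgn d (cyc F xs)" by (simp add: cyc_def ssgn_sum)
qed

text \<open>Bracketing with the form of \<open>a\<close> puts \<open>a\<close> into the last slot of
  the cyclization. Each rotation feeds \<open>a\<close> to one form \<open>bs ! j\<close>; what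
  remains is a rotation of the product of the others, and rotations do not change the
  cyclization.\<close>

lemma hbracket_vec_form_tensor_list:
  assumes bs: "linear_forms bs" "bs \<noteq> []" and a: "a \<in> G i"
  shows "hbracket (sum_list (map fst bs)) (vec_form (BB a)) (cyc (tensor_list bs)) xs =
    (\<Sum>j<length bs. ssgn (fst (bs ! j) * sum_list (map fst (take j bs)))
       (hbracket (fst (bs ! j)) (vec_form (BB a)) (snd (bs ! j)) [] *
        cyc (tensor_list (take j bs @ drop (Suc j) bs)) xs))"
proof -
  let ?n = "length bs" and ?D = "sum_list (map fst bs)" and ?m = "i - 1"
  let ?O = "cyc (tensor_list bs)"
  define T where "T j = tensor_list (take j bs @ drop (Suc j) bs)" for j
  \<comment> \<open>The minus sign and \<open>?m\<close> come from exchanging the arguments of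
    \<open>BB\<close>; the other exponent moves the form \<open>bs ! j\<close> past its
    predecessors.\<close>
  define C where "C j = - ssgn (?m + fst (bs ! j) * sum_list (map fst (take j bs))) (snd (bs ! j) [a])" for j
  have ph: "ph ?m a" by (rule G_ph[OF a])
  note O = cyclic_formsD[OF cyc_tensor_list[OF bs(1)]]
  have \<beta>: "snd (bs ! j) \<in> cyclic_forms 1" "has_degree (fst (bs ! j)) (snd (bs ! j))" if "j < ?n" for j
    using bs(1) that nth_mem[OF that] by (auto simp: linear_forms_def case_prod_unfold)
  have lf: "linear_forms (take j bs @ drop (Suc j) bs)" for j
    using bs(1) by (auto simp: linear_forms_def dest: in_set_takeD in_set_dropD)
  have mT: "mlin (*) (T j)" for j unfolding T_def by (rule mlin_tensor_list[OF lf])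
  have T_len: "T j ys = 0" if "j < ?n" "length ys + 1 \<noteq> ?n" for j ys
    unfolding T_def by (rule tensor_list_length[OF lf]) (use that in auto)
  have BBa: "BB a v = - ssgn ?m (BB v a)" for v
    using BB_antisym_ph[OF ph, of v] by (simp add: ssgn_minus) (simp add: ssgn_def)
  have bracket: "hbracket (fst (bs ! j)) (vec_form (BB a)) (snd (bs ! j)) [] = - ssgn ?m (snd (bs ! j) [a])" if "j < ?n" for j
    by (simp add: hbracket_Nil form_map_vec_form BBa BB_form_map[OF cyclic_formsD(1)[OF \<beta>(1)[OF that]]])
  have pairing: "pairing ?D (vec_form (BB a)) ?O ys = (\<Sum>j<?n. C j * (rot ^^ (?n - Suc j)) (T j) ys)" for ys
  proof (rule mlin_eqI)
    show "mlin (*) (pairing ?D (vec_form (BB a)) ?O)"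
      by (rule mlin_pairing[OF cyclic_formsD(1)[OF vec_form_BB_cyclic] O(1)])
    show "mlin (*) (\<lambda>ys. \<Sum>j<?n. C j * (rot ^^ (?n - Suc j)) (T j) ys)"
      by (intro mlin_sum_fun vector_space_mult mlin_const_scale[where s = "(*)"] mlin_rot_pow mT)
    fix ys assume "set ys \<subseteq> homog - {0}"
    then have ys: "set ys \<subseteq> homog" by auto
    have "pairing ?D (vec_form (BB a)) ?O ys = BB a (form_map ?O ys)"
      unfolding pairing_def by (subst sp_left_empty) (auto simp: form_map_vec_form)
    then have P: "pairing ?D (vec_form (BB a)) ?O ys = - ssgn ?m (?O (ys @ [a]))"
      by (simp add: BBa BB_form_map[OF O(1)])
    show "pairing ?D (vec_form (BB a)) ?O ys = (\<Sum>j<?n. C j * (rot ^^ (?n - Suc j)) (T j) ys)"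
    proof (cases "length ys + 1 = ?n")
      case False
      have "(rot ^^ k) (T j) ys = 0" if "j < ?n" for j k
        using rot_pow_cong_length[of ys "T j" "\<lambda>_. 0" k] T_len[OF that] False
          rot_pow_scale[of k 0 "\<lambda>_. 0" ys] by simp
      then show ?thesis unfolding P using O(3)[of "ys @ [a]"] False by simp
    next
      case len: True
      show ?thesis
      \<comment> \<open>For \<open>a = 0\<close> the value of \<open>deg a\<close> is a default that
        need not be \<open>i - 1\<close>.\<close>
      proof (cases "a = 0")
        case True
        have "snd (bs ! j) [0] = 0" if "j < ?n" for j
          using mlin_zero[OF cyclic_formsD(1)[OF \<beta>(1)[OF that]], of "[]" "[]"] by simp
        then show ?thesis using True by (simp add: C_def pairing_def form_map_vec_form cong: sp_cong_all)
      next
        case a0: False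
        have m: "deg a = ?m" by (rule deg_eq[OF a a0])
        have "?O (ys @ [a]) = (\<Sum>k\<le>length ys. ssgn (ldeg (take k ys) * (ldeg (drop k ys) + deg a))
            (tensor_list bs (drop k ys @ a # take k ys)))"
          using cyc_snoc[OF mlin_tensor_list[OF bs(1)] ys G_homog[OF a]] by (simp add: sp_eq_sum)
        also have "\<dots> = (\<Sum>k<?n. ssgn (ldeg (take k ys) * (ldeg (drop k ys) + deg a))
            (tensor_list bs (drop k ys @ a # take k ys)))"
          by (rule sum.cong) (use len in auto)
        \<comment> \<open>Since \<open>ys\<close> has length \<open>?n - 1\<close>, this reindexing
          makes \<open>j\<close> the position of \<open>a\<close>, hence the index of the form that
          receives it.\<close>
        also have "\<dots> = (\<Sum>j<?n. ssgn (ldeg (take (?n - Suc j) ys) * (ldeg (drop (?n - Suc j) ys) + deg a))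
            (tensor_list bs (drop (?n - Suc j) ys @ a # take (?n - Suc j) ys)))"
          by (rule sum.nat_diff_reindex[symmetric])
        also have "- ssgn ?m \<dots> = (\<Sum>j<?n. C j * (rot ^^ (?n - Suc j)) (T j) ys)"
          unfolding ssgn_sum sum_negf[symmetric]
        proof (rule sum.cong[OF refl])
          fix j assume "j \<in> {..<?n}"
          then have j: "j < ?n" by simp
          let ?w = "take (?n - Suc j) ys" and ?v = "drop (?n - Suc j) ys" and ?e = "fst (bs ! j)"
          let ?t = "snd (bs ! j) [a] * T j (?v @ ?w)"
          have v: "length ?v = j" using len j by simp
          have hom: "set ?w \<subseteq> homog" "set ?v \<subseteq> homog"
            using ys by (auto dest: in_set_takeD in_set_dropD)
          have D: "?D = sum_list (map fst (take j bs)) + ?e + sum_list (map fst (drop (Suc j) bs))"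
            using arg_cong[OF id_take_nth_drop[OF j], of "\<lambda>l. sum_list (map fst l)"] by simp
          have "tensor_list bs (?v @ a # ?w) = ssgn (?e * (?D - ?e)) ?t"
            using tensor_list_remove[OF bs(1) j v] unfolding T_def .
          moreover have "C j * (rot ^^ (?n - Suc j)) (T j) ys =
              - ssgn (?m + ?e * sum_list (map fst (take j bs)) + ldeg ?w * ldeg ?v) ?t"
            unfolding C_def by (subst rot_pow_take[OF mT ys])
              (use len in \<open>auto simp: ssgn_mult_left[symmetric] ssgn_mult_right[symmetric] ssgn_minus algebra_simps\<close>)
          moreover have "ssgn (?m + (ldeg ?w * (ldeg ?v + deg a) + ?e * (?D - ?e))) ?t =
              ssgn (?m + ?e * sum_list (map fst (take j bs)) + ldeg ?w * ldeg ?v) ?t"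
          proof (rule ssgn_cong)
            assume nz: "?t \<noteq> 0"
            then have "snd (bs ! j) [a] \<noteq> 0" by auto
            then have 1: "?e + deg a = 0"
              using \<beta>(2)[OF j, unfolded has_degree_def, rule_format, of "[a]"] G_homog[OF a] by simp
            have "even (sum_list (map fst (drop j (take j bs @ drop (Suc j) bs))) + ldeg ?w)"
              using tensor_list_ldeg[OF lf hom(2,1), of j] nz v j by (simp add: T_def)
            then have 2: "even (sum_list (map fst (drop (Suc j) bs)) + ldeg ?w)"
              using j by simp
            have "even (ldeg ?w * deg a + ?e * sum_list (map fst (drop (Suc j) bs)))"
              using 1 2 by (simp add: even_add even_mult_iff) presburger
            then show "even (?m + (ldeg ?w * (ldeg ?v + deg a) + ?e * (?D - ?e)) -
              (?m + ?e * sum_list (map fst (take j bs)) + ldeg ?w * ldeg ?v))"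
              unfolding D by (simp add: algebra_simps)
          qed
          ultimately show "- ssgn ?m (ssgn (ldeg ?w * (ldeg ?v + deg a)) (tensor_list bs (?v @ a # ?w))) =
              C j * (rot ^^ (?n - Suc j)) (T j) ys"
            by simp
        qed
        finally show ?thesis unfolding P .
      qed
    qed
  qed
  have "hbracket ?D (vec_form (BB a)) ?O xs = (\<Sum>j<?n. C j * cyc ((rot ^^ (?n - Suc j)) (T j)) xs)"
  proof -
    have "pairing ?D (vec_form (BB a)) ?O = (\<lambda>ys. \<Sum>j<?n. C j * (rot ^^ (?n - Suc j)) (T j) ys)"
      using pairing by blast
    then show ?thesis by (simp only: hbracket_def cyc_sum cyc_scale)
  qed
  also have "\<dots> = (\<Sum>j<?n. ssgn (fst (bs ! j) * sum_list (map fst (take j bs)))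
       (hbracket (fst (bs ! j)) (vec_form (BB a)) (snd (bs ! j)) [] * cyc (T j) xs))"
    by (intro sum.cong refl)
       (simp add: bracket cyc_rot_pow[OF mT] C_def ssgn_mult_left ssgn_minus add.commute)
  finally show ?thesis unfolding T_def .
qed

text \<open>Every linear form is \<open>vec_form (BB a)\<close> for some \<open>a\<close>, and both
  sides are linear in \<open>a\<close>, so it suffices to treat homogeneous
  \<open>a\<close>.\<close>

lemma form_bracket_derivation:
  assumes \<alpha>: "\<alpha> \<in> cyclic_forms 1" and bs: "linear_forms bs" "bs \<noteq> []"
  shows "form_bracket \<alpha> (cyclization (tensor_list bs)) xs = (\<Sum>j<length bs.
    ksgn (fst (bs ! j) * (\<Sum>i<j. fst (bs ! i))) * form_bracket \<alpha> (snd (bs ! j)) [] *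
    cyclization (tensor_list (take j bs @ drop (Suc j) bs)) xs)"
proof -
  let ?n = "length bs"
  have lf: "linear_forms (take j bs @ drop (Suc j) bs)" for j
    using bs(1) by (auto simp: linear_forms_def dest: in_set_takeD in_set_dropD)
  have sums: "(\<Sum>i<j. fst (bs ! i)) = sum_list (map fst (take j bs))" if "j < ?n" for j
    using that by (simp add: sum_list_sum_nth atLeast0LessThan)
  have \<beta>: "snd (bs ! j) \<in> cyclic_forms 1" "has_degree (fst (bs ! j)) (snd (bs ! j))" if "j < ?n" for j
    using bs(1) that nth_mem[OF that] by (auto simp: linear_forms_def case_prod_unfold)
  note cycl = cyclization_eq[OF mlin_tensor_list[OF bs(1)]] cyclization_eq[OF mlin_tensor_list[OF lf]]
  let ?O = "cyc (tensor_list bs)"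
  have O: "?O \<in> all_cyclic_forms" by (rule cyclic_forms_all[OF cyc_tensor_list[OF bs(1)]])
  note vec = cyclic_forms_all[OF vec_form_BB_cyclic]
  have lin: "Vector_Spaces.linear scale (*) (\<lambda>a. form_bracket (vec_form (BB a)) B zs)" if "B \<in> all_cyclic_forms" for B zs
  proof -
    have *: "form_bracket (vec_form (BB (c *s x + y))) B zs = c * form_bracket (vec_form (BB x)) B zs + form_bracket (vec_form (BB y)) B zs" for c x y
      unfolding vec_form_BB_linear form_bracket_linear_left[OF vec vec that] ..
    have "form_bracket (vec_form (BB 0)) B zs = 0" using *[of "- 1" 0 0] by simp
    then show ?thesis
      using *[of 1] *[of _ _ 0] by (simp add: Vector_Spaces.linear_iff vector_space_axioms vector_space_mult)
  qed
  have "form_bracket (vec_form (BB a)) ?O xs = (\<Sum>j<?n. ksgn (fst (bs ! j) * (\<Sum>i<j. fst (bs ! i))) *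
    form_bracket (vec_form (BB a)) (snd (bs ! j)) [] * cyc (tensor_list (take j bs @ drop (Suc j) bs)) xs)" for a
  proof (rule linear_eqI[OF lin[OF O]])
    show "Vector_Spaces.linear (*s) (*) (\<lambda>a. \<Sum>j<?n. ksgn (fst (bs ! j) * (\<Sum>i<j. fst (bs ! i))) *
      form_bracket (vec_form (BB a)) (snd (bs ! j)) [] * cyc (tensor_list (take j bs @ drop (Suc j) bs)) xs)"
      using lin[OF cyclic_forms_all[OF \<beta>(1)]]
      by (simp add: Vector_Spaces.linear_iff vector_space_axioms vector_space_mult sum.distrib
          sum_distrib_left algebra_simps)
    fix a assume "a \<in> homog - {0}"
    then obtain i where a: "a \<in> G i" by (auto simp: homog_def)
    have 1: "form_bracket (vec_form (BB a)) ?O = hbracket (sum_list (map fst bs)) (vec_form (BB a)) ?O"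
      by (rule form_bracket_parity[OF vec O parity_cyc[OF parity_tensor_list[OF bs(1)]]])
    have 2: "form_bracket (vec_form (BB a)) (snd (bs ! j)) = hbracket (fst (bs ! j)) (vec_form (BB a)) (snd (bs ! j))"
      if "j < ?n" for j
      by (rule form_bracket_parity[OF vec cyclic_forms_all[OF \<beta>(1)[OF that]]
          has_degree_parity[OF cyclic_formsD(1)[OF \<beta>(1)[OF that]] \<beta>(2)[OF that]]])
    show "form_bracket (vec_form (BB a)) ?O xs = (\<Sum>j<?n. ksgn (fst (bs ! j) * (\<Sum>i<j. fst (bs ! i))) *
      form_bracket (vec_form (BB a)) (snd (bs ! j)) [] * cyc (tensor_list (take j bs @ drop (Suc j) bs)) xs)"
      unfolding 1 hbracket_vec_form_tensor_list[OF bs a]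
      by (intro sum.cong refl) (simp add: 2 sums ksgn_mult_left ssgn_mult_left)
  qed
  moreover obtain a where "\<alpha> = vec_form (BB a)" using linear_form_eq_vec_form[OF \<alpha>] by blast
  ultimately show ?thesis unfolding cycl by (simp only:)
qed

lemma pinczon_bracket_form_bracket: "pinczon_bracket form_bracket"
  unfolding pinczon_bracket_def
proof (intro conjI allI impI ballI)
  show "graded_lie_bracket form_bracket" by (rule graded_lie_bracket_form_bracket)
  show "{A. central form_bracket A \<and> (\<forall>xs. length xs > 2 \<longrightarrow> A xs = 0)} = cyclic_forms 0" by (rule form_bracket_center)
  show "form_bracket A B = (\<lambda>_. 0)" if "A \<notin> all_cyclic_forms \<or> B \<notin> all_cyclic_forms" for A B
    using that by (auto simp: form_bracket_def)
  show "form_bracket A B \<in> cyclic_forms (k + k')" if A: "A \<in> cyclic_forms (k + 1)" and B: "B \<in> cyclic_forms (k' + 1)" for A B k k'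
  proof -
    have p: "par p B \<in> cyclic_forms (k' + 1)" for p
      using cyclic_formsD[OF B] by (intro cyclic_formsI mlin_par rot_par) (auto simp: par_def)
    show ?thesis
      using cyclic_forms_add[OF hbracket_arity[OF A p[of 0], of 0] hbracket_arity[OF A p[of 1], of 1]]
        cyclic_forms_all[OF A] cyclic_forms_all[OF B] by (simp add: form_bracket_def)
  qed
  fix \<alpha> bs
  assume "\<alpha> \<in> cyclic_forms 1" "bs \<noteq> [] \<and> (\<forall>(d, \<beta>)\<in>set bs. \<beta> \<in> cyclic_forms 1 \<and> has_degree d \<beta>)"
  then show "form_bracket \<alpha> (cyclization (tensor_list bs)) = (\<lambda>xs. \<Sum>j<length bs.
    ksgn (fst (bs ! j) * (\<Sum>i<j. fst (bs ! i))) * form_bracket \<alpha> (snd (bs ! j)) [] *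
    cyclization (tensor_list (take j bs @ drop (Suc j) bs)) xs)"
    by (intro ext form_bracket_derivation) (auto simp: linear_forms_def)
qed

end

context graded_vector_space
begin

subsection \<open>Decomposition into homogeneous forms\<close>

lemma finite_degrees: "\<exists>I. finite I \<and> (\<forall>x i. i \<notin> I \<longrightarrow> component x i = 0)"
proof -
  obtain B where B: "finite B" "span B = UNIV" using finite_dimensional by blast
  let ?I = "\<Union>x\<in>B. {i. component x i \<noteq> 0}"
  have "component x i = 0" if "i \<notin> ?I" for x i
  proof -
    have "subspace {x. component x i = 0}"
      by (auto simp: subspace_def component_add component_scale)
    moreover have "x \<in> span B" using B by simp
    ultimately show ?thesis using span_induct[of x B "\<lambda>x. component x i = 0"] that by blast
  qed
  moreover have "finite ?I" using B finite_component by blast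
  ultimately show ?thesis by blast
qed

definition degrees :: "int set" where
  "degrees = (SOME I. finite I \<and> (\<forall>x i. i \<notin> I \<longrightarrow> component x i = 0))"

lemma finite_degrees': "finite degrees"
  and component_degrees: "i \<notin> degrees \<Longrightarrow> component x i = 0"
  using someI_ex[OF finite_degrees] unfolding degrees_def by blast+

text \<open>The part of degree \<open>d\<close>, obtained by expanding the arguments over the
  finitely many degrees of the space. A component of degree \<open>i\<close> adds its shifted degree
  \<open>i - 1\<close> to \<open>d\<close>, and the total has to end at \<open>0\<close>.\<close>

fun dpart :: "int \<Rightarrow> ('v list \<Rightarrow> 'k) \<Rightarrow> 'v list \<Rightarrow> 'k" where
  "dpart d F [] = (if d = 0 then F [] else 0)"
| "dpart d F (x # xs) = (\<Sum>i\<in>degrees. dpart (d + i - 1) (\<lambda>u. F (component x i # u)) xs)"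

lemma dpart_add: "dpart d (\<lambda>u. F u + H u) xs = dpart d F xs + dpart d H xs"
  by (induction xs arbitrary: d F H) (auto simp: sum.distrib)

lemma dpart_scale: "dpart d (\<lambda>u. c * F u) xs = c * dpart d F xs"
  by (induction xs arbitrary: d F) (auto simp: sum_distrib_left)

lemma mlin_dpart: "mlin (*) F \<Longrightarrow> mlin (*) (dpart d F)"
proof -
  have "dpart d F (us @ (x + y) # vs) = dpart d F (us @ x # vs) + dpart d F (us @ y # vs) \<and>
    dpart d F (us @ (c *s x) # vs) = c * dpart d F (us @ x # vs)" if "mlin (*) F" for us vs x y c d F
    using that
  proof (induction us arbitrary: d F)
    case Nil
    have "F ((a + a') # u) = F (a # u) + F (a' # u)" "F ((c *s a) # u) = c * F (a # u)" for a a' u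
      using mlin_add[OF Nil, of "[]"] mlin_scale[OF Nil, of "[]"] by auto
    then show ?case
      by (simp add: component_add component_scale dpart_add dpart_scale sum.distrib sum_distrib_left)
  next
    case (Cons a us)
    show ?case
      using Cons.IH[OF mlin_Cons[OF Cons.prems]] by (simp add: sum.distrib sum_distrib_left)
  qed
  then show "mlin (*) F \<Longrightarrow> mlin (*) (dpart d F)" by (intro mlinI vector_space_mult) auto
qed

lemma dpart_homog:
  "mlin (*) F \<Longrightarrow> set xs \<subseteq> homog - {0} \<Longrightarrow> dpart d F xs = (if d + ldeg xs = 0 then F xs else 0)"
proof (induction xs arbitrary: d F)
  case (Cons x xs)
  obtain j where j: "x \<in> G j" "x \<noteq> 0" using Cons.prems(2) by (auto simp: homog_def)
  have dx: "deg x = j - 1" by (rule deg_eq[OF j])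
  have "j \<in> degrees" using component_degrees[of j x] j by (auto simp: component_homog[OF j(1)])
  have "dpart (d + i - 1) (\<lambda>u. F (component x i # u)) xs =
      (if i = j then dpart (d + deg x) (\<lambda>u. F (x # u)) xs else 0)" for i
  proof (cases "i = j")
    case False
    have "(\<lambda>u. F (component x i # u)) = (\<lambda>u. 0 * F u)"
      using mlin_zero[OF Cons.prems(1), of "[]"] False by (simp add: component_homog[OF j(1)])
    then show ?thesis using False by (simp only: dpart_scale) simp
  qed (simp add: component_homog[OF j(1)] dx algebra_simps)
  then have "dpart d F (x # xs) = dpart (d + deg x) (\<lambda>u. F (x # u)) xs"
    using \<open>j \<in> degrees\<close> finite_degrees' by simp
  also have "\<dots> = (if d + ldeg (x # xs) = 0 then F (x # xs) else 0)"
    using Cons.IH[OF mlin_Cons[OF Cons.prems(1)]] Cons.prems(2) by (simp add: add.assoc)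
  finally show ?case .
qed simp

lemma has_degree_dpart: assumes "mlin (*) F" shows "has_degree d (dpart d F)"
  unfolding has_degree_def
proof (intro allI impI)
  fix xs assume xs: "set xs \<subseteq> homog \<and> dpart d F xs \<noteq> 0"
  then have "0 \<notin> set xs" using mlin_zero_set[OF mlin_dpart[OF assms]] by blast
  then have "set xs \<subseteq> homog - {0}" using xs by blast
  from dpart_homog[OF assms this, of d] show "d + ldeg xs = 0" using xs by (simp split: if_splits)
qed

lemma dpart_cyclic: assumes "F \<in> cyclic_forms k" shows "dpart d F \<in> cyclic_forms k"
proof (rule cyclic_formsI)
  note F = cyclic_formsD[OF assms]
  show m: "mlin (*) (dpart d F)" by (rule mlin_dpart[OF F(1)])
  show "rot (dpart d F) = dpart d F"
  proof
    fix xs show "rot (dpart d F) xs = dpart d F xs"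
    proof (rule mlin_eqI[OF mlin_rot[OF m] m])
      fix ys assume ys: "set ys \<subseteq> homog - {0}"
      show "rot (dpart d F) ys = dpart d F ys"
      proof (cases ys)
        case (Cons a as)
        have h: "a \<in> homog" "set as \<subseteq> homog" using ys Cons by auto
        have "rot F (a # as) = ssgn (deg a * ldeg as) (F (as @ [a]))" by (rule rot_homog[OF F(1) h])
        then show ?thesis
          unfolding Cons rot_homog[OF m h] F(2) using ys Cons
          by (subst (1 2) dpart_homog[OF F(1)]) (auto simp: add.commute)
      qed simp
    qed
  qed
  show "dpart d F xs = 0" if "length xs \<noteq> k" for xs
    by (rule mlin_eqI[OF m mlin_zero_fun[OF vector_space_mult]])
       (use that in \<open>simp add: dpart_homog[OF F(1)] F(3)\<close>)
qed

lemma sum_dpart: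
  assumes "F \<in> cyclic_forms k"
  obtains S where "finite S" "F = (\<lambda>xs. \<Sum>d\<in>S. dpart d F xs)"
proof -
  note F = cyclic_formsD[OF assms]
  \<comment> \<open>\<open>M\<close> bounds the absolute value of all shifted degrees, so a form of
    arity \<open>k\<close> has only components of degree at most \<open>k * M\<close> in absolute
    value.\<close>
  define M where "M = (\<Sum>i\<in>degrees. \<bar>i - 1\<bar>)"
  have M: "\<bar>deg x\<bar> \<le> M" if "x \<in> homog - {0}" for x
  proof -
    obtain j where j: "x \<in> G j" "x \<noteq> 0" using \<open>x \<in> homog - {0}\<close> by (auto simp: homog_def)
    have "j \<in> degrees" using component_degrees[of j x] j by (auto simp: component_homog[OF j(1)])
    then show ?thesis
      unfolding M_def deg_eq[OF j] using finite_degrees' by (intro member_le_sum) auto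
  qed
  have ld: "\<bar>ldeg xs\<bar> \<le> int (length xs) * M" if "set xs \<subseteq> homog - {0}" for xs
    using that
  proof (induction xs)
    case (Cons x xs)
    then show ?case using M[of x] by (simp add: algebra_simps)
  qed simp
  let ?S = "{- (int k * M) .. int k * M}"
  have "F xs = (\<Sum>d\<in>?S. dpart d F xs)" for xs
  proof (rule mlin_eqI[OF F(1)])
    show "mlin (*) (\<lambda>xs. \<Sum>d\<in>?S. dpart d F xs)"
      by (intro mlin_sum_fun vector_space_mult mlin_dpart F)
    fix ys assume ys: "set ys \<subseteq> homog - {0}"
    show "F ys = (\<Sum>d\<in>?S. dpart d F ys)"
    proof (cases "length ys = k")
      case True
      then have "- ldeg ys \<in> ?S" using ld[OF ys] by auto
      moreover have "dpart d F ys = (if d = - ldeg ys then F ys else 0)" for d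
        by (simp add: dpart_homog[OF F(1) ys] eq_neg_iff_add_eq_0)
      ultimately show ?thesis by simp
    next
      case False
      then have "F ys = 0" by (rule F(3))
      then have "dpart d F ys = 0" for d by (simp only: dpart_homog[OF F(1) ys] if_cancel)
      then show ?thesis using \<open>F ys = 0\<close> by simp
    qed
  qed
  then show ?thesis by (intro that[of ?S] ext finite_atLeastAtMost_int)
qed

text \<open>This reduces additive statements to forms of one arity and one degree, the only ones on
  which a bracket is prescribed by formulas.\<close>

lemma all_cyclic_induct [consumes 1, case_names hom add]:
  assumes A: "A \<in> all_cyclic_forms"
    and hom: "\<And>k d F. F \<in> cyclic_forms k \<Longrightarrow> has_degree d F \<Longrightarrow> P F"
    and add: "\<And>F H. F \<in> all_cyclic_forms \<Longrightarrow> H \<in> all_cyclic_forms \<Longrightarrow> P F \<Longrightarrow> P H \<Longrightarrow> P (\<lambda>xs. F xs + H xs)"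
  shows "P A"
proof -
  have zero: "(\<lambda>_. 0) \<in> cyclic_forms k" for k
  proof (intro cyclic_formsI mlin_zero_fun vector_space_mult ext)
    show "rot (\<lambda>_. 0) xs = (0 :: 'k)" for xs by (cases xs) auto
  qed simp
  have P0: "P (\<lambda>_. 0)" by (rule hom[OF zero, of 0]) (simp add: has_degree_def)
  have sums: "P (\<lambda>xs. \<Sum>i\<in>I. f i xs) \<and> (\<lambda>xs. \<Sum>i\<in>I. f i xs) \<in> all_cyclic_forms"
    if "finite I" "\<And>i. i \<in> I \<Longrightarrow> P (f i) \<and> f i \<in> all_cyclic_forms" for I :: "'x set" and f
    using that
  proof (induction I)
    case empty
    then show ?case using P0 cyclic_forms_all[OF zero] by simp
  next
    case (insert i I)
    then show ?case by (simp add: add all_cyclic_add)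
  qed
  have arity: "P F" if F: "F \<in> cyclic_forms k" for F k
  proof -
    obtain S where S: "finite S" "F = (\<lambda>xs. \<Sum>d\<in>S. dpart d F xs)" by (rule sum_dpart[OF F])
    have "P (dpart d F) \<and> dpart d F \<in> all_cyclic_forms" for d
      using hom[OF dpart_cyclic[OF F] has_degree_dpart[OF cyclic_formsD(1)[OF F]]]
        cyclic_forms_all[OF dpart_cyclic[OF F]] by blast
    then have "P (\<lambda>xs. \<Sum>d\<in>S. dpart d F xs)"
      using sums[OF S(1), of "\<lambda>d. dpart d F"] by blast
    then show ?thesis by (subst S(2))
  qed
  obtain N where N: "\<And>xs. length xs > N \<Longrightarrow> A xs = 0" using all_cyclicD(3)[OF A] by blast
  have "A = (\<lambda>xs. \<Sum>k\<le>N. arity_part k A xs)"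
  proof
    fix xs show "A xs = (\<Sum>k\<le>N. arity_part k A xs)"
      using N[of xs] by (cases "length xs \<le> N") (auto simp: arity_part_def)
  qed
  moreover have "P (\<lambda>xs. \<Sum>k\<le>N. arity_part k A xs)"
  proof -
    have "arity_part k A \<in> cyclic_forms k" for k using A by (simp add: all_cyclic_forms_def)
    then have "P (arity_part k A) \<and> arity_part k A \<in> all_cyclic_forms" for k
      using arity cyclic_forms_all by blast
    then show ?thesis using sums[of "{..N}" "\<lambda>k. arity_part k A"] by blast
  qed
  ultimately show "P A" by (simp only:)
qed

lemma graded_lie_bracketD:
  assumes "graded_lie_bracket br" "A \<in> all_cyclic_forms" "B \<in> all_cyclic_forms"
  shows "A' \<in> all_cyclic_forms \<Longrightarrow> br (\<lambda>xs. A xs + A' xs) B = (\<lambda>xs. br A B xs + br A' B xs)"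
    "B' \<in> all_cyclic_forms \<Longrightarrow> br A (\<lambda>xs. B xs + B' xs) = (\<lambda>xs. br A B xs + br A B' xs)"
    "has_degree d A \<Longrightarrow> has_degree e B \<Longrightarrow> br A B = (\<lambda>xs. - ksgn ((d - 2) * (e - 2)) * br B A xs)"
proof -
  note br = assms(1)[unfolded graded_lie_bracket_def]
  show "br (\<lambda>xs. A xs + A' xs) B = (\<lambda>xs. br A B xs + br A' B xs)" if "A' \<in> all_cyclic_forms"
    using br[THEN conjunct2, THEN conjunct1, rule_format, OF assms(2) that assms(3), of 1] by simp
  show "br A (\<lambda>xs. B xs + B' xs) = (\<lambda>xs. br A B xs + br A B' xs)" if "B' \<in> all_cyclic_forms"
    using br[THEN conjunct2, THEN conjunct1, rule_format, OF assms(3) that assms(2), of 1] by simp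
  show "br A B = (\<lambda>xs. - ksgn ((d - 2) * (e - 2)) * br B A xs)" if "has_degree d A" "has_degree e B"
    using br assms(2,3) that by blast
qed

text \<open>The formula relating a bracket to \<open>b\<close> says nothing about constants. Their
  brackets vanish because constants are central, on the other side by antisymmetry.\<close>

lemma pinczon_constant:
  assumes br: "pinczon_bracket br" and A: "A \<in> cyclic_forms 0" "has_degree d A"
    and B: "B \<in> cyclic_forms k" "has_degree e B"
  shows "br A B = (\<lambda>_. 0)" "br B A = (\<lambda>_. 0)"
proof -
  have L: "graded_lie_bracket br" and "A \<in> {A. central br A \<and> (\<forall>xs. length xs > 2 \<longrightarrow> A xs = 0)}"
    using br A(1) unfolding pinczon_bracket_def by blast+
  then show 0: "br A B = (\<lambda>_. 0)" using cyclic_forms_all[OF B(1)] unfolding central_def by blast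
  show "br B A = (\<lambda>_. 0)"
    using graded_lie_bracketD(3)[OF L cyclic_forms_all[OF B(1)] cyclic_forms_all[OF A(1)] B(2) A(2)] 0 by simp
qed

end

section \<open>Dual bases, and uniqueness of the bracket of a form\<close>

context form_graded_vector_space
begin

lemma dual_bases_exist: "\<exists>es es'. dual_bases b es es'"
proof -
  obtain E where E: "finite E" "E \<subseteq> homog" "independent E" "span E = UNIV" by (rule homog_basis)
  obtain es where es: "set es = E" "distinct es" using finite_distinct_list[OF E(1)] by blast
  interpret vp: vector_space_pair scale "(*) :: 'k \<Rightarrow> 'k \<Rightarrow> 'k"
    by (simp add: vector_space_pair_def vector_space_axioms vector_space_mult)
  have "\<exists>w\<in>homog. \<forall>x\<in>E. b x w = (if x = e then 1 else 0)" if e: "e \<in> E" for e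
  proof -
    \<comment> \<open>The value \<open>- 1\<close> compensates the sign in \<open>bv\<close>, where
      the arguments of the form are exchanged.\<close>
    obtain g where g: "Vector_Spaces.linear scale (*) g" "\<And>x. x \<in> E \<Longrightarrow> g x = (if x = e then - 1 else 0)"
      using vp.linear_independent_extend[OF E(3), of "\<lambda>x. if x = e then - 1 else 0"] by blast
    obtain v where v: "\<And>y. BB v y = g y" using Riesz[OF g(1)] by blast
    have bv: "b y v = - g y" for y
      using BB_antisym[of v y] sg_cong[of 2 0 y] by (simp add: v[symmetric] BB_eq)
    obtain l where l: "e \<in> G l" using E(2) e by (auto simp: homog_def)
    have "e \<noteq> 0" using E(3) e dependent_zero by blast
    \<comment> \<open>The representing vector \<open>v\<close> need not be homogeneous. Only its
      component of degree \<open>- l\<close> pairs with vectors of degree \<open>l\<close>, and that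
      component pairs to \<open>0\<close> with all other degrees.\<close>
    have "b x (component v (- l)) = (if x = e then 1 else 0)" if x: "x \<in> E" for x
    proof -
      obtain m where m: "x \<in> G m" using E(2) x by (auto simp: homog_def)
      have x0: "x \<noteq> 0" using E(3) x dependent_zero by blast
      show ?thesis
      proof (cases "m = l")
        case True
        have "b x y = b x (component y (- l))" for y
        proof (rule linear_eqI[OF linear_b_right])
          show "Vector_Spaces.linear (*s) (*) (\<lambda>y. b x (component y (- l)))"
            by (simp add: Vector_Spaces.linear_iff vector_space_axioms vector_space_mult component_add
                component_scale b_add_right b_scale_right)
          fix y assume "y \<in> homog - {0}"
          then obtain n where n: "y \<in> G n" by (auto simp: homog_def)
          show "b x y = b x (component y (- l))"
            using b_degree[OF m n] True by (cases "n = - l") (auto simp: component_homog[OF n] b_zero_right)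
        qed
        then show ?thesis using bv[of x] g(2)[OF x] by (auto split: if_splits)
      next
        case False
        then have "b x (component v (- l)) = 0" using b_degree[OF m component_in, of v "- l"] by auto
        moreover have "x \<noteq> e" using False vdeg_eq[OF m x0] vdeg_eq[OF l \<open>e \<noteq> 0\<close>] by auto
        ultimately show ?thesis by simp
      qed
    qed
    then show ?thesis using component_in_homog by blast
  qed
  then obtain f where f: "\<And>e. e \<in> E \<Longrightarrow> f e \<in> homog" "\<And>e x. e \<in> E \<Longrightarrow> x \<in> E \<Longrightarrow> b x (f e) = (if x = e then 1 else 0)"
    by metis
  have "dual_bases b es (map f es)"
    unfolding dual_bases_def
    using es E f nth_eq_iff_index_eq[OF es(2)] by (auto simp: nth_mem)
  then show ?thesis by blast
qed

lemma dual_bases_expand: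
  assumes "dual_bases b es es'" shows "v = (\<Sum>i<length es. b v (es' ! i) *s es ! i)"
proof -
  note d = assms[unfolded dual_bases_def]
  define L where "L v = (\<Sum>i<length es. b v (es' ! i) *s es ! i)" for v
  have "L (x + y) = L x + L y" "L (c *s x) = c *s L x" "L 0 = 0" for x y c
    by (simp_all add: L_def b_add_left b_scale_left b_zero_left scale_left_distrib sum.distrib scale_sum_right)
  then have "subspace {v. v = L v}"
    by (simp add: subspace_def)
  moreover have "x = L x" if x: "x \<in> set es" for x
  proof -
    obtain j where j: "j < length es" "x = es ! j" using x by (auto simp: in_set_conv_nth)
    have "b x (es' ! i) *s es ! i = (if i = j then x else 0)" if "i < length es" for i
      using d j that by auto
    then have "(\<Sum>i<length es. b x (es' ! i) *s es ! i) = (\<Sum>i<length es. if i = j then x else 0)"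
      by (intro sum.cong) auto
    then show ?thesis using j(1) by (simp add: L_def)
  qed
  moreover have "v \<in> span (set es)" using d by simp
  ultimately have "v = L v" using span_induct[of v "set es" "\<lambda>v. v = L v"] by blast
  then show ?thesis unfolding L_def .
qed

text \<open>By cyclic invariance, contraction with \<open>es' ! i\<close> gives the coordinates of
  the value of the second map, and contraction with \<open>es ! i\<close> pairs the value of the
  first map with the basis vectors; summing over \<open>i\<close> pairs the two values. The signs
  cancel because dual vectors have equal parity.\<close>

lemma dual_bases_bracket:
  assumes es: "dual_bases b es es'"
    and A: "A \<in> cyclic_forms (k + 1)" and B: "B \<in> cyclic_forms (k' + 1)" "has_degree d' B"
  shows "(\<Sum>i<length es. ksgn (d' * deg (es ! i)) *
     odot (d' + deg (es' ! i)) (contract (es ! i) A) (contract (es' ! i) B) xs) = hbracket d' A B xs"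
proof -
  note A' = cyclic_formsD[OF A] and B' = cyclic_formsD[OF B(1)]
  note pB = has_degree_parity[OF B'(1) B(2)]
  note d = es[unfolded dual_bases_def]
  let ?t = "\<lambda>i. tens (d' + deg (es' ! i)) (contract (es ! i) A) (contract (es' ! i) B)"
  have odot: "odot (d' + deg (es' ! i)) (contract (es ! i) A) (contract (es' ! i) B) = cyc (?t i)" for i
    unfolding odot_def
    by (simp add: tensor_eq cyclization_eq mlin_tens mlin_contract A'(1) B'(1))
  have "(\<Sum>i<length es. ksgn (d' * deg (es ! i)) * ?t i ys) = pairing d' A B ys" for ys
  proof -
    have "(\<Sum>i<length es. ksgn (d' * deg (es ! i)) *
        (contract (es ! i) A (map (sg (d' + deg (es' ! i))) u) * contract (es' ! i) B w)) =
      BB (form_map A (map (sg d') u)) (form_map B w)" (is "?L = BB ?q ?q'") for u w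
    proof -
      have "ksgn (d' * deg (es ! i)) *
        (contract (es ! i) A (map (sg (d' + deg (es' ! i))) u) * contract (es' ! i) B w) =
        b ?q' (es' ! i) * BB ?q (es ! i)" if i: "i < length es" for i
      proof -
        let ?e = "es ! i" and ?e' = "es' ! i"
        have h: "?e \<in> homog" "?e' \<in> homog" using d i by (auto simp: nth_mem)
        have "b ?e ?e' = 1" using d i by simp
        then have "deg ?e + 1 + (deg ?e' + 1) = 0"
          by (intro b_degree[OF homog_deg[OF h(1)] homog_deg[OF h(2)]]) simp
        \<comment> \<open>The \<open>vdeg\<close> of dual vectors add up to 0, and each of the two
          degrees is shifted by one.\<close>
        then have ev: "deg ?e = - deg ?e' - 2" by simp
        have "contract ?e A (map (sg (d' + deg ?e')) u) = A (map (sg (deg ?e)) (map (sg (d' + deg ?e')) u) @ [?e])"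
          unfolding contract_def by (rule cyclic_move[OF A'(1,2) homog_ph[OF h(1)]])
        also have "\<dots> = BB ?q ?e"
        proof -
          have "map (sg (deg ?e + (d' + deg ?e'))) u = map (sg d') u"
            by (rule map_sg_cong) (simp add: ev)
          then show ?thesis unfolding map_sg_map_sg BB_form_map[OF A'(1)] by (rule arg_cong)
        qed
        finally have 1: "contract ?e A (map (sg (d' + deg ?e')) u) = BB ?q ?e" .
        have "contract ?e' B w = B (map (sg (deg ?e')) w @ [?e'])"
          unfolding contract_def by (rule cyclic_move[OF B'(1,2) homog_ph[OF h(2)]])
        also have "\<dots> = BB (ssgn (deg ?e' * d') (sg (deg ?e') ?q')) ?e'"
          using qparityD[OF qparity_form_map[OF B'(1) pB], of "deg ?e'" w] by (simp add: BB_form_map[OF B'(1), symmetric])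
        also have "\<dots> = ssgn (deg ?e' * d' + deg ?e' * deg ?e') (BB ?q' ?e')"
          by (simp add: BB_ssgn_left BB_sg ph_sg[OF homog_ph[OF h(2)]] BB_ssgn_right)
        also have "BB ?q' ?e' = ssgn (deg ?e') (b ?q' ?e')"
          by (simp add: BB_eq b_sg ph_sg[OF homog_ph[OF h(2)]] b_scale_right ksgn_mult_left flip: ksgn_scale)
        finally have 2: "contract ?e' B w = ssgn (deg ?e' * d' + deg ?e' * deg ?e' + deg ?e') (b ?q' ?e')"
          by simp
        have "ksgn (d' * deg ?e) * (BB ?q ?e * ssgn (deg ?e' * d' + deg ?e' * deg ?e' + deg ?e') (b ?q' ?e'))
          = ssgn (d' * deg ?e + (deg ?e' * d' + deg ?e' * deg ?e' + deg ?e')) (b ?q' ?e' * BB ?q ?e)"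
          by (simp add: ksgn_mult_left ssgn_mult_right[symmetric] mult.commute add.commute)
        also have "\<dots> = ssgn 0 (b ?q' ?e' * BB ?q ?e)"
          by (rule ssgn_cong) (simp add: ev algebra_simps)
        finally show ?thesis unfolding 1 2 by simp
      qed
      then have "?L = (\<Sum>i<length es. b ?q' (es' ! i) * BB ?q (es ! i))" by (intro sum.cong) auto
      also have "\<dots> = BB ?q (\<Sum>i<length es. b ?q' (es' ! i) *s es ! i)"
      proof -
        have "BB ?q (sum f I) = (\<Sum>i\<in>I. BB ?q (f i))" for f and I :: "nat set"
          by (induction I rule: infinite_finite_induct) (auto simp: BB_add_right)
        then show ?thesis by (simp add: BB_scale_right)
      qed
      finally show ?thesis using dual_bases_expand[OF es, of ?q'] by simp
    qed
    then show ?thesis by (simp add: pairing_def tens_def sp_mult_left[symmetric] sp_sum cong: sp_cong_all)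
  qed
  then have "pairing d' A B = (\<lambda>ys. \<Sum>i<length es. ksgn (d' * deg (es ! i)) * ?t i ys)" by auto
  then show ?thesis by (simp only: odot hbracket_def cyc_sum cyc_scale)
qed

text \<open>The sum over dual bases does not depend on the bases, and dual bases exist, so the
  condition becomes basis-free.\<close>

lemma bracket_from_form_iff:
  "bracket_from_form b br \<longleftrightarrow>
    (\<forall>k k' d d'. \<forall>A\<in>cyclic_forms (k + 1). \<forall>B\<in>cyclic_forms (k' + 1).
      has_degree d A \<and> has_degree d' B \<longrightarrow> br A B = hbracket d' A B)"
proof
  assume br: "bracket_from_form b br"
  obtain es es' where es: "dual_bases b es es'" using dual_bases_exist by blast
  show "\<forall>k k' d d'. \<forall>A\<in>cyclic_forms (k + 1). \<forall>B\<in>cyclic_forms (k' + 1).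
      has_degree d A \<and> has_degree d' B \<longrightarrow> br A B = hbracket d' A B"
  proof (intro allI ballI impI, elim conjE)
    fix k k' d d' A B
    assume *: "A \<in> cyclic_forms (k + 1)" "B \<in> cyclic_forms (k' + 1)" "has_degree d A" "has_degree d' B"
    then have "br A B = (\<lambda>xs. \<Sum>i<length es. ksgn (d' * deg (es ! i)) *
          odot (d' + deg (es' ! i)) (contract (es ! i) A) (contract (es' ! i) B) xs)"
      using br es unfolding bracket_from_form_def by blast
    then show "br A B = hbracket d' A B" using dual_bases_bracket[OF es *(1,2,4)] by simp
  qed
next
  assume *: "\<forall>k k' d d'. \<forall>A\<in>cyclic_forms (k + 1). \<forall>B\<in>cyclic_forms (k' + 1).
      has_degree d A \<and> has_degree d' B \<longrightarrow> br A B = hbracket d' A B"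
  show "bracket_from_form b br"
    unfolding bracket_from_form_def
  proof (intro conjI form allI ballI impI, elim conjE)
    fix es es' k k' d d' A B
    assume **: "A \<in> cyclic_forms (k + 1)" "B \<in> cyclic_forms (k' + 1)" "dual_bases b es es'"
      "has_degree d A" "has_degree d' B"
    show "br A B = (\<lambda>xs. \<Sum>i<length es. ksgn (d' * deg (es ! i)) *
          odot (d' + deg (es' ! i)) (contract (es ! i) A) (contract (es' ! i) B) xs)"
      using * **(1,2,4,5) dual_bases_bracket[OF **(3,1,2,5)] by auto
  qed
qed

lemma bracket_from_form_form_bracket: "bracket_from_form b form_bracket"
  unfolding bracket_from_form_iff
  by (auto intro!: form_bracket_parity cyclic_forms_all has_degree_parity dest: cyclic_formsD(1))

text \<open>The form prescribes the bracket on homogeneous forms of positive arity. Constants are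
  settled by the centre, sums by biadditivity, and arguments that are not cyclic forms by the
  default value \<open>0\<close>.\<close>

lemma pinczon_bracket_unique:
  assumes "pinczon_bracket br" "bracket_from_form b br" shows "br = form_bracket"
proof (intro ext)
  fix A B xs
  have L: "graded_lie_bracket br" "graded_lie_bracket form_bracket"
    using assms(1) pinczon_bracket_form_bracket unfolding pinczon_bracket_def by blast+
  have eq: "br A B = form_bracket A B"
    if A: "A \<in> cyclic_forms k" "has_degree d A" and B: "B \<in> cyclic_forms k'" "has_degree e B" for A B k d k' e
  proof (cases "k = 0 \<or> k' = 0")
    case True
    then show ?thesis
      using pinczon_constant[OF assms(1) _ A(2) B] pinczon_constant[OF pinczon_bracket_form_bracket _ A(2) B]
        pinczon_constant[OF assms(1) _ B(2) A] pinczon_constant[OF pinczon_bracket_form_bracket _ B(2) A] A(1) B(1)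
      by auto
  next
    case False
    then have "A \<in> cyclic_forms ((k - 1) + 1)" "B \<in> cyclic_forms ((k' - 1) + 1)" using A B by auto
    then have "br A B = hbracket e A B" "form_bracket A B = hbracket e A B"
      using assms(2) bracket_from_form_form_bracket A(2) B(2) unfolding bracket_from_form_iff by blast+
    then show ?thesis by simp
  qed
  have "br A B = form_bracket A B" if "A \<in> all_cyclic_forms" "B \<in> all_cyclic_forms"
    using that(2)
  proof (induction rule: all_cyclic_induct)
    case (hom k' e B)
    note B = this
    show ?case using that(1)
    proof (induction rule: all_cyclic_induct)
      case (hom k d A)
      then show ?case by (rule eq[OF _ _ B])
    next
      case (add F H)
      then show ?case
        using graded_lie_bracketD(1)[OF L(1) _ cyclic_forms_all[OF B(1)]]
          graded_lie_bracketD(1)[OF L(2) _ cyclic_forms_all[OF B(1)]] by simp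
    qed
  next
    case (add F H)
    then show ?case
      using graded_lie_bracketD(2)[OF L(1) that(1)] graded_lie_bracketD(2)[OF L(2) that(1)] by simp
  qed
  then show "br A B xs = form_bracket A B xs"
    using assms(1) pinczon_bracket_form_bracket unfolding pinczon_bracket_def by (cases "A \<in> all_cyclic_forms \<and> B \<in> all_cyclic_forms") auto
qed

end

section \<open>Shuffles\<close>

lemma extend_superset:
  assumes "vector_space s" "finite S" "Poly_Mapping.keys p \<subseteq> S"
  shows "extend s f p = (\<Sum>a\<in>S. s (Poly_Mapping.lookup p a) (f a))"
proof -
  interpret vector_space s by fact
  show ?thesis
    unfolding extend_def using assms(2,3) by (intro sum.mono_neutral_left) (auto simp: in_keys_iff)
qed

lemma extend_single: "vector_space s \<Longrightarrow> extend s f (Poly_Mapping.single a c) = s c (f a)"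
  using extend_superset[of s "{a}" "Poly_Mapping.single a c" f] by simp

lemma linear_extend: assumes "vector_space s" shows "Vector_Spaces.linear pscale s (extend s f)"
proof -
  interpret vector_space s by fact
  have "extend s f (p + q) = extend s f p + extend s f q" for p q
  proof -
    let ?S = "Poly_Mapping.keys p \<union> Poly_Mapping.keys q"
    have "Poly_Mapping.keys (p + q) \<subseteq> ?S" by (rule Poly_Mapping.keys_add)
    then show ?thesis
      by (simp add: extend_superset[OF assms, of ?S] lookup_add scale_left_distrib sum.distrib)
  qed
  moreover have "extend s f (pscale c p) = s c (extend s f p)" for c p
  proof -
    have "Poly_Mapping.keys (pscale c p) \<subseteq> Poly_Mapping.keys p"
      by (auto simp: in_keys_iff lookup_pscale)
    then show ?thesis
      by (simp add: extend_superset[OF assms, of "Poly_Mapping.keys p"] lookup_pscale scale_sum_right)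
  qed
  ultimately show ?thesis by (simp add: Vector_Spaces.linear_iff vector_space_pscale assms)
qed

lemma linear_0: "Vector_Spaces.linear s t f \<Longrightarrow> f 0 = 0"
  unfolding Vector_Spaces.linear_iff by (metis add_cancel_right_right add_0_right)

lemma linear_sum: "Vector_Spaces.linear s t f \<Longrightarrow> f (\<Sum>i\<in>I. g i) = (\<Sum>i\<in>I. f (g i))"
proof -
  assume f: "Vector_Spaces.linear s t f"
  then have "f (x + y) = f x + f y" for x y by (simp add: Vector_Spaces.linear_iff)
  then show ?thesis using linear_0[OF f] by (induction I rule: infinite_finite_induct) auto
qed

lemma linear_minus: "Vector_Spaces.linear s t f \<Longrightarrow> f (x - y) = f x - f y"
  unfolding Vector_Spaces.linear_iff by (metis add_diff_cancel_right' diff_add_cancel)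

lemma linear_span_zero:
  assumes "Vector_Spaces.linear s t f" "w \<in> module.span s S" "\<And>x. x \<in> S \<Longrightarrow> f x = 0"
  shows "f w = 0"
proof -
  interpret s: vector_space s using assms(1) by (simp add: Vector_Spaces.linear_iff)
  interpret t: vector_space t using assms(1) by (simp add: Vector_Spaces.linear_iff)
  have "s.subspace {x. f x = 0}"
    using assms(1) linear_0[OF assms(1)] by (auto simp: s.subspace_def Vector_Spaces.linear_iff)
  then show ?thesis using s.span_induct[of w S "\<lambda>x. f x = 0"] assms(2,3) by blast
qed

text \<open>Listing the inverse permutation turns \<sigma> into a word containing each position
  once; the positions of a block appear in increasing order exactly when \<sigma> is increasing on
  that block. The recursion of \<open>shuffles\<close> can then replace permutations.\<close>

lemma Sh_shuffles:
  "bij_betw (\<lambda>\<sigma>. map (inv \<sigma>) [0..<p + q]) (Sh p q) (shuffles [0..<p] [p..<p + q])"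
proof (rule bij_betwI')
  let ?n = "p + q" and ?f = "\<lambda>\<sigma>. map (inv \<sigma>) [0..<p + q]"
  fix \<sigma> \<tau> assume \<sigma>: "\<sigma> \<in> Sh p q" and \<tau>: "\<tau> \<in> Sh p q"
  have perm: "\<sigma> permutes {..<?n}" "\<tau> permutes {..<?n}" using \<sigma> \<tau> by (auto simp: Sh_def)
  show "(?f \<sigma> = ?f \<tau>) = (\<sigma> = \<tau>)"
  proof
    assume eq: "?f \<sigma> = ?f \<tau>"
    have "inv \<sigma> i = inv \<tau> i" for i
    proof (cases "i < ?n")
      case True
      then show ?thesis using arg_cong[OF eq, of "\<lambda>l. l ! i"] by simp
    next
      case False
      then show ?thesis using permutes_not_in[OF permutes_inv] perm by (metis lessThan_iff)
    qed
    then have "inv (inv \<sigma>) = inv (inv \<tau>)" by (metis ext)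
    then show "\<sigma> = \<tau>" using perm by (simp add: permutes_inv_inv)
  qed simp
next
  let ?n = "p + q" and ?f = "\<lambda>\<sigma>. map (inv \<sigma>) [0..<p + q]"
  fix \<sigma> assume \<sigma>: "\<sigma> \<in> Sh p q"
  have perm: "\<sigma> permutes {..<?n}" and mono: "strict_mono_on {..<p} \<sigma>" "strict_mono_on {p..<?n} \<sigma>"
    using \<sigma> by (auto simp: Sh_def)
  have set: "set (?f \<sigma>) = {..<?n}"
    using permutes_image[OF permutes_inv[OF perm]] by (simp add: atLeast0LessThan)
  \<comment> \<open>Used for both blocks of positions: monotonicity of \<sigma> on a block sorts its
    entries in the listed inverse.\<close>
  have s: "sorted_wrt (<) (filter P (?f \<sigma>))"
    if m: "strict_mono_on {i. i < ?n \<and> P i} \<sigma>" for P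
  proof -
    let ?l = "filter (P \<circ> inv \<sigma>) [0..<?n]"
    have "sorted_wrt (<) ?l" by (simp add: sorted_wrt_filter)
    then have "sorted_wrt (\<lambda>a c. inv \<sigma> a < inv \<sigma> c) ?l"
    proof (rule sorted_wrt_mono_rel[rotated])
      fix a c assume ac: "a \<in> set ?l" "c \<in> set ?l" "a < c"
      have in_n: "inv \<sigma> a < ?n" "inv \<sigma> c < ?n"
        using ac permutes_in_image[OF permutes_inv[OF perm]] by auto
      have inv: "\<sigma> (inv \<sigma> a) = a" "\<sigma> (inv \<sigma> c) = c" using permutes_inverses[OF perm] by auto
      show "inv \<sigma> a < inv \<sigma> c"
      proof (rule ccontr)
        assume "\<not> inv \<sigma> a < inv \<sigma> c"
        then have "inv \<sigma> c < inv \<sigma> a" using inv ac(3) by (metis linorder_neqE_nat less_irrefl)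
        then have "\<sigma> (inv \<sigma> c) < \<sigma> (inv \<sigma> a)"
          using m in_n ac by (auto simp: strict_mono_on_def)
        then show False using inv ac(3) by simp
      qed
    qed
    then show ?thesis by (simp add: filter_map sorted_wrt_map)
  qed
  have 1: "filter (\<lambda>i. i < p) (?f \<sigma>) = [0..<p]"
  proof (rule strict_sorted_equal)
    show "sorted_wrt (<) (filter (\<lambda>i. i < p) (?f \<sigma>))"
      by (rule s) (use mono(1) in \<open>auto simp: strict_mono_on_def\<close>)
  qed (use set in auto)
  have 2: "filter (\<lambda>i. \<not> i < p) (?f \<sigma>) = [p..<?n]"
  proof (rule strict_sorted_equal)
    show "sorted_wrt (<) (filter (\<lambda>i. \<not> i < p) (?f \<sigma>))"
      by (rule s) (use mono(2) in \<open>auto simp: strict_mono_on_def\<close>)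
  qed (use set in auto)
  show "?f \<sigma> \<in> shuffles [0..<p] [p..<?n]"
    using partition_in_shuffles[of "?f \<sigma>" "\<lambda>i. i < p"] unfolding 1 2 .
next
  let ?n = "p + q" and ?f = "\<lambda>\<sigma>. map (inv \<sigma>) [0..<p + q]"
  fix l assume l: "l \<in> shuffles [0..<p] [p..<?n]"
  have len: "length l = ?n" using length_shuffles[OF l] by simp
  have set: "set l = {..<?n}"
    unfolding set_shuffles[OF l] set_upt lessThan_atLeast0 by (rule ivl_disj_un_two(3)) simp_all
  have dist: "distinct l" by (rule distinct_disjoint_shuffles[OF _ _ _ l]) simp_all
  define \<tau> where "\<tau> i = (if i < ?n then l ! i else i)" for i
  have "bij_betw \<tau> {..<?n} {..<?n}"
  proof -
    have "bij_betw ((!) l) {..<?n} {..<?n}"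
      by (rule bij_betw_nth[OF dist]) (simp_all only: len set)
    moreover have "\<tau> i = l ! i" if "i \<in> {..<?n}" for i using that by (simp add: \<tau>_def)
    ultimately show ?thesis by (subst bij_betw_cong[where g = "(!) l"])
  qed
  then have \<tau>: "\<tau> permutes {..<?n}"
    by (rule bij_imp_permutes) (simp add: \<tau>_def)
  let ?\<sigma> = "inv \<tau>"
  have \<sigma>: "?\<sigma> permutes {..<?n}" by (rule permutes_inv[OF \<tau>])
  have inv: "inv ?\<sigma> = \<tau>" by (rule permutes_inv_inv[OF \<tau>])
  have f: "?f ?\<sigma> = l" unfolding inv using len by (auto simp: \<tau>_def intro!: nth_equalityI)
  \<comment> \<open>The converse: two entries of a block in the wrong order in \<open>l\<close>
    would contradict sortedness of the filtered list.\<close>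
  have mono: "strict_mono_on {i. i < ?n \<and> P i} ?\<sigma>" if P: "sorted_wrt (<) (filter P l)" for P
  proof (unfold strict_mono_on_def, intro allI impI, elim conjE)
    fix i j assume ij: "i \<in> {i. i < ?n \<and> P i}" "j \<in> {i. i < ?n \<and> P i}" "i < j"
    let ?a = "?\<sigma> i" and ?c = "?\<sigma> j"
    have ac: "?a < ?n" "?c < ?n" using permutes_in_image[OF \<sigma>] ij by auto
    have "\<tau> ?a = i" "\<tau> ?c = j" using permutes_inverses[OF \<tau>] by auto
    then have nth: "l ! ?a = i" "l ! ?c = j" using ac by (auto simp: \<tau>_def)
    show "?a < ?c"
    proof (rule ccontr)
      assume "\<not> ?a < ?c"
      moreover have "?a \<noteq> ?c" using nth ij(3) by auto
      ultimately have c: "?c < ?a" by simp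
      have "l = take ?a l @ i # drop (Suc ?a) l" using id_take_nth_drop[of ?a l] ac nth len by simp
      then have "filter P l = filter P (take ?a l) @ i # filter P (drop (Suc ?a) l)"
        using ij(1) by (metis (mono_tags, lifting) filter.simps(2) filter_append mem_Collect_eq)
      moreover have "j \<in> set (filter P (take ?a l))"
        using c nth ij(2) ac len by (auto simp: in_set_conv_nth)
      ultimately have "j < i" using P by (auto simp: sorted_wrt_append)
      then show False using ij(3) by simp
    qed
  qed
  have "filter (\<lambda>i. i < p) l = [0..<p]" "filter (\<lambda>i. \<not> i < p) l = [p..<?n]"
    using filter_shuffles[of "\<lambda>i. i < p" "[0..<p]" "[p..<?n]"]
      filter_shuffles[of "\<lambda>i. \<not> i < p" "[0..<p]" "[p..<?n]"] l
    by (auto simp: filter_id_conv filter_empty_conv)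
  then have "strict_mono_on {i. i < ?n \<and> i < p} ?\<sigma>" "strict_mono_on {i. i < ?n \<and> \<not> i < p} ?\<sigma>"
    by (auto intro!: mono)
  then have "?\<sigma> \<in> Sh p q" using \<sigma> by (auto simp: Sh_def strict_mono_on_def)
  then show "\<exists>\<sigma>\<in>Sh p q. l = ?f \<sigma>" using f by metis
qed

context graded_vector_space
begin

text \<open>The value of \<open>F\<close> on the signed shuffle product of two words, by recursion
  on the first letter of the result. A letter of the second word that comes first has passed the
  whole first word.\<close>

fun SH :: "('v list \<Rightarrow> 'w::ab_group_add) \<Rightarrow> 'v list \<Rightarrow> 'v list \<Rightarrow> 'w" where
  "SH F [] ys = F ys"
| "SH F (x # xs) [] = F (x # xs)"
| "SH F (x # xs) (y # ys) = SH (\<lambda>u. F (x # u)) xs (y # ys)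
     + ssgn (deg y * ldeg (x # xs)) (SH (\<lambda>u. F (y # u)) (x # xs) ys)"

lemma SH_Nil_right [simp]: "SH F xs [] = F xs"
  by (cases xs) auto

text \<open>The exponent of the Koszul sign, for a permutation written as the list of its values.\<close>

fun inv_deg :: "(nat \<Rightarrow> 'v) \<Rightarrow> nat list \<Rightarrow> int" where
  "inv_deg z [] = 0"
| "inv_deg z (a # l) = deg (z a) * ldeg (map z (filter (\<lambda>c. c < a) l)) + inv_deg z l"

text \<open>The inversions of \<open>x # l\<close> are those involving the first entry and those of
  \<open>l\<close>.\<close>

lemma prod_inversions:
  "(\<Prod>(a, c)\<in>{(a, c). a < c \<and> c < length l \<and> l ! c < l ! a}. ksgn (deg (z (l ! c)) * deg (z (l ! a)))) =
    (ksgn (inv_deg z l) :: 'k)"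
proof (induction l)
  case (Cons x l)
  let ?h = "\<lambda>l (a, c). ksgn (deg (z (l ! c)) * deg (z (l ! a))) :: 'k"
  let ?I = "\<lambda>l. {(a, c). a < c \<and> c < length l \<and> l ! c < l ! a}"
  let ?A = "(\<lambda>c. (0, Suc c)) ` {c. c < length l \<and> l ! c < x}"
  let ?B = "(\<lambda>(a, c). (Suc a, Suc c)) ` ?I l"
  have I: "?I (x # l) = ?A \<union> ?B"
  proof (rule set_eqI)
    fix p show "p \<in> ?I (x # l) \<longleftrightarrow> p \<in> ?A \<union> ?B"
      by (cases p; cases "fst p"; cases "snd p") (auto simp: image_iff)
  qed
  have fin: "finite (?I l)"
    by (rule finite_subset[of _ "{..<length l} \<times> {..<length l}"]) auto
  have "prod (?h (x # l)) (?I (x # l)) = prod (?h (x # l)) ?A * prod (?h (x # l)) ?B"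
    unfolding I by (rule prod.union_disjoint) (use fin in auto)
  also have "prod (?h (x # l)) ?B = prod (?h l) (?I l)"
    by (subst prod.reindex) (auto simp: inj_on_def intro!: prod.cong)
  also have "prod (?h (x # l)) ?A = (\<Prod>c | c < length l \<and> l ! c < x. ksgn (deg (z (l ! c)) * deg (z x)))"
    by (subst prod.reindex) (auto simp: inj_on_def)
  also have "\<dots> = ksgn (deg (z x) * ldeg (map z (filter (\<lambda>c. c < x) l)))"
  proof (induction l)
    case (Cons y l)
    have eq: "{c. c < length (y # l) \<and> (y # l) ! c < x} =
      (if y < x then {0} else {}) \<union> Suc ` {c. c < length l \<and> l ! c < x}"
    proof (rule set_eqI)
      fix c show "c \<in> {c. c < length (y # l) \<and> (y # l) ! c < x} \<longleftrightarrow>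
        c \<in> (if y < x then {0} else {}) \<union> Suc ` {c. c < length l \<and> l ! c < x}"
        by (cases c) (auto simp: image_iff)
    qed
    show ?case unfolding eq using Cons.IH
      by (subst prod.union_disjoint) (auto simp: prod.reindex ksgn_add algebra_simps)
  qed (simp add: ksgn_def)
  finally show ?case unfolding Cons.IH by (simp add: ksgn_add)
qed (simp add: ksgn_def)

text \<open>An inversion of \<sigma> at positions \<open>i < j\<close> is an inversion of the listed
  inverse at positions \<open>\<sigma> j < \<sigma> i\<close>.\<close>

lemma koszul_sign_eq:
  assumes perm: "\<sigma> permutes {..<length zs}"
  shows "koszul_sign \<sigma> zs = ksgn (inv_deg ((!) zs) (map (inv \<sigma>) [0..<length zs]))"
proof -
  let ?n = "length zs" and ?l = "map (inv \<sigma>) [0..<length zs]"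
  let ?I = "{(i, j). i < j \<and> j < ?n \<and> \<sigma> j < \<sigma> i}"
  let ?J = "{(a, c). a < c \<and> c < length ?l \<and> ?l ! c < ?l ! a}"
  have inv: "inv \<sigma> (\<sigma> i) = i" "\<sigma> (inv \<sigma> i) = i" for i using permutes_inverses[OF perm] by auto
  have lt: "\<sigma> i < ?n \<longleftrightarrow> i < ?n" "inv \<sigma> i < ?n \<longleftrightarrow> i < ?n" for i
    using permutes_in_image[OF perm] permutes_in_image[OF permutes_inv[OF perm]] by auto
  have "koszul_sign \<sigma> zs = (\<Prod>(a, c)\<in>?J. ksgn (deg (zs ! (?l ! c)) * deg (zs ! (?l ! a))))"
    unfolding koszul_sign_def
  proof (rule prod.reindex_bij_witness[where i = "\<lambda>(a, c). (inv \<sigma> c, inv \<sigma> a)" and j = "\<lambda>(i, j). (\<sigma> j, \<sigma> i)"])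
    fix p assume "p \<in> ?I"
    then obtain i j where p: "p = (i, j)" "i < j" "j < ?n" "\<sigma> j < \<sigma> i" by auto
    moreover have "\<sigma> i < ?n" "\<sigma> j < ?n" using p lt by auto
    ultimately show "(\<lambda>(a, c). (inv \<sigma> c, inv \<sigma> a)) ((\<lambda>(i, j). (\<sigma> j, \<sigma> i)) p) = p"
      "(\<lambda>(i, j). (\<sigma> j, \<sigma> i)) p \<in> ?J"
      "(\<lambda>(a, c). ksgn (deg (zs ! (?l ! c)) * deg (zs ! (?l ! a)))) ((\<lambda>(i, j). (\<sigma> j, \<sigma> i)) p)
        = ((\<lambda>(i, j). ksgn (deg (zs ! i) * deg (zs ! j))) p :: 'k)"
      by (auto simp: inv)
  next
    fix p assume "p \<in> ?J"
    then obtain a c where p: "p = (a, c)" "a < c" "c < ?n" "?l ! c < ?l ! a" by auto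
    then show "(\<lambda>(i, j). (\<sigma> j, \<sigma> i)) ((\<lambda>(a, c). (inv \<sigma> c, inv \<sigma> a)) p) = p"
      "(\<lambda>(a, c). (inv \<sigma> c, inv \<sigma> a)) p \<in> ?I"
      by (auto simp: inv lt)
  qed
  then show ?thesis by (simp only: prod_inversions)
qed

lemma SH_shuffles:
  assumes "vector_space s" "sorted_wrt (<) us" "sorted_wrt (<) vs" "\<And>u v. u \<in> set us \<Longrightarrow> v \<in> set vs \<Longrightarrow> u < v"
  shows "(\<Sum>l\<in>shuffles us vs. s (ksgn (inv_deg z l)) (F (map z l))) = SH F (map z us) (map z vs)"
proof -
  interpret s: vector_space s by fact
  have ks: "s (ksgn m) w = ssgn m w" for m w by (simp add: ksgn_def ssgn_def)
  have sorted: "inv_deg z l = 0" if "sorted_wrt (<) l" for l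
    using that
  proof (induction l)
    case (Cons a l)
    then have "filter (\<lambda>c. c < a) l = []" by (auto simp: filter_empty_conv dest: less_not_sym)
    then show ?case using Cons by simp
  qed simp
  show ?thesis unfolding ks using assms(2-)
  proof (induction us vs arbitrary: F rule: shuffles.induct)
    case (3 x xs y ys)
    let ?A = "shuffles xs (y # ys)" and ?B = "shuffles (x # xs) ys"
    have xy: "x < y" using 3 by auto
    have disj: "(#) x ` ?A \<inter> (#) y ` ?B = {}" using xy by auto
    have A: "inv_deg z (x # l) = inv_deg z l" if "l \<in> ?A" for l
    proof -
      have "x < c" if "c \<in> set l" for c using set_shuffles[OF \<open>l \<in> ?A\<close>] that 3 by auto
      then have "filter (\<lambda>c. c < x) l = []" by (auto simp: filter_empty_conv dest: less_not_sym)
      then show ?thesis by simp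
    qed
    have B: "inv_deg z (y # l) = deg (z y) * ldeg (map z (x # xs)) + inv_deg z l" if "l \<in> ?B" for l
    proof -
      have "filter (\<lambda>c. c < y) (x # xs) = x # xs" using 3 by (auto simp: filter_id_conv)
      moreover have "filter (\<lambda>c. c < y) ys = []" using 3 by (auto simp: filter_empty_conv dest: less_not_sym)
      ultimately have "filter (\<lambda>c. c < y) l \<in> shuffles (x # xs) []"
        using filter_shuffles[of "\<lambda>c. c < y" "x # xs" ys] that by (metis image_eqI)
      then have "filter (\<lambda>c. c < y) l = x # xs" by simp
      then show ?thesis by simp
    qed
    have "(\<Sum>l\<in>shuffles (x # xs) (y # ys). ssgn (inv_deg z l) (F (map z l))) =
      (\<Sum>l\<in>?A. ssgn (inv_deg z (x # l)) (F (map z (x # l)))) + (\<Sum>l\<in>?B. ssgn (inv_deg z (y # l)) (F (map z (y # l))))"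
      by (simp add: sum.union_disjoint[OF _ _ disj] sum.reindex)
    also have "\<dots> = SH (\<lambda>u. F (z x # u)) (map z xs) (map z (y # ys)) +
       ssgn (deg (z y) * ldeg (map z (x # xs))) (SH (\<lambda>u. F (z y # u)) (map z (x # xs)) (map z ys))"
    proof (rule arg_cong2[where f = "(+)"])
      show "(\<Sum>l\<in>?A. ssgn (inv_deg z (x # l)) (F (map z (x # l)))) = SH (\<lambda>u. F (z x # u)) (map z xs) (map z (y # ys))"
        using 3(1)[of "\<lambda>u. F (z x # u)"] 3(3-) by (simp add: A del: inv_deg.simps)
      show "(\<Sum>l\<in>?B. ssgn (inv_deg z (y # l)) (F (map z (y # l)))) =
        ssgn (deg (z y) * ldeg (map z (x # xs))) (SH (\<lambda>u. F (z y # u)) (map z (x # xs)) (map z ys))"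
        using 3(2)[of "\<lambda>u. F (z y # u)"] 3(3-) by (simp add: B del: inv_deg.simps ssgn_ssgn flip: ssgn_ssgn ssgn_sum)
    qed
    finally show ?case by simp
  qed (auto simp: sorted simp del: inv_deg.simps)
qed

lemma extend_sh: assumes s: "vector_space s" shows "extend s F (sh xs ys) = SH F xs ys"
proof -
  let ?p = "length xs" and ?q = "length ys" and ?zs = "xs @ ys"
  have "extend s F (sh xs ys) = (\<Sum>\<sigma>\<in>Sh ?p ?q. s (koszul_sign \<sigma> ?zs) (F (permute_list (inv \<sigma>) ?zs)))"
    unfolding sh_def by (simp add: linear_sum[OF linear_extend[OF s]] extend_single[OF s])
  also have "\<dots> = (\<Sum>\<sigma>\<in>Sh ?p ?q. s (ksgn (inv_deg ((!) ?zs) (map (inv \<sigma>) [0..<?p + ?q])))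
      (F (map ((!) ?zs) (map (inv \<sigma>) [0..<?p + ?q]))))"
    by (rule sum.cong) (auto simp: Sh_def koszul_sign_eq permute_list_def comp_def)
  also have "\<dots> = (\<Sum>l\<in>shuffles [0..<?p] [?p..<?p + ?q]. s (ksgn (inv_deg ((!) ?zs) l)) (F (map ((!) ?zs) l)))"
    by (rule sum.reindex_bij_betw[OF Sh_shuffles])
  also have "\<dots> = SH F (map ((!) ?zs) [0..<?p]) (map ((!) ?zs) [?p..<?p + ?q])"
    by (rule SH_shuffles[OF s]) auto
  also have "map ((!) ?zs) [0..<?p] = xs" by (auto intro!: nth_equalityI simp: nth_append)
  also have "map ((!) ?zs) [?p..<?p + ?q] = ys" by (auto intro!: nth_equalityI simp: nth_append)
  finally show ?thesis .
qed

subsection \<open>Calculus of shuffles\<close>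

lemma SH_cong: "(\<And>u. mset u = mset xs + mset ys \<Longrightarrow> F u = H u) \<Longrightarrow> SH F xs ys = SH H xs ys"
proof (induction F xs ys arbitrary: H rule: SH.induct)
  case (3 F x xs y ys)
  have "SH (\<lambda>u. F (x # u)) xs (y # ys) = SH (\<lambda>u. H (x # u)) xs (y # ys)"
    by (rule 3(1)) (rule 3(3), simp)
  moreover have "SH (\<lambda>u. F (y # u)) (x # xs) ys = SH (\<lambda>u. H (y # u)) (x # xs) ys"
    by (rule 3(2)) (rule 3(3), simp)
  ultimately show ?case by simp
qed auto

lemma SH_hom:
  assumes "h 0 = 0" "\<And>x y. h (x + y) = h x + h y" "\<And>x. h (- x) = - h x"
  shows "h (SH F xs ys) = SH (\<lambda>u. h (F u)) xs ys"
proof -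
  have "h (ssgn m w) = ssgn m (h w)" for m w using assms by (simp add: ssgn_def)
  then show ?thesis by (induction F xs ys rule: SH.induct) (auto simp: assms)
qed

lemma SH_add: "SH (\<lambda>u. F u + H u) xs ys = SH F xs ys + SH H xs ys"
proof (induction F xs ys arbitrary: H rule: SH.induct)
  case (3 F x xs y ys)
  show ?case using 3(1)[of "\<lambda>u. H (x # u)"] 3(2)[of "\<lambda>u. H (y # u)"] by (simp add: ssgn_add)
qed auto

lemma SH_ssgn: "SH (\<lambda>u. ssgn m (F u)) xs ys = ssgn m (SH F xs ys)"
  by (rule SH_hom[symmetric]) (auto simp: ssgn_add ssgn_minus)

lemma SH_zero: "SH (\<lambda>u. 0) xs ys = 0"
  using SH_hom[of "\<lambda>_. 0" "\<lambda>u. 0" xs ys] by simp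

lemma SH_sp: "SH (\<lambda>u. sp (f u) r) xs ys = sp (\<lambda>v w. SH (\<lambda>u. f u v w) xs ys) r"
  by (induction r arbitrary: f) (auto simp: SH_add)

lemma SH_comm: "SH F xs ys = ssgn (ldeg xs * ldeg ys) (SH F ys xs)"
proof (induction F xs ys rule: SH.induct)
  case (3 F x xs y ys)
  have "SH F (x # xs) (y # ys) = ssgn (ldeg xs * ldeg (y # ys)) (SH (\<lambda>u. F (x # u)) (y # ys) xs)
    + ssgn (deg y * ldeg (x # xs)) (ssgn (ldeg (x # xs) * ldeg ys) (SH (\<lambda>u. F (y # u)) ys (x # xs)))"
    using 3 by simp
  also have "\<dots> = ssgn (ldeg (x # xs) * ldeg (y # ys)) (SH F (y # ys) (x # xs))"
    unfolding SH.simps(3) ssgn_add ssgn_ssgn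
    by (subst add.commute, rule arg_cong2[where f = "(+)"]; rule ssgn_cong) (auto simp: algebra_simps)
  finally show ?case .
qed auto

text \<open>Deconcatenation is a morphism for the shuffle product.\<close>

lemma SH_sp_fun:
  "SH (sp g) xs ys = sp (\<lambda>x1 x2. sp (\<lambda>y1 y2.
     ssgn (ldeg x2 * ldeg y1) (SH (\<lambda>u. SH (g u) x2 y2) x1 y1)) ys) xs"
proof (induction "length xs + length ys" arbitrary: g xs ys rule: less_induct)
  case less
  show ?case
  proof (cases xs)
    case (Cons x xs')
    show ?thesis
    proof (cases ys)
      case ys: (Cons y ys')
      let ?e = "deg y * ldeg (x # xs')"
      define T where "T x1 x2 y1 y2 = ssgn (ldeg x2 * ldeg y1) (SH (\<lambda>u. SH (g u) x2 y2) x1 y1)" for x1 x2 y1 y2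
      define P where "P x1 x2 y1 y2 = ssgn (ldeg x2 * ldeg y1) (SH (\<lambda>u. SH (g (x # u)) x2 y2) x1 y1)" for x1 x2 y1 y2
      define S where "S x1 x2 y1 y2 = ssgn (ldeg x2 * ldeg y1) (SH (\<lambda>u. SH (g (y # u)) x2 y2) x1 y1)" for x1 x2 y1 y2
      have P: "SH (sp (\<lambda>v. g (x # v))) xs' (y # ys') = sp (\<lambda>x1 x2. sp (P x1 x2) (y # ys')) xs'"
        unfolding P_def by (rule less) (simp add: Cons ys)
      have S: "SH (sp (\<lambda>v. g (y # v))) (x # xs') ys' = sp (\<lambda>x1 x2. sp (S x1 x2) ys') (x # xs')"
        unfolding S_def by (rule less) (simp add: Cons ys)
      have T0: "T [] xs [] ys = SH (g []) xs ys" by (simp add: T_def)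
      have T1: "T (x # x1) x2 [] y2 = P x1 x2 [] y2" for x1 x2 y2 by (simp add: T_def P_def)
      have T2: "T [] xs (y # y1) y2 = ssgn ?e (S [] xs y1 y2)" for y1 y2
        by (simp add: T_def S_def Cons algebra_simps)
      have T3: "T (x # x1) x2 (y # y1) y2 = P x1 x2 (y # y1) y2 + ssgn ?e (S (x # x1) x2 y1 y2)"
        if "x1 @ x2 = xs'" for x1 x2 y1 y2
        using that by (auto simp: T_def P_def S_def ssgn_add intro!: ssgn_cong)
      have "SH (sp g) xs ys = SH (\<lambda>u. g [] (x # u) + sp (\<lambda>v. g (x # v)) u) xs' (y # ys')
         + ssgn ?e (SH (\<lambda>u. g [] (y # u) + sp (\<lambda>v. g (y # v)) u) (x # xs') ys')"
        by (simp add: Cons ys)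
      also have "\<dots> = SH (g []) xs ys + (SH (sp (\<lambda>v. g (x # v))) xs' (y # ys')
         + ssgn ?e (SH (sp (\<lambda>v. g (y # v))) (x # xs') ys'))"
        by (simp only: SH_add ssgn_add Cons ys SH.simps(3) ac_simps)
      also have "\<dots> = T [] xs [] ys + (sp (\<lambda>x1 x2. sp (P x1 x2) (y # ys')) xs'
         + ssgn ?e (sp (\<lambda>x1 x2. sp (S x1 x2) ys') (x # xs')))"
        by (simp only: P S T0)
      also have "\<dots> = T [] xs [] ys + sp (\<lambda>y1 y2. T [] xs (y # y1) y2) ys'
         + sp (\<lambda>x1 x2. T (x # x1) x2 [] ys + (sp (\<lambda>y1 y2. P x1 x2 (y # y1) y2 + ssgn ?e (S (x # x1) x2 y1 y2)) ys')) xs'"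
        by (simp add: T1 T2[unfolded Cons ldeg_simps] ssgn_add sp_ssgn sp_add Cons ys ac_simps cong: sp_cong_all)
      also have "sp (\<lambda>x1 x2. T (x # x1) x2 [] ys + (sp (\<lambda>y1 y2. P x1 x2 (y # y1) y2 + ssgn ?e (S (x # x1) x2 y1 y2)) ys')) xs'
        = sp (\<lambda>x1 x2. sp (T (x # x1) x2) ys) xs'"
        proof (rule sp_cong)
        fix x1 x2 assume "x1 @ x2 = xs'"
        from T3[OF this, symmetric]
        show "T (x # x1) x2 [] ys + sp (\<lambda>y1 y2. P x1 x2 (y # y1) y2 + ssgn ?e (S (x # x1) x2 y1 y2)) ys'
          = sp (T (x # x1) x2) ys"
          by (simp only: ys sp.simps)
      qed
      also have "T [] xs [] ys + sp (\<lambda>y1 y2. T [] xs (y # y1) y2) ys' = sp (T [] xs) ys"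
        by (simp add: ys)
      also have "sp (T [] xs) ys + sp (\<lambda>x1 x2. sp (T (x # x1) x2) ys) xs' = sp (\<lambda>x1 x2. sp (T x1 x2) ys) xs"
        by (simp add: Cons)
      finally show ?thesis unfolding T_def .
    qed (simp add: Cons)
  qed simp
qed

text \<open>A marked letter \<open>a\<close> of the first word cuts the second word into the letters
  placed before and after \<open>a\<close>; the former pass \<open>a\<close> and
  \<open>vs\<close>.\<close>

lemma SH_mark:
  "SH F (us @ a # vs) ys = sp (\<lambda>y1 y2. ssgn (ldeg (a # vs) * ldeg y1)
     (SH (\<lambda>u. SH (\<lambda>v. F (u @ a # v)) vs y2) us y1)) ys"
proof (induction us arbitrary: F ys)
  case Nil
  show ?case
  proof (induction ys arbitrary: F)
    case (Cons y ys)
    show ?case using Cons[of "\<lambda>u. F (y # u)"] by (simp add: sp_ssgn algebra_simps cong: sp_cong_all)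
  qed simp
next
  case (Cons x us)
  note IH = this
  show ?case
  proof (induction ys arbitrary: F)
    case (Cons y ys)
    have "SH F ((x # us) @ a # vs) (y # ys) = SH (\<lambda>u. F (x # u)) (us @ a # vs) (y # ys)
      + ssgn (deg y * ldeg (x # us @ a # vs)) (SH (\<lambda>u. F (y # u)) ((x # us) @ a # vs) ys)"
      by simp
    also have "\<dots> = sp (\<lambda>y1 y2. ssgn (ldeg (a # vs) * ldeg y1)
        (SH (\<lambda>u. SH (\<lambda>v. F (x # u @ a # v)) vs y2) us y1)) (y # ys)
      + ssgn (deg y * ldeg (x # us @ a # vs)) (sp (\<lambda>y1 y2. ssgn (ldeg (a # vs) * ldeg y1)
        (SH (\<lambda>u. SH (\<lambda>v. F (y # u @ a # v)) vs y2) (x # us) y1)) ys)"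
      using IH[of "\<lambda>u. F (x # u)" "y # ys"] Cons[of "\<lambda>u. F (y # u)"] by (simp only: append_Cons)
    also have "\<dots> = sp (\<lambda>y1 y2. ssgn (ldeg (a # vs) * ldeg y1)
        (SH (\<lambda>u. SH (\<lambda>v. F (u @ a # v)) vs y2) (x # us) y1)) (y # ys)"
      by (simp add: sp_ssgn sp_add[symmetric] ssgn_add algebra_simps cong: sp_cong_all)
    finally show ?case .
  qed simp
qed

lemma SH_mark_right:
  "SH F xs (us @ a # vs) = sp (\<lambda>x1 x2. ssgn (ldeg x2 * ldeg (us @ [a]))
     (SH (\<lambda>u. SH (\<lambda>v. F (u @ a # v)) x2 vs) x1 us)) xs"
proof -
  have "SH F xs (us @ a # vs) = sp (\<lambda>x1 x2. ssgn (ldeg xs * ldeg (us @ a # vs) + ldeg (a # vs) * ldeg x1)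
     (SH (\<lambda>u. SH (\<lambda>v. F (u @ a # v)) vs x2) us x1)) xs"
    by (subst SH_comm, subst SH_mark) (simp add: sp_ssgn cong: sp_cong_all)
  also have "\<dots> = sp (\<lambda>x1 x2. ssgn (ldeg x2 * ldeg (us @ [a]))
     (SH (\<lambda>u. SH (\<lambda>v. F (u @ a # v)) x2 vs) x1 us)) xs"
  proof (rule sp_cong)
    fix x1 x2 assume xs: "x1 @ x2 = xs"
    have inner: "SH (\<lambda>v. F (u @ a # v)) vs x2 = ssgn (ldeg vs * ldeg x2) (SH (\<lambda>v. F (u @ a # v)) x2 vs)" for u
      by (rule SH_comm)
    have "SH (\<lambda>u. SH (\<lambda>v. F (u @ a # v)) vs x2) us x1 =
       ssgn (ldeg vs * ldeg x2) (ssgn (ldeg us * ldeg x1) (SH (\<lambda>u. SH (\<lambda>v. F (u @ a # v)) x2 vs) x1 us))"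
      by (simp only: inner SH_ssgn SH_comm[of _ us x1])
    then have "SH (\<lambda>u. SH (\<lambda>v. F (u @ a # v)) vs x2) us x1 =
       ssgn (ldeg us * ldeg x1 + ldeg vs * ldeg x2) (SH (\<lambda>u. SH (\<lambda>v. F (u @ a # v)) x2 vs) x1 us)"
      by (simp add: add.commute)
    then show "ssgn (ldeg xs * ldeg (us @ a # vs) + ldeg (a # vs) * ldeg x1)
       (SH (\<lambda>u. SH (\<lambda>v. F (u @ a # v)) vs x2) us x1) =
      ssgn (ldeg x2 * ldeg (us @ [a])) (SH (\<lambda>u. SH (\<lambda>v. F (u @ a # v)) x2 vs) x1 us)"
      using xs by (auto intro!: ssgn_cong simp: algebra_simps)
  qed
  finally show ?thesis .
qed

text \<open>The defining recursion reads the first letter. The transposed bracketing removes letters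
  at both ends, so the recursion on the last letter is needed as well.\<close>

lemma SH_snoc:
  "SH F (xs @ [x]) (ys @ [y]) = ssgn (deg x * ldeg (ys @ [y])) (SH (\<lambda>u. F (u @ [x])) xs (ys @ [y]))
     + SH (\<lambda>u. F (u @ [y])) (xs @ [x]) ys"
proof (induction "length xs + length ys" arbitrary: F xs ys rule: less_induct)
  case less
  show ?case
  proof (cases xs)
    case xs: Nil
    show ?thesis
    proof (cases ys)
      case (Cons y' ys')
      show ?thesis
        using less[of "[]" ys' "\<lambda>u. F (y' # u)"] by (simp add: xs Cons ssgn_add algebra_simps)
    qed (simp add: xs mult.commute)
  next
    case xs: (Cons x' xs')
    show ?thesis
    proof (cases ys)
      case Nil
      show ?thesis
        using less[of xs' "[]" "\<lambda>u. F (x' # u)"] by (simp add: xs Nil ssgn_add algebra_simps)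
    next
      case (Cons y' ys')
      show ?thesis
        using less[of xs' ys "\<lambda>u. F (x' # u)"] less[of xs ys' "\<lambda>u. F (y' # u)"]
        by (simp add: xs Cons ssgn_add algebra_simps)
    qed
  qed
qed

lemma ldeg_mset: assumes "mset u = mset xs + mset ys" shows "ldeg u = ldeg xs + ldeg ys"
proof -
  have "ldeg v = \<Sum>\<^sub># (image_mset deg (mset v))" for v
    by (simp add: ldeg_def sum_mset_sum_list[symmetric])
  then show ?thesis by (simp add: assms)
qed

lemma set_mset_append: assumes "mset u = mset xs + mset ys" shows "set u = set xs \<union> set ys"
  using arg_cong[OF assms, of set_mset] by simp

lemma length_mset_append: assumes "mset u = mset xs + mset ys" shows "length u = length xs + length ys"
  using arg_cong[OF assms, of size] by simp

text \<open>Vanishing in all arities, demanded on homogeneous words only because the signs in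
  \<open>SH\<close> use \<open>deg\<close>.\<close>

definition svan :: "('v list \<Rightarrow> 'w::ab_group_add) \<Rightarrow> bool" where
  "svan F \<longleftrightarrow> (\<forall>xs ys. xs \<noteq> [] \<and> ys \<noteq> [] \<and> set xs \<subseteq> homog \<and> set ys \<subseteq> homog \<longrightarrow> SH F xs ys = 0)"

lemma svanD: "svan F \<Longrightarrow> xs \<noteq> [] \<Longrightarrow> ys \<noteq> [] \<Longrightarrow> set xs \<subseteq> homog \<Longrightarrow> set ys \<subseteq> homog \<Longrightarrow> SH F xs ys = 0"
  by (simp add: svan_def)

lemma vanishes_iff_svan:
  assumes "vector_space s"
  shows "(\<forall>k\<ge>1. vanishes_on_shuffles s k (arity_part k F)) \<longleftrightarrow> svan F"
proof -
  have "SH (arity_part (length xs + length ys) F) xs ys = SH F xs ys" for xs ys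
    by (rule SH_cong) (auto simp: arity_part_def dest: length_mset_append)
  then show ?thesis
    unfolding vanishes_on_shuffles_def svan_def extend_sh[OF assms]
    by (auto simp: Suc_le_eq) (metis length_greater_0_conv trans_less_add1)
qed

definition qdegree :: "int \<Rightarrow> ('v list \<Rightarrow> 'v) \<Rightarrow> bool" where
  "qdegree q Q \<longleftrightarrow> (\<forall>xs. set xs \<subseteq> homog \<longrightarrow> Q xs \<in> G (ldeg xs + q + 1))"

text \<open>As cuts are compatible with shuffles, the block fed to \<open>Q\<close> is a shuffle of
  a block of \<open>xs\<close> and a block of \<open>ys\<close>. Since \<open>Q\<close> vanishes on
  proper shuffles, one of these blocks is empty. The value of \<open>Q\<close> on the other is then
  a single letter replacing a block of its word, and the sum is a shuffle product of two non-empty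
  words, killed by \<open>F\<close>.\<close>

lemma SH_act:
  assumes F: "mlin s F" "svan F" and Q: "mlin scale Q" "svan Q" "Q [] = 0" "qdegree q Q"
    and ne: "xs \<noteq> []" "ys \<noteq> []" and hom: "set xs \<subseteq> homog" "set ys \<subseteq> homog"
  shows "SH (act q F Q) xs ys = 0"
proof -
  define g where "g u = sp (\<lambda>v w. F (map (sg q) u @ Q v # w))" for u
  have act: "act q F Q = sp g" by (simp add: act_def g_def[abs_def])
  have SHg: "SH (g u) x2 y2 = sp (\<lambda>xa xb. SH (\<lambda>w. F (map (sg q) u @ Q xa # w)) xb y2) x2
      + sp (\<lambda>ya yb. ssgn (ldeg x2 * ldeg ya) (SH (\<lambda>w. F (map (sg q) u @ Q ya # w)) x2 yb)) y2"
    if h: "set x2 \<subseteq> homog" "set y2 \<subseteq> homog" for u x2 y2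
  proof -
    \<comment> \<open>\<open>?A\<close> and \<open>?B\<close> hold the terms in which the block fed
      to \<open>Q\<close> comes only from the first or only from the second word; if both blocks are
      empty, \<open>Q [] = 0\<close>.\<close>
    let ?A = "\<lambda>xa xb ya yb. if ya = [] then SH (\<lambda>w. F (map (sg q) u @ Q xa # w)) xb yb else 0"
    let ?B = "\<lambda>xa xb ya yb. if xa = [] then ssgn (ldeg xb * ldeg ya) (SH (\<lambda>w. F (map (sg q) u @ Q ya # w)) xb yb) else 0"
    have "SH (g u) x2 y2 = sp (\<lambda>xa xb. sp (\<lambda>ya yb. ssgn (ldeg xb * ldeg ya)
        (SH (\<lambda>v. SH (\<lambda>w. F (map (sg q) u @ Q v # w)) xb yb) xa ya)) y2) x2"
      unfolding g_def by (rule SH_sp_fun)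
    also have "\<dots> = sp (\<lambda>xa xb. sp (\<lambda>ya yb. ?A xa xb ya yb + ?B xa xb ya yb) y2) x2"
    proof (rule sp_cong, rule sp_cong)
      fix xa xb ya yb assume x2: "xa @ xb = x2" and y2: "ya @ yb = y2"
      have "SH (\<lambda>v. SH (\<lambda>w. F (map (sg q) u @ Q v # w)) xb yb) xa ya =
        SH (\<lambda>w. F (map (sg q) u @ SH Q xa ya # w)) xb yb"
        by (rule SH_hom[symmetric, of "\<lambda>z. SH (\<lambda>w. F (map (sg q) u @ z # w)) xb yb"])
           (auto simp: mlin_zero[OF F(1)] mlin_add[OF F(1)] mlin_minus[OF F(1)] SH_zero SH_add
             intro!: SH_hom[symmetric])
      moreover have "SH Q xa ya = 0" if "xa \<noteq> []" "ya \<noteq> []"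
        using svanD[OF Q(2) that] h x2 y2 by auto
      ultimately show "ssgn (ldeg xb * ldeg ya) (SH (\<lambda>v. SH (\<lambda>w. F (map (sg q) u @ Q v # w)) xb yb) xa ya) =
        ?A xa xb ya yb + ?B xa xb ya yb"
        by (cases "xa = []"; cases "ya = []") (auto simp: Q(3) mlin_zero[OF F(1)] SH_zero)
    qed
    also have "\<dots> = sp (\<lambda>xa xb. sp (\<lambda>ya yb. ?A xa xb ya yb) y2) x2 + sp (\<lambda>xa xb. sp (\<lambda>ya yb. ?B xa xb ya yb) y2) x2"
      by (simp only: sp_add)
    also have "sp (\<lambda>xa xb. sp (\<lambda>ya yb. ?A xa xb ya yb) y2) x2 = sp (\<lambda>xa xb. SH (\<lambda>w. F (map (sg q) u @ Q xa # w)) xb y2) x2"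
      by (rule sp_cong_all, subst sp_left_empty) auto
    also have "sp (\<lambda>xa xb. sp (\<lambda>ya yb. ?B xa xb ya yb) y2) x2 =
        sp (\<lambda>ya yb. ssgn (ldeg x2 * ldeg ya) (SH (\<lambda>w. F (map (sg q) u @ Q ya # w)) x2 yb)) y2"
      by (subst sp_left_empty) auto
    finally show ?thesis .
  qed
  \<comment> \<open>The prefix is a shuffle of \<open>x1\<close> and \<open>y1\<close> and has a
    fixed total degree, so its sign can be taken out of both shuffles.\<close>
  have sgu: "SH (\<lambda>u. SH (\<lambda>w. F (map (sg q) u @ z # w)) x2 y2) x1 y1 =
      ssgn (q * (ldeg x1 + ldeg y1)) (SH (\<lambda>u. SH (\<lambda>w. F (u @ z # w)) x2 y2) x1 y1)"
    if h: "set x1 \<subseteq> homog" "set y1 \<subseteq> homog" for z x1 x2 y1 y2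
  proof -
    have "SH (\<lambda>w. F (map (sg q) u @ z # w)) x2 y2 = ssgn (q * (ldeg x1 + ldeg y1)) (SH (\<lambda>w. F (u @ z # w)) x2 y2)"
      if "mset u = mset x1 + mset y1" for u
    proof -
      have "set u \<subseteq> homog" using set_mset_append[OF that] h by auto
      then have "F (map (sg q) u @ z # w) = ssgn (q * (ldeg x1 + ldeg y1)) (F (u @ z # w))" for w
        using mlin_sg_list[OF F(1), of u "[]" q "z # w"] ldeg_mset[OF that] by simp
      then show ?thesis by (simp add: SH_ssgn)
    qed
    then have "SH (\<lambda>u. SH (\<lambda>w. F (map (sg q) u @ z # w)) x2 y2) x1 y1 =
       SH (\<lambda>u. ssgn (q * (ldeg x1 + ldeg y1)) (SH (\<lambda>w. F (u @ z # w)) x2 y2)) x1 y1"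
      by (rule SH_cong)
    then show ?thesis by (simp only: SH_ssgn)
  qed
  have Qh: "Q v \<in> homog" "Q v \<noteq> 0 \<Longrightarrow> deg (Q v) = ldeg v + q" if "set v \<subseteq> homog" for v
    using Q(4) that deg_eq[of "Q v" "ldeg v + q + 1"] G_homog unfolding qdegree_def by auto
  have F0: "F (u @ 0 # w) = 0" for u w by (rule mlin_zero[OF F(1)])
  \<comment> \<open>The degree of \<open>Q xa\<close> is that of \<open>xa\<close> increased by
    \<open>q\<close>; this makes the signs those of shuffling \<open>x1 @ Q xa # xb\<close> with
    \<open>ys\<close>.\<close>
  have A0: "sp (\<lambda>y1 y2. ssgn (ldeg (xa @ xb) * ldeg y1) (SH (\<lambda>u. SH (\<lambda>w. F (map (sg q) u @ Q xa # w)) xb y2) x1 y1)) ys = 0"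
    if h: "set x1 \<subseteq> homog" "set xa \<subseteq> homog" "set xb \<subseteq> homog" for x1 xa xb
  proof (cases "Q xa = 0")
    case False
    note deg = Qh(2)[OF h(2) False]
    have "sp (\<lambda>y1 y2. ssgn (ldeg (xa @ xb) * ldeg y1) (SH (\<lambda>u. SH (\<lambda>w. F (map (sg q) u @ Q xa # w)) xb y2) x1 y1)) ys
      = ssgn (q * ldeg x1) (SH F (x1 @ Q xa # xb) ys)"
      unfolding SH_mark sp_ssgn
    proof (rule sp_cong)
      fix y1 y2 assume "y1 @ y2 = ys"
      then have "set y1 \<subseteq> homog" using hom by auto
      then show "ssgn (ldeg (xa @ xb) * ldeg y1) (SH (\<lambda>u. SH (\<lambda>w. F (map (sg q) u @ Q xa # w)) xb y2) x1 y1) =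
        ssgn (q * ldeg x1) (ssgn (ldeg (Q xa # xb) * ldeg y1) (SH (\<lambda>u. SH (\<lambda>v. F (u @ Q xa # v)) xb y2) x1 y1))"
        by (simp add: sgu[OF h(1)] deg algebra_simps)
    qed
    also have "SH F (x1 @ Q xa # xb) ys = 0"
      by (rule svanD[OF F(2)]) (use h Qh(1)[OF h(2)] ne hom in auto)
    finally show ?thesis by simp
  qed (simp add: F0 SH_zero)
  have B0: "sp (\<lambda>x1 x2. ssgn (ldeg x2 * ldeg y1) (ssgn (ldeg x2 * ldeg ya)
      (SH (\<lambda>u. SH (\<lambda>w. F (map (sg q) u @ Q ya # w)) x2 yb) x1 y1))) xs = 0"
    if h: "set y1 \<subseteq> homog" "set ya \<subseteq> homog" "set yb \<subseteq> homog" for y1 ya yb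
  proof (cases "Q ya = 0")
    case False
    note deg = Qh(2)[OF h(2) False]
    have "sp (\<lambda>x1 x2. ssgn (ldeg x2 * ldeg y1) (ssgn (ldeg x2 * ldeg ya)
      (SH (\<lambda>u. SH (\<lambda>w. F (map (sg q) u @ Q ya # w)) x2 yb) x1 y1))) xs
      = ssgn (q * (ldeg xs + ldeg y1)) (SH F xs (y1 @ Q ya # yb))"
      unfolding SH_mark_right sp_ssgn
    proof (rule sp_cong)
      fix x1 x2 assume xs: "x1 @ x2 = xs"
      then have "set x1 \<subseteq> homog" using hom by auto
      then show "ssgn (ldeg x2 * ldeg y1) (ssgn (ldeg x2 * ldeg ya)
          (SH (\<lambda>u. SH (\<lambda>w. F (map (sg q) u @ Q ya # w)) x2 yb) x1 y1)) =
        ssgn (q * (ldeg xs + ldeg y1)) (ssgn (ldeg x2 * ldeg (y1 @ [Q ya])) (SH (\<lambda>u. SH (\<lambda>v. F (u @ Q ya # v)) x2 yb) x1 y1))"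
        using xs by (auto simp: sgu[OF _ h(1)] deg algebra_simps intro!: ssgn_cong)
    qed
    also have "SH F xs (y1 @ Q ya # yb) = 0"
      by (rule svanD[OF F(2)]) (use h Qh(1)[OF h(2)] ne hom in auto)
    finally show ?thesis by simp
  qed (simp add: F0 SH_zero)
  have "SH (act q F Q) xs ys = sp (\<lambda>x1 x2. sp (\<lambda>y1 y2. ssgn (ldeg x2 * ldeg y1) (SH (\<lambda>u. SH (g u) x2 y2) x1 y1)) ys) xs"
    unfolding act by (rule SH_sp_fun)
  also have "\<dots> = sp (\<lambda>x1 x2. sp (\<lambda>y1 y2.
      sp (\<lambda>xa xb. ssgn (ldeg x2 * ldeg y1) (SH (\<lambda>u. SH (\<lambda>w. F (map (sg q) u @ Q xa # w)) xb y2) x1 y1)) x2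
    + sp (\<lambda>ya yb. ssgn (ldeg x2 * ldeg y1) (ssgn (ldeg x2 * ldeg ya)
        (SH (\<lambda>u. SH (\<lambda>w. F (map (sg q) u @ Q ya # w)) x2 yb) x1 y1))) y2) ys) xs"
  proof (rule sp_cong, rule sp_cong)
    fix x1 x2 y1 y2 assume "x1 @ x2 = xs" "y1 @ y2 = ys"
    then have "set x2 \<subseteq> homog" "set y2 \<subseteq> homog" using hom by auto
    then show "ssgn (ldeg x2 * ldeg y1) (SH (\<lambda>u. SH (g u) x2 y2) x1 y1) =
      sp (\<lambda>xa xb. ssgn (ldeg x2 * ldeg y1) (SH (\<lambda>u. SH (\<lambda>w. F (map (sg q) u @ Q xa # w)) xb y2) x1 y1)) x2
    + sp (\<lambda>ya yb. ssgn (ldeg x2 * ldeg y1) (ssgn (ldeg x2 * ldeg ya)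
        (SH (\<lambda>u. SH (\<lambda>w. F (map (sg q) u @ Q ya # w)) x2 yb) x1 y1))) y2"
      by (simp only: SHg SH_add SH_sp ssgn_add sp_ssgn SH_ssgn)
  qed
  \<comment> \<open>The cut of the other word is moved innermost, which completes the shuffle
    products of \<open>A0\<close> and \<open>B0\<close>.\<close>
  also have "\<dots> = sp (\<lambda>x1 x2. sp (\<lambda>xa xb. sp (\<lambda>y1 y2.
       ssgn (ldeg x2 * ldeg y1) (SH (\<lambda>u. SH (\<lambda>w. F (map (sg q) u @ Q xa # w)) xb y2) x1 y1)) ys) x2) xs
    + sp (\<lambda>y1 y2. sp (\<lambda>ya yb. sp (\<lambda>x1 x2. ssgn (ldeg x2 * ldeg y1) (ssgn (ldeg x2 * ldeg ya)
        (SH (\<lambda>u. SH (\<lambda>w. F (map (sg q) u @ Q ya # w)) x2 yb) x1 y1))) xs) y2) ys"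
  proof -
    show ?thesis
      unfolding sp_add
      by (rule arg_cong2[where f = "(+)"])
         (rule sp_cong_all, rule sp_swap, subst sp_swap, rule sp_cong_all, rule sp_swap)
  qed
  also have "\<dots> = 0 + 0"
  proof (rule arg_cong2[where f = "(+)"])
    show "sp (\<lambda>x1 x2. sp (\<lambda>xa xb. sp (\<lambda>y1 y2.
       ssgn (ldeg x2 * ldeg y1) (SH (\<lambda>u. SH (\<lambda>w. F (map (sg q) u @ Q xa # w)) xb y2) x1 y1)) ys) x2) xs = 0"
    proof (rule sp_zero, rule sp_zero)
      fix x1 x2 xa xb assume x: "x1 @ x2 = xs" "xa @ xb = x2"
      then have h: "set x1 \<subseteq> homog" "set xa \<subseteq> homog" "set xb \<subseteq> homog" using hom by auto
      show "sp (\<lambda>y1 y2. ssgn (ldeg x2 * ldeg y1) (SH (\<lambda>u. SH (\<lambda>w. F (map (sg q) u @ Q xa # w)) xb y2) x1 y1)) ys = 0"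
        using A0[OF h] unfolding x(2) .
    qed
    show "sp (\<lambda>y1 y2. sp (\<lambda>ya yb. sp (\<lambda>x1 x2. ssgn (ldeg x2 * ldeg y1) (ssgn (ldeg x2 * ldeg ya)
        (SH (\<lambda>u. SH (\<lambda>w. F (map (sg q) u @ Q ya # w)) x2 yb) x1 y1))) xs) y2) ys = 0"
    proof (rule sp_zero, rule sp_zero)
      fix y1 y2 ya yb assume y: "y1 @ y2 = ys" "ya @ yb = y2"
      then have h: "set y1 \<subseteq> homog" "set ya \<subseteq> homog" "set yb \<subseteq> homog" using hom by auto
      show "sp (\<lambda>x1 x2. ssgn (ldeg x2 * ldeg y1) (ssgn (ldeg x2 * ldeg ya)
        (SH (\<lambda>u. SH (\<lambda>w. F (map (sg q) u @ Q ya # w)) x2 yb) x1 y1))) xs = 0"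
        by (rule B0[OF h])
    qed
  qed
  finally show ?thesis by simp
qed

lemma svan_act:
  "mlin s F \<Longrightarrow> svan F \<Longrightarrow> mlin scale Q \<Longrightarrow> svan Q \<Longrightarrow> Q [] = 0 \<Longrightarrow> qdegree q Q \<Longrightarrow> svan (act q F Q)"
  unfolding svan_def[of "act q F Q"] using SH_act by blast

subsection \<open>The dual of right-normed bracketing\<close>

text \<open>\<open>Dn n F\<close> is, on lists of length \<open>n + 1\<close>, the composition of \<open>F\<close> with the adjoint of the
  map $a_1 \dots a_k \mapsto [a_1, [a_2, \dots, a_k]]$.  Composition with this adjoint is
  multiplication by the length on functions vanishing on shuffles, and its image consists of such
  functions; this is how the cobracket is inverted.\<close>

fun Dn :: "nat \<Rightarrow> ('v list \<Rightarrow> 'k) \<Rightarrow> 'v list \<Rightarrow> 'k" where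
  "Dn 0 F = F"
| "Dn (Suc n) F = (\<lambda>xs.
     (case xs of [] \<Rightarrow> 0 | x # r \<Rightarrow> Dn n (\<lambda>u. F (x # u)) r)
     - (rot ^^ Suc n) (\<lambda>xs. case xs of [] \<Rightarrow> 0 | x # r \<Rightarrow> Dn n (\<lambda>u. F (x # u)) r) xs)"

definition Dy :: "('v list \<Rightarrow> 'k) \<Rightarrow> 'v list \<Rightarrow> 'k" where
  "Dy F xs = Dn (length xs - 1) F xs"

lemma rot_pow_linear: "(rot ^^ j) (\<lambda>u. c * F u + H u) zs = c * (rot ^^ j) F zs + ((rot ^^ j) H zs :: 'k)"
proof -
  have "(rot ^^ j) (\<lambda>u. \<Sum>i\<in>UNIV. (\<lambda>i u. if i then c * F u else H u) i u) zs =
      (\<Sum>i\<in>UNIV. (rot ^^ j) ((\<lambda>i u. if i then c * F u else H u) i) zs)"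
    by (rule rot_pow_sum)
  then show ?thesis by (simp add: UNIV_bool rot_pow_scale add.commute)
qed

lemma Dn_linear: "Dn n (\<lambda>u. c * F u + H u) xs = c * Dn n F xs + Dn n H xs"
proof (induction n arbitrary: F H xs)
  case (Suc n)
  let ?K = "\<lambda>F xs. case xs of [] \<Rightarrow> 0 | x # r \<Rightarrow> Dn n (\<lambda>u. F (x # u)) r"
  have K: "?K (\<lambda>u. c * F u + H u) = (\<lambda>xs. c * ?K F xs + ?K H xs)"
  proof
    fix xs show "?K (\<lambda>u. c * F u + H u) xs = c * ?K F xs + ?K H xs"
      by (cases xs) (simp_all add: Suc)
  qed
  show ?case unfolding Dn.simps K rot_pow_linear by (simp add: algebra_simps)
qed simp

lemma Dn_zero: "Dn n (\<lambda>u. 0) xs = 0"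
  using Dn_linear[of n "- 1" "\<lambda>u. 0" "\<lambda>u. 0" xs] by simp

lemma mlin_Dn_step:
  assumes "mlin (*) F" and IH: "\<And>F. mlin (*) F \<Longrightarrow> mlin (*) (Dn n F)"
  shows "mlin (*) (\<lambda>xs. case xs of [] \<Rightarrow> 0 | x # r \<Rightarrow> Dn n (\<lambda>u. F (x # u)) r)"
proof (rule mlinI[OF vector_space_mult])
  fix us vs x y c
  note m = IH[OF mlin_Cons[OF assms(1)]]
  have "F ((x + y) # u) = 1 * F (x # u) + F (y # u)" "F ((c *s x) # u) = c * F (x # u) + 0" for u
    using mlin_add[OF assms(1), of "[]"] mlin_scale[OF assms(1), of "[]"] by auto
  then show "(case us @ (x + y) # vs of [] \<Rightarrow> 0 | x # r \<Rightarrow> Dn n (\<lambda>u. F (x # u)) r) =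
      (case us @ x # vs of [] \<Rightarrow> 0 | x # r \<Rightarrow> Dn n (\<lambda>u. F (x # u)) r) +
      (case us @ y # vs of [] \<Rightarrow> 0 | x # r \<Rightarrow> Dn n (\<lambda>u. F (x # u)) r)"
    "(case us @ (c *s x) # vs of [] \<Rightarrow> 0 | x # r \<Rightarrow> Dn n (\<lambda>u. F (x # u)) r) =
      c * (case us @ x # vs of [] \<Rightarrow> 0 | x # r \<Rightarrow> Dn n (\<lambda>u. F (x # u)) r)"
    using mlin_add[OF m] mlin_scale[OF m] by (cases us; simp only: append.simps list.case Dn_linear Dn_zero; simp)+
qed

lemma mlin_Dn: "mlin (*) F \<Longrightarrow> mlin (*) (Dn n F)"
proof (induction n arbitrary: F)
  case (Suc n)
  show ?case unfolding Dn.simps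
    by (intro mlin_minus_fun mlin_rot_pow mlin_Dn_step Suc)
qed simp

lemma mlin_Dy: assumes "mlin (*) F" shows "mlin (*) (Dy F)"
  by (rule mlinI[OF vector_space_mult])
     (simp_all add: Dy_def mlin_add[OF mlin_Dn[OF assms]] mlin_scale[OF mlin_Dn[OF assms]])

lemma Dy_single [simp]: "Dy F [x] = F [x]"
  by (simp add: Dy_def)

text \<open>The outermost commutator puts its letter in front or at the end of the word: this letter
  is \<open>x\<close> or \<open>z\<close>.\<close>

lemma Dy_rec:
  assumes F: "mlin (*) F" and hom: "x \<in> homog" "set m \<subseteq> homog" "z \<in> homog"
  shows "Dy F (x # m @ [z]) = Dy (\<lambda>u. F (x # u)) (m @ [z])
    - ssgn (deg z * ldeg (x # m)) (Dy (\<lambda>u. F (z # u)) (x # m))"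
proof -
  let ?K = "\<lambda>xs. case xs of [] \<Rightarrow> 0 | x # r \<Rightarrow> Dn (length m) (\<lambda>u. F (x # u)) r"
  have K: "mlin (*) ?K" by (intro mlin_Dn_step F mlin_Dn)
  have "(rot ^^ length (x # m)) ?K ((x # m) @ [z]) = ssgn (ldeg (x # m) * ldeg [z]) (?K ([z] @ (x # m)))"
    by (rule rot_pow_block[OF K]) (use hom in auto)
  then have "(rot ^^ Suc (length m)) ?K (x # m @ [z]) = ssgn (deg z * ldeg (x # m)) (Dn (length m) (\<lambda>u. F (z # u)) (x # m))"
    by (simp add: mult.commute del: funpow.simps)
  then show ?thesis unfolding Dy_def by (simp del: funpow.simps)
qed

lemma SH_minus: "SH (\<lambda>u. F u - H u) xs ys = SH F xs ys - SH H xs ys"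
  using SH_add[of F "\<lambda>u. - H u" xs ys] SH_hom[of uminus H xs ys] by simp

text \<open>Iterated brackets are Lie elements, and these are orthogonal to shuffle products. In the
  induction, the parts of \<open>Dy\<close> that remove the first and the last letter shuffle to
  zero as long as both remaining words are non-empty; only boundary terms survive, and those of the
  two parts agree.\<close>

lemma svan_Dy: assumes "mlin (*) F" shows "svan (Dy F)"
  unfolding svan_def
proof (intro allI impI, elim conjE)
  fix xs ys :: "'v list"
  assume "xs \<noteq> []" "ys \<noteq> []" "set xs \<subseteq> homog" "set ys \<subseteq> homog"
  then show "SH (Dy F) xs ys = 0" using assms
  proof (induction "length xs + length ys" arbitrary: F xs ys rule: less_induct)
    case less
    note hom = less.prems(3,4) and F = less.prems(5)
    define K1 where "K1 u = Dy (\<lambda>v. F (hd u # v)) (tl u)" for u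
    define K2 where "K2 u = ssgn (deg (last u) * ldeg (butlast u)) (Dy (\<lambda>v. F (last u # v)) (butlast u))" for u
    have IH: "SH (Dy (\<lambda>v. F (a # v))) us vs = 0"
      if "length us + length vs < length xs + length ys" "us \<noteq> []" "vs \<noteq> []" "set us \<subseteq> homog" "set vs \<subseteq> homog" for a us vs
      by (rule less.hyps[OF that mlin_Cons[OF F]])
    obtain x us where xs: "xs = x # us" using less.prems(1) by (cases xs) auto
    obtain y vs where ys: "ys = y # vs" using less.prems(2) by (cases ys) auto
    obtain us' x' where xs': "xs = us' @ [x']" using less.prems(1) by (cases xs rule: rev_cases) auto
    obtain vs' y' where ys': "ys = vs' @ [y']" using less.prems(2) by (cases ys rule: rev_cases) auto
    have "SH (Dy F) xs ys = SH (\<lambda>u. K1 u - K2 u) xs ys"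
    proof (rule SH_cong)
      fix u assume u: "mset u = mset xs + mset ys"
      have "length u \<ge> 2" using length_mset_append[OF u] by (simp add: xs ys)
      then obtain a m z where amz: "u = a # m @ [z]"
        by (metis Suc_le_length_iff append_butlast_last_id list.distinct(1) numeral_2_eq_2)
      show "Dy F u = K1 u - K2 u"
        using set_mset_append[OF u] hom unfolding amz K1_def K2_def
        by (subst Dy_rec[OF F]) (auto simp: butlast_append)
    qed
    also have "\<dots> = SH K1 xs ys - SH K2 xs ys" by (rule SH_minus)
    also have "SH K1 xs ys = (if us = [] then Dy (\<lambda>v. F (x # v)) ys else 0)
        + (if vs = [] then ssgn (deg y * ldeg xs) (Dy (\<lambda>v. F (y # v)) xs) else 0)"
    proof -
      have "SH K1 xs ys = SH (Dy (\<lambda>v. F (x # v))) us ys + ssgn (deg y * ldeg xs) (SH (Dy (\<lambda>v. F (y # v))) xs vs)"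
        by (simp add: xs ys K1_def)
      moreover have "SH (Dy (\<lambda>v. F (x # v))) us ys = (if us = [] then Dy (\<lambda>v. F (x # v)) ys else 0)"
        using IH[of us ys x] hom less.prems(2) by (auto simp: xs)
      moreover have "SH (Dy (\<lambda>v. F (y # v))) xs vs = (if vs = [] then Dy (\<lambda>v. F (y # v)) xs else 0)"
        using IH[of xs vs y] hom less.prems(1) by (auto simp: ys)
      ultimately show ?thesis by simp
    qed
    also have "SH K2 xs ys = (if us' = [] then Dy (\<lambda>v. F (x' # v)) ys else 0)
        + (if vs' = [] then ssgn (deg y' * ldeg xs) (Dy (\<lambda>v. F (y' # v)) xs) else 0)"
    proof -
      have h: "set us' \<subseteq> homog" "set vs' \<subseteq> homog" using hom xs' ys' by auto
      have 1: "SH (\<lambda>u. K2 (u @ [x'])) us' ys = ssgn (deg x' * (ldeg us' + ldeg ys)) (SH (Dy (\<lambda>v. F (x' # v))) us' ys)"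
        unfolding SH_ssgn[symmetric] by (rule SH_cong) (simp add: K2_def ldeg_mset)
      have 2: "SH (\<lambda>u. K2 (u @ [y'])) xs vs' = ssgn (deg y' * (ldeg xs + ldeg vs')) (SH (Dy (\<lambda>v. F (y' # v))) xs vs')"
        unfolding SH_ssgn[symmetric] by (rule SH_cong) (simp add: K2_def ldeg_mset)
      have "SH K2 xs ys = ssgn (deg x' * ldeg ys) (SH (\<lambda>u. K2 (u @ [x'])) us' ys) + SH (\<lambda>u. K2 (u @ [y'])) xs vs'"
        using SH_snoc[of K2 us' x' vs' y'] by (simp add: xs' ys')
      also have "\<dots> = ssgn (deg x' * ldeg ys) (ssgn (deg x' * (ldeg us' + ldeg ys)) (SH (Dy (\<lambda>v. F (x' # v))) us' ys))
        + ssgn (deg y' * (ldeg xs + ldeg vs')) (SH (Dy (\<lambda>v. F (y' # v))) xs vs')"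
        unfolding 1 2 ..
      also have "\<dots> = (if us' = [] then Dy (\<lambda>v. F (x' # v)) ys else 0)
        + (if vs' = [] then ssgn (deg y' * ldeg xs) (Dy (\<lambda>v. F (y' # v)) xs) else 0)"
      proof (rule arg_cong2[where f = "(+)"])
        show "ssgn (deg x' * ldeg ys) (ssgn (deg x' * (ldeg us' + ldeg ys)) (SH (Dy (\<lambda>v. F (x' # v))) us' ys)) =
          (if us' = [] then Dy (\<lambda>v. F (x' # v)) ys else 0)"
          using IH[of us' ys x'] h hom(2) less.prems(2) by (simp add: xs') (auto simp: ssgn_def)
        show "ssgn (deg y' * (ldeg xs + ldeg vs')) (SH (Dy (\<lambda>v. F (y' # v))) xs vs') =
          (if vs' = [] then ssgn (deg y' * ldeg xs) (Dy (\<lambda>v. F (y' # v)) xs) else 0)"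
          using IH[of xs vs' y'] h hom(1) less.prems(1) by (simp add: ys')
      qed
      finally show ?thesis .
    qed
    finally have eq: "SH (Dy F) xs ys = (if us = [] then Dy (\<lambda>v. F (x # v)) ys else 0)
        + (if vs = [] then ssgn (deg y * ldeg xs) (Dy (\<lambda>v. F (y # v)) xs) else 0)
        - ((if us' = [] then Dy (\<lambda>v. F (x' # v)) ys else 0)
        + (if vs' = [] then ssgn (deg y' * ldeg xs) (Dy (\<lambda>v. F (y' # v)) xs) else 0))" .
    \<comment> \<open>A boundary term occurs only for a word of one letter, whose first and last
      letter coincide; the contributions of \<open>K1\<close> and \<open>K2\<close> then
      cancel.\<close>
    have "us = [] \<longleftrightarrow> us' = []" "us = [] \<Longrightarrow> x' = x" using xs xs' by (cases us'; auto)+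
    moreover have "vs = [] \<longleftrightarrow> vs' = []" "vs = [] \<Longrightarrow> y' = y" using ys ys' by (cases vs'; auto)+
    ultimately show ?case unfolding eq by (cases "us = []"; cases "vs = []") simp_all
  qed
qed

text \<open>The exponent of the sign of the antipode.\<close>

fun asg :: "'v list \<Rightarrow> int" where
  "asg [] = 0"
| "asg (x # w) = 1 + deg x * ldeg w + asg w"

lemma asg_snoc: "asg (w @ [z]) = asg w + 1 + deg z * ldeg w"
  by (induction w) (auto simp: algebra_simps)

lemma sp_Cons_snoc: "sp f (x # m @ [z]) = f [] (x # m @ [z]) + sp (\<lambda>u w. f (x # u) (w @ [z])) m + f (x # m @ [z]) []"
  by (simp add: sp_snoc add.assoc)

text \<open>The antipode property of the shuffle algebra: the convolution of the identity with
  signed reversal vanishes on non-empty words. A shuffle of \<open>x # u\<close> with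
  \<open>z # rev w\<close> starts with \<open>x\<close> or with \<open>z\<close>, which reduces the
  sum to two shorter words.\<close>

lemma antipode: "xs \<noteq> [] \<Longrightarrow> sp (\<lambda>u w. ssgn (asg w) (SH F u (rev w))) xs = 0"
proof (induction "length xs" arbitrary: F xs rule: less_induct)
  case less
  let ?A = "\<lambda>F. sp (\<lambda>u w. ssgn (asg w) (SH F u (rev w)))"
  obtain x r where xs: "xs = x # r" using less.prems by (cases xs) auto
  show ?case
  proof (cases r rule: rev_cases)
    case Nil
    then show ?thesis by (simp add: xs ssgn_def)
  next
    case (snoc m z)
    let ?e = "1 + deg z * ldeg (x # m)"
    have 1: "?A (\<lambda>u. F (x # u)) (m @ [z]) = sp (\<lambda>u w. ssgn (asg (w @ [z])) (SH (\<lambda>u. F (x # u)) u (z # rev w))) m + F (x # m @ [z])"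
      by (simp add: sp_snoc)
    have 2: "?A (\<lambda>u. F (z # u)) (x # m) = ssgn (asg (x # m)) (F (z # rev (x # m)))
        + sp (\<lambda>u w. ssgn (asg w) (SH (\<lambda>u. F (z # u)) (x # u) (rev w))) m"
      by simp
    have "?A F xs = ssgn (asg xs) (F (z # rev (x # m)))
        + sp (\<lambda>u w. ssgn (asg (w @ [z])) (SH (\<lambda>u. F (x # u)) u (z # rev w))
            + ssgn ?e (ssgn (asg w) (SH (\<lambda>u. F (z # u)) (x # u) (rev w)))) m + F xs"
    proof -
      have "?A F xs = ssgn (asg xs) (F (z # rev (x # m)))
        + sp (\<lambda>u w. ssgn (asg (w @ [z])) (SH F (x # u) (z # rev w))) m + F xs"
        unfolding xs snoc sp_Cons_snoc by simp
      also have "sp (\<lambda>u w. ssgn (asg (w @ [z])) (SH F (x # u) (z # rev w))) m =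
        sp (\<lambda>u w. ssgn (asg (w @ [z])) (SH (\<lambda>u. F (x # u)) u (z # rev w))
            + ssgn ?e (ssgn (asg w) (SH (\<lambda>u. F (z # u)) (x # u) (rev w)))) m"
      proof (rule sp_cong)
        fix u w assume "u @ w = m"
        then show "ssgn (asg (w @ [z])) (SH F (x # u) (z # rev w)) =
          ssgn (asg (w @ [z])) (SH (\<lambda>u. F (x # u)) u (z # rev w))
            + ssgn ?e (ssgn (asg w) (SH (\<lambda>u. F (z # u)) (x # u) (rev w)))"
          by (auto simp: ssgn_add asg_snoc algebra_simps intro!: ssgn_cong)
      qed
      finally show ?thesis .
    qed
    also have "\<dots> = ?A (\<lambda>u. F (x # u)) (m @ [z]) + ssgn ?e (?A (\<lambda>u. F (z # u)) (x # m))"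
      unfolding 1 2 sp_add ssgn_add sp_ssgn by (simp add: xs snoc asg_snoc algebra_simps)
    also have "\<dots> = 0" using less.hyps[of "m @ [z]"] less.hyps[of "x # m"] by (simp add: xs snoc)
    finally show ?thesis .
  qed
qed

text \<open>The Dynkin operator is the convolution of multiplication by the length with the
  antipode. The recursion of the sum differs from \<open>Dy_rec\<close> only because
  \<open>length (x # u) = 1 + length u\<close>, and the surplus is the sum that vanishes by
  \<open>antipode\<close>.\<close>

lemma Dy_eq_sum:
  assumes "mlin (*) F" "set xs \<subseteq> homog" "xs \<noteq> []"
  shows "Dy F xs = sp (\<lambda>u w. of_nat (length u) * ssgn (asg w) (SH F u (rev w))) xs"
  using assms
proof (induction "length xs" arbitrary: F xs rule: less_induct)
  case less
  let ?A = "\<lambda>F. sp (\<lambda>u w. ssgn (asg w) (SH F u (rev w)))"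
  let ?T = "\<lambda>F. sp (\<lambda>u w. of_nat (length u) * ssgn (asg w) (SH F u (rev w)) :: 'k)"
  obtain x r where xs: "xs = x # r" using less.prems by (cases xs) auto
  show ?case
  proof (cases r rule: rev_cases)
    case Nil
    then show ?thesis by (simp add: xs)
  next
    case (snoc m z)
    let ?e = "1 + deg z * ldeg (x # m)"
    have 1: "?T (\<lambda>u. F (x # u)) (m @ [z]) + ?A (\<lambda>u. F (x # u)) (m @ [z]) =
        sp (\<lambda>u w. of_nat (length (x # u)) * ssgn (asg (w @ [z])) (SH (\<lambda>u. F (x # u)) u (z # rev w))) m
        + of_nat (length xs) * F xs"
      by (simp add: sp_snoc xs snoc algebra_simps sp_add)
    have 2: "?T (\<lambda>u. F (z # u)) (x # m) =
       sp (\<lambda>u w. of_nat (length (x # u)) * ssgn (asg w) (SH (\<lambda>u. F (z # u)) (x # u) (rev w))) m"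
      by simp
    have "?T F xs = sp (\<lambda>u w. of_nat (length (x # u)) * ssgn (asg (w @ [z])) (SH F (x # u) (z # rev w))) m
        + of_nat (length xs) * F xs"
      unfolding xs snoc sp_Cons_snoc by simp
    also have "sp (\<lambda>u w. of_nat (length (x # u)) * ssgn (asg (w @ [z])) (SH F (x # u) (z # rev w))) m =
        sp (\<lambda>u w. of_nat (length (x # u)) * ssgn (asg (w @ [z])) (SH (\<lambda>u. F (x # u)) u (z # rev w))
          + ssgn ?e (of_nat (length (x # u)) * ssgn (asg w) (SH (\<lambda>u. F (z # u)) (x # u) (rev w)))) m"
    proof (rule sp_cong)
      fix u w assume "u @ w = m"
      then have "ssgn (asg (w @ [z])) (SH F (x # u) (z # rev w)) =
        ssgn (asg (w @ [z])) (SH (\<lambda>u. F (x # u)) u (z # rev w))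
          + ssgn ?e (ssgn (asg w) (SH (\<lambda>u. F (z # u)) (x # u) (rev w)))"
        by (auto simp: ssgn_add asg_snoc algebra_simps intro!: ssgn_cong)
      then show "of_nat (length (x # u)) * ssgn (asg (w @ [z])) (SH F (x # u) (z # rev w)) =
        of_nat (length (x # u)) * ssgn (asg (w @ [z])) (SH (\<lambda>u. F (x # u)) u (z # rev w))
          + ssgn ?e (of_nat (length (x # u)) * ssgn (asg w) (SH (\<lambda>u. F (z # u)) (x # u) (rev w)))"
        by (simp only: distrib_left ssgn_mult_right)
    qed
    also have "\<dots> + of_nat (length xs) * F xs =
        ?T (\<lambda>u. F (x # u)) (m @ [z]) + ?A (\<lambda>u. F (x # u)) (m @ [z]) + ssgn ?e (?T (\<lambda>u. F (z # u)) (x # m))"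
      unfolding 1 2 sp_add sp_ssgn by simp
    also have "?A (\<lambda>u. F (x # u)) (m @ [z]) = 0" by (rule antipode) simp
    also have "?T (\<lambda>u. F (x # u)) (m @ [z]) = Dy (\<lambda>u. F (x # u)) (m @ [z])"
      using less by (intro less.hyps[symmetric] mlin_Cons) (auto simp: xs snoc)
    also have "?T (\<lambda>u. F (z # u)) (x # m) = Dy (\<lambda>u. F (z # u)) (x # m)"
      using less by (intro less.hyps[symmetric] mlin_Cons) (auto simp: xs snoc)
    also have "Dy (\<lambda>u. F (x # u)) (m @ [z]) + 0 + ssgn ?e (Dy (\<lambda>u. F (z # u)) (x # m)) = Dy F xs"
      unfolding xs snoc using less.prems
      by (subst Dy_rec) (auto simp: xs snoc ssgn_def)
    finally show ?thesis by simp
  qed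
qed

text \<open>Every proper cut contributes a shuffle of non-empty words and vanishes, and the cut with
  empty first part has weight 0. The uncut word remains, weighted by its length: the dual form of
  the Dynkin-Specht-Wever theorem.\<close>

lemma Dy_svan:
  assumes "mlin (*) F" "svan F" "set xs \<subseteq> homog" "xs \<noteq> []"
  shows "Dy F xs = of_nat (length xs) * F xs"
proof -
  have "Dy F xs = sp (\<lambda>u w. if w = [] then of_nat (length u) * F u else 0) xs"
    unfolding Dy_eq_sum[OF assms(1,3,4)]
  proof (rule sp_cong)
    fix u w assume uw: "u @ w = xs"
    have "SH F u (rev w) = 0" if "u \<noteq> []" "w \<noteq> []"
      by (rule svanD[OF assms(2)]) (use that uw assms(3) in auto)
    then show "of_nat (length u) * ssgn (asg w) (SH F u (rev w)) = (if w = [] then of_nat (length u) * F u else 0)"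
      by (cases "u = []"; cases "w = []") auto
  qed
  also have "\<dots> = of_nat (length xs) * F xs" by (subst sp_right_empty) auto
  finally show ?thesis .
qed

subsection \<open>Functionals on words modulo shuffles\<close>

lemma extend_cong: "(\<And>a. a \<in> Poly_Mapping.keys p \<Longrightarrow> f a = g a) \<Longrightarrow> extend s f p = extend s g p"
  by (simp add: extend_def)

lemma linear_eq_extend:
  assumes "Vector_Spaces.linear pscale s D" shows "D w = extend s (\<lambda>a. D (Poly_Mapping.single a 1)) w"
proof -
  have "Poly_Mapping.lookup w b = (\<Sum>a\<in>Poly_Mapping.keys w. if a = b then Poly_Mapping.lookup w a else 0)" for b
    by (cases "b \<in> Poly_Mapping.keys w") (auto simp: in_keys_iff)
  then have "w = (\<Sum>a\<in>Poly_Mapping.keys w. pscale (Poly_Mapping.lookup w a) (Poly_Mapping.single a 1))"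
    by (intro poly_mapping_eqI) (simp add: lookup_sum lookup_pscale lookup_single when_def if_distrib cong: if_cong)
  from arg_cong[OF this, of D] show ?thesis
    unfolding linear_sum[OF assms] using assms by (simp add: Vector_Spaces.linear_iff extend_def)
qed

lemma extend_extend:
  assumes "vector_space s" shows "extend s F (extend pscale f w) = extend s (\<lambda>a. extend s F (f a)) w"
proof -
  note L = linear_extend[OF assms, of F]
  show ?thesis
    unfolding extend_def[of pscale] linear_sum[OF L]
    using L by (simp add: Vector_Spaces.linear_iff extend_def[of s "\<lambda>a. extend s F (f a)"])
qed

lemma extend_mult_add: "extend (*) F (p + q) = extend (*) F p + (extend (*) F q :: 'k)"
  and extend_mult_diff: "extend (*) F (p - q) = extend (*) F p - (extend (*) F q :: 'k)"
  and extend_mult_scale: "extend (*) F (pscale c p) = c * (extend (*) F p :: 'k)"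
  using linear_extend[OF vector_space_mult, of F] linear_minus[OF linear_extend[OF vector_space_mult, of F]]
  by (auto simp: Vector_Spaces.linear_iff)

lemma extend_eqI:
  fixes p q :: "'a \<Rightarrow>\<^sub>0 'k"
  assumes "\<And>F :: 'a \<Rightarrow> 'k. extend (*) F p = extend (*) F q" shows "p = q"
proof (rule poly_mapping_eqI)
  fix a
  have "extend (*) (\<lambda>b. if b = a then 1 else 0) p = Poly_Mapping.lookup p a" for p :: "'a \<Rightarrow>\<^sub>0 'k"
  proof -
    let ?S = "insert a (Poly_Mapping.keys p)"
    have "extend (*) (\<lambda>b. if b = a then 1 else 0) p = (\<Sum>b\<in>?S. Poly_Mapping.lookup p b * (if b = a then 1 else 0))"
      by (rule extend_superset[OF vector_space_mult]) auto
    also have "\<dots> = (\<Sum>b\<in>?S. if b = a then Poly_Mapping.lookup p b else 0)"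
      by (rule sum.cong) auto
    finally show ?thesis by simp
  qed
  then show "Poly_Mapping.lookup p a = Poly_Mapping.lookup q a" using assms by metis
qed

lemma extend_pprod:
  fixes F :: "'a \<times> 'b \<Rightarrow> 'k"
  shows "extend (*) F (pprod u v) = extend (*) (\<lambda>a. extend (*) (\<lambda>b. F (a, b)) v) u"
  unfolding pprod_def linear_sum[OF linear_extend[OF vector_space_mult]] extend_single[OF vector_space_mult]
  by (simp add: extend_def sum_distrib_left mult.assoc)

definition word_generators :: "('v list \<Rightarrow>\<^sub>0 'k) set" where
  "word_generators =
     {Poly_Mapping.single (us @ (x + y) # vs) 1 - Poly_Mapping.single (us @ x # vs) 1
        - Poly_Mapping.single (us @ y # vs) 1 | us vs x y i.
        set us \<subseteq> homog \<and> set vs \<subseteq> homog \<and> x \<in> G i \<and> y \<in> G i} \<union>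
     {Poly_Mapping.single (us @ (c *s x) # vs) 1 - Poly_Mapping.single (us @ x # vs) c | us vs x c.
        set us \<subseteq> homog \<and> set vs \<subseteq> homog \<and> x \<in> homog} \<union>
     {sh xs ys | xs ys. xs \<noteq> [] \<and> ys \<noteq> [] \<and> set xs \<subseteq> homog \<and> set ys \<subseteq> homog}"

lemma word_relations_eq: "word_relations = module.span pscale word_generators"
  by (simp only: word_relations_def word_generators_def)

lemma word_relations_kill:
  assumes F: "mlin s F" "svan F" and r: "r \<in> word_relations" shows "extend s F r = 0"
proof (rule linear_span_zero[OF linear_extend[OF mlin_vs[OF F(1)]] r[unfolded word_relations_eq]])
  interpret s: vector_space s by (rule mlin_vs[OF F(1)])
  note L = linear_extend[OF mlin_vs[OF F(1)], of F] and e = extend_single[OF mlin_vs[OF F(1)]]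
  note lm = linear_minus[OF L]
  fix x
  assume "x \<in> word_generators"
  then show "extend s F x = 0"
    using svanD[OF F(2)]
    by (auto simp: word_generators_def lm e mlin_add[OF F(1)] mlin_scale[OF F(1)] extend_sh[OF mlin_vs[OF F(1)]])
qed

text \<open>The relations only involve homogeneous letters, so a functional on words modulo
  relations is multilinear in this restricted sense; \<open>hext\<close> extends it to all
  vectors.\<close>

definition hmlin :: "('v list \<Rightarrow> 'k) \<Rightarrow> bool" where
  "hmlin f \<longleftrightarrow>
     (\<forall>us vs x y i. set us \<subseteq> homog \<and> set vs \<subseteq> homog \<and> x \<in> G i \<and> y \<in> G i \<longrightarrow>
        f (us @ (x + y) # vs) = f (us @ x # vs) + f (us @ y # vs)) \<and>
     (\<forall>us vs c x. set us \<subseteq> homog \<and> set vs \<subseteq> homog \<and> x \<in> homog \<longrightarrow>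
        f (us @ (c *s x) # vs) = c * f (us @ x # vs))"

fun hext :: "('v list \<Rightarrow> 'k) \<Rightarrow> 'v list \<Rightarrow> 'k" where
  "hext f [] = f []"
| "hext f (x # xs) = (\<Sum>i\<in>degrees. hext (\<lambda>u. f (component x i # u)) xs)"

lemma hmlin_Cons: "hmlin f \<Longrightarrow> a \<in> homog \<Longrightarrow> hmlin (\<lambda>u. f (a # u))"
proof -
  assume f: "hmlin f" and a: "a \<in> homog"
  show ?thesis unfolding hmlin_def
  proof (intro conjI allI impI, goal_cases)
    case (1 us vs x y i)
    then show ?case using f[unfolded hmlin_def, THEN conjunct1, rule_format, of "a # us" vs x i y] a by simp
  next
    case (2 us vs c x)
    then show ?case using f[unfolded hmlin_def, THEN conjunct2, rule_format, of "a # us" vs x c] a by simp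
  qed
qed

lemma hext_cong: "(\<And>u. set u \<subseteq> homog \<Longrightarrow> f u = g u) \<Longrightarrow> hext f xs = hext g xs"
proof (induction xs arbitrary: f g)
  case (Cons x xs)
  have "hext (\<lambda>u. f (component x i # u)) xs = hext (\<lambda>u. g (component x i # u)) xs" for i
    by (rule Cons.IH) (rule Cons.prems, simp)
  then show ?case by simp
qed simp

lemma hext_linear: "hext (\<lambda>u. c * f u + g u) xs = c * hext f xs + hext g xs"
  by (induction xs arbitrary: f g) (auto simp: sum.distrib sum_distrib_left)

lemma hext_zero: "hext (\<lambda>u. 0) xs = 0"
  using hext_linear[of "- 1" "\<lambda>u. 0" "\<lambda>u. 0" xs] by simp

lemma mlin_hext: "hmlin f \<Longrightarrow> mlin (*) (hext f)"
proof -
  have "hext f (us @ (x + y) # vs) = hext f (us @ x # vs) + hext f (us @ y # vs) \<and>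
    hext f (us @ (c *s x) # vs) = c * hext f (us @ x # vs)" if "hmlin f" for us vs x y c f
    using that
  proof (induction us arbitrary: f)
    case Nil
    have 1: "hext (\<lambda>u. f ((component x i + component y i) # u)) vs =
      hext (\<lambda>u. 1 * f (component x i # u) + f (component y i # u)) vs" for i
      using Nil[unfolded hmlin_def, THEN conjunct1, rule_format, of "[]" _ "component x i" i "component y i"]
        component_in by (intro hext_cong) auto
    have 2: "hext (\<lambda>u. f ((c *s component x i) # u)) vs = hext (\<lambda>u. c * f (component x i # u) + 0) vs" for i
      using Nil[unfolded hmlin_def, THEN conjunct2, rule_format, of "[]" _ "component x i" c]
      by (intro hext_cong) auto
    show ?case
      by (simp only: append_Nil hext.simps component_add component_scale 1 2 hext_linear hext_zero)
         (simp add: sum.distrib sum_distrib_left)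
  next
    case (Cons a us)
    show ?case
      using Cons.IH[OF hmlin_Cons[OF Cons.prems component_in_homog]] by (simp add: sum.distrib sum_distrib_left)
  qed
  then show "hmlin f \<Longrightarrow> mlin (*) (hext f)" by (intro mlinI vector_space_mult) auto
qed

lemma hext_homog: "hmlin f \<Longrightarrow> set xs \<subseteq> homog \<Longrightarrow> hext f xs = f xs"
proof (induction xs arbitrary: f)
  case (Cons x xs)
  obtain j where j: "x \<in> G j" using Cons.prems(2) by (auto simp: homog_def)
  have zero: "f (0 # u) = 0" if "set u \<subseteq> homog" for u
    using Cons.prems(1)[unfolded hmlin_def, THEN conjunct2, rule_format, of "[]" u x 0] that Cons.prems(2) by simp
  have "hext (\<lambda>u. f (0 # u)) xs = 0"
    using hext_cong[of "\<lambda>u. f (0 # u)" "\<lambda>u. 0" xs] zero by (simp add: hext_zero)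
  then have "hext (\<lambda>u. f (component x i # u)) xs = (if i = j then hext (\<lambda>u. f (x # u)) xs else 0)" for i
    by (simp add: component_homog[OF j])
  moreover have "hext (\<lambda>u. f (x # u)) xs = f (x # xs)"
    using Cons.IH[OF hmlin_Cons[OF Cons.prems(1)]] Cons.prems(2) by simp
  moreover have "f (x # xs) = 0" if "j \<notin> degrees"
  proof -
    have "x = 0" using component_degrees[OF that, of x] by (simp add: component_homog[OF j])
    then show ?thesis using zero[of xs] Cons.prems(2) by simp
  qed
  ultimately show ?case using finite_degrees' by (cases "j \<in> degrees") auto
qed simp

text \<open>If \<open>w\<close> were not a relation, some linear functional would vanish on all
  relations but not on \<open>w\<close>. Restricted to words it is multilinear in homogeneous
  letters and vanishes on shuffles, hence extends to an admissible \<open>F\<close> that does not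
  kill \<open>w\<close>.\<close>

lemma word_relationsI:
  assumes w: "w \<in> hom_words" and kill: "\<And>F. mlin (*) F \<Longrightarrow> svan F \<Longrightarrow> extend (*) F w = (0 :: 'k)"
  shows "w \<in> word_relations"
proof (rule ccontr)
  interpret P: vector_space "pscale :: 'k \<Rightarrow> ('v list \<Rightarrow>\<^sub>0 'k) \<Rightarrow> _" by (rule vector_space_pscale)
  interpret pairing: vector_space_pair "pscale :: 'k \<Rightarrow> ('v list \<Rightarrow>\<^sub>0 'k) \<Rightarrow> _" "(*) :: 'k \<Rightarrow> 'k \<Rightarrow> 'k"
    by (simp add: vector_space_pair_def vector_space_pscale vector_space_mult)
  have WR: "word_relations = P.span word_generators" by (rule word_relations_eq)
  assume nw: "w \<notin> word_relations"
  obtain B where B: "B \<subseteq> word_generators" "P.independent B" "word_generators \<subseteq> P.span B" "P.span B = P.span word_generators"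
    using P.maximal_independent_subset[of word_generators] P.span_mono P.span_span by (metis P.span_eq subset_antisym P.span_superset)
  have wB: "w \<notin> P.span B" using nw B(4) WR by simp
  then have ind: "P.independent (insert w B)" by (rule P.independent_insertI[OF _ B(2)])
  obtain \<phi> where \<phi>: "Vector_Spaces.linear pscale (*) \<phi>" "\<And>x. x \<in> insert w B \<Longrightarrow> \<phi> x = (if x = w then 1 else 0 :: 'k)"
    using pairing.linear_independent_extend[OF ind, of "\<lambda>x. if x = w then 1 else 0"] by blast
  have \<phi>0: "\<phi> r = 0" if "r \<in> word_relations" for r
  proof (rule linear_span_zero[OF \<phi>(1)])
    show "r \<in> P.span B" using that WR B(4) by simp
    show "\<phi> x = 0" if "x \<in> B" for x using \<phi>(2)[of x] that wB P.span_base by auto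
  qed
  \<comment> \<open>The empty word does not occur in \<open>hom_words\<close>; \<open>0\<close> is a
    default value.\<close>
  define f where "f xs = (if xs = [] then 0 else \<phi> (Poly_Mapping.single xs 1))" for xs
  note lm = linear_minus[OF \<phi>(1)]
  have sc: "\<phi> (Poly_Mapping.single xs c) = c * \<phi> (Poly_Mapping.single xs 1)" for xs c
  proof -
    have "Poly_Mapping.single xs c = pscale c (Poly_Mapping.single xs 1)"
      by (rule poly_mapping_eqI) (simp add: lookup_pscale lookup_single when_def)
    then show ?thesis using \<phi>(1) by (simp add: Vector_Spaces.linear_iff)
  qed
  have hm: "hmlin f"
    unfolding hmlin_def
  proof (intro conjI allI impI, goal_cases)
    case (1 us vs x y i)
    then have "Poly_Mapping.single (us @ (x + y) # vs) 1 - Poly_Mapping.single (us @ x # vs) 1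
        - Poly_Mapping.single (us @ y # vs) (1::'k) \<in> word_generators" unfolding word_generators_def by blast
    from \<phi>0[OF P.span_base[OF this, folded WR]] show ?case by (simp add: lm f_def diff_eq_eq add.commute)
  next
    case (2 us vs c x)
    then have "Poly_Mapping.single (us @ (c *s x) # vs) 1 - Poly_Mapping.single (us @ x # vs) c \<in> word_generators"
      unfolding word_generators_def by blast
    from \<phi>0[OF P.span_base[OF this, folded WR]] show ?case by (simp add: lm f_def sc[of _ c])
  qed
  let ?F = "hext f"
  have F: "mlin (*) ?F" by (rule mlin_hext[OF hm])
  have ext: "extend (*) ?F p = \<phi> p" if "p \<in> hom_words" for p
  proof -
    have "?F xs = \<phi> (Poly_Mapping.single xs 1)" if "xs \<in> Poly_Mapping.keys p" for xs
      using hext_homog[OF hm, of xs] \<open>p \<in> hom_words\<close> that by (auto simp: hom_words_def f_def)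
    then show ?thesis unfolding linear_eq_extend[OF \<phi>(1), of p] by (rule extend_cong)
  qed
  have "svan ?F"
    unfolding svan_def
  proof (intro allI impI, elim conjE)
    fix xs ys :: "'v list" assume h: "xs \<noteq> []" "ys \<noteq> []" "set xs \<subseteq> homog" "set ys \<subseteq> homog"
    have "SH ?F xs ys = SH f xs ys"
      using h by (intro SH_cong hext_homog[OF hm]) (auto dest: set_mset_append)
    also have "\<dots> = SH (\<lambda>xs. \<phi> (Poly_Mapping.single xs 1)) xs ys"
      using h by (intro SH_cong) (auto simp: f_def dest: length_mset_append)
    also have "\<dots> = extend (*) (\<lambda>xs. \<phi> (Poly_Mapping.single xs 1)) (sh xs ys)"
      by (rule extend_sh[OF vector_space_mult, symmetric])
    also have "\<dots> = \<phi> (sh xs ys)" by (rule linear_eq_extend[OF \<phi>(1), symmetric])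
    also have "\<dots> = 0"
    proof (rule \<phi>0)
      have "sh xs ys \<in> word_generators" using h unfolding word_generators_def by blast
      then show "sh xs ys \<in> word_relations" unfolding WR by (rule P.span_base)
    qed
    finally show "SH ?F xs ys = 0" .
  qed
  from kill[OF F this] ext[OF w] have "\<phi> w = 0" by simp
  then show False using \<phi>(2)[of w] by simp
qed

subsection \<open>Coderivations\<close>

text \<open>Terms in which a Taylor component vanishes are left out, so that all degrees occurring
  below are the true ones and no relation is needed to see that \<open>codr Q\<close> is a coderivation.\<close>

definition cword :: "('v list \<Rightarrow> 'v) \<Rightarrow> 'v list \<Rightarrow> ('v list \<Rightarrow>\<^sub>0 'k)" where
  "cword Q xs = (if set xs \<subseteq> homog then sp (\<lambda>u r. sp (\<lambda>v w.
     if Q v = 0 then 0 else Poly_Mapping.single (u @ Q v # w) (ksgn (ldeg u))) r) xs else 0)"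

definition codr :: "('v list \<Rightarrow> 'v) \<Rightarrow> ('v list \<Rightarrow>\<^sub>0 'k) \<Rightarrow> ('v list \<Rightarrow>\<^sub>0 'k)" where
  "codr Q = extend pscale (cword Q)"

lemma linear_codr: "Vector_Spaces.linear pscale pscale (codr Q)"
  unfolding codr_def by (rule linear_extend[OF vector_space_pscale])

lemma codr_single: "codr Q (Poly_Mapping.single xs 1) = cword Q xs"
  unfolding codr_def extend_single[OF vector_space_pscale] by (rule poly_mapping_eqI) (simp add: lookup_pscale)

lemma extend_cword:
  assumes s: "vector_space s" and xs: "set xs \<subseteq> homog"
  shows "extend s F (cword Q xs) =
    sp (\<lambda>u r. sp (\<lambda>v w. if Q v = 0 then 0 else ssgn (ldeg u) (F (u @ Q v # w))) r) xs"
proof -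
  interpret s: vector_space s by fact
  have L: "extend s F 0 = 0" "extend s F (p + q) = extend s F p + extend s F q" for p q
    using linear_extend[OF s, of F] linear_0[OF linear_extend[OF s, of F]] by (auto simp: Vector_Spaces.linear_iff)
  have "s (ksgn m) z = ssgn m z" for m z by (simp add: ksgn_def ssgn_def)
  then have "extend s F (if Q v = 0 then 0 else Poly_Mapping.single (u @ Q v # w) (ksgn (ldeg u))) =
    (if Q v = 0 then 0 else ssgn (ldeg u) (F (u @ Q v # w)))" for u v w
    by (simp add: L(1) extend_single[OF s])
  then show ?thesis
    using xs by (simp add: cword_def sp_hom[of "extend s F", OF L] cong: sp_cong_all)
qed

text \<open>The transpose of the coderivation is insertion, so iterates of \<open>codr\<close> can
  be computed with \<open>act\<close>.\<close>

lemma extend_cword_act: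
  assumes F: "mlin s F" and xs: "set xs \<subseteq> homog"
  shows "extend s F (cword Q xs) = act 1 F Q xs"
  unfolding extend_cword[OF mlin_vs[OF F] xs] act_def
proof (rule sp_cong, rule sp_cong)
  fix u r v w assume "u @ r = xs"
  then have "set u \<subseteq> homog" using xs by auto
  then show "(if Q v = 0 then 0 else ssgn (ldeg u) (F (u @ Q v # w))) = F (map (sg 1) u @ Q v # w)"
    using mlin_sg_list[OF F, of u "[]" 1 "Q v # w"] by (simp add: mlin_zero[OF F])
qed

lemma extend_codr:
  assumes F: "mlin s F" and w: "w \<in> hom_words"
  shows "extend s F (codr Q w) = extend s (act 1 F Q) w"
  unfolding codr_def extend_extend[OF mlin_vs[OF F]]
  by (rule extend_cong, rule extend_cword_act[OF F]) (use w in \<open>auto simp: hom_words_def\<close>)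

lemma sp_closed:
  assumes "\<And>x y. P x \<Longrightarrow> P y \<Longrightarrow> P (x + y)" "\<And>u w. u @ w = xs \<Longrightarrow> P (f u w)" shows "P (sp f xs)"
  using assms(2)
proof (induction xs arbitrary: f)
  case (Cons x xs)
  have "P (sp (\<lambda>u. f (x # u)) xs)" by (rule Cons.IH) (rule Cons.prems, simp)
  then show ?case using Cons.prems[of "[]" "x # xs"] assms(1) by simp
qed simp

lemma keys_cword:
  assumes Q: "qdegree 1 Q" and ys: "ys \<in> Poly_Mapping.keys (cword Q xs)"
  shows "ys \<noteq> [] \<and> set ys \<subseteq> homog \<and> ldeg ys = ldeg xs + 1"
proof (cases "set xs \<subseteq> homog")
  case True
  define P where "P p \<longleftrightarrow> (\<forall>ys\<in>Poly_Mapping.keys p. ys \<noteq> [] \<and> set ys \<subseteq> homog \<and> ldeg ys = ldeg xs + 1)"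
    for p :: "'v list \<Rightarrow>\<^sub>0 'k"
  have add: "P (p + q)" if "P p" "P q" for p q
    using that Poly_Mapping.keys_add[of p q] unfolding P_def by blast
  have "P (cword Q xs)"
    unfolding cword_def if_P[OF True]
  proof (rule sp_closed[of P], rule add, assumption, assumption, rule sp_closed[of P], rule add, assumption, assumption)
    fix u r v w assume ur: "u @ r = xs" and vw: "v @ w = r"
    have hom: "set v \<subseteq> homog" "set u \<subseteq> homog" "set w \<subseteq> homog" using True ur vw by auto
    have Qv: "Q v \<in> G (ldeg v + 1 + 1)" using Q hom by (simp add: qdegree_def)
    have "P (Poly_Mapping.single (u @ Q v # w) (ksgn (ldeg u)))" if "Q v \<noteq> 0"
      unfolding P_def using hom G_homog[OF Qv] deg_eq[OF Qv that] ur vw by auto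
    moreover have "P 0" by (simp add: P_def)
    ultimately show "P (if Q v = 0 then 0 else Poly_Mapping.single (u @ Q v # w) (ksgn (ldeg u)))" by simp
  qed
  then show ?thesis using ys by (simp add: P_def)
qed (use ys in \<open>simp add: cword_def\<close>)

lemma hom_words_subspace:
  "0 \<in> hom_words" "p \<in> hom_words \<Longrightarrow> q \<in> hom_words \<Longrightarrow> p + q \<in> hom_words"
  "p \<in> hom_words \<Longrightarrow> pscale c p \<in> hom_words" "p \<in> hom_words \<Longrightarrow> q \<in> hom_words \<Longrightarrow> p - q \<in> hom_words"
proof -
  show "0 \<in> hom_words" by (simp add: hom_words_def)
  have "Poly_Mapping.keys (p - q) \<subseteq> Poly_Mapping.keys p \<union> Poly_Mapping.keys q"
    by (auto simp: in_keys_iff lookup_minus)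
  then show "p \<in> hom_words \<Longrightarrow> q \<in> hom_words \<Longrightarrow> p - q \<in> hom_words" unfolding hom_words_def by blast
  show "p \<in> hom_words \<Longrightarrow> q \<in> hom_words \<Longrightarrow> p + q \<in> hom_words"
    using Poly_Mapping.keys_add[of p q] unfolding hom_words_def by blast
  have "Poly_Mapping.keys (pscale c p) \<subseteq> Poly_Mapping.keys p"
    by (auto simp: in_keys_iff lookup_pscale)
  then show "p \<in> hom_words \<Longrightarrow> pscale c p \<in> hom_words" unfolding hom_words_def by blast
qed

lemma extend_pscale_sum: "extend pscale f w = (\<Sum>a\<in>Poly_Mapping.keys w. pscale (Poly_Mapping.lookup w a) (f a))"
  by (simp add: extend_def)

lemma sum_closed:
  assumes "P 0" "\<And>x y. P x \<Longrightarrow> P y \<Longrightarrow> P (x + y)" "\<And>i. i \<in> I \<Longrightarrow> P (f i)" shows "P (\<Sum>i\<in>I. f i)"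
  using assms by (induction I rule: infinite_finite_induct) auto

lemma codr_hom_words: assumes "qdegree 1 Q" "w \<in> hom_words" shows "codr Q w \<in> hom_words"
  unfolding codr_def extend_pscale_sum
proof (rule sum_closed[where P = "\<lambda>w. w \<in> hom_words"])
  fix xs
  have "cword Q xs \<in> hom_words" using keys_cword[OF assms(1), of _ xs] by (auto simp: hom_words_def)
  then show "pscale (Poly_Mapping.lookup w xs) (cword Q xs) \<in> hom_words" by (rule hom_words_subspace)
qed (rule hom_words_subspace; assumption)+

lemma keys_sum_singles: "xs \<in> Poly_Mapping.keys (Poly_Mapping.single a c) \<Longrightarrow> xs = a"
  by (auto split: if_splits)

lemma sh_hom_words:
  assumes "xs \<noteq> []" "set xs \<subseteq> homog" "set ys \<subseteq> homog" shows "sh xs ys \<in> hom_words"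
  unfolding sh_def
proof (rule sum_closed[where P = "\<lambda>w. w \<in> hom_words"])
  fix \<sigma> assume "\<sigma> \<in> Sh (length xs) (length ys)"
  then have "inv \<sigma> permutes {..<length (xs @ ys)}" by (auto simp: Sh_def permutes_inv)
  then have "mset (permute_list (inv \<sigma>) (xs @ ys)) = mset (xs @ ys)" by (rule mset_permute_list)
  then have "set (permute_list (inv \<sigma>) (xs @ ys)) = set (xs @ ys)" "permute_list (inv \<sigma>) (xs @ ys) \<noteq> []"
    using assms(1) by (metis set_mset_mset, metis append_is_Nil_conv mset_zero_iff)
  then show "Poly_Mapping.single (permute_list (inv \<sigma>) (xs @ ys)) (koszul_sign \<sigma> (xs @ ys)) \<in> hom_words"
    using assms by (auto simp: hom_words_def dest!: keys_sum_singles)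
qed (rule hom_words_subspace; assumption)+

lemma single_hom_words: "xs \<noteq> [] \<Longrightarrow> set xs \<subseteq> homog \<Longrightarrow> Poly_Mapping.single xs c \<in> hom_words"
  by (auto simp: hom_words_def dest!: keys_sum_singles)

lemma word_relations_hom_words: assumes "r \<in> word_relations" shows "r \<in> hom_words"
proof -
  interpret P: vector_space "pscale :: 'k \<Rightarrow> ('v list \<Rightarrow>\<^sub>0 'k) \<Rightarrow> _" by (rule vector_space_pscale)
  have sub: "P.subspace hom_words" by (simp add: P.subspace_def hom_words_subspace)
  have add: "x + y \<in> homog" if "x \<in> G i" "y \<in> G i" for x y i
    using subspace_add[OF subspace_component that] by (rule G_homog)
  have gen: "word_generators \<subseteq> hom_words"
    unfolding word_generators_def
    by (auto intro!: hom_words_subspace(4) single_hom_words sh_hom_words scale_homog intro: G_homog add)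
  show ?thesis
    using assms P.span_minimal[OF gen sub] unfolding word_relations_eq by blast
qed

lemma word_relations_subspace: "module.subspace pscale (word_relations :: ('v list \<Rightarrow>\<^sub>0 'k) set)"
  and pair_relations_subspace: "module.subspace pscale (pair_relations :: ('v list \<times> 'v list \<Rightarrow>\<^sub>0 'k) set)"
proof -
  interpret P: vector_space "pscale :: 'k \<Rightarrow> ('v list \<Rightarrow>\<^sub>0 'k) \<Rightarrow> _" by (rule vector_space_pscale)
  interpret pairing: vector_space "pscale :: 'k \<Rightarrow> ('v list \<times> 'v list \<Rightarrow>\<^sub>0 'k) \<Rightarrow> _" by (rule vector_space_pscale)
  show "P.subspace word_relations" unfolding word_relations_def by (rule P.subspace_span)
  show "pairing.subspace pair_relations" unfolding pair_relations_def by (rule pairing.subspace_span)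
qed

lemma subspace_pscaleD:
  assumes "module.subspace pscale (S :: ('a \<Rightarrow>\<^sub>0 'k) set)"
  shows "0 \<in> S" "p \<in> S \<Longrightarrow> q \<in> S \<Longrightarrow> p + q \<in> S" "p \<in> S \<Longrightarrow> pscale c p \<in> S" "p \<in> S \<Longrightarrow> q \<in> S \<Longrightarrow> p - q \<in> S"
proof -
  interpret P: vector_space "pscale :: 'k \<Rightarrow> ('a \<Rightarrow>\<^sub>0 'k) \<Rightarrow> _" by (rule vector_space_pscale)
  show "0 \<in> S" "p \<in> S \<Longrightarrow> q \<in> S \<Longrightarrow> p + q \<in> S" "p \<in> S \<Longrightarrow> pscale c p \<in> S" "p \<in> S \<Longrightarrow> q \<in> S \<Longrightarrow> p - q \<in> S"
    by (rule P.subspace_0[OF assms] P.subspace_add[OF assms] P.subspace_scale[OF assms]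
        P.subspace_diff[OF assms]; assumption)+
qed

definition good_family :: "('v list \<Rightarrow> 'v) \<Rightarrow> bool" where
  "good_family Q \<longleftrightarrow> mlin scale Q \<and> svan Q \<and> Q [] = 0 \<and> qdegree 1 Q"

text \<open>Tested against functionals: insertion of \<open>Q\<close> preserves multilinearity and
  vanishing on shuffles.\<close>

lemma codr_word_relations:
  assumes Q: "good_family Q" and r: "r \<in> word_relations" shows "codr Q r \<in> word_relations"
proof (rule word_relationsI)
  have hr: "r \<in> hom_words" by (rule word_relations_hom_words[OF r])
  show "codr Q r \<in> hom_words" using Q hr by (intro codr_hom_words) (auto simp: good_family_def)
  fix F :: "'v list \<Rightarrow> 'k" assume F: "mlin (*) F" "svan F"
  show "extend (*) F (codr Q r) = 0"
    unfolding extend_codr[OF F(1) hr]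
    using Q by (intro word_relations_kill[OF _ _ r] mlin_act svan_act F) (auto simp: good_family_def intro: F)
qed

lemma cobracket_eq_sp:
  fixes F :: "'v list \<times> 'v list \<Rightarrow> 'k"
  shows "extend (*) F (cobracket w) = extend (*) (sp (\<lambda>a c.
    if a = [] \<or> c = [] then 0 else F (a, c) - ssgn (ldeg a * ldeg c) (F (c, a)))) w"
proof -
  have "extend (*) F (\<Sum>j=1..<length xs. Poly_Mapping.single (take j xs, drop j xs) 1
     - Poly_Mapping.single (drop j xs, take j xs) (ksgn (ldeg (take j xs) * ldeg (drop j xs)))) =
    sp (\<lambda>a c. if a = [] \<or> c = [] then 0 else F (a, c) - ssgn (ldeg a * ldeg c) (F (c, a))) xs" for xs
  proof -
    have "extend (*) F (\<Sum>j=1..<length xs. Poly_Mapping.single (take j xs, drop j xs) 1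
       - Poly_Mapping.single (drop j xs, take j xs) (ksgn (ldeg (take j xs) * ldeg (drop j xs)))) =
      (\<Sum>j=1..<length xs. F (take j xs, drop j xs) - ssgn (ldeg (take j xs) * ldeg (drop j xs)) (F (drop j xs, take j xs)))"
      unfolding linear_sum[OF linear_extend[OF vector_space_mult]] extend_mult_diff extend_single[OF vector_space_mult]
      by (simp add: ksgn_mult_left)
    also have "\<dots> = (\<Sum>j\<le>length xs. if take j xs = [] \<or> drop j xs = [] then 0 else
        F (take j xs, drop j xs) - ssgn (ldeg (take j xs) * ldeg (drop j xs)) (F (drop j xs, take j xs)))"
      by (rule sum.mono_neutral_cong_left) auto
    finally show ?thesis unfolding sp_eq_sum .
  qed
  then show ?thesis unfolding cobracket_def extend_extend[OF vector_space_mult] by simp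
qed

lemma extend_pair_action:
  fixes F :: "'v list \<times> 'v list \<Rightarrow> 'k"
  shows "extend (*) F (pair_action m D p) = extend (*) (\<lambda>(a, c).
    extend (*) (\<lambda>x. F (x, c)) (D (Poly_Mapping.single a 1))
    + ssgn (m * ldeg a) (extend (*) (\<lambda>y. F (a, y)) (D (Poly_Mapping.single c 1)))) p"
  unfolding pair_action_def extend_extend[OF vector_space_mult]
  by (rule extend_cong)
     (auto simp: extend_mult_add extend_mult_scale extend_pprod extend_single[OF vector_space_mult] ksgn_mult_left)

text \<open>The inserted letter ends up in one of the two parts of a cut, and \<open>codr Q\<close>
  then acts on that part. The equality already holds for representatives, before passing to the
  quotient.\<close>

lemma cobracket_codr:
  assumes Q: "good_family Q" and w: "w \<in> hom_words"
  shows "cobracket (codr Q w) = pair_action 1 (codr Q) (cobracket w)"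
proof (rule extend_eqI)
  fix F :: "'v list \<times> 'v list \<Rightarrow> 'k"
  define c where "c a d = (if a = [] \<or> d = [] then 0 else F (a, d) - ssgn (ldeg a * ldeg d) (F (d, a)))" for a d
  have Q0: "Q [] = 0" and Qd: "qdegree 1 Q" using Q by (auto simp: good_family_def)
  \<comment> \<open>\<open>L a d\<close> inserts \<open>Q\<close> into the first factor
    \<open>a\<close>, and \<open>R d a\<close> inserts it into the second factor
    \<open>a\<close>.\<close>
  define L where "L a d = sp (\<lambda>u r. sp (\<lambda>v w. if Q v = 0 then 0 else ssgn (ldeg u) (F (u @ Q v # w, d))) r) a" for a d
  define R where "R d a = sp (\<lambda>u r. sp (\<lambda>v w. if Q v = 0 then 0 else ssgn (ldeg u) (F (d, u @ Q v # w))) r) a" for a d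
  have "extend (*) F (cobracket (codr Q w)) = extend (*) (sp c) (codr Q w)"
    unfolding cobracket_eq_sp c_def ..
  also have "\<dots> = extend (*) (\<lambda>xs. extend (*) (sp c) (cword Q xs)) w"
    unfolding codr_def by (rule extend_extend[OF vector_space_mult])
  also have "\<dots> = extend (*) (sp (\<lambda>a d. if a = [] \<or> d = [] then 0 else
      (L a d + ssgn (ldeg a) (R a d)) - ssgn (ldeg a * ldeg d) (L d a + ssgn (ldeg d) (R d a)))) w"
  proof (rule extend_cong)
    fix xs assume "xs \<in> Poly_Mapping.keys w"
    then have xs: "set xs \<subseteq> homog" using w by (auto simp: hom_words_def)
    \<comment> \<open>The case \<open>Q v = 0\<close> is kept together with the sign, because
      \<open>deg (Q v)\<close> is known to be \<open>ldeg v + 1\<close> only for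
      \<open>Q v \<noteq> 0\<close>.\<close>
    define f where "f u v x = (if Q v = 0 then 0 else ssgn (ldeg u) x)" for u v and x :: 'k
    have f_add: "f u v (x + y) = f u v x + f u v y" for u v x y by (simp add: f_def ssgn_add)
    have f_0: "f u v 0 = 0" for u v by (simp add: f_def)
    have f_sp: "f u v (sp h zs) = sp (\<lambda>a b. f u v (h a b)) zs" for u v h and zs :: "'v list"
      by (rule sp_hom) (simp add: f_def, rule f_add)
    have "extend (*) (sp c) (cword Q xs) = sp (\<lambda>u r. sp (\<lambda>v w. f u v (sp c (u @ Q v # w))) r) xs"
      unfolding extend_cword[OF vector_space_mult xs] f_def ..
    also have "\<dots> = sp (\<lambda>u r. sp (\<lambda>v w. sp (\<lambda>a d. f u v (c a (d @ Q v # w))) u) r) xs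
       + sp (\<lambda>u r. sp (\<lambda>v w. sp (\<lambda>a d. f u v (c (u @ Q v # a) d)) w) r) xs"
      by (simp add: sp_insert f_add f_sp sp_add cong: sp_cong_all)
    \<comment> \<open>Cuts before the inserted letter, which thus lies in the second part.\<close>
    also have "sp (\<lambda>u r. sp (\<lambda>v w. sp (\<lambda>a d. f u v (c a (d @ Q v # w))) u) r) xs =
      sp (\<lambda>a R. sp (\<lambda>d r. sp (\<lambda>v w. f (a @ d) v (c a (d @ Q v # w))) r) R) xs"
    proof -
      have "sp (\<lambda>u r. sp (\<lambda>v w. sp (\<lambda>a d. f u v (c a (d @ Q v # w))) u) r) xs =
        sp (\<lambda>u r. sp (\<lambda>a d. sp (\<lambda>v w. f u v (c a (d @ Q v # w))) r) u) xs"
        by (rule sp_cong_all, rule sp_swap)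
      also have "\<dots> = sp (\<lambda>u r. sp (\<lambda>a d. sp (\<lambda>v w. f (a @ d) v (c a (d @ Q v # w))) r) u) xs"
        by (rule sp_cong_all, rule sp_cong) simp
      also have "\<dots> = sp (\<lambda>a R. sp (\<lambda>d r. sp (\<lambda>v w. f (a @ d) v (c a (d @ Q v # w))) r) R) xs"
        by (rule sp_assoc[symmetric])
      finally show ?thesis .
    qed
    also have "\<dots> = sp (\<lambda>a d. if a = [] \<or> d = [] then 0 else
        ssgn (ldeg a) (R a d) - ssgn (ldeg a * ldeg d) (L d a)) xs"
    proof (rule sp_cong)
      fix a d assume ad: "a @ d = xs"
      have d: "set d \<subseteq> homog" using ad xs by auto
      have "sp (\<lambda>u r. sp (\<lambda>v w. f (a @ u) v (c a (u @ Q v # w))) r) d =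
        (if a = [] then 0 else ssgn (ldeg a) (R a d) - ssgn (ldeg a * ldeg d) (L d a))"
      proof (cases "a = []")
        case False
        have "f (a @ u) v (c a (u @ Q v # w)) =
          ssgn (ldeg a) (if Q v = 0 then 0 else ssgn (ldeg u) (F (a, u @ Q v # w)))
          - ssgn (ldeg a * ldeg d) (if Q v = 0 then 0 else ssgn (ldeg u) (F (u @ Q v # w, a)))"
          if "u @ v @ w = d" for u v w
        proof (cases "Q v = 0")
          case Qv: False
          have "set v \<subseteq> homog" using d that by auto
          then have "deg (Q v) = ldeg v + 1"
            using Qd Qv deg_eq[of "Q v" "ldeg v + 1 + 1"] by (simp add: qdegree_def)
          then show ?thesis using Qv False that
            by (auto simp: f_def c_def ssgn_diff intro!: ssgn_cong)
        qed (simp add: f_def)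
        then have "sp (\<lambda>u r. sp (\<lambda>v w. f (a @ u) v (c a (u @ Q v # w))) r) d =
          sp (\<lambda>u r. sp (\<lambda>v w. ssgn (ldeg a) (if Q v = 0 then 0 else ssgn (ldeg u) (F (a, u @ Q v # w)))
          - ssgn (ldeg a * ldeg d) (if Q v = 0 then 0 else ssgn (ldeg u) (F (u @ Q v # w, a)))) r) d"
          by (intro sp_cong) auto
        then show ?thesis using False by (simp add: R_def L_def sp_diff sp_ssgn cong: sp_cong_all)
      qed (simp add: c_def f_0 cong: sp_cong_all)
      moreover have "R a [] = 0" "L [] a = 0" by (auto simp: R_def L_def Q0)
      ultimately show "sp (\<lambda>u r. sp (\<lambda>v w. f (a @ u) v (c a (u @ Q v # w))) r) d =
        (if a = [] \<or> d = [] then 0 else ssgn (ldeg a) (R a d) - ssgn (ldeg a * ldeg d) (L d a))"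
        by auto
    qed
    \<comment> \<open>Cuts after the inserted letter, which thus lies in the first part.\<close>
    also have "sp (\<lambda>u r. sp (\<lambda>v w. sp (\<lambda>a d. f u v (c (u @ Q v # a) d)) w) r) xs =
      sp (\<lambda>A d. sp (\<lambda>u r. sp (\<lambda>v a. f u v (c (u @ Q v # a) d)) r) A) xs"
    proof -
      have "sp (\<lambda>A d. sp (\<lambda>u r. sp (\<lambda>v a. f u v (c (u @ Q v # a) d)) r) A) xs =
        sp (\<lambda>u R. sp (\<lambda>r d. sp (\<lambda>v a. f u v (c (u @ Q v # a) d)) r) R) xs"
        by (rule sp_assoc[symmetric])
      also have "\<dots> = sp (\<lambda>u R. sp (\<lambda>v w. sp (\<lambda>a d. f u v (c (u @ Q v # a) d)) w) R) xs"
        by (rule sp_cong_all, rule sp_assoc[symmetric])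
      finally show ?thesis by (simp add: f_def)
    qed
    also have "\<dots> = sp (\<lambda>a d. if a = [] \<or> d = [] then 0 else
        L a d - ssgn (ldeg a * ldeg d) (ssgn (ldeg d) (R d a))) xs"
    proof (rule sp_cong)
      fix a d assume ad: "a @ d = xs"
      have a: "set a \<subseteq> homog" using ad xs by auto
      have "sp (\<lambda>u r. sp (\<lambda>v w. f u v (c (u @ Q v # w) d)) r) a =
        (if d = [] then 0 else L a d - ssgn (ldeg a * ldeg d) (ssgn (ldeg d) (R d a)))"
      proof (cases "d = []")
        case False
        have "f u v (c (u @ Q v # w) d) = (if Q v = 0 then 0 else ssgn (ldeg u) (F (u @ Q v # w, d)))
          - ssgn (ldeg a * ldeg d) (ssgn (ldeg d) (if Q v = 0 then 0 else ssgn (ldeg u) (F (d, u @ Q v # w))))"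
          if "u @ v @ w = a" for u v w
        proof (cases "Q v = 0")
          case Qv: False
          have "set v \<subseteq> homog" using a that by auto
          then have "deg (Q v) = ldeg v + 1"
            using Qd Qv deg_eq[of "Q v" "ldeg v + 1 + 1"] by (simp add: qdegree_def)
          then show ?thesis using Qv False that
            by (auto simp: f_def c_def ssgn_diff algebra_simps intro!: ssgn_cong)
        qed (simp add: f_def)
        then have "sp (\<lambda>u r. sp (\<lambda>v w. f u v (c (u @ Q v # w) d)) r) a =
          sp (\<lambda>u r. sp (\<lambda>v w. (if Q v = 0 then 0 else ssgn (ldeg u) (F (u @ Q v # w, d)))
          - ssgn (ldeg a * ldeg d) (ssgn (ldeg d) (if Q v = 0 then 0 else ssgn (ldeg u) (F (d, u @ Q v # w))))) r) a"
          by (intro sp_cong) auto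
        then show ?thesis using False by (simp add: R_def L_def sp_diff sp_ssgn cong: sp_cong_all)
      qed (simp add: c_def f_0 cong: sp_cong_all)
      moreover have "R d [] = 0" "L [] d = 0" by (auto simp: R_def L_def Q0)
      ultimately show "sp (\<lambda>u r. sp (\<lambda>v w. f u v (c (u @ Q v # w) d)) r) a =
        (if a = [] \<or> d = [] then 0 else L a d - ssgn (ldeg a * ldeg d) (ssgn (ldeg d) (R d a)))"
        by auto
    qed
    finally show "extend (*) (sp c) (cword Q xs) = sp (\<lambda>a d. if a = [] \<or> d = [] then 0 else
      (L a d + ssgn (ldeg a) (R a d)) - ssgn (ldeg a * ldeg d) (L d a + ssgn (ldeg d) (R d a))) xs"
      unfolding sp_add[symmetric] by (rule trans) (rule sp_cong_all, simp add: ssgn_add)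
  qed
  also have "\<dots> = extend (*) F (pair_action 1 (codr Q) (cobracket w))"
    unfolding extend_pair_action cobracket_eq_sp codr_single
  proof (rule extend_cong)
    fix xs assume "xs \<in> Poly_Mapping.keys w"
    then have xs: "set xs \<subseteq> homog" using w by (auto simp: hom_words_def)
    show "sp (\<lambda>a d. if a = [] \<or> d = [] then 0 else
      (L a d + ssgn (ldeg a) (R a d)) - ssgn (ldeg a * ldeg d) (L d a + ssgn (ldeg d) (R d a))) xs =
      sp (\<lambda>a d. if a = [] \<or> d = [] then 0
        else (case (a, d) of (a, d) \<Rightarrow> extend (*) (\<lambda>x. F (x, d)) (cword Q a)
            + ssgn (1 * ldeg a) (extend (*) (\<lambda>y. F (a, y)) (cword Q d)))
          - ssgn (ldeg a * ldeg d) (case (d, a) of (a, d) \<Rightarrow> extend (*) (\<lambda>x. F (x, d)) (cword Q a)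
            + ssgn (1 * ldeg a) (extend (*) (\<lambda>y. F (a, y)) (cword Q d)))) xs"
    proof (rule sp_cong)
      fix a d assume "a @ d = xs"
      then have "set a \<subseteq> homog" "set d \<subseteq> homog" using xs by auto
      note e = extend_cword[OF vector_space_mult this(1)] extend_cword[OF vector_space_mult this(2)]
      show "(if a = [] \<or> d = [] then 0 else
        (L a d + ssgn (ldeg a) (R a d)) - ssgn (ldeg a * ldeg d) (L d a + ssgn (ldeg d) (R d a))) =
        (if a = [] \<or> d = [] then 0
        else (case (a, d) of (a, d) \<Rightarrow> extend (*) (\<lambda>x. F (x, d)) (cword Q a)
            + ssgn (1 * ldeg a) (extend (*) (\<lambda>y. F (a, y)) (cword Q d)))
          - ssgn (ldeg a * ldeg d) (case (d, a) of (a, d) \<Rightarrow> extend (*) (\<lambda>x. F (x, d)) (cword Q a)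
            + ssgn (1 * ldeg a) (extend (*) (\<lambda>y. F (a, y)) (cword Q d))))"
        by (simp add: e L_def R_def)
    qed
  qed
  finally show "extend (*) F (cobracket (codr Q w)) = extend (*) F (pair_action 1 (codr Q) (cobracket w))" .
qed

lemma coderivation_codr: assumes Q: "good_family Q" shows "coderivation 1 (codr Q)"
proof -
  have Qd: "qdegree 1 Q" using Q by (simp add: good_family_def)
  have "\<exists>w\<in>hom_words. (\<forall>ys\<in>Poly_Mapping.keys w. ldeg ys = ldeg xs + 1) \<and>
      codr Q (Poly_Mapping.single xs 1) - w \<in> word_relations" if "xs \<noteq> [] \<and> set xs \<subseteq> homog" for xs
  proof (intro bexI conjI)
    show "codr Q (Poly_Mapping.single xs 1) - cword Q xs \<in> word_relations"
      by (simp add: codr_single subspace_pscaleD(1)[OF word_relations_subspace])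
  qed (use keys_cword[OF Qd, of _ xs] in \<open>auto simp: hom_words_def\<close>)
  then have "map_of_degree 1 (codr Q)"
    unfolding map_of_degree_def
    using linear_codr codr_hom_words[OF Qd] codr_word_relations[OF Q] by blast
  then show ?thesis
    unfolding coderivation_def
    by (simp add: cobracket_codr[OF Q] subspace_pscaleD(1)[OF pair_relations_subspace])
qed

lemma extend_swap:
  fixes F :: "'a \<Rightarrow> 'b \<Rightarrow> 'k"
  shows "extend (*) (\<lambda>a. extend (*) (F a) v) u = extend (*) (\<lambda>b. extend (*) (\<lambda>a. F a b) u) v"
  unfolding extend_def sum_distrib_left by (subst sum.swap) (simp add: mult.left_commute)

lemma extend_zero: "(\<And>a. a \<in> Poly_Mapping.keys p \<Longrightarrow> F a = 0) \<Longrightarrow> extend (*) F p = (0 :: 'k)"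
  by (simp add: extend_def)

lemma pair_relations_kill:
  fixes F :: "'v list \<times> 'v list \<Rightarrow> 'k"
  assumes left: "\<And>c. c \<noteq> [] \<Longrightarrow> set c \<subseteq> homog \<Longrightarrow> mlin (*) (\<lambda>a. F (a, c)) \<and> svan (\<lambda>a. F (a, c))"
    and right: "\<And>a. a \<noteq> [] \<Longrightarrow> set a \<subseteq> homog \<Longrightarrow> mlin (*) (\<lambda>c. F (a, c)) \<and> svan (\<lambda>c. F (a, c))"
    and p: "p \<in> pair_relations"
  shows "extend (*) F p = 0"
proof (rule linear_span_zero[OF linear_extend[OF vector_space_mult] p[unfolded pair_relations_def]])
  fix x assume "x \<in> {pprod r w | r w. r \<in> word_relations \<and> w \<in> hom_words} \<union>
    {pprod w r | r w. r \<in> word_relations \<and> w \<in> hom_words}"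
  then obtain r w where rw: "r \<in> word_relations" "w \<in> hom_words" "x = pprod r w \<or> x = pprod w r" by blast
  have w: "c \<noteq> []" "set c \<subseteq> homog" if "c \<in> Poly_Mapping.keys w" for c
    using rw(2) that by (auto simp: hom_words_def)
  have "extend (*) F (pprod r w) = extend (*) (\<lambda>c. extend (*) (\<lambda>a. F (a, c)) r) w"
    unfolding extend_pprod by (rule extend_swap)
  also have "\<dots> = 0"
    by (rule extend_zero, rule word_relations_kill[OF _ _ rw(1)]) (use left w in blast)+
  finally have "extend (*) F (pprod r w) = 0" .
  moreover have "extend (*) F (pprod w r) = 0"
    unfolding extend_pprod
    by (rule extend_zero, rule word_relations_kill[OF _ _ rw(1)]) (use right w in blast)+
  ultimately show "extend (*) F x = 0" using rw(3) by auto
qed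

lemma svan_short: assumes "\<And>u. length u \<ge> 2 \<Longrightarrow> F u = 0" shows "svan F"
  unfolding svan_def
proof (intro allI impI, elim conjE)
  fix xs ys :: "'v list" assume "xs \<noteq> []" "ys \<noteq> []"
  then have "SH F xs ys = SH (\<lambda>u. 0) xs ys"
  proof (intro SH_cong assms)
    fix u assume "mset u = mset xs + mset ys"
    from length_mset_append[OF this] have "length u = length xs + length ys" .
    moreover have "length xs \<ge> 1" "length ys \<ge> 1" using \<open>xs \<noteq> []\<close> \<open>ys \<noteq> []\<close> by (simp_all add: Suc_le_eq)
    ultimately show "2 \<le> length u" by simp
  qed
  then show "SH F xs ys = 0" by (simp add: SH_zero)
qed

text \<open>On words of length at least 2, a functional vanishing on shuffles factors through the cobracket,
  because it is the image under \<open>Dy\<close> of a rescaling of itself.\<close>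

lemma cobracket_kernel:
  assumes u: "u \<in> hom_words" and pr: "cobracket u \<in> pair_relations" and pV: "proj_V u = 0"
  shows "u \<in> word_relations"
proof (rule word_relationsI[OF u])
  fix F :: "'v list \<Rightarrow> 'k" assume F: "mlin (*) F" "svan F"
  \<comment> \<open>Division by the length inverts the factor in \<open>Dy_svan\<close>. On the
    empty list the inverse is \<open>0\<close>, which is harmless because \<open>u\<close> contains
    no empty word.\<close>
  define H where "H xs = inverse (of_nat (length xs)) * F xs" for xs
  have H: "mlin (*) H" unfolding H_def by (rule mlin_length_scale[OF F(1)])
  have "svan H"
    unfolding svan_def
  proof (intro allI impI, elim conjE)
    fix xs ys :: "'v list" assume h: "xs \<noteq> []" "ys \<noteq> []" "set xs \<subseteq> homog" "set ys \<subseteq> homog"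
    have "SH H xs ys = SH (\<lambda>u. inverse (of_nat (length xs + length ys)) * F u) xs ys"
      by (rule SH_cong) (simp add: H_def length_mset_append)
    also have "\<dots> = inverse (of_nat (length xs + length ys)) * SH F xs ys"
      by (rule SH_hom[symmetric]) (auto simp: algebra_simps)
    finally show "SH H xs ys = 0" using svanD[OF F(2) h] by simp
  qed
  then have HF: "Dy H xs = F xs" if "set xs \<subseteq> homog" "xs \<noteq> []" for xs
    using Dy_svan[OF H _ that] that(2) by (simp add: H_def)
  \<comment> \<open>Composed with the cobracket, \<open>K\<close> leaves only the cuts after the
    first and before the last letter, and these give the two terms of \<open>Dy_rec\<close>.\<close>
  define K where "K = (\<lambda>(a, c). if length a = 1 then Dy (\<lambda>v. H (hd a # v)) c else 0)"
  have lin: "Vector_Spaces.linear scale (*) (\<lambda>x. Dy (\<lambda>v. H (x # v)) c)" for c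
  proof -
    have "H ((x + y) # v) = 1 * H (x # v) + H (y # v)" "H ((k *s x) # v) = k * H (x # v) + 0" for x y v k
      using mlin_add[OF H, of "[]"] mlin_scale[OF H, of "[]"] by auto
    then show ?thesis
      by (simp only: Vector_Spaces.linear_iff vector_space_axioms vector_space_mult Dy_def Dn_linear Dn_zero) simp
  qed
  have K0: "extend (*) K (cobracket u) = 0"
  proof (rule pair_relations_kill[OF _ _ pr])
    fix c :: "'v list"
    have "(\<lambda>a. K (a, c)) = vec_form (\<lambda>x. Dy (\<lambda>v. H (x # v)) c)"
      by (auto simp: K_def vec_form_def)
    then show "mlin (*) (\<lambda>a. K (a, c)) \<and> svan (\<lambda>a. K (a, c))"
      using cyclic_formsD(1)[OF vec_form_cyclic[OF lin]] by (auto intro!: svan_short simp: vec_form_def)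
  next
    fix a :: "'v list"
    show "mlin (*) (\<lambda>c. K (a, c)) \<and> svan (\<lambda>c. K (a, c))"
    proof (cases "length a = 1")
      case True
      have "mlin (*) (\<lambda>v. H (hd a # v))" by (rule mlin_Cons[OF H])
      then show ?thesis using mlin_Dy svan_Dy True by (simp add: K_def)
    next
      case False
      then show ?thesis by (simp add: K_def mlin_zero_fun[OF vector_space_mult] svan_short)
    qed
  qed
  have K: "sp (\<lambda>a c. if a = [] \<or> c = [] then 0 else K (a, c) - ssgn (ldeg a * ldeg c) (K (c, a))) xs =
      (if length xs = 1 then 0 else F xs)" if xs: "xs \<noteq> []" "set xs \<subseteq> homog" for xs
  proof -
    obtain x r where xr: "xs = x # r" using xs(1) by (cases xs) auto
    show ?thesis
    proof (cases r rule: rev_cases)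
      case Nil
      then show ?thesis by (simp add: xr)
    next
      case (snoc m z)
      have "sp (\<lambda>a c. if a = [] \<or> c = [] then 0 else K (a, c) - ssgn (ldeg a * ldeg c) (K (c, a))) xs =
        sp (\<lambda>u w. K (x # u, w @ [z])) m - sp (\<lambda>u w. ssgn (ldeg (x # u) * ldeg (w @ [z])) (K (w @ [z], x # u))) m"
        unfolding xr snoc sp_Cons_snoc by (simp add: sp_diff)
      also have "sp (\<lambda>u w. K (x # u, w @ [z])) m = Dy (\<lambda>v. H (x # v)) (m @ [z])"
        by (subst sp_left_empty) (auto simp: K_def)
      also have "sp (\<lambda>u w. ssgn (ldeg (x # u) * ldeg (w @ [z])) (K (w @ [z], x # u))) m =
          ssgn (deg z * ldeg (x # m)) (Dy (\<lambda>v. H (z # v)) (x # m))"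
        by (subst sp_right_empty) (auto simp: K_def mult.commute)
      also have "Dy (\<lambda>v. H (x # v)) (m @ [z]) - ssgn (deg z * ldeg (x # m)) (Dy (\<lambda>v. H (z # v)) (x # m)) = Dy H xs"
        unfolding xr snoc by (rule Dy_rec[OF H, symmetric]) (use xs xr snoc in auto)
      finally show ?thesis using HF xs by (simp add: xr snoc)
    qed
  qed
  \<comment> \<open>Words of one letter have zero cobracket; their contribution is read off from
    \<open>proj_V u\<close>.\<close>
  have "extend (*) F u = extend (*) (\<lambda>xs. (if length xs = 1 then 0 else F xs) + (if length xs = 1 then F [hd xs] else 0)) u"
  proof (rule extend_cong)
    fix xs :: "'v list"
    show "F xs = (if length xs = 1 then 0 else F xs) + (if length xs = 1 then F [hd xs] else 0)"
      by (cases xs) auto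
  qed
  also have "\<dots> = extend (*) (\<lambda>xs. if length xs = 1 then 0 else F xs) u
      + extend (*) (\<lambda>xs. if length xs = 1 then F [hd xs] else 0) u"
    by (simp add: extend_def sum.distrib distrib_left)
  also have "extend (*) (\<lambda>xs. if length xs = 1 then 0 else F xs) u = extend (*) K (cobracket u)"
    unfolding cobracket_eq_sp by (rule extend_cong, rule K[symmetric]) (use u in \<open>auto simp: hom_words_def\<close>)
  also have "extend (*) (\<lambda>xs. if length xs = 1 then F [hd xs] else 0) u = F [proj_V u]"
  proof -
    have L: "Vector_Spaces.linear scale (*) (\<lambda>x. F [x])" using mlinD[OF F(1), of "[]" "[]"] by simp
    have "F [proj_V u] = (\<Sum>a\<in>Poly_Mapping.keys u. F [Poly_Mapping.lookup u a *s (if length a = 1 then hd a else 0)])"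
      unfolding proj_V_def extend_def by (rule linear_sum[OF L])
    also have "\<dots> = (\<Sum>a\<in>Poly_Mapping.keys u. Poly_Mapping.lookup u a * (if length a = 1 then F [hd a] else 0))"
      using L linear_0[OF L] by (intro sum.cong) (auto simp: Vector_Spaces.linear_iff)
    finally show ?thesis by (simp add: extend_def)
  qed
  finally show "extend (*) F u = 0" using K0 pV mlin_zero[OF F(1), of "[]" "[]"] by simp
qed

subsection \<open>Taylor components determine a coderivation\<close>

lemma mlin_proj: "mlin scale (\<lambda>xs. if length xs = 1 then hd xs else 0)"
proof (rule mlinI[OF vector_space_axioms])
  fix us vs :: "'v list" and x y c
  show "(if length (us @ (x + y) # vs) = 1 then hd (us @ (x + y) # vs) else 0) =
    (if length (us @ x # vs) = 1 then hd (us @ x # vs) else 0) + (if length (us @ y # vs) = 1 then hd (us @ y # vs) else 0)"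
    "(if length (us @ (c *s x) # vs) = 1 then hd (us @ (c *s x) # vs) else 0) =
    c *s (if length (us @ x # vs) = 1 then hd (us @ x # vs) else 0)"
    by (cases us; simp)+
qed

lemma svan_proj: "svan (\<lambda>xs. if length xs = 1 then hd xs else 0)"
  by (rule svan_short) auto

lemma linear_proj_V: "Vector_Spaces.linear pscale scale proj_V"
  unfolding proj_V_def by (rule linear_extend[OF vector_space_axioms])

text \<open>The projection to letters is itself multilinear and vanishes on shuffles, whose words
  have length at least 2.\<close>

lemma proj_V_word_relations: "r \<in> word_relations \<Longrightarrow> proj_V r = 0"
  unfolding proj_V_def by (rule word_relations_kill[OF mlin_proj svan_proj])

lemma act_proj: "act q (\<lambda>xs. if length xs = 1 then hd xs else 0) Q xs = Q xs"
proof -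
  have "act q (\<lambda>xs. if length xs = 1 then hd xs else 0) Q xs =
      sp (\<lambda>u r. if u = [] then Q r else 0) xs"
    unfolding act_def
  proof (rule sp_cong_all)
    fix u r
    show "sp (\<lambda>v w. if length (map (sg q) u @ Q v # w) = 1 then hd (map (sg q) u @ Q v # w) else 0) r = (if u = [] then Q r else 0)"
      by (subst sp_right_empty) auto
  qed
  also have "\<dots> = Q xs" by (subst sp_left_empty) auto
  finally show ?thesis .
qed

lemma proj_V_codr: "w \<in> hom_words \<Longrightarrow> proj_V (codr Q w) = extend scale Q w"
proof -
  have "act 1 (\<lambda>xs. if length xs = 1 then hd xs else 0) Q = Q" using act_proj by blast
  then show "w \<in> hom_words \<Longrightarrow> proj_V (codr Q w) = extend scale Q w"
    unfolding proj_V_def using extend_codr[OF mlin_proj, of w Q] by simp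
qed

lemma extend_scale_single: "extend scale Q (Poly_Mapping.single xs 1) = Q xs"
  by (simp add: extend_single[OF vector_space_axioms])

lemma pprod_diff_left: "pprod (u - u') v = pprod u v - pprod u' (v :: 'b \<Rightarrow>\<^sub>0 'k)"
  and pprod_diff_right: "pprod w (v - v') = pprod w v - pprod w (v' :: 'b \<Rightarrow>\<^sub>0 'k)"
proof -
  show "pprod (u - u') v = pprod u v - pprod u' v"
    by (rule extend_eqI) (simp add: extend_pprod extend_mult_diff)
  show "pprod w (v - v') = pprod w v - pprod w v'"
    by (rule extend_eqI)
       (simp add: extend_pprod extend_mult_diff, simp add: extend_def sum_subtractf right_diff_distrib)
qed

lemma pair_relationsI:
  "r \<in> word_relations \<Longrightarrow> w \<in> hom_words \<Longrightarrow> pprod r w \<in> pair_relations"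
  "r \<in> word_relations \<Longrightarrow> w \<in> hom_words \<Longrightarrow> pprod w r \<in> pair_relations"
proof -
  interpret P: vector_space "pscale :: 'k \<Rightarrow> ('v list \<times> 'v list \<Rightarrow>\<^sub>0 'k) \<Rightarrow> _" by (rule vector_space_pscale)
  show "r \<in> word_relations \<Longrightarrow> w \<in> hom_words \<Longrightarrow> pprod r w \<in> pair_relations"
    "r \<in> word_relations \<Longrightarrow> w \<in> hom_words \<Longrightarrow> pprod w r \<in> pair_relations"
    unfolding pair_relations_def by (rule P.span_base, blast)+
qed

lemma pscale_diff: "pscale c p - pscale c q = pscale c (p - q)"
  by (rule poly_mapping_eqI) (simp add: lookup_pscale lookup_minus right_diff_distrib)

lemma pair_action_diff:
  assumes "\<And>a c. (a, c) \<in> Poly_Mapping.keys p \<Longrightarrow>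
     a \<noteq> [] \<and> c \<noteq> [] \<and> set a \<subseteq> homog \<and> set c \<subseteq> homog \<and>
     D (Poly_Mapping.single a 1) - E (Poly_Mapping.single a 1) \<in> word_relations \<and>
     D (Poly_Mapping.single c 1) - E (Poly_Mapping.single c 1) \<in> word_relations"
  shows "pair_action m D p - pair_action m E p \<in> pair_relations"
proof -
  note PR = subspace_pscaleD[OF pair_relations_subspace]
  have "pair_action m D p - pair_action m E p =
    (\<Sum>x\<in>Poly_Mapping.keys p. pscale (Poly_Mapping.lookup p x) (case x of (a, c) \<Rightarrow>
       pprod (D (Poly_Mapping.single a 1) - E (Poly_Mapping.single a 1)) (Poly_Mapping.single c 1)
     + pscale (ksgn (m * ldeg a)) (pprod (Poly_Mapping.single a 1) (D (Poly_Mapping.single c 1) - E (Poly_Mapping.single c 1)))))"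
    unfolding pair_action_def extend_def sum_subtractf[symmetric] pscale_diff
    by (intro sum.cong refl arg_cong[of _ _ "pscale _"])
       (auto simp: pprod_diff_left pprod_diff_right pscale_diff[symmetric])
  also have "\<dots> \<in> pair_relations"
  proof (rule sum_closed[where P = "\<lambda>p. p \<in> pair_relations"])
    fix x assume "x \<in> Poly_Mapping.keys p"
    then show "pscale (Poly_Mapping.lookup p x) (case x of (a, c) \<Rightarrow>
       pprod (D (Poly_Mapping.single a 1) - E (Poly_Mapping.single a 1)) (Poly_Mapping.single c 1)
     + pscale (ksgn (m * ldeg a)) (pprod (Poly_Mapping.single a 1) (D (Poly_Mapping.single c 1) - E (Poly_Mapping.single c 1))))
      \<in> pair_relations"
      using assms[of "fst x" "snd x"] unfolding case_prod_beta
      by (auto intro!: PR pair_relationsI(1)[OF _ single_hom_words] pair_relationsI(2)[OF _ single_hom_words])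
  qed (rule PR; assumption)+
  finally show ?thesis .
qed

lemma keys_cobracket:
  assumes xs: "xs \<noteq> []" "set xs \<subseteq> homog" and ac: "(a, c) \<in> Poly_Mapping.keys (cobracket (Poly_Mapping.single xs (1::'k)))"
  shows "a \<noteq> [] \<and> c \<noteq> [] \<and> set a \<subseteq> homog \<and> set c \<subseteq> homog \<and> length a < length xs \<and> length c < length xs"
proof -
  define good where "good = {(a, c). a \<noteq> [] \<and> c \<noteq> [] \<and> set a \<subseteq> homog \<and> set c \<subseteq> homog \<and> length a < length xs \<and> length c < length xs}"
  have add: "Poly_Mapping.keys (p + q) \<subseteq> good" if "Poly_Mapping.keys p \<subseteq> good" "Poly_Mapping.keys q \<subseteq> good"
    for p q :: "'v list \<times> 'v list \<Rightarrow>\<^sub>0 'k" using that Poly_Mapping.keys_add[of p q] by blast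
  have eq: "cobracket (Poly_Mapping.single xs 1) = (\<Sum>j=1..<length xs. Poly_Mapping.single (take j xs, drop j xs) 1
     - Poly_Mapping.single (drop j xs, take j xs) (ksgn (ldeg (take j xs) * ldeg (drop j xs))))"
    unfolding cobracket_def extend_single[OF vector_space_pscale] by (rule poly_mapping_eqI) (simp add: lookup_pscale)
  have "Poly_Mapping.keys (cobracket (Poly_Mapping.single xs (1::'k))) \<subseteq> good"
    unfolding eq
  proof (rule sum_closed[where P = "\<lambda>p. Poly_Mapping.keys p \<subseteq> good"], simp, rule add, assumption, assumption)
    fix j assume j: "j \<in> {1..<length xs}"
    have "(take j xs, drop j xs) \<in> good" "(drop j xs, take j xs) \<in> good"
      using j xs by (auto simp: good_def dest!: in_set_takeD in_set_dropD)
    moreover have "Poly_Mapping.keys (p - q) \<subseteq> Poly_Mapping.keys p \<union> Poly_Mapping.keys q"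
      for p q :: "'v list \<times> 'v list \<Rightarrow>\<^sub>0 'k" by (auto simp: in_keys_iff lookup_minus)
    ultimately show "Poly_Mapping.keys (Poly_Mapping.single (take j xs, drop j xs) (1::'k)
     - Poly_Mapping.single (drop j xs, take j xs) (ksgn (ldeg (take j xs) * ldeg (drop j xs)))) \<subseteq> good"
      by (smt (verit, del_insts) UnE keys_sum_singles subset_iff)
  qed
  then show ?thesis using ac by (auto simp: good_def)
qed

text \<open>Induction on the length: modulo relations, the cobracket of the difference involves the
  two maps only on shorter words, where they agree, and the Taylor components agree by assumption.
  Then \<open>cobracket_kernel\<close> applies to the difference.\<close>

lemma coderivation_unique:
  assumes D: "coderivation 1 D" "taylor_components_of D Q" and Q: "good_family Q" and w: "w \<in> hom_words"
  shows "D w - codr Q w \<in> word_relations"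
proof -
  note WR = subspace_pscaleD[OF word_relations_subspace] and PR = subspace_pscaleD[OF pair_relations_subspace]
  have lD: "Vector_Spaces.linear pscale pscale D" and hD: "D ` hom_words \<subseteq> hom_words"
    using D(1) by (auto simp: coderivation_def map_of_degree_def)
  have Qd: "qdegree 1 Q" using Q by (simp add: good_family_def)
  have lcob: "Vector_Spaces.linear pscale pscale cobracket"
    unfolding cobracket_def by (rule linear_extend[OF vector_space_pscale])
  have single: "D (Poly_Mapping.single xs 1) - codr Q (Poly_Mapping.single xs 1) \<in> word_relations"
    if "xs \<noteq> []" "set xs \<subseteq> homog" for xs
    using that
  proof (induction "length xs" arbitrary: xs rule: less_induct)
    case less
    let ?s = "Poly_Mapping.single xs 1" and ?E = "D (Poly_Mapping.single xs 1) - codr Q (Poly_Mapping.single xs 1)"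
    have s: "?s \<in> hom_words" by (rule single_hom_words[OF less.prems])
    show ?case
    proof (rule cobracket_kernel)
      show "?E \<in> hom_words"
        using hD s codr_hom_words[OF Qd s] by (intro hom_words_subspace(4)) auto
      have "proj_V (D ?s) = Q xs" using D(2) less.prems by (simp add: taylor_components_of_def)
      then show "proj_V ?E = 0"
        by (simp add: linear_minus[OF linear_proj_V] proj_V_codr[OF s] extend_scale_single)
      have "cobracket (D ?s) - pair_action 1 D (cobracket ?s) \<in> pair_relations"
        using D(1) s by (simp add: coderivation_def)
      moreover have "pair_action 1 D (cobracket ?s) - pair_action 1 (codr Q) (cobracket ?s) \<in> pair_relations"
      proof (rule pair_action_diff)
        fix a c assume "(a, c) \<in> Poly_Mapping.keys (cobracket ?s)"
        from keys_cobracket[OF less.prems this] show "a \<noteq> [] \<and> c \<noteq> [] \<and> set a \<subseteq> homog \<and> set c \<subseteq> homog \<and>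
            D (Poly_Mapping.single a 1) - codr Q (Poly_Mapping.single a 1) \<in> word_relations \<and>
            D (Poly_Mapping.single c 1) - codr Q (Poly_Mapping.single c 1) \<in> word_relations"
          using less.hyps[of a] less.hyps[of c] by simp
      qed
      ultimately have "(cobracket (D ?s) - pair_action 1 D (cobracket ?s)) +
        (pair_action 1 D (cobracket ?s) - pair_action 1 (codr Q) (cobracket ?s)) \<in> pair_relations"
        by (rule PR(2))
      then show "cobracket ?E \<in> pair_relations"
        by (simp add: linear_minus[OF lcob] cobracket_codr[OF Q s])
    qed
  qed
  have "D w - codr Q w = (\<Sum>xs\<in>Poly_Mapping.keys w. pscale (Poly_Mapping.lookup w xs)
      (D (Poly_Mapping.single xs 1) - codr Q (Poly_Mapping.single xs 1)))"
    by (subst linear_eq_extend[OF lD], subst linear_eq_extend[OF linear_codr])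
       (simp add: extend_def sum_subtractf pscale_diff[symmetric])
  also have "\<dots> \<in> word_relations"
  proof (rule sum_closed[where P = "\<lambda>p. p \<in> word_relations"])
    fix xs assume "xs \<in> Poly_Mapping.keys w"
    then show "pscale (Poly_Mapping.lookup w xs) (D (Poly_Mapping.single xs 1) - codr Q (Poly_Mapping.single xs 1)) \<in> word_relations"
      using w by (intro WR(3) single) (auto simp: hom_words_def)
  qed (rule WR; assumption)+
  finally show ?thesis .
qed

lemma taylor_family_iff: "taylor_family Q \<longleftrightarrow> Q [] = 0 \<and> mlin scale Q \<and> svan Q"
proof -
  have "(\<forall>k\<ge>1. multilinear (*s) k (arity_part k Q)) \<longleftrightarrow> mlin scale Q" if Q0: "Q [] = 0"
  proof
    assume *: "\<forall>k\<ge>1. multilinear (*s) k (arity_part k Q)"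
    have "mlin scale (arity_part k Q)" for k
    proof (cases "k = 0")
      case True
      have "arity_part 0 Q = (\<lambda>_. 0)" using Q0 by (auto simp: arity_part_def)
      then show ?thesis using True by (simp add: mlin_zero_fun[OF vector_space_axioms])
    next
      case False
      then show ?thesis using * by (simp add: multilinear_iff_mlin[OF vector_space_axioms])
    qed
    then show "mlin scale Q" by (rule mlin_by_arity[OF vector_space_axioms])
  next
    assume "mlin scale Q"
    then show "\<forall>k\<ge>1. multilinear (*s) k (arity_part k Q)"
      by (simp add: multilinear_iff_mlin[OF vector_space_axioms] mlin_arity_part) (simp add: arity_part_def)
  qed
  then show ?thesis
    unfolding taylor_family_def vanishes_iff_svan[OF vector_space_axioms, symmetric] by blast
qed

lemma graded_commutator_self: "graded_commutator 1 1 D D w = pscale 2 (D (D w))"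
  unfolding graded_commutator_def by (rule poly_mapping_eqI) (simp add: lookup_minus lookup_pscale ksgn_def)

text \<open>The coderivation is \<open>codr Q\<close>. Against a functional \<open>F\<close>, its
  square becomes the insertion of \<open>act 1 Q Q\<close> into \<open>F\<close>, because
  \<open>Q\<close> is odd.\<close>

lemma C_infinityI:
  assumes Q: "good_family Q" and form_map: "\<And>xs. act 1 Q Q xs = 0" shows "C_infinity Q"
  unfolding C_infinity_def
proof (intro exI conjI ballI)
  have Q': "mlin scale Q" "svan Q" "Q [] = 0" "qdegree 1 Q" using Q by (auto simp: good_family_def)
  show "coderivation 1 (codr Q)" by (rule coderivation_codr[OF Q])
  show "taylor_components_of (codr Q) Q"
    using Q' by (simp add: taylor_components_of_def taylor_family_iff proj_V_codr single_hom_words extend_scale_single)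
  fix w assume w: "w \<in> hom_words"
  have cw: "codr Q w \<in> hom_words" "codr Q (codr Q w) \<in> hom_words"
    using w codr_hom_words[OF Q'(4)] by auto
  show "graded_commutator 1 1 (codr Q) (codr Q) w \<in> word_relations"
  proof (rule word_relationsI)
    show "graded_commutator 1 1 (codr Q) (codr Q) w \<in> hom_words"
      unfolding graded_commutator_self by (rule hom_words_subspace(3)[OF cw(2)])
    fix F :: "'v list \<Rightarrow> 'k" assume F: "mlin (*) F" "svan F"
    have qp: "qparity 1 Q"
    proof -
      have "Q (map (sg m) xs) = ssgn m (sg m (Q xs))" for m xs
      proof (rule mlin_eqI[OF mlin_map_sg[OF Q'(1)]])
        show "mlin scale (\<lambda>xs. ssgn m (sg m (Q xs)))"
        proof -
          have "Vector_Spaces.linear scale scale (\<lambda>x. ssgn m (sg m x))"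
            by (simp add: Vector_Spaces.linear_iff vector_space_axioms sg_add sg_scale ssgn_add ssgn_scale)
          then show ?thesis using Q'(1) by (auto simp: mlin_def intro!: linear_comp[where f = "\<lambda>x. ssgn m (sg m x)"])
        qed
        fix ys assume "set ys \<subseteq> homog - {0}"
        then have ys: "set ys \<subseteq> homog" by auto
        have "Q ys \<in> G (ldeg ys + 1 + 1)" using Q'(4) ys by (simp add: qdegree_def)
        from ph_sg[OF G_ph[OF this], of m]
        show "Q (map (sg m) ys) = ssgn m (sg m (Q ys))"
          by (simp add: mlin_sg_list0[OF Q'(1) ys]) (rule ssgn_cong, simp add: algebra_simps)
      qed
      then show ?thesis by (simp add: qparity_def)
    qed
    have "extend (*) F (codr Q (codr Q w)) = extend (*) (act 1 (act 1 F Q) Q) w"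
      by (simp add: extend_codr[OF F(1) cw(1)] extend_codr[OF mlin_act[OF F(1) Q'(1)] w])
    also have "\<dots> = 0"
    proof (rule extend_zero)
      fix xs
      have "act 1 (act 1 F Q) Q xs = act (1 + 1) F (act 1 Q Q) xs"
        by (rule act_act_odd[OF F(1) Q'(1) qp]) simp
      also have "act 1 Q Q = (\<lambda>_. 0)" using form_map by blast
      finally show "act 1 (act 1 F Q) Q xs = 0" by (simp add: act_zero_right[OF F(1)])
    qed
    finally show "extend (*) F (graded_commutator 1 1 (codr Q) (codr Q) w) = 0"
      by (simp add: graded_commutator_self extend_mult_scale)
  qed
qed

text \<open>The coderivation is given only by its properties, but modulo relations
  \<open>coderivation_unique\<close> replaces it by \<open>codr Q\<close>. The projection of its
  square to letters is then \<open>act 1 Q Q\<close>.\<close>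

lemma C_infinityD:
  assumes "C_infinity Q" shows "good_family Q" "act 1 Q Q xs = 0"
proof -
  obtain D where D: "coderivation 1 D" "taylor_components_of D Q"
    and DD: "\<And>w. w \<in> hom_words \<Longrightarrow> graded_commutator 1 1 D D w \<in> word_relations"
    using assms unfolding C_infinity_def by blast
  note WR = subspace_pscaleD[OF word_relations_subspace]
  have mD: "map_of_degree 1 D" using D(1) by (simp add: coderivation_def)
  have lD: "Vector_Spaces.linear pscale pscale D" and hD: "D ` hom_words \<subseteq> hom_words"
    and rD: "D ` word_relations \<subseteq> word_relations" using mD by (auto simp: map_of_degree_def)
  have T: "Q [] = 0" "mlin scale Q" "svan Q"
    using D(2) by (auto simp: taylor_components_of_def taylor_family_iff)
  have QD: "Q xs = proj_V (D (Poly_Mapping.single xs 1))" if "xs \<noteq> []" "set xs \<subseteq> homog" for xs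
    using D(2) that by (auto simp: taylor_components_of_def)
  \<comment> \<open>\<open>D\<close> respects degrees only modulo relations, and the projection to
    letters does not see relations.\<close>
  have "Q xs \<in> G (ldeg xs + 1 + 1)" if xs: "set xs \<subseteq> homog" for xs
  proof (cases "xs = []")
    case False
    then have "\<exists>w\<in>hom_words. (\<forall>ys\<in>Poly_Mapping.keys w. ldeg ys = ldeg xs + 1) \<and>
        D (Poly_Mapping.single xs 1) - w \<in> word_relations"
      using mD xs by (simp add: map_of_degree_def)
    then obtain w where w: "w \<in> hom_words" "\<forall>ys\<in>Poly_Mapping.keys w. ldeg ys = ldeg xs + 1"
      "D (Poly_Mapping.single xs 1) - w \<in> word_relations"
      by (elim bexE conjE)
    have "Q xs = proj_V w"
      using proj_V_word_relations[OF w(3)] QD[OF False xs] by (simp add: linear_minus[OF linear_proj_V])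
    also have "\<dots> \<in> G (ldeg xs + 1 + 1)"
      unfolding proj_V_def extend_def
    proof (intro subspace_sum subspace_component subspace_scale)
      fix ys assume ys: "ys \<in> Poly_Mapping.keys w"
      show "(if length ys = 1 then hd ys else 0) \<in> G (ldeg xs + 1 + 1)"
      proof (cases "length ys = 1")
        case True
        then obtain y where "ys = [y]" by (cases ys) auto
        then show ?thesis using bspec[OF w(2) ys] w(1) ys homog_deg[of y] by (auto simp: hom_words_def)
      qed simp
    qed
    finally show ?thesis .
  qed (simp add: T(1))
  then have Qd: "qdegree 1 Q" by (simp add: qdegree_def)
  show Q: "good_family Q" using T Qd by (simp add: good_family_def)
  show "act 1 Q Q xs = 0"
  proof (rule mlin_eqI[OF mlin_act[OF T(2) T(2)] mlin_zero_fun[OF vector_space_axioms]])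
    fix xs assume "set xs \<subseteq> homog - {0}"
    then have xs: "set xs \<subseteq> homog" by auto
    show "act 1 Q Q xs = 0"
    proof (cases "xs = []")
      case True
      then show ?thesis using mlin_zero[OF T(2), of "[]" "[]"] by (simp add: act_def T(1))
    next
      case False
      let ?s = "Poly_Mapping.single xs (1::'k)"
      have s: "?s \<in> hom_words" by (rule single_hom_words[OF False xs])
      have cs: "codr Q ?s \<in> hom_words" by (rule codr_hom_words[OF Qd s])
      have 1: "D ?s - codr Q ?s \<in> word_relations" by (rule coderivation_unique[OF D Q s])
      \<comment> \<open>The second comparison of \<open>D\<close> with \<open>codr Q\<close>, now on
        the combination \<open>codr Q ?s\<close> instead of a single word.\<close>
      have 2: "D (codr Q ?s) - codr Q (codr Q ?s) \<in> word_relations" by (rule coderivation_unique[OF D Q cs])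
      have "D (D ?s - codr Q ?s) \<in> word_relations" using 1 rD by blast
      then have 3: "D (D ?s) - D (codr Q ?s) \<in> word_relations" by (simp add: linear_minus[OF lD])
      \<comment> \<open>The graded commutator of an odd map with itself is twice its square.\<close>
      have "pscale (1/2) (pscale 2 (D (D ?s))) \<in> word_relations"
        using DD[OF s] unfolding graded_commutator_self by (rule WR(3))
      moreover have "pscale (1/2) (pscale 2 p) = p" for p :: "'v list \<Rightarrow>\<^sub>0 'k"
        by (rule poly_mapping_eqI) (simp add: lookup_pscale)
      ultimately have 4: "D (D ?s) \<in> word_relations" by simp
      have "proj_V (D (D ?s)) = 0" "proj_V (D (D ?s)) = proj_V (D (codr Q ?s))"
        "proj_V (D (codr Q ?s)) = proj_V (codr Q (codr Q ?s))"
        using proj_V_word_relations[OF 4] proj_V_word_relations[OF 3] proj_V_word_relations[OF 2]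
        by (simp_all add: linear_minus[OF linear_proj_V])
      then have "0 = proj_V (codr Q (codr Q ?s))" by simp
      also have "\<dots> = extend scale Q (codr Q ?s)" by (rule proj_V_codr[OF cs])
      also have "\<dots> = act 1 Q Q xs" by (simp add: extend_codr[OF T(2) s] extend_scale_single)
      finally show ?thesis by simp
    qed
  qed
qed

end

section \<open>Commutative Pinczon algebras\<close>

context form_graded_vector_space
begin

lemma form_of_snoc: "xs \<noteq> [] \<Longrightarrow> form_of b Q (xs @ [y]) = BB (Q xs) y"
  by (cases xs) (auto simp: form_of_def)

lemma form_of_short: "length xs < 2 \<Longrightarrow> form_of b Q xs = 0"
  by (simp add: form_of_def)

lemma mlin_form_of: assumes Q: "mlin scale Q" shows "mlin (*) (form_of b Q)"
proof (rule mlinI[OF vector_space_mult])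
  fix us vs x y c
  show "form_of b Q (us @ (x + y) # vs) = form_of b Q (us @ x # vs) + form_of b Q (us @ y # vs)"
    by (cases vs rule: rev_cases)
       (auto simp: form_of_def butlast_append BB_add_right BB_add_left mlin_add[OF Q])
  show "form_of b Q (us @ (c *s x) # vs) = c * form_of b Q (us @ x # vs)"
    by (cases vs rule: rev_cases)
       (auto simp: form_of_def butlast_append BB_scale_right BB_scale_left mlin_scale[OF Q])
qed

text \<open>\<open>form_of\<close> does not record \<open>Q []\<close>, so the map is recovered
  under the condition that this value is \<open>0\<close>.\<close>

lemma form_map_form_of: assumes "mlin scale Q" "Q [] = 0" shows "form_map (form_of b Q) = Q"
proof
  fix xs show "form_map (form_of b Q) xs = Q xs"
  proof (rule form_map_eqI[OF mlin_form_of[OF assms(1)]])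
    fix y show "BB (Q xs) y = form_of b Q (xs @ [y])"
      by (cases "xs = []") (auto simp: form_of_snoc form_of_short assms(2))
  qed
qed

lemma form_of_form_map:
  assumes "mlin (*) A" "\<And>xs. length xs < 2 \<Longrightarrow> A xs = 0" shows "form_of b (form_map A) = A"
proof
  fix xs show "form_of b (form_map A) xs = A xs"
  proof (cases "length xs < 2")
    case False
    then have "xs \<noteq> []" by auto
    then show ?thesis using False by (simp add: form_of_def BB_form_map[OF assms(1)])
  qed (simp add: form_of_short assms(2))
qed

lemma form_of_arity_part: "k \<ge> 1 \<Longrightarrow> form_of b (arity_part k Q) = arity_part (k + 1) (form_of b Q)"
proof
  fix zs assume "k \<ge> 1"
  then show "form_of b (arity_part k Q) zs = arity_part (k + 1) (form_of b Q) zs"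
    by (cases zs rule: rev_cases) (auto simp: form_of_def arity_part_def linear_0[OF linear_BB_left])
qed

lemma quadratic_iff:
  assumes "mlin scale Q" shows "quadratic b Q \<longleftrightarrow> rot (form_of b Q) = form_of b Q"
proof -
  let ?A = "form_of b Q"
  have m: "mlin (*) ?A" by (rule mlin_form_of[OF assms])
  have "quadratic b Q \<longleftrightarrow> (\<forall>k\<ge>1. arity_part (k + 1) ?A \<in> cyclic_forms (k + 1))"
    by (simp add: quadratic_def form_of_arity_part)
  also have "\<dots> \<longleftrightarrow> (\<forall>k\<ge>1. arity_part (k + 1) (rot ?A) = arity_part (k + 1) ?A)"
  proof -
    have "\<forall>xs. length xs \<noteq> k \<longrightarrow> arity_part k ?A xs = 0" for k by (simp add: arity_part_def)
    then show ?thesis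
      using mlin_arity_part[OF m] by (simp add: cyclic_forms_iff multilinear_iff_mlin[OF vector_space_mult] rot_arity_part)
  qed
  also have "\<dots> \<longleftrightarrow> rot ?A = ?A"
  proof
    assume *: "\<forall>k\<ge>1. arity_part (k + 1) (rot ?A) = arity_part (k + 1) ?A"
    show "rot ?A = ?A"
    proof
      fix xs show "rot ?A xs = ?A xs"
      proof (cases "length xs < 2")
        case True
        then show ?thesis by (cases xs) (auto simp: form_of_short)
      next
        case False
        then have "1 \<le> length xs - 1" "length xs - 1 + 1 = length xs" by auto
        then have "arity_part (length xs) (rot ?A) = arity_part (length xs) ?A" using *[rule_format, of "length xs - 1"] by simp
        then have "arity_part (length xs) (rot ?A) xs = arity_part (length xs) ?A xs" by (rule fun_cong)
        then show ?thesis by (simp add: arity_part_def)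
      qed
    qed
  qed simp
  finally show ?thesis .
qed

text \<open>By non-degeneracy, the last argument \<open>y\<close> runs through a separating family
  of functionals on the values of the map.\<close>

lemma svan_form_map_iff:
  assumes A: "mlin (*) A"
  shows "svan (form_map A) \<longleftrightarrow> (\<forall>k\<ge>1. \<forall>y. vanishes_on_shuffles (*) k (\<lambda>xs. arity_part (k + 1) A (xs @ [y])))"
proof -
  have eq: "extend (*) (\<lambda>us. arity_part (length xs + length ys + 1) A (us @ [y])) (sh xs ys) = BB (SH (form_map A) xs ys) y" for xs ys y
  proof -
    have "extend (*) (\<lambda>us. arity_part (length xs + length ys + 1) A (us @ [y])) (sh xs ys) =
      SH (\<lambda>us. A (us @ [y])) xs ys"
      unfolding extend_sh[OF vector_space_mult]
      by (rule SH_cong) (auto simp: arity_part_def dest: length_mset_append)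
    also have "\<dots> = SH (\<lambda>us. BB (form_map A us) y) xs ys" by (simp add: BB_form_map[OF A])
    also have "\<dots> = BB (SH (form_map A) xs ys) y"
      using BB_scale_left[of "- 1"] by (intro SH_hom[symmetric]) (auto simp: BB_add_left)
    finally show ?thesis .
  qed
  show ?thesis
  proof
    assume "svan (form_map A)"
    then show "\<forall>k\<ge>1. \<forall>y. vanishes_on_shuffles (*) k (\<lambda>xs. arity_part (k + 1) A (xs @ [y]))"
      unfolding vanishes_on_shuffles_def using eq svanD[of "form_map A"] by auto
  next
    assume *: "\<forall>k\<ge>1. \<forall>y. vanishes_on_shuffles (*) k (\<lambda>xs. arity_part (k + 1) A (xs @ [y]))"
    show "svan (form_map A)"
      unfolding svan_def
    proof (intro allI impI, elim conjE)
      fix xs ys :: "'v list" assume h: "xs \<noteq> []" "ys \<noteq> []" "set xs \<subseteq> homog" "set ys \<subseteq> homog"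
      have "length xs + length ys \<ge> 1" using h by (cases xs) auto
      then have "BB (SH (form_map A) xs ys) y = 0" for y
        using *[rule_format, of "length xs + length ys" y, unfolded vanishes_on_shuffles_def, rule_format, of xs ys] h eq[of xs ys y]
        by simp
      then show "SH (form_map A) xs ys = 0" by (rule BB_nondegenerate)
    qed
  qed
qed

text \<open>On a list of fixed length, the block \<open>v\<close> determines the arities of both
  maps, so each insertion occurs in exactly one summand.\<close>

lemma act_arity_sum:
  assumes Q: "mlin scale Q" "Q [] = 0" and n: "length zs = n"
  shows "(\<Sum>k=1..n. act q (arity_part k Q) (arity_part (n + 1 - k) Q) zs) = act q Q Q zs"
proof -
  have "(\<Sum>k=1..n. act q (arity_part k Q) (arity_part (n + 1 - k) Q) zs) =
    sp (\<lambda>u r. sp (\<lambda>v w. \<Sum>k=1..n. arity_part k Q (map (sg q) u @ arity_part (n + 1 - k) Q v # w)) r) zs"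
    unfolding act_def by (simp add: sp_sum cong: sp_cong_all)
  also have "\<dots> = sp (\<lambda>u r. sp (\<lambda>v w. Q (map (sg q) u @ Q v # w)) r) zs"
  proof (rule sp_cong, rule sp_cong)
    fix u r v w assume "u @ r = zs" "v @ w = r"
    then have len: "length u + length v + length w = n" using n by auto
    show "(\<Sum>k=1..n. arity_part k Q (map (sg q) u @ arity_part (n + 1 - k) Q v # w)) = Q (map (sg q) u @ Q v # w)"
    proof (cases "v = []")
      case True
      have "arity_part (n + 1 - k) Q v = 0" for k using True Q(2) by (simp add: arity_part_def)
      then show ?thesis
        using True mlin_zero[OF Q(1)] mlin_zero[OF mlin_arity_part[OF Q(1)]] by (simp add: Q(2))
    next
      case False
      \<comment> \<open>The outer map receives the \<open>n - length v\<close> remaining letters and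
        one inserted value.\<close>
      let ?k = "n + 1 - length v"
      have lv: "1 \<le> length v" using False by (cases v) auto
      have k: "?k \<in> {1..n}" using len lv by auto
      have "arity_part k Q (map (sg q) u @ arity_part (n + 1 - k) Q v # w) =
        (if k = ?k then Q (map (sg q) u @ Q v # w) else 0)" if "k \<in> {1..n}" for k
        using len lv that by (auto simp: arity_part_def)
      then show ?thesis using k by simp
    qed
  qed
  finally show ?thesis by (simp add: act_def)
qed

lemma has_degree_arity_part: "has_degree d A \<Longrightarrow> has_degree d (arity_part k A)"
  by (auto simp: has_degree_def arity_part_def split: if_splits)

lemma arity_part_cyclic: "mlin (*) A \<Longrightarrow> rot A = A \<Longrightarrow> arity_part k A \<in> cyclic_forms k"
  by (intro cyclic_formsI mlin_arity_part) (simp_all add: rot_arity_part, simp add: arity_part_def)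

lemma form_map_arity_part: assumes "mlin (*) A" shows "form_map (arity_part (k + 1) A) = arity_part k (form_map A)"
  by (rule ext, rule form_map_eqI[OF mlin_arity_part[OF assms]]) (simp add: arity_part_def BB_form_map[OF assms])

text \<open>For forms of degree 3 the maps are odd, so each bracket is the sum of the insertions in
  either order. Reversing the summation identifies the two halves, whence the factor 2.\<close>

lemma Maurer_Cartan_sum:
  assumes A: "mlin (*) A" "rot A = A" "has_degree 3 A" "\<And>xs. length xs < 2 \<Longrightarrow> A xs = 0"
    and n: "length zs = n"
  shows "(\<Sum>i=2..n + 1. hbracket 3 (arity_part i A) (arity_part (n + 1 + 2 - i) A) (zs @ [y])) =
    2 * BB (act 1 (form_map A) (form_map A) zs) y"
proof -
  let ?Q = "\<lambda>k. arity_part k (form_map A)"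
  have QA: "mlin scale (form_map A)" "form_map A [] = 0" using mlin_form_map[OF A(1)] by (auto intro!: form_map_zero A)
  have cyc: "mlin (*) (arity_part i A)" "rot (arity_part i A) = arity_part i A" "parity 3 (arity_part i A)" for i
    by (rule mlin_arity_part[OF A(1)], simp add: rot_arity_part A(2),
        rule has_degree_parity[OF mlin_arity_part[OF A(1)] has_degree_arity_part[OF A(3)]])
  have act3: "act 3 Q R = act 1 Q R" for Q R :: "'v list \<Rightarrow> 'v" by (rule act_cong) simp
  \<comment> \<open>A form of arity \<open>k + 1\<close> belongs to a map of arity
    \<open>k\<close>.\<close>
  have "(\<Sum>i=2..n + 1. hbracket 3 (arity_part i A) (arity_part (n + 1 + 2 - i) A) (zs @ [y])) =
    (\<Sum>k=1..n. hbracket 3 (arity_part (k + 1) A) (arity_part (n + 1 - k + 1) A) (zs @ [y]))"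
    by (rule sum.reindex_bij_witness[where i = "\<lambda>k. k + 1" and j = "\<lambda>i. i - 1"])
       (auto simp: Suc_diff_le numeral_2_eq_2)
  also have "\<dots> = (\<Sum>k=1..n. BB (act 1 (?Q k) (?Q (n + 1 - k)) zs + act 1 (?Q (n + 1 - k)) (?Q k) zs) y)"
    unfolding hbracket_snoc[OF cyc cyc] form_map_arity_part[OF A(1)] qcomm_def act3
    by (simp add: ssgn_def)
  also have "\<dots> = (\<Sum>k=1..n. BB (act 1 (?Q k) (?Q (n + 1 - k)) zs) y) + (\<Sum>k=1..n. BB (act 1 (?Q (n + 1 - k)) (?Q k) zs) y)"
    by (simp add: BB_add_left sum.distrib)
  also have "(\<Sum>k=1..n. BB (act 1 (?Q (n + 1 - k)) (?Q k) zs) y) = (\<Sum>k=1..n. BB (act 1 (?Q k) (?Q (n + 1 - k)) zs) y)"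
    by (rule sum.reindex_bij_witness[where i = "\<lambda>k. n + 1 - k" and j = "\<lambda>k. n + 1 - k"]) auto
  also have "(\<Sum>k=1..n. BB (act 1 (?Q k) (?Q (n + 1 - k)) zs) y) = BB (act 1 (form_map A) (form_map A) zs) y"
    unfolding act_arity_sum[OF QA n, symmetric] by (rule linear_sum[OF linear_BB_left, symmetric])
  finally show ?thesis by simp
qed

text \<open>The equation with index \<open>n\<close> lives in arity \<open>n\<close>, and
  non-degeneracy strips off its last argument.\<close>

lemma Maurer_Cartan_iff:
  assumes br: "bracket_from_form b br"
    and A: "mlin (*) A" "rot A = A" "has_degree 3 A" "\<And>xs. length xs < 2 \<Longrightarrow> A xs = 0"
  shows "(\<forall>n xs. (\<Sum>i=2..n. br (arity_part i A) (arity_part (n + 2 - i) A) xs) = 0) \<longleftrightarrow>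
    (\<forall>xs. act 1 (form_map A) (form_map A) xs = 0)"
proof -
  have cyc: "arity_part i A \<in> cyclic_forms i" for i by (rule arity_part_cyclic[OF A(1,2)])
  note deg = has_degree_arity_part[OF A(3)]
  have br_eq: "br (arity_part i A) (arity_part (n + 2 - i) A) = hbracket 3 (arity_part i A) (arity_part (n + 2 - i) A)"
    if "i \<in> {2..n}" for i n
  proof -
    have "arity_part i A \<in> cyclic_forms ((i - 1) + 1)" "arity_part (n + 2 - i) A \<in> cyclic_forms ((n + 1 - i) + 1)"
      using cyc[of i] cyc[of "n + 2 - i"] that by (auto simp: Suc_diff_le)
    then show ?thesis using br deg unfolding bracket_from_form_iff by blast
  qed
  have sum: "(\<Sum>i=2..n. br (arity_part i A) (arity_part (n + 2 - i) A) xs) =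
      (\<Sum>i=2..n. hbracket 3 (arity_part i A) (arity_part (n + 2 - i) A) xs)" for n xs
    by (rule sum.cong) (simp_all only: br_eq)
  show ?thesis
    unfolding sum
  proof
    assume *: "\<forall>n xs. (\<Sum>i=2..n. hbracket 3 (arity_part i A) (arity_part (n + 2 - i) A) xs) = 0"
    show "\<forall>xs. act 1 (form_map A) (form_map A) xs = 0"
    proof
      fix xs
      have "2 * BB (act 1 (form_map A) (form_map A) xs) y = 0" for y
        using Maurer_Cartan_sum[OF A refl, of xs y] *[rule_format, of "length xs + 1" "xs @ [y]"] by simp
      then show "act 1 (form_map A) (form_map A) xs = 0" by (intro BB_nondegenerate) simp
    qed
  next
    assume *: "\<forall>xs. act 1 (form_map A) (form_map A) xs = 0"
    show "\<forall>n xs. (\<Sum>i=2..n. hbracket 3 (arity_part i A) (arity_part (n + 2 - i) A) xs) = 0"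
    proof (intro allI)
      fix n xs
      show "(\<Sum>i=2..n. hbracket 3 (arity_part i A) (arity_part (n + 2 - i) A) xs) = 0"
      proof (cases "length xs = n \<and> n \<ge> 2")
        case True
        then obtain zs y where zs: "xs = zs @ [y]" by (cases xs rule: rev_cases) auto
        then have "n = length zs + 1" using True by simp
        then show ?thesis using Maurer_Cartan_sum[OF A refl, of zs y] * by (simp add: zs)
      next
        case False
        \<comment> \<open>Forms of arity \<open>i\<close> and \<open>n + 2 - i\<close> have a
          bracket of arity \<open>n\<close>, so every summand vanishes on lists of another length;
          for \<open>n < 2\<close> there are no summands.\<close>
        show ?thesis
        proof (rule sum.neutral, rule ballI)
          fix i assume i: "i \<in> {2..n}"
          have "arity_part i A \<in> cyclic_forms ((i - 1) + 1)" "arity_part (n + 2 - i) A \<in> cyclic_forms ((n + 1 - i) + 1)"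
            using cyc[of i] cyc[of "n + 2 - i"] i by (auto simp: Suc_diff_le)
          from hbracket_arity[OF this, of 3]
          show "hbracket 3 (arity_part i A) (arity_part (n + 2 - i) A) xs = 0"
            by (rule cyclic_formsD(3)) (use False i in auto)
        qed
      qed
    qed
  qed
qed

text \<open>The definition imposes cyclicity arity by arity from 2 on. As arities 0 and 1 vanish,
  all conditions can be stated for the whole form and its map.\<close>

lemma commutative_pinczon_algebra_iff:
  assumes "bracket_from_form b br"
  shows "commutative_pinczon_algebra br A \<longleftrightarrow> pinczon_bracket br \<and> mlin (*) A \<and> rot A = A \<and>
    (\<forall>xs. length xs < 2 \<longrightarrow> A xs = 0) \<and> has_degree 3 A \<and> svan (form_map A) \<and> (\<forall>xs. act 1 (form_map A) (form_map A) xs = 0)"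
proof -
  have 1: "(\<forall>k\<ge>1. arity_part (k + 1) A \<in> cyclic_forms (k + 1)) \<longleftrightarrow> mlin (*) A \<and> rot A = A"
    if short: "\<forall>xs. length xs < 2 \<longrightarrow> A xs = 0"
  proof
    assume *: "\<forall>k\<ge>1. arity_part (k + 1) A \<in> cyclic_forms (k + 1)"
    have c: "arity_part k A \<in> cyclic_forms k" for k
    proof (cases "k < 2")
      case True
      have "arity_part k A = (\<lambda>_. 0)" using short True by (auto simp: arity_part_def)
      moreover have "rot (\<lambda>_. 0 :: 'k) = (\<lambda>_. 0)" by (rule ext) (metis add_0 rot.elims)
      ultimately show ?thesis
        by (simp add: cyclic_forms_iff multilinear_iff_mlin[OF vector_space_mult] mlin_zero_fun[OF vector_space_mult])
    next
      case False
      then show ?thesis using *[rule_format, of "k - 1"] by simp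
    qed
    show "mlin (*) A \<and> rot A = A"
    proof
      show "mlin (*) A" by (rule mlin_by_arity[OF vector_space_mult cyclic_formsD(1)[OF c]])
      show "rot A = A"
      proof
        fix xs
        have "arity_part (length xs) (rot A) xs = arity_part (length xs) A xs"
          using cyclic_formsD(2)[OF c[of "length xs"]] by (simp add: rot_arity_part)
        then show "rot A xs = A xs" by (simp add: arity_part_def)
      qed
    qed
  next
    assume "mlin (*) A \<and> rot A = A"
    then show "\<forall>k\<ge>1. arity_part (k + 1) A \<in> cyclic_forms (k + 1)" using arity_part_cyclic by blast
  qed
  show ?thesis
    unfolding commutative_pinczon_algebra_def vsp_forms_def mem_Collect_eq
    using 1 svan_form_map_iff[of A] Maurer_Cartan_iff[OF assms, of A] by blast
qed

text \<open>On forms without components of arity 0 and 1, \<open>form_map\<close> is inverse to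
  \<open>form_of b\<close>; this gives existence and uniqueness of \<open>Q\<close> at once.\<close>

theorem commutative_pinczon_to_C_infinity:
  assumes "commutative_pinczon_algebra br A" and br: "bracket_from_form b br"
  shows "\<exists>!Q. taylor_family Q \<and> A = form_of b Q"
    and "taylor_family Q \<Longrightarrow> A = form_of b Q \<Longrightarrow> C_infinity Q \<and> quadratic b Q"
proof -
  have A: "mlin (*) A" "rot A = A" "\<And>xs. length xs < 2 \<Longrightarrow> A xs = 0" "has_degree 3 A" "svan (form_map A)"
    "\<And>xs. act 1 (form_map A) (form_map A) xs = 0"
    using assms(1) unfolding commutative_pinczon_algebra_iff[OF br] by auto
  have Q0: "form_map A [] = 0" by (intro form_map_zero A) simp
  have eq: "Q = form_map A" if "taylor_family Q" "A = form_of b Q" for Q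
    using form_map_form_of[of Q] that by (simp add: taylor_family_iff)
  have T: "taylor_family (form_map A)" using Q0 mlin_form_map[OF A(1)] A(5) by (simp add: taylor_family_iff)
  have F: "A = form_of b (form_map A)" using form_of_form_map[OF A(1,3)] by simp
  show "\<exists>!Q. taylor_family Q \<and> A = form_of b Q" using T F eq by blast
  have "qdegree 1 (form_map A)"
    using form_map_in_G[OF A(1,4)] by (simp add: qdegree_def)
  then have "C_infinity (form_map A)"
    using Q0 mlin_form_map[OF A(1)] A(5,6) by (intro C_infinityI) (auto simp: good_family_def)
  moreover have "quadratic b (form_map A)"
    unfolding quadratic_iff[OF mlin_form_map[OF A(1)]] F[symmetric] by (rule A(2))
  ultimately show "C_infinity Q \<and> quadratic b Q" if "taylor_family Q" "A = form_of b Q"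
    unfolding eq[OF that] by blast
qed

theorem C_infinity_to_commutative_pinczon:
  assumes "C_infinity Q" "quadratic b Q"
  shows "commutative_pinczon_algebra form_bracket (form_of b Q)"
proof -
  note Q = C_infinityD[OF assms(1)]
  have Q': "mlin scale Q" "svan Q" "Q [] = 0" "qdegree 1 Q" using Q(1) by (auto simp: good_family_def)
  have "has_degree 3 (form_of b Q)"
    unfolding has_degree_def
  proof (intro allI impI)
    fix xs assume xs: "set xs \<subseteq> homog \<and> form_of b Q xs \<noteq> 0"
    then have "\<not> length xs < 2" using form_of_short by auto
    then obtain zs y where zs: "xs = zs @ [y]" "zs \<noteq> []" by (cases xs rule: rev_cases) auto
    have nz: "BB (Q zs) y \<noteq> 0" using xs zs by (simp add: form_of_snoc)
    \<comment> \<open>The value has degree \<open>ldeg zs + 2\<close> and \<open>y\<close> has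
      degree \<open>deg y + 1\<close>. A non-zero pairing forces these to add up to 0, and the
      offsets give the 3.\<close>
    have "Q zs \<in> G (ldeg zs + 1 + 1)" "y \<in> G (deg y + 1)"
      using Q'(4) xs zs homog_deg by (auto simp: qdegree_def)
    from BB_degree[OF this nz] show "3 + ldeg xs = 0" by (simp add: zs)
  qed
  then show ?thesis
    unfolding commutative_pinczon_algebra_iff[OF bracket_from_form_form_bracket] form_map_form_of[OF Q'(1,3)]
    using pinczon_bracket_form_bracket mlin_form_of[OF Q'(1)] quadratic_iff[OF Q'(1)] assms(2) form_of_short Q'(2) Q(2)
    by blast
qed

end

theorem proposition5p5:
  fixes scale :: "'k::field_char_0 \<Rightarrow> 'v::ab_group_add \<Rightarrow> 'v"
    and G :: "int \<Rightarrow> 'v set"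
  assumes V: "graded_vector_space scale G"
  shows
    "(\<forall>br \<Omega> b.
        graded_vector_space.commutative_pinczon_algebra scale G br \<Omega> \<and>
        graded_vector_space.bracket_from_form scale G b br \<longrightarrow>
        (\<exists>!Q. graded_vector_space.taylor_family scale G Q \<and>
              \<Omega> = graded_vector_space.form_of G b Q) \<and>
        (\<forall>Q. graded_vector_space.taylor_family scale G Q \<and>
             \<Omega> = graded_vector_space.form_of G b Q \<longrightarrow>
             graded_vector_space.C_infinity scale G Q \<and>
             graded_vector_space.quadratic scale G b Q))
     \<and>
     (\<forall>b Q.
        graded_vector_space.symmetric_nondegenerate scale G b \<and>
        graded_vector_space.C_infinity scale G Q \<and>
        graded_vector_space.quadratic scale G b Q \<longrightarrow>
        (\<exists>!S. case S of (br, \<Omega>) \<Rightarrow>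
           graded_vector_space.commutative_pinczon_algebra scale G br \<Omega> \<and>
           graded_vector_space.bracket_from_form scale G b br \<and>
           \<Omega> = graded_vector_space.form_of G b Q))"
proof -
  interpret graded_vector_space scale G by (rule V)
  have loc: "form_graded_vector_space scale G b" if "symmetric_nondegenerate b" for b
    using that by unfold_locales
  have forward: "(\<exists>!Q. taylor_family Q \<and> \<Omega> = form_of b Q) \<and>
      (\<forall>Q. taylor_family Q \<and> \<Omega> = form_of b Q \<longrightarrow> C_infinity Q \<and> quadratic b Q)"
    if *: "commutative_pinczon_algebra br \<Omega> \<and> bracket_from_form b br" for br \<Omega> b
  proof -
    interpret form_graded_vector_space scale G b by (rule loc) (use * in \<open>simp add: bracket_from_form_def\<close>)
    show ?thesis
      using commutative_pinczon_to_C_infinity[OF conjunct1[OF *] conjunct2[OF *]] by simp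
  qed
  have backward: "\<exists>!S. case S of (br, \<Omega>) \<Rightarrow>
      commutative_pinczon_algebra br \<Omega> \<and> bracket_from_form b br \<and> \<Omega> = form_of b Q"
    if *: "symmetric_nondegenerate b \<and> C_infinity Q \<and> quadratic b Q" for b Q
  proof -
    interpret form_graded_vector_space scale G b by (rule loc) (use * in simp)
    show ?thesis
    proof (rule ex1I[of _ "(form_bracket, form_of b Q)"])
      show "case (form_bracket, form_of b Q) of (br, \<Omega>) \<Rightarrow>
          commutative_pinczon_algebra br \<Omega> \<and> bracket_from_form b br \<and> \<Omega> = form_of b Q"
        using * C_infinity_to_commutative_pinczon bracket_from_form_form_bracket by simp
      fix S assume "case S of (br, \<Omega>) \<Rightarrow>
          commutative_pinczon_algebra br \<Omega> \<and> bracket_from_form b br \<and> \<Omega> = form_of b Q"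
      \<comment> \<open>The form is prescribed, so only the bracket of a competing pair has to be
        identified.\<close>
      then show "S = (form_bracket, form_of b Q)"
        using pinczon_bracket_unique by (auto simp: commutative_pinczon_algebra_def)
    qed
  qed
  show ?thesis using forward backward by simp
qed

end
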